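(* Let $G$ be a locally compact group. Then the following assertions are equivalent. (a) $M_*(G)^*$ is Arens regular. (b) For every weight function $\omega$ on $G$, the Banach algebra $M_*(G,\omega)^*$ is Arens regular. (c) There exists a weight function $\omega$ on $G$ such that $M_*(G,\omega)^*$ is Arens regular and $\omega^*$ is bounded. (d) There exists a weight function $\omega$ on $G$ such that $M_*(G,\omega)^*$ is reflexive and $\omega^*$ is bounded. (e) There exists a weight function $\omega$ on $G$ such that $M_*(G,\omega)^*$ is a $C^*$-algebra. (f) $G$ is finite.
   Context: All groups are Hausdorff locally compact. A weight (weight function) on $G$ is a continuous function $\omega:G\to[1,\infty)$ with $\omega(e)=1$ and $\omega(xy)\le\omega(x)\omega(y)$ for all $x,y\in G$; $\omega^*(x)=\omega(x)\omega(x^{-1})$ for $x\in G$. $M(G,\omega)$ is the Banach algebra (under convolution, norm $\|\mu\|_\omega=\|\omega\mu\|$) of complex regular Borel measures $\mu$ on $G$ with $\omega\mu\in M(G)$. A functional $\lambda\in M(G,\omega)^*$ vanishes at infinity if for every $\varepsilon>0$ there is a compact $K\subseteq G$ with $|\langle\lambda,\mu\rangle|<\varepsilon$ for all $\mu\in M(G,\omega)$ with $|\mu|(K)=0$ and $\|\mu\|_\omega=1$. $M_*(G,\omega)$ is the (norm closed) subspace of $M(G,\omega)^*$ of all functionals that vanish at infinity; $M_*(G)$ is $M_*(G,\omega)$ for $\omega\equiv1$. First Arens product: for a Banach algebra $\mathfrak A$, $f\in\mathfrak A^*$, $a,b\in\mathfrak A$, $\Phi,\Psi\in\mathfrak A^{**}$,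 put $\langle fa,b\rangle=\langle f,ab\rangle$, $\langle\Psi f,a\rangle=\langle\Psi,fa\rangle$, $\langle\Phi\diamond\Psi,f\rangle=\langle\Phi,\Psi f\rangle$. The same formulas, with $\mathfrak A=M(G,\omega)$ and $f$ in the left introverted subspace $M_*(G,\omega)$ of $M(G,\omega)^*$, define the product making $M_*(G,\omega)^*$ a Banach algebra. A Banach algebra $\mathfrak A$ is Arens regular if for every $\Phi\in\mathfrak A^{**}$ the map $\Psi\mapsto\Phi\diamond\Psi$ is weak$^*$-weak$^*$ continuous on $\mathfrak A^{**}$.
   Formalization: In (e), "is a C*-algebra" is taken to mean: for some involution and some norm equivalent to the given one. With the given norm, (f) does not imply (e): for the group of order two, |a|+t|b| with t ≥ 1 is never the C*-norm max(|a+b|,|a−b|). *)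

theory Defs
  imports "HOL-Analysis.Analysis" "HOL-Library.Function_Algebras"
begin

section \<open>Normed spaces of complex-valued functions and their duals\<close>

text \<open>
  The spaces below (measures, functionals, functionals on functionals) depend on a weight and
  hence are not types. Each of them consists of complex-valued functions on some type, with the
  pointwise vector space operations, so only the carrier and the norm have to be recorded.
  Functions living on a proper subset of a type are taken to vanish outside it.
\<close>

record 'i nspace =
  Carrier :: "('i \<Rightarrow> complex) set"
  Norm :: "('i \<Rightarrow> complex) \<Rightarrow> real"

record 'i nalg = "'i nspace" +
  Mult :: "('i \<Rightarrow> complex) \<Rightarrow> ('i \<Rightarrow> complex) \<Rightarrow> ('i \<Rightarrow> complex)"

definition scale :: "complex \<Rightarrow> ('i \<Rightarrow> complex) \<Rightarrow> 'i \<Rightarrow> complex" where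
  "scale c u = (\<lambda>i. c * u i)"

definition bounded_functional :: "('i, 'z) nspace_scheme \<Rightarrow> (('i \<Rightarrow> complex) \<Rightarrow> complex) \<Rightarrow> bool" where
  "bounded_functional E f \<longleftrightarrow>
     (\<forall>u\<in>Carrier E. \<forall>v\<in>Carrier E. f (u + v) = f u + f v) \<and>
     (\<forall>c. \<forall>u\<in>Carrier E. f (scale c u) = c * f u) \<and>
     (\<exists>B. \<forall>u\<in>Carrier E. cmod (f u) \<le> B * Norm E u)"

definition dual :: "('i, 'z) nspace_scheme \<Rightarrow> ('i \<Rightarrow> complex) nspace" where
  "dual E = \<lparr> Carrier = {f. bounded_functional E f \<and> (\<forall>u. u \<notin> Carrier E \<longrightarrow> f u = 0)},
              Norm = (\<lambda>f. SUP u\<in>{u\<in>Carrier E. Norm E u \<le> 1}. cmod (f u)) \<rparr>"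

text \<open>The weak* topology on the dual of \<open>E\<close>: pointwise convergence on \<open>E\<close>.\<close>

definition weak_star :: "('i, 'z) nspace_scheme \<Rightarrow> (('i \<Rightarrow> complex) \<Rightarrow> complex) topology" where
  "weak_star E = pullback_topology (Carrier (dual E)) (\<lambda>f. restrict f (Carrier E))
                   (product_topology (\<lambda>_. euclidean) (Carrier E))"

definition reflexive_space :: "('i, 'z) nspace_scheme \<Rightarrow> bool" where
  "reflexive_space E \<longleftrightarrow>
     (\<forall>F\<in>Carrier (dual (dual E)). \<exists>u\<in>Carrier E. \<forall>f\<in>Carrier (dual E). F f = f u)"


section \<open>Arens products\<close>

text \<open>
  In \<open>arens_prod\<close> the set \<open>X\<close> is meant to be a left introverted subspace of the dual of \<open>A\<close>, and the
  product is the one on the dual of \<open>X\<close>; the whole dual of \<open>A\<close> gives the first Arens product on the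
  bidual.
\<close>

definition functional_act :: "('i, 'z) nalg_scheme \<Rightarrow> (('i \<Rightarrow> complex) \<Rightarrow> complex) \<Rightarrow>
    ('i \<Rightarrow> complex) \<Rightarrow> ('i \<Rightarrow> complex) \<Rightarrow> complex" where
  "functional_act A f a = (\<lambda>b. if b \<in> Carrier A then f (Mult A a b) else 0)"

definition bidual_act :: "('i, 'z) nalg_scheme \<Rightarrow> ((('i \<Rightarrow> complex) \<Rightarrow> complex) \<Rightarrow> complex) \<Rightarrow>
    (('i \<Rightarrow> complex) \<Rightarrow> complex) \<Rightarrow> ('i \<Rightarrow> complex) \<Rightarrow> complex" where
  "bidual_act A \<Psi> f = (\<lambda>a. if a \<in> Carrier A then \<Psi> (functional_act A f a) else 0)"

definition arens_prod :: "('i, 'z) nalg_scheme \<Rightarrow> (('i \<Rightarrow> complex) \<Rightarrow> complex) set \<Rightarrow>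
    ((('i \<Rightarrow> complex) \<Rightarrow> complex) \<Rightarrow> complex) \<Rightarrow> ((('i \<Rightarrow> complex) \<Rightarrow> complex) \<Rightarrow> complex) \<Rightarrow>
    (('i \<Rightarrow> complex) \<Rightarrow> complex) \<Rightarrow> complex" where
  "arens_prod A X \<Phi> \<Psi> = (\<lambda>f. if f \<in> X then \<Phi> (bidual_act A \<Psi> f) else 0)"

definition arens_regular :: "('i, 'z) nalg_scheme \<Rightarrow> bool" where
  "arens_regular A \<longleftrightarrow>
     (\<forall>\<Phi>\<in>Carrier (dual (dual A)).
        continuous_map (weak_star (dual A)) (weak_star (dual A))
          (arens_prod A (Carrier (dual A)) \<Phi>))"


section \<open>C*-algebras\<close>

definition norm_on :: "('i \<Rightarrow> complex) set \<Rightarrow> (('i \<Rightarrow> complex) \<Rightarrow> real) \<Rightarrow> bool" where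
  "norm_on V p \<longleftrightarrow>
     (\<forall>u\<in>V. 0 \<le> p u \<and> (p u = 0 \<longleftrightarrow> u = 0)) \<and>
     (\<forall>c. \<forall>u\<in>V. p (scale c u) = cmod c * p u) \<and>
     (\<forall>u\<in>V. \<forall>v\<in>V. p (u + v) \<le> p u + p v)"

definition banach_space :: "('i, 'z) nspace_scheme \<Rightarrow> bool" where
  "banach_space E \<longleftrightarrow>
     0 \<in> Carrier E \<and>
     (\<forall>u\<in>Carrier E. \<forall>v\<in>Carrier E. u + v \<in> Carrier E) \<and>
     (\<forall>c. \<forall>u\<in>Carrier E. scale c u \<in> Carrier E) \<and>
     norm_on (Carrier E) (Norm E) \<and>
     (\<forall>s. (\<forall>n::nat. s n \<in> Carrier E) \<longrightarrow>
          (\<forall>e>0. \<exists>N. \<forall>m\<ge>N. \<forall>n\<ge>N. Norm E (s m - s n) < e) \<longrightarrow>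
          (\<exists>l\<in>Carrier E. (\<lambda>n. Norm E (s n - l)) \<longlonglongrightarrow> 0))"

definition banach_algebra :: "('i, 'z) nalg_scheme \<Rightarrow> bool" where
  "banach_algebra A \<longleftrightarrow>
     banach_space A \<and>
     (\<forall>u\<in>Carrier A. \<forall>v\<in>Carrier A. Mult A u v \<in> Carrier A \<and> Norm A (Mult A u v) \<le> Norm A u * Norm A v) \<and>
     (\<forall>u\<in>Carrier A. \<forall>v\<in>Carrier A. \<forall>w\<in>Carrier A.
        Mult A (Mult A u v) w = Mult A u (Mult A v w) \<and>
        Mult A (u + v) w = Mult A u w + Mult A v w \<and>
        Mult A u (v + w) = Mult A u v + Mult A u w) \<and>
     (\<forall>c. \<forall>u\<in>Carrier A. \<forall>v\<in>Carrier A.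
        Mult A (scale c u) v = scale c (Mult A u v) \<and>
        Mult A u (scale c v) = scale c (Mult A u v))"

definition cstar_algebra :: "('i, 'z) nalg_scheme \<Rightarrow> (('i \<Rightarrow> complex) \<Rightarrow> ('i \<Rightarrow> complex)) \<Rightarrow> bool" where
  "cstar_algebra A star \<longleftrightarrow>
     banach_algebra A \<and>
     (\<forall>u\<in>Carrier A. star u \<in> Carrier A \<and> star (star u) = u) \<and>
     (\<forall>u\<in>Carrier A. \<forall>v\<in>Carrier A. star (u + v) = star u + star v) \<and>
     (\<forall>c. \<forall>u\<in>Carrier A. star (scale c u) = scale (cnj c) (star u)) \<and>
     (\<forall>u\<in>Carrier A. \<forall>v\<in>Carrier A. star (Mult A u v) = Mult A (star v) (star u)) \<and>
     (\<forall>u\<in>Carrier A. Norm A (Mult A (star u) u) = (Norm A u)\<^sup>2)"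

definition equivalent_norms :: "('i \<Rightarrow> complex) set \<Rightarrow> (('i \<Rightarrow> complex) \<Rightarrow> real) \<Rightarrow>
    (('i \<Rightarrow> complex) \<Rightarrow> real) \<Rightarrow> bool" where
  "equivalent_norms V p q \<longleftrightarrow> (\<exists>c>0. \<exists>d>0. \<forall>u\<in>V. c * p u \<le> q u \<and> q u \<le> d * p u)"

text \<open>
  A Banach algebra "is a C*-algebra" if it is so for some involution and some norm defining its
  topology, i.e. if it is isomorphic as a topological algebra to a C*-algebra. The given norm cannot
  be required to be the C*-norm: for the group of order two the algebras considered below have norm
  \<open>\<bar>a\<bar> + t * \<bar>b\<bar>\<close> (with \<open>t \<ge> 1\<close>) on \<open>a \<delta>\<^sub>e + b \<delta>\<^sub>s\<close>, whereas the only C*-norm is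
  \<open>max \<bar>a + b\<bar> \<bar>a - b\<bar>\<close>.
\<close>

definition is_cstar_algebra :: "('i, 'z) nalg_scheme \<Rightarrow> bool" where
  "is_cstar_algebra A \<longleftrightarrow>
     (\<exists>p star. equivalent_norms (Carrier A) (Norm A) p \<and> cstar_algebra (A\<lparr>Norm := p\<rparr>) star)"


section \<open>Complex regular Borel measures\<close>

text \<open>A complex measure is a set function that is set to 0 on non-Borel sets.\<close>

definition complex_borel_measure :: "('a::topological_space set \<Rightarrow> complex) \<Rightarrow> bool" where
  "complex_borel_measure \<mu> \<longleftrightarrow>
     (\<forall>A::nat \<Rightarrow> 'a set. range A \<subseteq> sets borel \<longrightarrow> disjoint_family A \<longrightarrow>
        (\<lambda>n. \<mu> (A n)) sums \<mu> (\<Union>n. A n)) \<and>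
     (\<forall>E. E \<notin> sets borel \<longrightarrow> \<mu> E = 0)"

definition variation :: "('a::topological_space set \<Rightarrow> complex) \<Rightarrow> 'a set \<Rightarrow> ennreal" where
  "variation \<mu> E =
     (SUP A\<in>{A::nat \<Rightarrow> 'a set. range A \<subseteq> sets borel \<and> disjoint_family A \<and> (\<Union>n. A n) = E}.
        \<Sum>n. ennreal (cmod (\<mu> (A n))))"

definition variation_measure :: "('a::topological_space set \<Rightarrow> complex) \<Rightarrow> 'a measure" where
  "variation_measure \<mu> = measure_of UNIV (sets borel) (variation \<mu>)"

definition regular_complex_measure :: "('a::topological_space set \<Rightarrow> complex) \<Rightarrow> bool" where
  "regular_complex_measure \<mu> \<longleftrightarrow>
     complex_borel_measure \<mu> \<and>
     (\<forall>E\<in>sets borel.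
        variation \<mu> E = (SUP K\<in>{K. compact K \<and> K \<subseteq> E}. variation \<mu> K) \<and>
        variation \<mu> E = (INF U\<in>{U. open U \<and> E \<subseteq> U}. variation \<mu> U))"

text \<open>
  Positive part in the Jordan decomposition of a real measure (\<open>ennreal\<close> maps negative numbers to 0);
  the negative part of \<open>\<nu>\<close> is the positive part of \<open>-\<nu>\<close>.
\<close>

definition jordan_pos :: "('a::topological_space set \<Rightarrow> real) \<Rightarrow> 'a measure" where
  "jordan_pos \<nu> =
     measure_of UNIV (sets borel) (\<lambda>E. SUP B\<in>{B\<in>sets borel. B \<subseteq> E}. ennreal (\<nu> B))"

definition cm_integral :: "('a::topological_space set \<Rightarrow> complex) \<Rightarrow> ('a \<Rightarrow> complex) \<Rightarrow> complex" where
  "cm_integral \<mu> f =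
     (integral\<^sup>L (jordan_pos (\<lambda>E. Re (\<mu> E))) f - integral\<^sup>L (jordan_pos (\<lambda>E. - Re (\<mu> E))) f) +
     \<i> * (integral\<^sup>L (jordan_pos (\<lambda>E. Im (\<mu> E))) f - integral\<^sup>L (jordan_pos (\<lambda>E. - Im (\<mu> E))) f)"


section \<open>Weighted measure algebras\<close>

text \<open>
  Groups are written additively, but are not assumed commutative: the class
  \<open>topological_group_add\<close> extends \<open>group_add\<close>, not \<open>ab_group_add\<close>.
\<close>

definition weight :: "('a::topological_group_add \<Rightarrow> real) \<Rightarrow> bool" where
  "weight \<omega> \<longleftrightarrow>
     continuous_on UNIV \<omega> \<and> (\<forall>x. 1 \<le> \<omega> x) \<and> \<omega> 0 = 1 \<and> (\<forall>x y. \<omega> (x + y) \<le> \<omega> x * \<omega> y)"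

definition weight_star :: "('a::topological_group_add \<Rightarrow> real) \<Rightarrow> 'a \<Rightarrow> real" where
  "weight_star \<omega> x = \<omega> x * \<omega> (- x)"

definition weighted :: "('a::topological_space \<Rightarrow> real) \<Rightarrow> ('a set \<Rightarrow> complex) \<Rightarrow> 'a set \<Rightarrow> complex" where
  "weighted \<omega> \<mu> =
     (\<lambda>E. if E \<in> sets borel then cm_integral \<mu> (\<lambda>x. indicator E x * complex_of_real (\<omega> x)) else 0)"

definition convolution :: "('a::topological_group_add set \<Rightarrow> complex) \<Rightarrow> ('a set \<Rightarrow> complex) \<Rightarrow>
    'a set \<Rightarrow> complex" where
  "convolution \<mu> \<nu> =
     (\<lambda>E. if E \<in> sets borel then cm_integral \<nu> (\<lambda>y. \<mu> {x. x + y \<in> E}) else 0)"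

text \<open>
  \<open>M(G,\<omega>)\<close>. The integrability condition says that \<open>\<omega>\<mu>\<close> is defined; without it the
  integral in \<^const>\<open>weighted\<close> would have the default value 0.
\<close>

definition M_alg :: "('a::topological_group_add \<Rightarrow> real) \<Rightarrow> 'a set nalg" where
  "M_alg \<omega> =
     \<lparr> Carrier = {\<mu>. regular_complex_measure \<mu> \<and> integrable (variation_measure \<mu>) \<omega> \<and>
                     regular_complex_measure (weighted \<omega> \<mu>)},
       Norm = (\<lambda>\<mu>. enn2real (variation (weighted \<omega> \<mu>) UNIV)),
       Mult = convolution \<rparr>"

definition vanishes_at_infinity ::
    "('a::topological_group_add \<Rightarrow> real) \<Rightarrow> (('a set \<Rightarrow> complex) \<Rightarrow> complex) \<Rightarrow> bool" where
  "vanishes_at_infinity \<omega> f \<longleftrightarrow>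
     (\<forall>e>0. \<exists>K. compact K \<and>
        (\<forall>\<mu>\<in>Carrier (M_alg \<omega>). variation \<mu> K = 0 \<longrightarrow> Norm (M_alg \<omega>) \<mu> = 1 \<longrightarrow> cmod (f \<mu>) < e))"

definition M_star :: "('a::topological_group_add \<Rightarrow> real) \<Rightarrow> ('a set \<Rightarrow> complex) nspace" where
  "M_star \<omega> =
     \<lparr> Carrier = {f\<in>Carrier (dual (M_alg \<omega>)). vanishes_at_infinity \<omega> f},
       Norm = Norm (dual (M_alg \<omega>)) \<rparr>"

text \<open>The Banach algebra \<open>M\<^sub>*(G,\<omega>)\<^sup>*\<close>.\<close>

definition M_star_dual ::
    "('a::topological_group_add \<Rightarrow> real) \<Rightarrow> (('a set \<Rightarrow> complex) \<Rightarrow> complex) nalg" where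
  "M_star_dual \<omega> =
     \<lparr> Carrier = Carrier (dual (M_star \<omega>)),
       Norm = Norm (dual (M_star \<omega>)),
       Mult = arens_prod (M_alg \<omega>) (Carrier (M_star \<omega>)) \<rparr>"

end

theory Submission
  imports Defs "HOL-Complex_Analysis.Complex_Analysis"
begin

text \<open>
  Evaluation of functionals on \<open>M\<^sub>*(G,\<omega>)\<close> at point masses gives a bounded homomorphism \<open>q\<close> of
  \<open>M\<^sub>*(G,\<omega>)\<^sup>*\<close> onto a convolution algebra of weighted summable functions on \<open>G\<close>.
  If \<open>G\<close> is infinite, ultrafilter limits of normalized point masses contradict reflexivity, and, for
  bounded \<open>\<omega>\<^sup>*\<close>, also Arens regularity (a double limit argument along sequences for which the sets
  of the products \<open>x\<^sub>n y\<^sub>m\<close> with \<open>n < m\<close> and with \<open>n \<ge> m\<close> are disjoint).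
  If the algebra is a C*-algebra, then the cotype 2 inequality in \<open>l\<^sup>1\<close> bounds the number of points in
  the part of the spectrum of a unitary that is seen by \<open>q\<close>. Hence, modulo the kernel of \<open>q\<close>,
  selfadjoint elements are combinations of boundedly many orthogonal idempotents, the image of \<open>q\<close>
  has finite dimension, and \<open>G\<close> is finite. For finite \<open>G\<close> everything is finite-dimensional, and
  the operator norm of convolution on \<open>l\<^sup>2(G)\<close> is a C*-norm.
\<close>

text \<open>For nondiscrete \<open>G\<close> the dual of \<open>M\<^sub>*\<close> in general
  contains much more than measures, and no description of the whole algebra is at hand; this is why
  everything passes through the atoms. The kernel of \<open>q\<close> can be large, and what is used
  of it is that it is a closed two-sided ideal. The C*-part therefore forms no quotient algebra:
  spectral identities are asserted after applying \<open>q\<close>, while selfadjointness is kept on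
  the level of representatives. The weight matters differently in the three cases. Normalized point
  masses have norm at most 1 for every weight, which is enough against reflexivity. Their products
  carry the factor \<omega>(x+y) / (\<omega>(x) \<omega>(y)), which could tend to 0; bounded
  \<open>weight_star\<close> keeps it away from 0 and so keeps the iterated limits apart. In the
  C*-case \<omega> \<ge> 1 lets the weight be dropped: the plain l^1 norm of the image is bounded by
  a multiple of any norm equivalent to the given one. Cotype then limits disjoint spectral pieces,
  because their unimodular combinations stay bounded in the C*-norm but grow in l^1 like the square
  root of their number.\<close>

section \<open>Jordan decomposition of real measures\<close>

definition sigma_additive :: "('a::topological_space set \<Rightarrow> 'b::real_normed_vector) \<Rightarrow> bool" where
  "sigma_additive \<nu> \<longleftrightarrow> (\<forall>A::nat \<Rightarrow> 'a set. range A \<subseteq> sets borel \<longrightarrow> disjoint_family A \<longrightarrow>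
     (\<lambda>n. \<nu> (A n)) sums \<nu> (\<Union>n. A n))"

lemma sigma_additiveD:
  "sigma_additive \<nu> ==> (\<And>n. A n \<in> sets borel) ==> disjoint_family A ==> (\<lambda>n. \<nu> (A n)) sums \<nu> (\<Union>n. A n)"
  unfolding sigma_additive_def by blast

lemma sigma_additive_empty:
  assumes "sigma_additive \<nu>" shows "\<nu> {} = 0"
proof -
  have "(\<lambda>n::nat. \<nu> {}) sums \<nu> {}"
    using sigma_additiveD[OF assms, of "\<lambda>_. {}"] by (simp add: disjoint_family_on_def)
  then show ?thesis
    by (metis sums_summable summable_const_iff)
qed

lemma sigma_additive_Un:
  assumes \<nu>: "sigma_additive \<nu>" and "A \<in> sets borel" "B \<in> sets borel" "A \<inter> B = {}"
  shows "\<nu> (A \<union> B) = \<nu> A + \<nu> B"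
proof -
  have "(\<lambda>n. \<nu> (binaryset A B n)) sums \<nu> (\<Union>n. binaryset A B n)"
    using assms by (intro sigma_additiveD[OF \<nu>]) (auto simp: binaryset_def disjoint_family_on_def)
  moreover have "(\<lambda>n. \<nu> (binaryset A B n)) sums (\<nu> A + \<nu> B)"
    by (rule binaryset_sums) (simp add: sigma_additive_empty[OF \<nu>])
  ultimately show ?thesis
    by (metis UN_binaryset_eq sums_unique2)
qed

lemma sigma_additive_Diff:
  assumes \<nu>: "sigma_additive \<nu>" and "A \<in> sets borel" "B \<in> sets borel" "B \<subseteq> A"
  shows "\<nu> (A - B) = \<nu> A - \<nu> B"
  using sigma_additive_Un[OF \<nu>, of B "A - B"] assms by (simp add: Un_absorb1)

text \<open>\<open>measure_of\<close> falls back to the zero measure when the given set function is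
  not countably additive, so each construction by \<open>measure_of\<close> below has to pass
  through this check.\<close>

lemma emeasure_borel_measure_of:
  fixes f :: "'a::topological_space set \<Rightarrow> ennreal"
  assumes "f {} = 0"
    and "\<And>A::nat \<Rightarrow> 'a set. range A \<subseteq> sets borel ==> disjoint_family A ==> (\<Sum>i. f (A i)) = f (\<Union>i. A i)"
    and E: "E \<in> sets borel"
  shows "emeasure (measure_of UNIV (sets borel) f) E = f E"
proof (rule emeasure_measure_of_sigma[OF _ _ _ E])
  show "sigma_algebra UNIV (sets (borel :: 'a measure))"
    by (metis sets.sigma_algebra_axioms space_borel)
qed (use assms in \<open>auto simp: positive_def countably_additive_def\<close>)

lemma sets_borel_measure_of [simp]: "sets (measure_of UNIV (sets borel) f) = sets borel"
  using sets.sets_measure_of_eq[of "borel"] by (simp add: space_borel)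

lemma space_borel_measure_of [simp]: "space (measure_of UNIV (sets borel) f) = UNIV"
  using sets.space_measure_of_eq[of borel f] by simp

definition pos_part :: "('a::topological_space set \<Rightarrow> real) \<Rightarrow> 'a set \<Rightarrow> ennreal" where
  "pos_part \<nu> E = (SUP B\<in>{B\<in>sets borel. B \<subseteq> E}. ennreal (\<nu> B))"

lemma pos_part_upper: "B \<in> sets borel ==> B \<subseteq> E ==> ennreal (\<nu> B) \<le> pos_part \<nu> E"
  unfolding pos_part_def by (rule SUP_upper) auto

lemma pos_part_mono: "E \<subseteq> F ==> pos_part \<nu> E \<le> pos_part \<nu> F"
  unfolding pos_part_def by (rule SUP_subset_mono) auto

text \<open>\<open>ennreal\<close> sends negative terms to 0, which can only raise the partial sums;
  hence an inequality and not an equality.\<close>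

lemma ennreal_sums_le:
  assumes "x sums s" shows "ennreal s \<le> (\<Sum>i. ennreal (x i))"
proof (rule LIMSEQ_le_const2)
  show "(\<lambda>n. ennreal (sum x {..<n})) \<longlonglongrightarrow> ennreal s"
    using assms unfolding sums_def by (rule tendsto_ennrealI)
  have "ennreal (sum x {..<n}) \<le> (\<Sum>i. ennreal (x i))" for n
  proof -
    have "ennreal (sum x {..<n}) \<le> ennreal (\<Sum>i<n. max 0 (x i))"
      by (intro ennreal_leI sum_mono) auto
    also have "\<dots> = (\<Sum>i<n. ennreal (max 0 (x i)))"
      by (subst sum_ennreal) auto
    also have "\<dots> = (\<Sum>i<n. ennreal (x i))"
      by (intro sum.cong refl) (metis ennreal_max_0)
    also have "\<dots> \<le> (\<Sum>i. ennreal (x i))"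
      by (rule sum_le_suminf) auto
    finally show ?thesis .
  qed
  then show "\<exists>N. \<forall>n\<ge>N. ennreal (sum x {..<n}) \<le> (\<Sum>i. ennreal (x i))" by auto
qed

lemma pos_part_superadd:
  assumes \<nu>: "sigma_additive \<nu>" and E: "E \<inter> F = {}"
  shows "pos_part \<nu> E + pos_part \<nu> F \<le> pos_part \<nu> (E \<union> F)"
proof -
  let ?S = "\<lambda>E. {B\<in>sets borel. B \<subseteq> (E::'a set)}"
  have ne: "?S E \<noteq> {}" for E by auto
  have *: "ennreal (\<nu> B) + ennreal (\<nu> C) \<le> pos_part \<nu> (E \<union> F)" if B: "B \<in> ?S E" and C: "C \<in> ?S F" for B C
  \<comment> \<open>\<open>ennreal\<close> is additive only on nonnegative numbers; a piece of
    nonpositive value counts as 0 on the left and is dropped instead of being united with the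
    other.\<close>
  proof (cases "\<nu> B \<le> 0 \<or> \<nu> C \<le> 0")
    case True
    then show ?thesis
    proof
      assume "\<nu> B \<le> 0"
      then show ?thesis using C pos_part_upper[of C "E \<union> F" \<nu>] by (auto simp: ennreal_neg)
    next
      assume "\<nu> C \<le> 0"
      then show ?thesis using B pos_part_upper[of B "E \<union> F" \<nu>] by (auto simp: ennreal_neg)
    qed
  next
    case False
    then have "ennreal (\<nu> B) + ennreal (\<nu> C) = ennreal (\<nu> B + \<nu> C)" by (simp add: ennreal_plus)
    also have "\<nu> B + \<nu> C = \<nu> (B \<union> C)"
      using B C E by (subst sigma_additive_Un[OF \<nu>]) auto
    also have "ennreal (\<nu> (B \<union> C)) \<le> pos_part \<nu> (E \<union> F)"
      using B C by (intro pos_part_upper) auto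
    finally show ?thesis .
  qed
  have "pos_part \<nu> E + pos_part \<nu> F = (SUP B\<in>?S E. ennreal (\<nu> B) + pos_part \<nu> F)"
    unfolding pos_part_def[of \<nu> E] by (rule ennreal_SUP_add_left[OF ne, symmetric])
  also have "\<dots> = (SUP B\<in>?S E. SUP C\<in>?S F. ennreal (\<nu> B) + ennreal (\<nu> C))"
    unfolding pos_part_def[of \<nu> F]
    by (rule SUP_cong[OF refl], rule ennreal_SUP_add_right[OF ne])
  also have "\<dots> \<le> pos_part \<nu> (E \<union> F)"
    by (intro SUP_least *) auto
  finally show ?thesis .
qed

lemma pos_part_empty: "sigma_additive \<nu> ==> pos_part \<nu> {} = 0"
proof -
  assume "sigma_additive \<nu>"
  moreover have "{B \<in> sets borel. B \<subseteq> {}} = {{} :: 'a set}" by auto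
  ultimately show ?thesis unfolding pos_part_def by (simp add: sigma_additive_empty)
qed

text \<open>Superadditivity on finite unions gives one direction. For the other, a subset
  \<open>B\<close> of the union is cut into the pieces \<open>B \<inter> A n\<close>, each of which
  competes in the supremum for \<open>A n\<close>.\<close>

lemma pos_part_countably_additive:
  assumes \<nu>: "sigma_additive \<nu>" and A: "range A \<subseteq> sets borel" "disjoint_family (A::nat \<Rightarrow> _)"
  shows "(\<Sum>i. pos_part \<nu> (A i)) = pos_part \<nu> (\<Union>i. A i)"
proof (rule antisym)
  have "(\<Sum>i<n. pos_part \<nu> (A i)) \<le> pos_part \<nu> (\<Union>i<n. A i)" for n
  proof (induction n)
    case (Suc n)
    have disj: "(\<Union>i<n. A i) \<inter> A n = {}"
    proof -
      have "A i \<inter> A n = {}" if "i < n" for i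
        using disjoint_family_onD[OF A(2), of i n] that by auto
      then show ?thesis by blast
    qed
    have "(\<Sum>i<Suc n. pos_part \<nu> (A i)) \<le> pos_part \<nu> (\<Union>i<n. A i) + pos_part \<nu> (A n)"
      using Suc by (simp add: add_right_mono)
    also have "\<dots> \<le> pos_part \<nu> ((\<Union>i<n. A i) \<union> A n)"
      by (rule pos_part_superadd[OF \<nu> disj])
    also have "(\<Union>i<n. A i) \<union> A n = (\<Union>i<Suc n. A i)" by (auto simp: lessThan_Suc)
    finally show ?case .
  qed simp
  also have "pos_part \<nu> (\<Union>i<n. A i) \<le> pos_part \<nu> (\<Union>i. A i)" for n by (rule pos_part_mono) auto
  finally have *: "(\<Sum>i<n. pos_part \<nu> (A i)) \<le> pos_part \<nu> (\<Union>i. A i)" for n .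
  show "(\<Sum>i. pos_part \<nu> (A i)) \<le> pos_part \<nu> (\<Union>i. A i)"
    by (rule suminf_le_const[OF _ *]) auto
next
  show "pos_part \<nu> (\<Union>i. A i) \<le> (\<Sum>i. pos_part \<nu> (A i))"
    unfolding pos_part_def[of \<nu> "\<Union>i. A i"]
  proof (rule SUP_least, clarsimp)
    fix B :: "'a set" assume B: "B \<in> sets borel" "B \<subseteq> (\<Union>i. A i)"
    have "(\<lambda>n. \<nu> (B \<inter> A n)) sums \<nu> (\<Union>n. B \<inter> A n)"
      using A B by (intro sigma_additiveD[OF \<nu>]) (auto simp: disjoint_family_on_def)
    moreover have "(\<Union>n. B \<inter> A n) = B" using B by auto
    ultimately have "ennreal (\<nu> B) \<le> (\<Sum>i. ennreal (\<nu> (B \<inter> A i)))" using ennreal_sums_le by metis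
    also have "\<dots> \<le> (\<Sum>i. pos_part \<nu> (A i))"
      using A B by (intro suminf_le pos_part_upper) auto
    finally show "ennreal (\<nu> B) \<le> (\<Sum>i. pos_part \<nu> (A i))" .
  qed
qed

text \<open>If the positive part were infinite, one could peel off disjoint sets \<open>F n - F (Suc n)\<close>
  with \<open>\<bar>\<nu>\<bar> \<ge> 1\<close>, against convergence of the series.\<close>

lemma pos_part_finite:
  assumes \<nu>: "sigma_additive \<nu>" shows "pos_part \<nu> UNIV < \<infinity>"
proof (rule ccontr)
  assume inf: "\<not> ?thesis"
  define Q where "Q E \<longleftrightarrow> E \<in> sets borel \<and> pos_part \<nu> E = \<infinity>" for E
  have step: "\<exists>F. Q F \<and> F \<subseteq> E \<and> \<bar>\<nu> (E - F)\<bar> \<ge> 1" if E: "Q E" for E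
  proof -
    \<comment> \<open>A subset \<open>B\<close> with \<nu> B > 1 + |\<nu> E| has |\<nu>| at least 1
      both on \<open>B\<close> and on \<open>E - B\<close>. So whichever of the two retains an
      infinite positive part, the discarded one has value at least 1 in modulus.\<close>
    have "ennreal (1 + \<bar>\<nu> E\<bar>) < pos_part \<nu> E" using E by (simp add: Q_def)
    then obtain B where B: "B \<in> sets borel" "B \<subseteq> E" "ennreal (1 + \<bar>\<nu> E\<bar>) < ennreal (\<nu> B)"
      unfolding pos_part_def less_SUP_iff by auto
    then have nB: "1 + \<bar>\<nu> E\<bar> < \<nu> B"
      by (smt (verit) ennreal_leI linorder_not_less)
    have Eb: "E \<in> sets borel" using E by (simp add: Q_def)
    have "pos_part \<nu> E = pos_part \<nu> B + pos_part \<nu> (E - B)"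
    proof -
      have "(\<Sum>i. pos_part \<nu> (binaryset B (E - B) i)) = pos_part \<nu> (\<Union>i. binaryset B (E - B) i)"
        using B Eb by (intro pos_part_countably_additive[OF \<nu>]) (auto simp: binaryset_def disjoint_family_on_def)
      moreover have "(\<Sum>i. pos_part \<nu> (binaryset B (E - B) i)) = pos_part \<nu> B + pos_part \<nu> (E - B)"
        by (rule suminf_binaryset_eq) (rule pos_part_empty[OF \<nu>])
      ultimately show ?thesis using B by (simp add: UN_binaryset_eq Un_absorb1)
    qed
    then have "pos_part \<nu> B = \<infinity> \<or> pos_part \<nu> (E - B) = \<infinity>"
      using E by (auto simp: Q_def)
    then show ?thesis
    proof
      assume "pos_part \<nu> B = \<infinity>"
      moreover have "\<bar>\<nu> (E - B)\<bar> \<ge> 1" using nB sigma_additive_Diff[OF \<nu> Eb B(1,2)] by linarith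
      ultimately show ?thesis using B by (auto simp: Q_def)
    next
      assume "pos_part \<nu> (E - B) = \<infinity>"
      moreover have "E - (E - B) = B" using B by auto
      moreover have "\<bar>\<nu> B\<bar> \<ge> 1" using nB by linarith
      ultimately show ?thesis using B Eb by (intro exI[of _ "E - B"]) (auto simp: Q_def)
    qed
  qed
  have "Q UNIV" using inf by (auto simp: Q_def less_top[symmetric])
  then have "\<exists>F. \<forall>n::nat. Q (F n) \<and> (F (Suc n) \<subseteq> F n \<and> \<bar>\<nu> (F n - F (Suc n))\<bar> \<ge> 1)"
    using step by (intro dependent_nat_choice[of "\<lambda>_. Q" "\<lambda>_ E F. F \<subseteq> E \<and> \<bar>\<nu> (E - F)\<bar> \<ge> 1"]) auto
  then obtain F where F: "\<And>n::nat. Q (F n)" "\<And>n. F (Suc n) \<subseteq> F n \<and> \<bar>\<nu> (F n - F (Suc n))\<bar> \<ge> 1"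
    by blast
  have dec: "decseq F" using F(2) by (intro decseq_SucI) auto
  have "(\<lambda>n. \<nu> (F n - F (Suc n))) sums \<nu> (\<Union>n. F n - F (Suc n))"
  proof (intro sigma_additiveD[OF \<nu>])
    show "F n - F (Suc n) \<in> sets borel" for n using F(1) by (auto simp: Q_def)
    have "(F m - F (Suc m)) \<inter> (F n - F (Suc n)) = {}" if "m < n" for m n
      using decseqD[OF dec, of "Suc m" n] that by auto
    then show "disjoint_family (\<lambda>n. F n - F (Suc n))"
      unfolding disjoint_family_on_def by (metis Int_commute linorder_neqE_nat)
  qed
  then have "(\<lambda>n. \<nu> (F n - F (Suc n))) \<longlonglongrightarrow> 0"
    using sums_summable summable_LIMSEQ_zero by blast
  then have "\<forall>\<^sub>F n in sequentially. \<bar>\<nu> (F n - F (Suc n))\<bar> < 1"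
    by (auto dest!: tendstoD[where e=1])
  then show False using F(2) by (metis (mono_tags, lifting) eventually_sequentially linorder_not_less order_refl)
qed

lemma jordan_pos_eq: "jordan_pos \<nu> = measure_of UNIV (sets borel) (pos_part \<nu>)"
  unfolding jordan_pos_def pos_part_def ..

lemma sets_jordan_pos [simp]: "sets (jordan_pos \<nu>) = sets borel"
  and space_jordan_pos [simp]: "space (jordan_pos \<nu>) = UNIV"
  unfolding jordan_pos_eq by simp_all

lemma emeasure_jordan_pos:
  "sigma_additive \<nu> ==> E \<in> sets borel ==> emeasure (jordan_pos \<nu>) E = pos_part \<nu> E"
  unfolding jordan_pos_eq
  by (rule emeasure_borel_measure_of) (auto simp: pos_part_empty pos_part_countably_additive)

lemma finite_measure_jordan_pos:
  assumes "sigma_additive \<nu>" shows "finite_measure (jordan_pos \<nu>)"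
  using pos_part_finite[OF assms] by (intro finite_measureI) (simp add: emeasure_jordan_pos assms)

lemma sigma_additive_uminus: "sigma_additive (\<nu> :: _ \<Rightarrow> real) ==> sigma_additive (\<lambda>E. - \<nu> E)"
  unfolding sigma_additive_def by (auto intro: sums_minus)

text \<open>Complementation inside \<open>E\<close> exchanges the two suprema: \<nu> B = \<nu> E -
  \<nu> (E - B) is at most \<nu> E plus the negative part of \<open>E\<close>, and symmetrically for
  -\<nu>.\<close>

lemma jordan_decomposition:
  assumes \<nu>: "sigma_additive \<nu>" and E: "E \<in> sets borel"
  shows "\<nu> E = measure (jordan_pos \<nu>) E - measure (jordan_pos (\<lambda>E. - \<nu> E)) E"
proof -
  interpret P: finite_measure "jordan_pos \<nu>" by (rule finite_measure_jordan_pos[OF \<nu>])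
  interpret N: finite_measure "jordan_pos (\<lambda>E. - \<nu> E)"
    by (rule finite_measure_jordan_pos[OF sigma_additive_uminus[OF \<nu>]])
  define a where "a = measure (jordan_pos \<nu>) E"
  define b where "b = measure (jordan_pos (\<lambda>E. - \<nu> E)) E"
  have a: "ennreal a = pos_part \<nu> E" and b: "ennreal b = pos_part (\<lambda>E. - \<nu> E) E"
    unfolding a_def b_def P.emeasure_eq_measure[symmetric] N.emeasure_eq_measure[symmetric]
    using emeasure_jordan_pos[OF \<nu> E] emeasure_jordan_pos[OF sigma_additive_uminus[OF \<nu>] E] by auto
  have ab: "a \<ge> 0" "b \<ge> 0" by (auto simp: a_def b_def)
  have ubB: "\<nu> B \<le> a" and ubB': "- \<nu> B \<le> b" if "B \<in> sets borel" "B \<subseteq> E" for B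
    using pos_part_upper[OF that, of \<nu>] pos_part_upper[OF that, of "\<lambda>E. - \<nu> E"] ab
    unfolding a[symmetric] b[symmetric] by (auto simp: ennreal_le_iff)
  have "pos_part \<nu> E \<le> ennreal (b + \<nu> E)"
    unfolding pos_part_def
  proof (rule SUP_least, clarsimp)
    fix B assume B: "B \<in> sets borel" "B \<subseteq> E"
    have "\<nu> (E - B) = \<nu> E - \<nu> B" by (rule sigma_additive_Diff[OF \<nu> E B])
    then show "ennreal (\<nu> B) \<le> ennreal (b + \<nu> E)" using ubB'[of "E - B"] B E by (intro ennreal_leI) auto
  qed
  moreover have "b + \<nu> E \<ge> 0" using ubB'[OF E] by simp
  ultimately have 1: "a \<le> b + \<nu> E" using a ab by (metis ennreal_le_iff)
  have "pos_part (\<lambda>E. - \<nu> E) E \<le> ennreal (a - \<nu> E)"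
    unfolding pos_part_def
  proof (rule SUP_least, clarsimp)
    fix B assume B: "B \<in> sets borel" "B \<subseteq> E"
    have "\<nu> (E - B) = \<nu> E - \<nu> B" by (rule sigma_additive_Diff[OF \<nu> E B])
    then show "ennreal (- \<nu> B) \<le> ennreal (a - \<nu> E)" using ubB[of "E - B"] B E by (intro ennreal_leI) auto
  qed
  moreover have "a - \<nu> E \<ge> 0" using ubB[OF E] by simp
  ultimately have 2: "b \<le> a - \<nu> E" using b ab by (metis ennreal_le_iff)
  show ?thesis using 1 2 unfolding a_def b_def by simp
qed

section \<open>Complex measures as densities, variation, polar decomposition\<close>

text \<open>The normal form of complex measures: it turns every integral against them into a Bochner
  integral over a finite positive measure. The value 0 off the Borel sets follows the convention of
  \<open>complex_borel_measure\<close>.\<close>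

definition dens :: "'a::topological_space measure \<Rightarrow> ('a \<Rightarrow> complex) \<Rightarrow> 'a set \<Rightarrow> complex" where
  "dens m g = (\<lambda>E. if E \<in> sets borel then (LINT x:E|m. g x) else 0)"

lemma complex_borel_measure_alt:
  "complex_borel_measure \<mu> \<longleftrightarrow> sigma_additive \<mu> \<and> (\<forall>E. E \<notin> sets borel \<longrightarrow> \<mu> E = 0)"
  unfolding complex_borel_measure_def sigma_additive_def ..

lemma set_integrable_of_integrable:
  assumes "integrable m g" "E \<in> sets m"
  shows "set_integrable m E (g :: 'a \<Rightarrow> 'b::{banach,second_countable_topology})"
  using integrable_mult_indicator[OF assms(2,1)] by (simp add: set_integrable_def)

lemma set_integral_sums:
  fixes g :: "'a \<Rightarrow> 'b::{banach,second_countable_topology}"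
  assumes g: "integrable m g" and A: "\<And>n::nat. A n \<in> sets m" "disjoint_family A"
  shows "(\<lambda>n. LINT x:A n|m. g x) sums (LINT x:(\<Union>n. A n)|m. g x)"
proof -
  have "(\<lambda>n. LINT x:(\<Union>i<n. A i)|m. g x) \<longlonglongrightarrow> (LINT x:(\<Union>n. \<Union>i<n. A i)|m. g x)"
  proof (rule set_integral_cont_up)
    show "incseq (\<lambda>n. \<Union>i<n. A i)" by (intro incseq_SucI) (auto simp: lessThan_Suc)
    show "set_integrable m (\<Union>n. \<Union>i<n. A i) g" using A by (intro set_integrable_of_integrable g) auto
  qed (use A in auto)
  moreover have "(\<Union>n. \<Union>i<n. A i) = (\<Union>n. A n)" by auto
  moreover have "(LINT x:(\<Union>i<n. A i)|m. g x) = (\<Sum>i<n. LINT x:A i|m. g x)" for n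
    using A by (intro set_integral_finite_Union)
      (auto intro: set_integrable_of_integrable[OF g] simp: disjoint_family_on_def)
  ultimately show ?thesis unfolding sums_def by simp
qed

lemma complex_borel_measure_dens:
  assumes "sets m = sets borel" "integrable m g"
  shows "complex_borel_measure (dens m g)"
  unfolding complex_borel_measure_def
proof (intro conjI allI impI)
  fix A :: "nat \<Rightarrow> 'a set" assume A: "range A \<subseteq> sets borel" "disjoint_family A"
  then have "(\<lambda>n. LINT x:A n|m. g x) sums (LINT x:(\<Union>n. A n)|m. g x)"
    using assms by (intro set_integral_sums) auto
  moreover have "(\<Union>n. A n) \<in> sets borel" "A n \<in> sets borel" for n using A by auto
  ultimately show "(\<lambda>n. dens m g (A n)) sums dens m g (\<Union>n. A n)" by (simp add: dens_def)
qed (simp add: dens_def)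

lemma variation_le:
  fixes T :: "'a::topological_space measure"
  assumes "sets T = sets borel" and "\<And>F. F \<in> sets borel ==> F \<subseteq> E ==> ennreal (cmod (\<mu> F)) \<le> emeasure T F"
  shows "variation \<mu> E \<le> emeasure T E"
  unfolding variation_def
proof (rule SUP_least, clarify)
  fix A :: "nat \<Rightarrow> 'a set" assume A: "range A \<subseteq> sets borel" "disjoint_family A" "E = (\<Union>n. A n)"
  have "(\<Sum>n. ennreal (cmod (\<mu> (A n)))) \<le> (\<Sum>n. emeasure T (A n))"
    using A by (intro suminf_le assms) auto
  also have "\<dots> = emeasure T (\<Union>n. A n)" using A assms(1) by (intro suminf_emeasure) auto
  finally show "(\<Sum>n. ennreal (cmod (\<mu> (A n)))) \<le> emeasure T (\<Union>n. A n)" .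
qed

lemma norm_set_integral_le:
  fixes g :: "'a \<Rightarrow> 'b::{banach,second_countable_topology}"
  assumes "integrable m g" "E \<in> sets m"
  shows "norm (LINT x:E|m. g x) \<le> (LINT x:E|m. norm (g x))"
  using set_integral_norm_bound[OF set_integrable_of_integrable[OF assms]] .

lemma emeasure_density_norm:
  fixes g :: "'a \<Rightarrow> 'b::{banach,second_countable_topology}"
  assumes "integrable m g" "E \<in> sets m"
  shows "emeasure (density m (\<lambda>x. ennreal (norm (g x)))) E = ennreal (LINT x:E|m. norm (g x))"
proof -
  have "emeasure (density m (\<lambda>x. ennreal (norm (g x)))) E = (\<integral>\<^sup>+x. ennreal (norm (g x)) * indicator E x \<partial>m)"
    using assms by (intro emeasure_density) auto
  also have "\<dots> = (\<integral>\<^sup>+x. ennreal (indicator E x * norm (g x)) \<partial>m)"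
    by (intro nn_integral_cong) (auto split: split_indicator)
  also have "\<dots> = ennreal (LINT x:E|m. norm (g x))"
    unfolding set_lebesgue_integral_def real_scaleR_def
    using integrable_mult_indicator[OF assms(2) integrable_norm[OF assms(1)]]
    by (intro nn_integral_eq_integral) auto
  finally show ?thesis .
qed

text \<open>For the lower bound the range of \<open>g\<close> is cut into cells of diameter at most \<open>2 \<epsilon>\<close>.\<close>

lemma variation_dens:
  assumes m: "sets m = sets borel" "finite_measure m" and g: "integrable m g" and E: "E \<in> sets borel"
  shows "variation (dens m g) E = ennreal (LINT x:E|m. norm (g x))"
proof (rule antisym)
  let ?T = "density m (\<lambda>x. ennreal (norm (g x)))"
  have Em: "E \<in> sets m" using E m by simp
  have "variation (dens m g) E \<le> emeasure ?T E"
  proof (rule variation_le)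
    fix F :: "'a set" assume F: "F \<in> sets borel"
    then show "ennreal (cmod (dens m g F)) \<le> emeasure ?T F"
      using norm_set_integral_le[OF g, of F] emeasure_density_norm[OF g, of F] m
      by (simp add: dens_def ennreal_leI)
  qed (simp add: m)
  then show "variation (dens m g) E \<le> ennreal (LINT x:E|m. norm (g x))"
    using emeasure_density_norm[OF g Em] by simp
next
  interpret finite_measure m by fact
  have [measurable]: "g \<in> borel_measurable m" using g by auto
  have Em: "E \<in> sets m" using E m by simp
  have key: "ennreal (LINT x:E|m. norm (g x)) \<le> variation (dens m g) E + ennreal (4 * \<epsilon> * measure m E)"
    if \<epsilon>: "\<epsilon> > 0" for \<epsilon> :: real
  proof -
    \<comment> \<open>The squares of an \<epsilon>-mesh of the plane are numbered by naturals,
      because \<open>variation\<close> ranges over partitions indexed by naturals.\<close>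
    define cell where "cell z = to_nat (\<lfloor>Re z / \<epsilon>\<rfloor>, \<lfloor>Im z / \<epsilon>\<rfloor>)" for z :: complex
    define A where "A n = {x \<in> E. cell (g x) = n}" for n
    have cell_close: "cmod (z - w) \<le> 2 * \<epsilon>" if "cell z = cell w" for z w
    proof -
      have *: "\<lfloor>Re z / \<epsilon>\<rfloor> = \<lfloor>Re w / \<epsilon>\<rfloor>" "\<lfloor>Im z / \<epsilon>\<rfloor> = \<lfloor>Im w / \<epsilon>\<rfloor>"
        using that by (auto simp: cell_def)
      have "\<bar>Re z / \<epsilon> - Re w / \<epsilon>\<bar> \<le> 1" "\<bar>Im z / \<epsilon> - Im w / \<epsilon>\<bar> \<le> 1" using * by linarith+
      then have "\<bar>Re z - Re w\<bar> \<le> \<epsilon>" "\<bar>Im z - Im w\<bar> \<le> \<epsilon>"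
        using \<epsilon> by (simp_all add: diff_divide_distrib[symmetric] abs_divide)
      then show ?thesis using cmod_le[of "z - w"] by simp
    qed
    have Am [measurable]: "A n \<in> sets m" for n
    proof -
      have "(\<lambda>x. (\<lfloor>Re (g x) / \<epsilon>\<rfloor>, \<lfloor>Im (g x) / \<epsilon>\<rfloor>)) \<in> measurable m (count_space UNIV \<Otimes>\<^sub>M count_space UNIV)"
        by measurable
      then have "(\<lambda>x. (\<lfloor>Re (g x) / \<epsilon>\<rfloor>, \<lfloor>Im (g x) / \<epsilon>\<rfloor>)) \<in> measurable m (count_space UNIV)"
        by (simp add: pair_measure_countable)
      then have "(\<lambda>x. cell (g x)) \<in> measurable m (count_space UNIV)"
        unfolding cell_def by (rule measurable_compose) simp
      then have "{x \<in> space m. cell (g x) = n} \<in> sets m" by measurable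
      moreover have "A n = E \<inter> {x \<in> space m. cell (g x) = n}"
        using sets.sets_into_space[OF Em] by (auto simp: A_def)
      ultimately show ?thesis using Em by auto
    qed
    have disj: "disjoint_family A" by (auto simp: A_def disjoint_family_on_def)
    have UA: "(\<Union>n. A n) = E" by (auto simp: A_def)
    \<comment> \<open>The error 4 \<epsilon> consists of 2 \<epsilon> for replacing |g| by |z| on
      the cell and 2 \<epsilon> for replacing the integral of \<open>g\<close> by z times the mass
      of the cell.\<close>
    have piece: "(LINT x:A n|m. norm (g x)) \<le> cmod (dens m g (A n)) + 4 * \<epsilon> * measure m (A n)" for n
    proof (cases "A n = {}")
      case False
      then obtain x0 where x0: "x0 \<in> A n" by auto
      define z where "z = g x0"
      have cl: "cmod (g x - z) \<le> 2 * \<epsilon>" if "x \<in> A n" for x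
        using x0 that by (intro cell_close) (auto simp: A_def z_def)
      have si: "set_integrable m (A n) g" "set_integrable m (A n) (\<lambda>x. norm (g x))"
        using g by (auto intro!: set_integrable_of_integrable)
      have sc: "set_integrable m (A n) (\<lambda>x. c)" for c :: "'c::{banach,second_countable_topology}"
        by (intro set_integrable_of_integrable) auto
      have "(LINT x:A n|m. norm (g x)) \<le> (LINT x:A n|m. cmod z + 2 * \<epsilon>)"
      proof (rule set_integral_mono[OF si(2) sc])
        fix x assume "x \<in> A n"
        then show "cmod (g x) \<le> cmod z + 2 * \<epsilon>" using cl[of x] norm_triangle_sub[of "g x" z] by linarith
      qed
      also have "\<dots> = (cmod z + 2 * \<epsilon>) * measure m (A n)"
        by (simp add: set_lebesgue_integral_def)
      finally have 1: "(LINT x:A n|m. norm (g x)) \<le> (cmod z + 2 * \<epsilon>) * measure m (A n)" .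
      have "cmod (z * measure m (A n) - (LINT x:A n|m. g x)) = cmod (LINT x:A n|m. z - g x)"
        by (subst set_integral_diff(2)[OF sc si(1)]) (simp add: set_lebesgue_integral_def scaleR_conv_of_real mult.commute)
      also have "\<dots> \<le> (LINT x:A n|m. norm (z - g x))"
        using g by (intro norm_set_integral_le) auto
      also have "\<dots> \<le> (LINT x:A n|m. 2 * \<epsilon>)"
        using cl g by (intro set_integral_mono sc set_integrable_of_integrable) (auto simp: norm_minus_commute)
      also have "\<dots> = 2 * \<epsilon> * measure m (A n)"
        by (simp add: set_lebesgue_integral_def)
      finally have "cmod (z * measure m (A n)) \<le> cmod (LINT x:A n|m. g x) + 2 * \<epsilon> * measure m (A n)"
        by (smt (verit) norm_triangle_ineq3)
      then have "cmod z * measure m (A n) \<le> cmod (LINT x:A n|m. g x) + 2 * \<epsilon> * measure m (A n)"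
        by (simp add: norm_mult)
      moreover have "dens m g (A n) = (LINT x:A n|m. g x)" using Am[of n] m by (simp add: dens_def)
      ultimately show ?thesis using 1 by (simp add: algebra_simps)
    qed (simp add: set_lebesgue_integral_def)
    have "ennreal (LINT x:E|m. norm (g x)) = emeasure (density m (\<lambda>x. ennreal (norm (g x)))) (\<Union>n. A n)"
      using emeasure_density_norm[OF g Em] UA by simp
    also have "\<dots> = (\<Sum>n. emeasure (density m (\<lambda>x. ennreal (norm (g x)))) (A n))"
      using disj by (intro suminf_emeasure[symmetric]) auto
    also have "\<dots> = (\<Sum>n. ennreal (LINT x:A n|m. norm (g x)))"
      by (intro suminf_cong emeasure_density_norm g) auto
    also have "\<dots> \<le> (\<Sum>n. ennreal (cmod (dens m g (A n))) + ennreal (4 * \<epsilon> * measure m (A n)))"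
    proof (intro suminf_le)
      fix n show "ennreal (LINT x:A n|m. norm (g x)) \<le> ennreal (cmod (dens m g (A n))) + ennreal (4 * \<epsilon> * measure m (A n))"
        using ennreal_leI[OF piece[of n]] \<epsilon> by (simp add: ennreal_plus)
    qed auto
    also have "\<dots> = (\<Sum>n. ennreal (cmod (dens m g (A n)))) + (\<Sum>n. ennreal (4 * \<epsilon> * measure m (A n)))"
      by (rule suminf_add[symmetric]) auto
    also have "(\<Sum>n. ennreal (4 * \<epsilon> * measure m (A n))) = ennreal (4 * \<epsilon>) * (\<Sum>n. emeasure m (A n))"
      using \<epsilon> by (simp add: emeasure_eq_measure ennreal_mult ennreal_suminf_cmult)
    also have "(\<Sum>n. emeasure m (A n)) = emeasure m E"
      using disj UA by (subst suminf_emeasure) auto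
    also have "ennreal (4 * \<epsilon>) * emeasure m E = ennreal (4 * \<epsilon> * measure m E)"
      using \<epsilon> by (simp add: emeasure_eq_measure ennreal_mult)
    also have "(\<Sum>n. ennreal (cmod (dens m g (A n)))) \<le> variation (dens m g) E"
      unfolding variation_def using disj UA Am m by (intro SUP_upper) auto
    finally show ?thesis by (simp add: add_right_mono)
  qed
  show "ennreal (LINT x:E|m. norm (g x)) \<le> variation (dens m g) E"
  proof (rule ennreal_le_epsilon)
    fix e :: real assume e: "e > 0"
    define \<epsilon> where "\<epsilon> = e / (4 * (measure m E + 1))"
    have M: "measure m E + 1 > 0" by (simp add: add_nonneg_pos)
    have "4 * \<epsilon> * measure m E = e * (measure m E / (measure m E + 1))" using M by (simp add: \<epsilon>_def field_simps)
    also have "\<dots> \<le> e * 1" using M e by (intro mult_left_mono) auto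
    finally have "ennreal (4 * \<epsilon> * measure m E) \<le> ennreal e" by (intro ennreal_leI) simp
    moreover have "\<epsilon> > 0" using e M by (simp add: \<epsilon>_def)
    ultimately show "ennreal (LINT x:E|m. norm (g x)) \<le> variation (dens m g) E + ennreal e"
      using key[of \<epsilon>] by (meson add_left_mono order_trans)
  qed
qed

text \<open>The set where \<open>r\<close> is positive is a Hahn set: the supremum over subsets of
  \<open>E\<close> is attained on its intersection with \<open>E\<close>. In the density
  \<open>ennreal\<close> cuts off the negative part of \<open>r\<close>.\<close>

lemma jordan_pos_dens:
  assumes m: "sets m = sets borel" and r: "integrable m r"
    and \<nu>: "\<And>E. E \<in> sets borel ==> \<nu> E = (LINT x:E|m. r x)"
  shows "jordan_pos \<nu> = density m (\<lambda>x. ennreal (r x))"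
proof (rule measure_eqI)
  fix E assume "E \<in> sets (jordan_pos \<nu>)"
  then have E: "E \<in> sets borel" by simp
  have [measurable]: "r \<in> borel_measurable m" using r by auto
  have sp: "space m = UNIV" using sets_eq_imp_space_eq[OF m] by simp
  have r': "integrable m (\<lambda>x. max 0 (r x))" using r by auto
  have dE: "emeasure (density m (\<lambda>x. ennreal (r x))) F = ennreal (LINT x:F|m. max 0 (r x))" if "F \<in> sets borel" for F
    using emeasure_density_norm[OF r', of F] that m
    by (simp add: abs_of_nonneg[OF max.cobounded1] ennreal_max_0)
  have sums: "sigma_additive \<nu>"
    unfolding sigma_additive_def
  proof (intro allI impI)
    fix A :: "nat \<Rightarrow> 'a set" assume A: "range A \<subseteq> sets borel" "disjoint_family A"
    then have "(\<lambda>n. LINT x:A n|m. r x) sums (LINT x:(\<Union>n. A n)|m. r x)"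
      using m r by (intro set_integral_sums) auto
    moreover have "(\<Union>n. A n) \<in> sets borel" "\<And>n. A n \<in> sets borel" using A by auto
    ultimately show "(\<lambda>n. \<nu> (A n)) sums \<nu> (\<Union>n. A n)" by (simp add: \<nu>)
  qed
  have "pos_part \<nu> E = ennreal (LINT x:E|m. max 0 (r x))"
  proof (rule antisym)
    show "pos_part \<nu> E \<le> ennreal (LINT x:E|m. max 0 (r x))"
      unfolding pos_part_def
    proof (rule SUP_least, clarify)
      fix B assume B: "B \<in> sets borel" "B \<subseteq> E"
      have "\<nu> B \<le> (LINT x:B|m. max 0 (r x))"
        unfolding \<nu>[OF B(1)] using B m r by (intro set_integral_mono set_integrable_of_integrable) auto
      then have "ennreal (\<nu> B) \<le> emeasure (density m (\<lambda>x. ennreal (r x))) B"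
        using dE[OF B(1)] by (simp add: ennreal_leI)
      also have "\<dots> \<le> emeasure (density m (\<lambda>x. ennreal (r x))) E"
        using B E m by (intro emeasure_mono) auto
      finally show "ennreal (\<nu> B) \<le> ennreal (LINT x:E|m. max 0 (r x))" using dE[OF E] by simp
    qed
  next
    define B where "B = E \<inter> {x \<in> space m. r x > 0}"
    have "{x \<in> space m. r x > 0} \<in> sets m" by measurable
    then have B: "B \<in> sets borel" "B \<subseteq> E" using E m by (auto simp: B_def)
    have "(LINT x:E|m. max 0 (r x)) = (LINT x:B|m. r x)"
      unfolding set_lebesgue_integral_def
      by (intro Bochner_Integration.integral_cong) (auto simp: B_def split: split_indicator)
    then show "ennreal (LINT x:E|m. max 0 (r x)) \<le> pos_part \<nu> E"
      using pos_part_upper[OF B, of \<nu>] \<nu>[OF B(1)] by simp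
  qed
  then show "emeasure (jordan_pos \<nu>) E = emeasure (density m (\<lambda>x. ennreal (r x))) E"
    using dE[OF E] emeasure_jordan_pos[OF sums E] by simp
qed (simp add: m)

lemma Re_dens: "integrable m g ==> sets m = sets borel ==> E \<in> sets borel ==> Re (dens m g E) = (LINT x:E|m. Re (g x))"
  and Im_dens: "integrable m g ==> sets m = sets borel ==> E \<in> sets borel ==> Im (dens m g E) = (LINT x:E|m. Im (g x))"
  using integral_Re[OF set_integrable_of_integrable[of m g E, unfolded set_integrable_def]]
    integral_Im[OF set_integrable_of_integrable[of m g E, unfolded set_integrable_def]]
  by (auto simp: dens_def set_lebesgue_integral_def)

text \<open>The four Jordan parts have as densities the positive and negative parts of the real and
  imaginary parts of \<open>g\<close>. All of them are dominated by |g|, so integrability of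
  \<open>f x * g x\<close> lets the four integrals be recombined into one.\<close>

lemma cm_integral_dens:
  assumes m: "sets m = sets borel" and g: "integrable m g"
    and f: "f \<in> borel_measurable m" and fg: "integrable m (\<lambda>x. f x * g x)"
  shows "cm_integral (dens m g) f = (\<integral>x. f x * g x \<partial>m)"
proof -
  have [measurable]: "g \<in> borel_measurable m" "f \<in> borel_measurable m" using g f by auto
  have *: "integral\<^sup>L (density m (\<lambda>x. ennreal (r x))) f = (\<integral>x. max 0 (r x) *\<^sub>R f x \<partial>m)"
      and int: "integrable m (\<lambda>x. max 0 (r x) *\<^sub>R f x)"
    if [measurable]: "r \<in> borel_measurable m" and r: "\<And>x. \<bar>r x\<bar> \<le> cmod (g x)" for r
  proof -
    have "density m (\<lambda>x. ennreal (r x)) = density m (\<lambda>x. ennreal (max 0 (r x)))"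
      by (simp only: ennreal_max_0)
    then show "integral\<^sup>L (density m (\<lambda>x. ennreal (r x))) f = (\<integral>x. max 0 (r x) *\<^sub>R f x \<partial>m)"
      by (simp add: integral_density)
    show "integrable m (\<lambda>x. max 0 (r x) *\<^sub>R f x)"
    proof (rule Bochner_Integration.integrable_bound[OF fg])
      have "cmod (max 0 (r x) *\<^sub>R f x) \<le> cmod (f x * g x)" for x
      proof -
        have "max 0 (r x) \<le> cmod (g x)" using r[of x] by auto
        then show ?thesis by (simp add: norm_mult mult.commute mult_left_mono)
      qed
      then show "AE x in m. cmod (max 0 (r x) *\<^sub>R f x) \<le> cmod (f x * g x)" by simp
    qed measurable
  qed
  have j: "jordan_pos (\<lambda>E. Re (dens m g E)) = density m (\<lambda>x. ennreal (Re (g x)))"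
    "jordan_pos (\<lambda>E. - Re (dens m g E)) = density m (\<lambda>x. ennreal (- Re (g x)))"
    "jordan_pos (\<lambda>E. Im (dens m g E)) = density m (\<lambda>x. ennreal (Im (g x)))"
    "jordan_pos (\<lambda>E. - Im (dens m g E)) = density m (\<lambda>x. ennreal (- Im (g x)))"
    using g by (intro jordan_pos_dens m; simp add: Re_dens Im_dens m set_integral_uminus set_integrable_of_integrable; fail)+
  have le: "\<bar>Re (g x)\<bar> \<le> cmod (g x)" "\<bar>- Re (g x)\<bar> \<le> cmod (g x)" "\<bar>Im (g x)\<bar> \<le> cmod (g x)" "\<bar>- Im (g x)\<bar> \<le> cmod (g x)" for x
    by (auto simp: abs_Re_le_cmod abs_Im_le_cmod)
  note I = *[OF _ le(1)] *[OF _ le(2)] *[OF _ le(3)] *[OF _ le(4)]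
  note J = int[OF _ le(1)] int[OF _ le(2)] int[OF _ le(3)] int[OF _ le(4)]
  have "cm_integral (dens m g) f =
    (\<integral>x. max 0 (Re (g x)) *\<^sub>R f x - max 0 (- Re (g x)) *\<^sub>R f x
       + \<i> * (max 0 (Im (g x)) *\<^sub>R f x - max 0 (- Im (g x)) *\<^sub>R f x) \<partial>m)"
    unfolding cm_integral_def j using I J by simp
  also have "\<dots> = (\<integral>x. f x * g x \<partial>m)"
  proof (intro Bochner_Integration.integral_cong refl)
    fix x
    have "max 0 t *\<^sub>R z - max 0 (- t) *\<^sub>R z = t *\<^sub>R z" for t :: real and z :: complex
      by (auto simp: max_def)
    then show "max 0 (Re (g x)) *\<^sub>R f x - max 0 (- Re (g x)) *\<^sub>R f x
       + \<i> * (max 0 (Im (g x)) *\<^sub>R f x - max 0 (- Im (g x)) *\<^sub>R f x) = f x * g x"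
      by (simp add: scaleR_conv_of_real complex_eq_iff)
  qed
  finally show ?thesis .
qed

lemma Radon_Nikodym_real:
  assumes "finite_measure m" "finite_measure N" "absolutely_continuous m N" "sets N = sets m"
  obtains r where "integrable m r" "\<And>x. 0 \<le> r x" "N = density m (\<lambda>x. ennreal (r x))"
    "\<And>E. E \<in> sets m ==> measure N E = (LINT x:E|m. r x)"
proof -
  interpret m: finite_measure m by fact
  interpret N: finite_measure N by fact
  obtain D where D [measurable]: "D \<in> borel_measurable m" and D': "AE x in m. RN_deriv m N x = ennreal (D x)" "\<And>x. 0 \<le> D x"
    using m.real_RN_deriv[OF assms(2,3,4)] by metis
  have N: "N = density m (\<lambda>x. ennreal (D x))"
  proof -
    have "density m (RN_deriv m N) = density m (\<lambda>x. ennreal (D x))"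
      using D' by (intro density_cong) auto
    then show ?thesis using m.density_RN_deriv[OF assms(3,4)] by simp
  qed
  have "(\<integral>\<^sup>+x. ennreal (D x) \<partial>m) = (\<integral>\<^sup>+x. ennreal (D x) * indicator (space m) x \<partial>m)"
    by (intro nn_integral_cong) auto
  also have "\<dots> = emeasure (density m (\<lambda>x. ennreal (D x))) (space m)"
    by (rule emeasure_density[symmetric]) auto
  also have "\<dots> = emeasure N (space N)"
    using N sets_eq_imp_space_eq[OF assms(4)] by simp
  finally have "(\<integral>\<^sup>+x. ennreal (D x) \<partial>m) = emeasure N (space N)" .
  then have "(\<integral>\<^sup>+x. ennreal (D x) \<partial>m) < \<infinity>"
    using N.emeasure_finite by (simp add: less_top[symmetric])
  then have iD: "integrable m D" using D'(2) by (intro integrableI_nonneg D) auto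
  have "measure N E = (LINT x:E|m. D x)" if "E \<in> sets m" for E
  proof -
    have "emeasure N E = ennreal (LINT x:E|m. D x)"
      using emeasure_density_norm[OF iD that] D'(2) by (simp add: N)
    moreover have "(LINT x:E|m. D x) \<ge> 0"
      unfolding set_lebesgue_integral_def using D'(2) by (intro Bochner_Integration.integral_nonneg) auto
    ultimately show ?thesis by (simp add: measure_def)
  qed
  then show thesis using that iD D'(2) N by blast
qed

lemma measure_of_borel_eqI:
  assumes "sets T = sets (borel :: 'a::topological_space measure)" "\<And>E. E \<in> sets borel ==> f E = emeasure T E"
  shows "measure_of UNIV (sets borel) f = T"
proof -
  have "measure_of UNIV (sets borel) f = measure_of UNIV (sets borel) (emeasure T)"
    using assms sets.sigma_sets_eq[of borel] by (intro measure_of_eq) auto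
  also have "\<dots> = measure_of (space T) (sets T) (emeasure T)"
    using assms(1) sets_eq_imp_space_eq[OF assms(1)] by simp
  finally show ?thesis using measure_of_of_measure[of T] by simp
qed

text \<open>A common base: both summands are absolutely continuous with respect to it, so measures
  given over different bases become comparable through densities.\<close>

definition sum_measure :: "'a::topological_space measure \<Rightarrow> 'a measure \<Rightarrow> 'a measure" where
  "sum_measure m n = measure_of UNIV (sets borel) (\<lambda>E. emeasure m E + emeasure n E)"

lemma sets_sum_measure [simp]: "sets (sum_measure m n) = sets borel"
  unfolding sum_measure_def by simp

lemma emeasure_sum_measure:
  assumes "sets m = sets borel" "sets n = sets borel" "E \<in> sets borel"
  shows "emeasure (sum_measure m n) E = emeasure m E + emeasure n E"
  unfolding sum_measure_def
proof (rule emeasure_borel_measure_of)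
  fix A :: "nat \<Rightarrow> 'a set" assume A: "range A \<subseteq> sets borel" "disjoint_family A"
  then show "(\<Sum>i. emeasure m (A i) + emeasure n (A i)) = emeasure m (\<Union>i. A i) + emeasure n (\<Union>i. A i)"
    using assms by (subst suminf_add[symmetric]) (auto simp: suminf_emeasure)
qed (use assms in auto)

lemma finite_measure_sum_measure:
  assumes "sets m = sets borel" "sets n = sets borel" "finite_measure m" "finite_measure n"
  shows "finite_measure (sum_measure m n)"
proof
  have "space (sum_measure m n) = UNIV" unfolding sum_measure_def by simp
  then show "emeasure (sum_measure m n) (space (sum_measure m n)) \<noteq> \<infinity>"
    using assms finite_measure.emeasure_finite[of m UNIV] finite_measure.emeasure_finite[of n UNIV]
    by (simp add: emeasure_sum_measure)
qed

lemma absolutely_continuous_sum_measure: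
  assumes "sets m = sets borel" "sets n = sets borel"
  shows "absolutely_continuous (sum_measure m n) m" "absolutely_continuous (sum_measure m n) n"
  using assms by (auto simp: absolutely_continuous_def null_sets_def emeasure_sum_measure)

lemma sigma_additive_Re: "sigma_additive \<mu> ==> sigma_additive (\<lambda>E. Re (\<mu> E))"
  and sigma_additive_Im: "sigma_additive \<mu> ==> sigma_additive (\<lambda>E. Im (\<mu> E))"
  unfolding sigma_additive_def by (auto intro: sums_Re sums_Im)

lemma complex_borel_measure_eqI:
  "complex_borel_measure \<mu> ==> complex_borel_measure \<nu> ==> (\<And>E. E \<in> sets borel ==> \<mu> E = \<nu> E) ==> \<mu> = \<nu>"
  by (rule ext) (metis complex_borel_measure_def)

text \<open>Radon-Nikodym with respect to the sum of the four Jordan parts of the real and imaginary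
  parts.\<close>

lemma complex_borel_measure_imp_dens:
  assumes \<mu>: "complex_borel_measure \<mu>"
  obtains m g where "sets m = sets borel" "finite_measure m" "integrable m g" "\<mu> = dens m g"
proof -
  have s: "sigma_additive (\<lambda>E. Re (\<mu> E))" "sigma_additive (\<lambda>E. - Re (\<mu> E))"
    "sigma_additive (\<lambda>E. Im (\<mu> E))" "sigma_additive (\<lambda>E. - Im (\<mu> E))"
    using \<mu> by (auto simp: complex_borel_measure_alt intro!: sigma_additive_Re sigma_additive_Im sigma_additive_uminus)
  define P1 P2 P3 P4 where "P1 = jordan_pos (\<lambda>E. Re (\<mu> E))" and "P2 = jordan_pos (\<lambda>E. - Re (\<mu> E))"
    and "P3 = jordan_pos (\<lambda>E. Im (\<mu> E))" and "P4 = jordan_pos (\<lambda>E. - Im (\<mu> E))"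
  define m where "m = sum_measure (sum_measure P1 P2) (sum_measure P3 P4)"
  have fin: "finite_measure P1" "finite_measure P2" "finite_measure P3" "finite_measure P4"
    unfolding P1_def P2_def P3_def P4_def by (intro finite_measure_jordan_pos s)+
  have st: "sets P1 = sets borel" "sets P2 = sets borel" "sets P3 = sets borel" "sets P4 = sets borel"
    unfolding P1_def P2_def P3_def P4_def by simp_all
  have m: "sets m = sets borel" "finite_measure m"
    unfolding m_def by (auto intro!: finite_measure_sum_measure simp: fin st)
  have ac: "absolutely_continuous m P1" "absolutely_continuous m P2" "absolutely_continuous m P3" "absolutely_continuous m P4"
    unfolding m_def by (auto simp: absolutely_continuous_def null_sets_def emeasure_sum_measure st)
  obtain r1 where r1: "integrable m r1" "\<And>E. E \<in> sets m ==> measure P1 E = (LINT x:E|m. r1 x)"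
    using Radon_Nikodym_real[OF m(2) fin(1) ac(1)] st m by metis
  obtain r2 where r2: "integrable m r2" "\<And>E. E \<in> sets m ==> measure P2 E = (LINT x:E|m. r2 x)"
    using Radon_Nikodym_real[OF m(2) fin(2) ac(2)] st m by metis
  obtain r3 where r3: "integrable m r3" "\<And>E. E \<in> sets m ==> measure P3 E = (LINT x:E|m. r3 x)"
    using Radon_Nikodym_real[OF m(2) fin(3) ac(3)] st m by metis
  obtain r4 where r4: "integrable m r4" "\<And>E. E \<in> sets m ==> measure P4 E = (LINT x:E|m. r4 x)"
    using Radon_Nikodym_real[OF m(2) fin(4) ac(4)] st m by metis
  define g where "g x = complex_of_real (r1 x - r2 x) + \<i> * complex_of_real (r3 x - r4 x)" for x
  have g: "integrable m g" unfolding g_def using r1 r2 r3 r4 by auto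
  have "\<mu> = dens m g"
  proof (rule complex_borel_measure_eqI[OF \<mu> complex_borel_measure_dens[OF m(1) g]])
    fix E :: "'a set" assume E: "E \<in> sets borel"
    then have Em: "E \<in> sets m" using m by simp
    have "Re (\<mu> E) = (LINT x:E|m. r1 x) - (LINT x:E|m. r2 x)"
      using jordan_decomposition[OF s(1) E] r1(2)[OF Em] r2(2)[OF Em] by (simp add: P1_def P2_def)
    also have "\<dots> = (LINT x:E|m. r1 x - r2 x)"
      using r1(1) r2(1) Em by (intro set_integral_diff(2)[symmetric] set_integrable_of_integrable)
    also have "\<dots> = Re (dens m g E)"
      using Re_dens[OF g m(1) E] by (simp add: g_def)
    finally have re: "Re (\<mu> E) = Re (dens m g E)" .
    have "Im (\<mu> E) = (LINT x:E|m. r3 x) - (LINT x:E|m. r4 x)"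
      using jordan_decomposition[OF s(3) E] r3(2)[OF Em] r4(2)[OF Em] by (simp add: P3_def P4_def)
    also have "\<dots> = (LINT x:E|m. r3 x - r4 x)"
      using r3(1) r4(1) Em by (intro set_integral_diff(2)[symmetric] set_integrable_of_integrable)
    also have "\<dots> = Im (dens m g E)"
      using Im_dens[OF g m(1) E] by (simp add: g_def)
    finally show "\<mu> E = dens m g E" using re by (simp add: complex_eq_iff)
  qed
  then show thesis using that m g by blast
qed

lemma variation_measure_dens:
  assumes m: "sets m = sets borel" "finite_measure m" and g: "integrable m g"
  shows "variation_measure (dens m g) = density m (\<lambda>x. ennreal (cmod (g x)))"
  unfolding variation_measure_def
  using m emeasure_density_norm[OF g] by (intro measure_of_borel_eqI) (auto simp: variation_dens[OF m g])

lemma polar_decomposition: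
  assumes \<mu>: "complex_borel_measure \<mu>"
  shows sets_variation_measure: "sets (variation_measure \<mu>) = sets borel"
    and finite_variation_measure: "finite_measure (variation_measure \<mu>)"
    and emeasure_variation_measure: "\<And>E. E \<in> sets borel ==> emeasure (variation_measure \<mu>) E = variation \<mu> E"
    and ex_polar: "\<exists>h\<in>borel_measurable borel. (\<forall>x. cmod (h x) = 1) \<and> \<mu> = dens (variation_measure \<mu>) h"
proof -
  obtain m g where m: "sets m = sets borel" "finite_measure m" and g: "integrable m g" and \<mu>g: "\<mu> = dens m g"
    using complex_borel_measure_imp_dens[OF \<mu>] by metis
  let ?T = "density m (\<lambda>x. ennreal (cmod (g x)))"
  have V: "variation_measure \<mu> = ?T" unfolding \<mu>g by (rule variation_measure_dens[OF m g])
  have mg [measurable]: "g \<in> borel_measurable m" using g by auto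
  have mgb: "g \<in> borel_measurable borel" using mg m(1) measurable_cong_sets by blast
  show s: "sets (variation_measure \<mu>) = sets borel" using V m by simp
  show e: "emeasure (variation_measure \<mu>) E = variation \<mu> E" if "E \<in> sets borel" for E
    using V emeasure_density_norm[OF g, of E] that m variation_dens[OF m g that] \<mu>g by simp
  show "finite_measure (variation_measure \<mu>)"
  proof
    have "space (variation_measure \<mu>) = UNIV" using sets_eq_imp_space_eq[OF s] by simp
    then show "emeasure (variation_measure \<mu>) (space (variation_measure \<mu>)) \<noteq> \<infinity>"
      using e[of UNIV] variation_dens[OF m g, of UNIV] \<mu>g by simp
  qed
  \<comment> \<open>The zero set of \<open>g\<close> has variation 0, so the value 1 chosen there is
    harmless and makes \<open>h\<close> unimodular everywhere.\<close>
  define h where "h x = (if g x = 0 then 1 else sgn (g x))" for x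
  have h [measurable]: "h \<in> borel_measurable borel" unfolding h_def using mgb by measurable
  have hm [measurable]: "h \<in> borel_measurable m" using h m(1) measurable_cong_sets by blast
  have "\<mu> = dens (variation_measure \<mu>) h"
  proof
    fix E
    show "\<mu> E = dens (variation_measure \<mu>) h E"
    proof (cases "E \<in> sets borel")
      case True
      have [measurable]: "E \<in> sets m" using True m by simp
      have "(LINT x:E|?T. h x) = (\<integral>x. cmod (g x) *\<^sub>R (indicator E x *\<^sub>R h x) \<partial>m)"
        unfolding set_lebesgue_integral_def by (rule integral_density) auto
      also have "\<dots> = (LINT x:E|m. g x)"
        unfolding set_lebesgue_integral_def
        by (intro Bochner_Integration.integral_cong)
          (auto simp: h_def sgn_div_norm scaleR_conv_of_real split: split_indicator)
      finally show ?thesis using True V \<mu>g by (simp add: dens_def)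
    qed (use \<mu>g in \<open>simp add: dens_def\<close>)
  qed
  moreover have "cmod (h x) = 1" for x by (simp add: h_def norm_sgn)
  ultimately show "\<exists>h\<in>borel_measurable borel. (\<forall>x. cmod (h x) = 1) \<and> \<mu> = dens (variation_measure \<mu>) h"
    using h by blast
qed

section \<open>Finite Radon measures\<close>

definition radon :: "'a::topological_space measure \<Rightarrow> bool" where
  "radon m \<longleftrightarrow> sets m = sets borel \<and> finite_measure m \<and>
     (\<forall>E\<in>sets borel. \<forall>\<epsilon>>0. \<exists>K. compact K \<and> K \<subseteq> E \<and> measure m (E - K) < \<epsilon>)"

lemma radon_sets: "radon m ==> sets m = sets borel"
  and radon_finite: "radon m ==> finite_measure m"
  by (auto simp: radon_def)

lemma radon_space: "radon m ==> space m = UNIV"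
  using radon_sets[of m] sets_eq_imp_space_eq[of m borel] by simp

lemma radonE:
  assumes "radon m" "E \<in> sets borel" "\<epsilon> > 0"
  obtains K where "compact K" "K \<subseteq> E" "measure m (E - K) < \<epsilon>"
  using assms unfolding radon_def by blast

lemma compact_borel [measurable]: "compact K ==> K \<in> sets (borel :: 'a::t2_space measure)"
  by (intro borel_closed compact_imp_closed)

text \<open>The variation is finite, so the supremum over compact subsets has an \<epsilon>-form.
  Outer regularity at \<open>E\<close> is inner regularity at its complement, since complements of
  compact sets are open in a Hausdorff space.\<close>

lemma regular_iff_radon:
  fixes \<mu> :: "'a::t2_space set \<Rightarrow> complex"
  assumes \<mu>: "complex_borel_measure \<mu>"
  shows "regular_complex_measure \<mu> \<longleftrightarrow> radon (variation_measure \<mu>)"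
proof -
  let ?V = "variation_measure \<mu>"
  note V = sets_variation_measure[OF \<mu>] emeasure_variation_measure[OF \<mu>]
  interpret finite_measure ?V by (rule finite_variation_measure[OF \<mu>])
  have VE: "variation \<mu> E = ennreal (measure ?V E)" if "E \<in> sets borel" for E
    using V(2)[OF that] emeasure_eq_measure by simp
  show ?thesis
  proof
    assume reg: "regular_complex_measure \<mu>"
    show "radon ?V" unfolding radon_def
    proof (intro conjI ballI allI impI)
      fix E :: "'a set" and \<epsilon> :: real assume E: "E \<in> sets borel" and \<epsilon>: "\<epsilon> > 0"
      have sup: "variation \<mu> E = (SUP K\<in>{K. compact K \<and> K \<subseteq> E}. variation \<mu> K)"
        using reg E by (auto simp: regular_complex_measure_def)
      show "\<exists>K. compact K \<and> K \<subseteq> E \<and> measure ?V (E - K) < \<epsilon>"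
      proof (cases "measure ?V E < \<epsilon>")
        case True then show ?thesis by (intro exI[of _ "{}"]) auto
      next
        case False
        then have "ennreal (measure ?V E - \<epsilon>) < variation \<mu> E"
          using \<epsilon> VE[OF E] by (subst VE[OF E]) (rule ennreal_lessI, auto)
        then obtain K where K: "compact K" "K \<subseteq> E" "ennreal (measure ?V E - \<epsilon>) < variation \<mu> K"
          unfolding sup less_SUP_iff by auto
        then have "ennreal (measure ?V E - \<epsilon>) < ennreal (measure ?V K)" using VE[of K] by simp
        then have "measure ?V E - \<epsilon> < measure ?V K" using False by (simp add: ennreal_less_iff)
        moreover have "measure ?V (E - K) = measure ?V E - measure ?V K"
          using E K V(1) by (intro finite_measure_Diff) auto
        ultimately show ?thesis using K by auto
      qed
    qed (use V finite_measure_axioms in auto)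
  next
    assume rad: "radon ?V"
    have mono: "variation \<mu> A \<le> variation \<mu> B" if "A \<in> sets borel" "B \<in> sets borel" "A \<subseteq> B" for A B
      using that V by (metis emeasure_mono)
    show "regular_complex_measure \<mu>"
      unfolding regular_complex_measure_def
    proof (intro conjI ballI \<mu> antisym)
      fix E :: "'a set" assume E: "E \<in> sets borel"
      show "variation \<mu> E \<le> (SUP K\<in>{K. compact K \<and> K \<subseteq> E}. variation \<mu> K)"
      proof (rule ennreal_le_epsilon)
        fix e :: real assume "e > 0"
        then obtain K where K: "compact K" "K \<subseteq> E" "measure ?V (E - K) < e" using radonE[OF rad E] by metis
        have "measure ?V (E - K) = measure ?V E - measure ?V K"
          using E K V(1) by (intro finite_measure_Diff) auto
        then have "variation \<mu> E \<le> ennreal (measure ?V K + e)"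
          using K VE[OF E] by (simp add: ennreal_leI)
        also have "\<dots> = variation \<mu> K + ennreal e" using VE[of K] K \<open>e > 0\<close> by (simp add: ennreal_plus)
        also have "\<dots> \<le> (SUP K\<in>{K. compact K \<and> K \<subseteq> E}. variation \<mu> K) + ennreal e"
          using K by (intro add_right_mono SUP_upper) auto
        finally show "variation \<mu> E \<le> (SUP K\<in>{K. compact K \<and> K \<subseteq> E}. variation \<mu> K) + ennreal e" .
      qed
      show "(SUP K\<in>{K. compact K \<and> K \<subseteq> E}. variation \<mu> K) \<le> variation \<mu> E"
        using E by (intro SUP_least mono) auto
      show "variation \<mu> E \<le> (INF U\<in>{U. open U \<and> E \<subseteq> U}. variation \<mu> U)"
        using E by (intro INF_greatest mono) auto
      show "(INF U\<in>{U. open U \<and> E \<subseteq> U}. variation \<mu> U) \<le> variation \<mu> E"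
      proof (rule ennreal_le_epsilon)
        fix e :: real assume "e > 0"
        then obtain K where K: "compact K" "K \<subseteq> - E" "measure ?V (- E - K) < e" using radonE[OF rad, of "- E"] E by auto
        have oK: "open (- K)" using K compact_imp_closed by auto
        have "measure ?V (- K - E) = measure ?V (- K) - measure ?V E"
          using E K oK V(1) by (intro finite_measure_Diff) auto
        moreover have "- K - E = - E - K" by auto
        ultimately have "variation \<mu> (- K) \<le> ennreal (measure ?V E + e)"
          using K oK VE[of "- K"] by (simp add: ennreal_leI)
        also have "\<dots> = variation \<mu> E + ennreal e" using VE[OF E] \<open>e > 0\<close> by (simp add: ennreal_plus)
        finally have "variation \<mu> (- K) \<le> variation \<mu> E + ennreal e" .
        moreover have "(INF U\<in>{U. open U \<and> E \<subseteq> U}. variation \<mu> U) \<le> variation \<mu> (- K)"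
          using K oK by (intro INF_lower) auto
        ultimately show "(INF U\<in>{U. open U \<and> E \<subseteq> U}. variation \<mu> U) \<le> variation \<mu> E + ennreal e" by simp
      qed
    qed
  qed
qed

text \<open>Compact sets increasing inside \<open>E\<close> leave a remainder that decreases to an
  \<open>m\<close>-null set. This limit is also \<open>N\<close>-null, and finiteness of
  \<open>N\<close> gives continuity from above.\<close>

lemma radon_absolutely_continuous:
  fixes m N :: "'a::t2_space measure"
  assumes m: "radon m" and N: "sets N = sets borel" "finite_measure N" and ac: "absolutely_continuous m N"
  shows "radon N"
  unfolding radon_def
proof (intro conjI ballI allI impI N)
  fix E :: "'a set" and \<epsilon> :: real assume E: "E \<in> sets borel" and \<epsilon>: "\<epsilon> > 0"
  interpret m: finite_measure m using m by (rule radon_finite)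
  interpret N: finite_measure N by fact
  have "\<exists>K. compact K \<and> K \<subseteq> E \<and> measure m (E - K) < (1/2)^n" for n :: nat
    using radonE[OF m E, of "(1/2)^n"] by (metis zero_less_divide_1_iff zero_less_numeral zero_less_power)
  then obtain K where K: "\<And>n. compact (K n)" "\<And>n. K n \<subseteq> E" "\<And>n::nat. measure m (E - K n) < (1/2)^n" by metis
  define L where "L n = (\<Union>i\<le>n. K i)" for n
  have L: "compact (L n)" "L n \<subseteq> E" for n unfolding L_def using K by auto
  have [measurable]: "E - L n \<in> sets m" "E - L n \<in> sets N" for n using L E N radon_sets[OF m] by auto
  have "measure m (\<Inter>n. E - L n) \<le> (1/2)^n" for n
  proof -
    have "measure m (\<Inter>n. E - L n) \<le> measure m (E - K n)"
      using K E radon_sets[OF m] by (intro m.finite_measure_mono) (auto simp: L_def)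
    then show ?thesis using K(3)[of n] by simp
  qed
  then have "measure m (\<Inter>n. E - L n) \<le> 0"
    by (intro LIMSEQ_le_const[of "\<lambda>n. (1/2::real)^n"]) (auto intro!: LIMSEQ_power_zero)
  then have 0: "measure m (\<Inter>n. E - L n) = 0" using measure_nonneg[of m] by (intro antisym) auto
  have "(\<Inter>n. E - L n) \<in> sets m" by (intro sets.countable_INT) auto
  then have "(\<Inter>n. E - L n) \<in> null_sets m" using 0 unfolding null_sets_def m.emeasure_eq_measure by simp
  then have null: "(\<Inter>n. E - L n) \<in> null_sets N" using ac by (auto simp: absolutely_continuous_def)
  have "(\<lambda>n. measure N (E - L n)) \<longlonglongrightarrow> measure N (\<Inter>n. E - L n)"
  proof (rule N.finite_Lim_measure_decseq)
    show "range (\<lambda>n. E - L n) \<subseteq> sets N" by auto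
    show "decseq (\<lambda>n. E - L n)" by (auto simp: L_def decseq_def)
  qed
  then have "(\<lambda>n. measure N (E - L n)) \<longlonglongrightarrow> 0" using measure_eq_0_null_sets[OF null] by (simp only:)
  then have "\<forall>\<^sub>F n in sequentially. measure N (E - L n) < \<epsilon>" using \<epsilon> by (rule order_tendstoD)
  then obtain n where "measure N (E - L n) < \<epsilon>" using eventually_happens'[OF sequentially_bot] by blast
  then show "\<exists>K. compact K \<and> K \<subseteq> E \<and> measure N (E - K) < \<epsilon>" using L by blast
qed

lemma radon_density:
  fixes m :: "'a::t2_space measure"
  assumes m: "radon m" and r: "integrable m (r :: 'a \<Rightarrow> real)"
  shows "radon (density m (\<lambda>x. ennreal (r x)))"
proof (rule radon_absolutely_continuous[OF m])
  have [measurable]: "r \<in> borel_measurable m" using r by auto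
  show "sets (density m (\<lambda>x. ennreal (r x))) = sets borel" using radon_sets[OF m] by simp
  show "absolutely_continuous m (density m (\<lambda>x. ennreal (r x)))"
    by (intro absolutely_continuousI_density) auto
  have "emeasure (density m (\<lambda>x. ennreal (r x))) (space m) = (\<integral>\<^sup>+x. ennreal (r x) * indicator (space m) x \<partial>m)"
    by (rule emeasure_density) auto
  also have "\<dots> = (\<integral>\<^sup>+x. ennreal (r x) \<partial>m)" by (intro nn_integral_cong) auto
  also have "\<dots> \<le> (\<integral>\<^sup>+x. ennreal (norm (r x)) \<partial>m)" by (intro nn_integral_mono ennreal_leI) auto
  also have "\<dots> < \<infinity>" using r by (simp add: integrable_iff_bounded)
  finally show "finite_measure (density m (\<lambda>x. ennreal (r x)))" by (intro finite_measureI) auto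
qed

lemma radon_sum_measure:
  fixes m n :: "'a::t2_space measure"
  assumes m: "radon m" and n: "radon n" shows "radon (sum_measure m n)"
  unfolding radon_def
proof (intro conjI ballI allI impI)
  note s = radon_sets[OF m] radon_sets[OF n]
  show "finite_measure (sum_measure m n)" using assms s by (intro finite_measure_sum_measure radon_finite)
  interpret m: finite_measure m using m by (rule radon_finite)
  interpret n: finite_measure n using n by (rule radon_finite)
  interpret finite_measure "sum_measure m n" by fact
  fix E :: "'a set" and \<epsilon> :: real assume E: "E \<in> sets borel" and \<epsilon>: "\<epsilon> > 0"
  obtain K where K: "compact K" "K \<subseteq> E" "measure m (E - K) < \<epsilon> / 2" using radonE[OF m E, of "\<epsilon>/2"] \<epsilon> by auto
  obtain L where L: "compact L" "L \<subseteq> E" "measure n (E - L) < \<epsilon> / 2" using radonE[OF n E, of "\<epsilon>/2"] \<epsilon> by auto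
  have b: "E - (K \<union> L) \<in> sets borel" using E K L by auto
  have "ennreal (measure (sum_measure m n) (E - (K \<union> L))) = ennreal (measure m (E - (K \<union> L)) + measure n (E - (K \<union> L)))"
    using emeasure_sum_measure[OF s b] unfolding emeasure_eq_measure m.emeasure_eq_measure n.emeasure_eq_measure
    by (simp add: ennreal_plus)
  then have "measure (sum_measure m n) (E - (K \<union> L)) = measure m (E - (K \<union> L)) + measure n (E - (K \<union> L))"
    by (subst (asm) ennreal_inj) auto
  also have "\<dots> \<le> measure m (E - K) + measure n (E - L)"
    using E K L s by (intro add_mono m.finite_measure_mono n.finite_measure_mono) auto
  also have "\<dots> < \<epsilon>" using K L by simp
  finally show "\<exists>K. compact K \<and> K \<subseteq> E \<and> measure (sum_measure m n) (E - K) < \<epsilon>"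
    using K L by (intro exI[of _ "K \<union> L"]) auto
qed simp

lemma radon_measurable: "radon m ==> borel_measurable m = borel_measurable borel"
  using radon_sets[of m] measurable_cong_sets by blast

lemma dens_add:
  "integrable m g ==> integrable m k ==> sets m = sets borel ==> dens m g + dens m k = dens m (\<lambda>x. g x + k x)"
  by (rule ext) (simp add: dens_def set_integral_add set_integrable_of_integrable)

lemma scale_dens: "scale c (dens m g) = dens m (\<lambda>x. c * g x)"
  by (rule ext) (simp add: dens_def scale_def)

lemma dens_density:
  assumes "sets m = sets borel" and [measurable]: "r \<in> borel_measurable m" "h \<in> borel_measurable m" and "\<And>x. 0 \<le> r x"
  shows "dens (density m (\<lambda>x. ennreal (r x))) h = dens m (\<lambda>x. complex_of_real (r x) * h x)"
proof
  fix E
  have "(LINT x:E|density m (\<lambda>x. ennreal (r x)). h x) = (LINT x:E|m. complex_of_real (r x) * h x)" if "E \<in> sets borel"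
  proof -
    have [measurable]: "E \<in> sets m" using that assms by simp
    have "(LINT x:E|density m (\<lambda>x. ennreal (r x)). h x) = (\<integral>x. r x *\<^sub>R (indicator E x *\<^sub>R h x) \<partial>m)"
      unfolding set_lebesgue_integral_def using assms by (intro integral_density) auto
    also have "\<dots> = (LINT x:E|m. complex_of_real (r x) * h x)"
      unfolding set_lebesgue_integral_def
      by (intro Bochner_Integration.integral_cong) (auto simp: scaleR_conv_of_real)
    finally show ?thesis .
  qed
  then show "dens (density m (\<lambda>x. ennreal (r x))) h E = dens m (\<lambda>x. complex_of_real (r x) * h x) E"
    by (simp add: dens_def)
qed

lemma integrable_bounded_mult:
  fixes f g :: "'a \<Rightarrow> complex"
  assumes "integrable m g" "f \<in> borel_measurable m" "\<And>x. cmod (f x) \<le> B"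
  shows "integrable m (\<lambda>x. f x * g x)"
proof (rule Bochner_Integration.integrable_bound[of m "\<lambda>x. B * cmod (g x)"])
  show "AE x in m. norm (f x * g x) \<le> norm (B * cmod (g x))"
  proof (rule AE_I2)
    fix x
    have "cmod (f x) * cmod (g x) \<le> B * cmod (g x)" using assms(3)[of x] by (intro mult_right_mono) auto
    then show "norm (f x * g x) \<le> norm (B * cmod (g x))" by (simp add: norm_mult)
  qed
qed (use assms in auto)

section \<open>The normed space of weighted measures\<close>

definition restr :: "'a::topological_space set \<Rightarrow> ('a set \<Rightarrow> complex) \<Rightarrow> 'a set \<Rightarrow> complex" where
  "restr K \<mu> = (\<lambda>E. if E \<in> sets borel then \<mu> (E \<inter> K) else 0)"

lemma restr_dens:
  assumes "sets m = sets borel" "K \<in> sets borel"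
  shows "restr K (dens m g) = dens m (\<lambda>x. indicator K x * g x)"
  using assms unfolding restr_def dens_def set_lebesgue_integral_def
  by (intro ext) (auto intro!: Bochner_Integration.integral_cong split: split_indicator)

locale weighted_group =
  fixes \<omega> :: "'a::{topological_group_add, t2_space} \<Rightarrow> real"
  assumes weight: "weight \<omega>"
begin

abbreviation M where "M \<equiv> Carrier (M_alg \<omega>)"
abbreviation nrm where "nrm \<equiv> Norm (M_alg \<omega>)"

lemma continuous_weight: "continuous_on UNIV \<omega>"
  and weight_ge_1: "1 \<le> \<omega> x" and weight_zero: "\<omega> 0 = 1" and weight_add: "\<omega> (x + y) \<le> \<omega> x * \<omega> y"
  using weight by (auto simp: weight_def)

lemma weight_measurable [measurable]: "\<omega> \<in> borel_measurable borel"
  by (rule borel_measurable_continuous_onI[OF continuous_weight])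

lemma weight_pos: "0 < \<omega> x"
  using weight_ge_1[of x] by linarith

lemma integrable_of_weighted:
  assumes m: "radon m" and [measurable]: "g \<in> borel_measurable borel"
    and i: "integrable m (\<lambda>x. \<omega> x * cmod (g x))"
  shows "integrable m g" "integrable m (\<lambda>x. complex_of_real (\<omega> x) * g x)"
proof -
  note [simp] = radon_measurable[OF m]
  have "cmod (g x) \<le> \<omega> x * cmod (g x)" for x
    using weight_ge_1[of x] mult_right_mono[of 1 "\<omega> x" "cmod (g x)"] by simp
  then show "integrable m g"
    by (intro Bochner_Integration.integrable_bound[OF i]) (auto intro!: AE_I2 order_trans[OF _ abs_ge_self])
  show "integrable m (\<lambda>x. complex_of_real (\<omega> x) * g x)"
    by (intro Bochner_Integration.integrable_bound[OF i]) (auto simp: norm_mult)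
qed

lemma dens_in_M:
  assumes m: "radon m" and g [measurable]: "g \<in> borel_measurable borel"
    and i: "integrable m (\<lambda>x. \<omega> x * cmod (g x))"
  shows "dens m g \<in> M" "nrm (dens m g) = (\<integral>x. \<omega> x * cmod (g x) \<partial>m)"
proof -
  note [simp] = radon_measurable[OF m]
  note s = radon_sets[OF m] and fin = radon_finite[OF m]
  note ig = integrable_of_weighted[OF m g i]
  have W: "weighted \<omega> (dens m g) = dens m (\<lambda>x. complex_of_real (\<omega> x) * g x)"
  proof
    fix E
    show "weighted \<omega> (dens m g) E = dens m (\<lambda>x. complex_of_real (\<omega> x) * g x) E"
    proof (cases "E \<in> sets borel")
      case True
      have eq: "indicator E x * complex_of_real (\<omega> x) * g x = indicator E x *\<^sub>R (complex_of_real (\<omega> x) * g x)" for x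
        by (auto split: split_indicator)
      have "cm_integral (dens m g) (\<lambda>x. indicator E x * complex_of_real (\<omega> x)) = (\<integral>x. indicator E x * complex_of_real (\<omega> x) * g x \<partial>m)"
        using True set_integrable_of_integrable[OF ig(2), of E] s
        by (intro cm_integral_dens s ig) (simp_all add: eq set_integrable_def)
      then show ?thesis using True by (simp add: weighted_def dens_def eq set_lebesgue_integral_def)
    qed (simp add: weighted_def dens_def)
  qed
  have reg: "regular_complex_measure (dens m k)" if k: "integrable m k" for k
    using regular_iff_radon[OF complex_borel_measure_dens[OF s k]] variation_measure_dens[OF s fin k]
      radon_density[OF m integrable_norm[OF k]] by simp
  have "integrable (variation_measure (dens m g)) \<omega>"
    unfolding variation_measure_dens[OF s fin ig(1)]
    by (subst integrable_density) (use i in \<open>auto simp: mult.commute\<close>)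
  then show "dens m g \<in> M"
    unfolding M_alg_def using reg[OF ig(1)] reg[OF ig(2)] W by simp
  have "nrm (dens m g) = (\<integral>x. cmod (complex_of_real (\<omega> x) * g x) \<partial>m)"
    unfolding M_alg_def using W variation_dens[OF s fin ig(2), of UNIV]
    by (simp add: set_lebesgue_integral_def)
  also have "\<dots> = (\<integral>x. \<omega> x * cmod (g x) \<partial>m)"
    using weight_pos by (intro Bochner_Integration.integral_cong) (auto simp: norm_mult abs_of_pos)
  finally show "nrm (dens m g) = (\<integral>x. \<omega> x * cmod (g x) \<partial>m)" .
qed

text \<open>The form \<mu> = g dm in which the vector operations, restrictions and norms on
  \<open>M\<close> are computed: the norm becomes the weighted L^1 norm of \<open>g\<close>.\<close>

definition rep :: "'a measure \<Rightarrow> ('a \<Rightarrow> complex) \<Rightarrow> bool" where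
  "rep m g \<longleftrightarrow> radon m \<and> g \<in> borel_measurable borel \<and> integrable m (\<lambda>x. \<omega> x * cmod (g x))"

lemma repD:
  assumes "rep m g"
  shows "radon m" "sets m = sets borel" "finite_measure m" "space m = UNIV" "borel_measurable m = borel_measurable borel"
    "g \<in> borel_measurable borel" "integrable m (\<lambda>x. \<omega> x * cmod (g x))"
    "integrable m g" "integrable m (\<lambda>x. complex_of_real (\<omega> x) * g x)"
    "dens m g \<in> M" "nrm (dens m g) = (\<integral>x. \<omega> x * cmod (g x) \<partial>m)"
  using assms integrable_of_weighted[of m g] dens_in_M[of m g] radon_sets radon_finite radon_space radon_measurable
  unfolding rep_def by blast+

lemma M_polar:
  assumes "\<mu> \<in> M"
  obtains h where "rep (variation_measure \<mu>) h" "\<And>x. cmod (h x) = 1" "\<mu> = dens (variation_measure \<mu>) h"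
    "integrable (variation_measure \<mu>) \<omega>"
proof -
  have r: "regular_complex_measure \<mu>" and i: "integrable (variation_measure \<mu>) \<omega>"
    using assms unfolding M_alg_def by auto
  then have c: "complex_borel_measure \<mu>" by (simp add: regular_complex_measure_def)
  obtain h where "h\<in>borel_measurable borel" "\<forall>x. cmod (h x) = 1" "\<mu> = dens (variation_measure \<mu>) h"
    using ex_polar[OF c] by auto
  moreover have "radon (variation_measure \<mu>)" using regular_iff_radon[OF c] r by simp
  ultimately show thesis using that[of h] i by (simp add: rep_def)
qed

lemma M_rep: assumes "\<mu> \<in> M" obtains m g where "rep m g" "\<mu> = dens m g"
  using M_polar[OF assms] by metis

lemma M_complex_borel_measure: "\<mu> \<in> M ==> complex_borel_measure \<mu>"
  unfolding M_alg_def regular_complex_measure_def by auto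

text \<open>Sums and norms of sums need both densities over one base; the sum of the two variations
  serves as such, and Radon-Nikodym transfers the polar forms to it.\<close>

lemma M_common_rep:
  assumes "\<mu> \<in> M" "\<nu> \<in> M"
  obtains m g k where "rep m g" "rep m k" "\<mu> = dens m g" "\<nu> = dens m k"
proof -
  obtain h where h: "rep (variation_measure \<mu>) h" "\<And>x. cmod (h x) = 1" "\<mu> = dens (variation_measure \<mu>) h"
      "integrable (variation_measure \<mu>) \<omega>" using M_polar[OF assms(1)] by metis
  obtain l where l: "rep (variation_measure \<nu>) l" "\<And>x. cmod (l x) = 1" "\<nu> = dens (variation_measure \<nu>) l"
      "integrable (variation_measure \<nu>) \<omega>" using M_polar[OF assms(2)] by metis
  define m where "m = sum_measure (variation_measure \<mu>) (variation_measure \<nu>)"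
  have m: "radon m" unfolding m_def by (intro radon_sum_measure repD(1)[OF h(1)] repD(1)[OF l(1)])
  have ac: "absolutely_continuous m (variation_measure \<mu>)" "absolutely_continuous m (variation_measure \<nu>)"
    unfolding m_def by (auto intro!: absolutely_continuous_sum_measure repD(2)[OF h(1)] repD(2)[OF l(1)])
  have *: "\<exists>g. rep m g \<and> dens N h = dens m g"
    if h: "rep N h" "\<And>x. cmod (h x) = 1" "integrable N \<omega>" and ac: "absolutely_continuous m N" for N h
  proof -
    obtain r where r: "integrable m r" "\<And>x. 0 \<le> r x" "N = density m (\<lambda>x. ennreal (r x))"
      using Radon_Nikodym_real[OF radon_finite[OF m] repD(3)[OF h(1)] ac] repD(2)[OF h(1)] radon_sets[OF m] by metis
    note [simp] = radon_measurable[OF m]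
    have rm: "r \<in> borel_measurable borel" using borel_measurable_integrable[OF r(1)] by simp
    have hm: "h \<in> borel_measurable borel" by (rule repD(6)[OF h(1)])
    have "integrable m (\<lambda>x. r x *\<^sub>R \<omega> x)"
      using h(3) r(2) rm unfolding r(3) by (subst (asm) integrable_density) auto
    then have "rep m (\<lambda>x. complex_of_real (r x) * h x)"
      unfolding rep_def using m rm hm h(2) r(2) by (auto simp: norm_mult mult.commute)
    moreover have "dens N h = dens m (\<lambda>x. complex_of_real (r x) * h x)"
      unfolding r(3) using rm hm r(2) radon_sets[OF m] by (intro dens_density) auto
    ultimately show ?thesis by blast
  qed
  show thesis using that *[OF h(1,2,4) ac(1)] *[OF l(1,2,4) ac(2)] h(3) l(3) by metis
qed

lemma rep_add:
  assumes g: "rep m g" and k: "rep m k"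
  shows "rep m (\<lambda>x. g x + k x)"
  unfolding rep_def
proof (intro conjI repD(1)[OF g])
  note [simp] = repD(5)[OF g]
  note [measurable] = repD(6)[OF g] repD(6)[OF k]
  show "(\<lambda>x. g x + k x) \<in> borel_measurable borel" by measurable
  have "\<omega> x * cmod (g x + k x) \<le> \<omega> x * cmod (g x) + \<omega> x * cmod (k x)" for x
    using mult_left_mono[OF norm_triangle_ineq[of "g x" "k x"], of "\<omega> x"] weight_pos[of x] by (simp add: algebra_simps)
  then show "integrable m (\<lambda>x. \<omega> x * cmod (g x + k x))"
    using weight_pos
    by (intro Bochner_Integration.integrable_bound[OF Bochner_Integration.integrable_add[OF repD(7)[OF g] repD(7)[OF k]]])
      (auto intro!: AE_I2 order_trans[OF _ abs_ge_self] simp: abs_mult abs_of_pos)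
qed

lemma rep_cmult: "rep m g ==> rep m (\<lambda>x. c * g x)"
  unfolding rep_def by (auto simp: norm_mult mult.left_commute)

lemma rep_indicator:
  assumes g: "rep m g" and K: "K \<in> sets borel"
  shows "rep m (\<lambda>x. indicator K x * g x)"
  unfolding rep_def
proof (intro conjI repD(1)[OF g])
  note [simp] = repD(5)[OF g]
  note [measurable] = repD(6)[OF g] K
  show "(\<lambda>x. indicator K x * g x) \<in> borel_measurable borel" by measurable
  show "integrable m (\<lambda>x. \<omega> x * cmod (indicator K x * g x))"
    using weight_pos
    by (intro Bochner_Integration.integrable_bound[OF repD(7)[OF g]]) (auto split: split_indicator)
qed

lemma M_add: "\<mu> \<in> M ==> \<nu> \<in> M ==> \<mu> + \<nu> \<in> M"
  and nrm_triangle: "\<mu> \<in> M ==> \<nu> \<in> M ==> nrm (\<mu> + \<nu>) \<le> nrm \<mu> + nrm \<nu>"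
proof -
  assume "\<mu> \<in> M" "\<nu> \<in> M"
  then obtain m g k where *: "rep m g" "rep m k" "\<mu> = dens m g" "\<nu> = dens m k" using M_common_rep by metis
  have "\<mu> + \<nu> = dens m (\<lambda>x. g x + k x)"
    using * repD(2,8)[OF *(1)] repD(8)[OF *(2)] by (simp add: dens_add)
  note a = this rep_add[OF *(1,2)]
  then show "\<mu> + \<nu> \<in> M" using repD(10)[OF a(2)] by simp
  have "nrm (\<mu> + \<nu>) = (\<integral>x. \<omega> x * cmod (g x + k x) \<partial>m)" using a repD(11) by simp
  also have "\<dots> \<le> (\<integral>x. \<omega> x * cmod (g x) + \<omega> x * cmod (k x) \<partial>m)"
  proof (rule integral_mono)
    show "\<omega> x * cmod (g x + k x) \<le> \<omega> x * cmod (g x) + \<omega> x * cmod (k x)" for x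
      using mult_left_mono[OF norm_triangle_ineq[of "g x" "k x"], of "\<omega> x"] weight_pos[of x] by (simp add: algebra_simps)
  qed (auto intro!: Bochner_Integration.integrable_add repD(7)[OF a(2)] repD(7)[OF *(1)] repD(7)[OF *(2)])
  also have "\<dots> = nrm \<mu> + nrm \<nu>"
    using * repD(7,11)[OF *(1)] repD(7,11)[OF *(2)] by simp
  finally show "nrm (\<mu> + \<nu>) \<le> nrm \<mu> + nrm \<nu>" .
qed

lemma M_scale: "\<mu> \<in> M ==> scale c \<mu> \<in> M"
  and nrm_scale: "\<mu> \<in> M ==> nrm (scale c \<mu>) = cmod c * nrm \<mu>"
proof -
  assume "\<mu> \<in> M"
  then obtain m g where *: "rep m g" "\<mu> = dens m g" using M_rep by metis
  have a: "scale c \<mu> = dens m (\<lambda>x. c * g x)" "rep m (\<lambda>x. c * g x)"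
    using * rep_cmult by (auto simp: scale_dens)
  then show "scale c \<mu> \<in> M" using repD(10)[OF a(2)] by simp
  show "nrm (scale c \<mu>) = cmod c * nrm \<mu>"
    using a repD(11)[OF a(2)] repD(11)[OF *(1)] *(2) by (simp add: norm_mult mult.left_commute)
qed

lemma nrm_nonneg: "0 \<le> nrm \<mu>"
  unfolding M_alg_def by simp

lemma M_restr: "\<mu> \<in> M ==> K \<in> sets borel ==> restr K \<mu> \<in> M"
  and nrm_restr_split: "\<mu> \<in> M ==> K \<in> sets borel ==> nrm (restr K \<mu>) + nrm (restr (- K) \<mu>) = nrm \<mu>"
  and restr_split: "\<mu> \<in> M ==> K \<in> sets borel ==> \<mu> = restr K \<mu> + restr (- K) \<mu>"
  and variation_restr: "\<mu> \<in> M ==> K \<in> sets borel ==> L \<in> sets borel ==> K \<inter> L = {} ==> variation (restr K \<mu>) L = 0"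
  and restr_add: "\<nu> \<in> M ==> restr K (\<mu> + \<nu>) = restr K \<mu> + restr K \<nu>"
  and restr_scale: "restr K (scale c \<mu>) = scale c (restr K \<mu>)"
proof -
  show "restr K (\<mu> + \<nu>) = restr K \<mu> + restr K \<nu>" by (rule ext) (simp add: restr_def)
  show "restr K (scale c \<mu>) = scale c (restr K \<mu>)" by (rule ext) (simp add: restr_def scale_def)
  assume \<mu>: "\<mu> \<in> M" and K: "K \<in> sets borel"
  obtain m g where *: "rep m g" "\<mu> = dens m g" using M_rep[OF \<mu>] by metis
  have mK: "- K \<in> sets borel" using K by auto
  have a: "restr K \<mu> = dens m (\<lambda>x. indicator K x * g x)" "restr (- K) \<mu> = dens m (\<lambda>x. indicator (- K) x * g x)"
    using restr_dens[OF repD(2)[OF *(1)] K] restr_dens[OF repD(2)[OF *(1)] mK] * by auto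
  note rK = rep_indicator[OF *(1) K] and rK' = rep_indicator[OF *(1) mK]
  show "restr K \<mu> \<in> M" using a repD(10)[OF rK] by simp
  have "nrm (restr K \<mu>) + nrm (restr (- K) \<mu>) = (\<integral>x. \<omega> x * cmod (indicator K x * g x) + \<omega> x * cmod (indicator (- K) x * g x) \<partial>m)"
    using a repD(7,11)[OF rK] repD(7,11)[OF rK'] by simp
  also have "\<dots> = (\<integral>x. \<omega> x * cmod (g x) \<partial>m)"
    by (intro Bochner_Integration.integral_cong) (auto split: split_indicator)
  finally show "nrm (restr K \<mu>) + nrm (restr (- K) \<mu>) = nrm \<mu>" using repD(11)[OF *(1)] * by simp
  have "restr K \<mu> + restr (- K) \<mu> = dens m (\<lambda>x. indicator K x * g x + indicator (- K) x * g x)"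
    unfolding a using repD(2,8)[OF rK] repD(8)[OF rK'] by (intro dens_add)
  also have "(\<lambda>x. indicator K x * g x + indicator (- K) x * g x) = g" by (rule ext) (auto split: split_indicator)
  finally show "\<mu> = restr K \<mu> + restr (- K) \<mu>" by (simp only: *(2))
  assume L: "L \<in> sets borel" "K \<inter> L = {}"
  have "variation (restr K \<mu>) L = ennreal (LINT x:L|m. cmod (indicator K x * g x))"
    unfolding a by (rule variation_dens[OF repD(2,3,8)[OF rK] L(1)])
  also have "(LINT x:L|m. cmod (indicator K x * g x)) = (\<integral>x. 0 \<partial>m)"
    unfolding set_lebesgue_integral_def using L(2) by (intro Bochner_Integration.integral_cong) (auto split: split_indicator)
  finally show "variation (restr K \<mu>) L = 0" by simp
qed

lemma nrm_restr_le: "\<mu> \<in> M ==> K \<in> sets borel ==> nrm (restr K \<mu>) \<le> nrm \<mu>"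
  using nrm_restr_split[of \<mu> K] nrm_nonneg[of "restr (- K) \<mu>"] by linarith

text \<open>The measure \<omega> |g| dm is again Radon, and its mass off \<open>K\<close> is exactly
  the norm of the part of \<mu> off \<open>K\<close>.\<close>

lemma nrm_tight:
  assumes \<mu>: "\<mu> \<in> M" and \<epsilon>: "\<epsilon> > 0"
  obtains K where "compact K" "nrm (restr (- K) \<mu>) < \<epsilon>"
proof -
  obtain m g where *: "rep m g" "\<mu> = dens m g" using M_rep[OF \<mu>] by metis
  note [simp] = repD(5)[OF *(1)]
  note r = repD[OF *(1)]
  have rad: "radon (density m (\<lambda>x. ennreal (\<omega> x * cmod (g x))))" by (intro radon_density r)
  have "UNIV \<in> sets (borel :: 'a measure)" by simp
  then obtain K where K: "compact K" "measure (density m (\<lambda>x. ennreal (\<omega> x * cmod (g x)))) (UNIV - K) < \<epsilon>"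
    using radonE[OF rad _ \<epsilon>] by metis
  have mK: "- K \<in> sets borel" using K by auto
  have "nrm (restr (- K) \<mu>) = (\<integral>x. \<omega> x * cmod (indicator (- K) x * g x) \<partial>m)"
    using repD(11)[OF rep_indicator[OF *(1) mK]] restr_dens[OF r(2) mK] * by simp
  also have "\<dots> = (LINT x:-K|m. \<omega> x * cmod (g x))"
    unfolding set_lebesgue_integral_def using weight_pos
    by (intro Bochner_Integration.integral_cong) (auto split: split_indicator simp: abs_mult abs_of_pos)
  also have "\<dots> = measure (density m (\<lambda>x. ennreal (\<omega> x * cmod (g x)))) (- K)"
  proof -
    have "\<And>x. \<bar>\<omega> x * cmod (g x)\<bar> = \<omega> x * cmod (g x)" using weight_pos by (simp add: abs_mult abs_of_pos)
    then have "emeasure (density m (\<lambda>x. ennreal (\<omega> x * cmod (g x)))) (- K) = ennreal (LINT x:-K|m. \<omega> x * cmod (g x))"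
      using emeasure_density_norm[OF r(7), of "- K"] mK r(2) by simp
    moreover have "0 \<le> (LINT x:-K|m. \<omega> x * cmod (g x))"
      unfolding set_lebesgue_integral_def using weight_pos[THEN less_imp_le]
      by (intro Bochner_Integration.integral_nonneg) auto
    ultimately show ?thesis using weight_pos by (simp add: measure_def abs_mult abs_of_pos)
  qed
  finally show thesis using K that by (simp add: Compl_eq_Diff_UNIV)
qed

text \<open>Atoms are disjoint, so their weighted masses add up inside the weighted variation. This
  bound is the source of all l^1 estimates for point evaluations.\<close>

lemma sum_points_le:
  assumes \<mu>: "\<mu> \<in> M" and F: "finite F"
  shows "(\<Sum>x\<in>F. \<omega> x * cmod (\<mu> {x})) \<le> nrm \<mu>"
proof -
  obtain m g where *: "rep m g" "\<mu> = dens m g" using M_rep[OF \<mu>] by metis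
  note r = repD[OF *(1)]
  have sm: "A \<in> sets m" if "A \<in> sets borel" for A using that r by simp
  have "(\<Sum>x\<in>F. \<omega> x * cmod (\<mu> {x})) \<le> (\<Sum>x\<in>F. LINT y:{x}|m. \<omega> y * cmod (g y))"
  proof (rule sum_mono)
    fix x
    have "\<omega> x * cmod (\<mu> {x}) \<le> \<omega> x * (LINT y:{x}|m. cmod (g y))"
      using norm_set_integral_le[OF r(8), of "{x}"] sm weight_pos[of x] by (simp add: * dens_def)
    also have "\<dots> = (LINT y:{x}|m. \<omega> x * cmod (g y))" by simp
    also have "\<dots> = (LINT y:{x}|m. \<omega> y * cmod (g y))"
      unfolding set_lebesgue_integral_def by (intro Bochner_Integration.integral_cong) (auto split: split_indicator)
    finally show "\<omega> x * cmod (\<mu> {x}) \<le> (LINT y:{x}|m. \<omega> y * cmod (g y))" .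
  qed
  also have "\<dots> = (LINT y:(\<Union>x\<in>F. {x})|m. \<omega> y * cmod (g y))"
    using F by (intro set_integral_finite_Union[symmetric] set_integrable_of_integrable r sm) (auto simp: disjoint_family_on_def)
  also have "\<dots> \<le> (\<integral>y. \<omega> y * cmod (g y) \<partial>m)"
    unfolding set_lebesgue_integral_def
    using F weight_pos[THEN less_imp_le] sm[OF borel_closed[OF finite_imp_closed[OF F]]]
      set_integrable_of_integrable[OF r(7), of F, unfolded set_integrable_def]
    by (intro integral_mono r) (auto split: split_indicator)
  also have "\<dots> = nrm \<mu>" using r * by simp
  finally show ?thesis .
qed

lemma cm_integral_M:
  assumes "rep m g" "f \<in> borel_measurable borel" "\<And>x. cmod (f x) \<le> B"
  shows "cm_integral (dens m g) f = (\<integral>x. f x * g x \<partial>m)" "integrable m (\<lambda>x. f x * g x)"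
proof -
  note r = repD[OF assms(1)]
  show i: "integrable m (\<lambda>x. f x * g x)" using assms r by (intro integrable_bounded_mult[of m g f B]) auto
  show "cm_integral (dens m g) f = (\<integral>x. f x * g x \<partial>m)"
    using assms i r by (intro cm_integral_dens) auto
qed

lemma cm_integral_bound:
  assumes \<mu>: "\<mu> \<in> M" and f: "f \<in> borel_measurable borel" "\<And>x. cmod (f x) \<le> B"
  shows "cmod (cm_integral \<mu> f) \<le> B * nrm \<mu>"
proof -
  obtain m g where *: "rep m g" "\<mu> = dens m g" using M_rep[OF \<mu>] by metis
  note r = repD[OF *(1)]
  have B: "B \<ge> 0" using f(2)[of 0] norm_ge_zero order_trans by blast
  have "cmod (cm_integral \<mu> f) \<le> (\<integral>x. cmod (f x * g x) \<partial>m)"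
    using cm_integral_M[OF *(1) f] * integral_norm_bound by simp
  also have "\<dots> \<le> (\<integral>x. B * (\<omega> x * cmod (g x)) \<partial>m)"
  proof (rule integral_mono)
    fix x
    have "cmod (f x) * cmod (g x) \<le> B * (\<omega> x * cmod (g x))"
      using f(2)[of x] B weight_ge_1[of x] mult_right_mono[of 1 "\<omega> x" "cmod (g x)"]
      by (intro mult_mono) auto
    then show "cmod (f x * g x) \<le> B * (\<omega> x * cmod (g x))" by (simp add: norm_mult)
  qed (use cm_integral_M[OF *(1) f] r in auto)
  also have "\<dots> = B * nrm \<mu>" using r * by simp
  finally show ?thesis .
qed

lemma cm_integral_add:
  assumes \<mu>: "\<mu> \<in> M" and f: "f \<in> borel_measurable borel" "\<And>x. cmod (f x) \<le> B"
    and f': "f' \<in> borel_measurable borel" "\<And>x. cmod (f' x) \<le> B'"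
  shows "cm_integral \<mu> (\<lambda>x. f x + f' x) = cm_integral \<mu> f + cm_integral \<mu> f'"
proof -
  obtain m g where *: "rep m g" "\<mu> = dens m g" using M_rep[OF \<mu>] by metis
  have "cmod (f x + f' x) \<le> B + B'" for x using f(2)[of x] f'(2)[of x] norm_triangle_mono by blast
  then have "cm_integral \<mu> (\<lambda>x. f x + f' x) = (\<integral>x. (f x + f' x) * g x \<partial>m)"
    using * f f' by (auto intro!: cm_integral_M(1)[where B = "B + B'"])
  then show ?thesis
    using cm_integral_M[OF *(1) f] cm_integral_M[OF *(1) f'] * by (simp add: distrib_right)
qed

lemma cm_integral_cmult:
  assumes \<mu>: "\<mu> \<in> M" and f: "f \<in> borel_measurable borel" "\<And>x. cmod (f x) \<le> B"
  shows "cm_integral \<mu> (\<lambda>x. c * f x) = c * cm_integral \<mu> f"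
proof -
  obtain m g where *: "rep m g" "\<mu> = dens m g" using M_rep[OF \<mu>] by metis
  have "cm_integral \<mu> (\<lambda>x. c * f x) = (\<integral>x. c * f x * g x \<partial>m)"
    unfolding *(2) using f by (intro cm_integral_M(1)[OF *(1), where B = "cmod c * B"]) (auto simp: norm_mult mult_left_mono)
  then show ?thesis using cm_integral_M[OF *(1) f] * by (simp add: mult.assoc)
qed

lemma cm_integral_add_measure:
  assumes \<mu>: "\<mu> \<in> M" "\<nu> \<in> M" and f: "f \<in> borel_measurable borel" "\<And>x. cmod (f x) \<le> B"
  shows "cm_integral (\<mu> + \<nu>) f = cm_integral \<mu> f + cm_integral \<nu> f"
proof -
  obtain m g k where *: "rep m g" "rep m k" "\<mu> = dens m g" "\<nu> = dens m k" using M_common_rep[OF \<mu>] by metis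
  have "\<mu> + \<nu> = dens m (\<lambda>x. g x + k x)"
    using * repD(2,8)[OF *(1)] repD(8)[OF *(2)] by (simp add: dens_add)
  then show ?thesis
    using cm_integral_M[OF *(1) f] cm_integral_M[OF *(2) f] cm_integral_M[OF rep_add[OF *(1,2)] f] *
    by (simp add: distrib_left)
qed

lemma cm_integral_scale_measure:
  assumes \<mu>: "\<mu> \<in> M" and f: "f \<in> borel_measurable borel" "\<And>x. cmod (f x) \<le> B"
  shows "cm_integral (scale c \<mu>) f = c * cm_integral \<mu> f"
proof -
  obtain m g where *: "rep m g" "\<mu> = dens m g" using M_rep[OF \<mu>] by metis
  show ?thesis
    using cm_integral_M[OF *(1) f] cm_integral_M[OF rep_cmult[OF *(1)] f, of c] *
    by (simp add: scale_dens mult.left_commute)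
qed

end

section \<open>Convolution of positive Radon measures\<close>

abbreviation rtrans :: "'a::group_add set \<Rightarrow> 'a \<Rightarrow> 'a set" where
  "rtrans E y \<equiv> {x. x + y \<in> E}"

lemma rtrans_borel [measurable]: "E \<in> sets borel ==> rtrans E (y::'a::topological_group_add) \<in> sets borel"
proof -
  assume E: "E \<in> sets borel"
  have "(\<lambda>x. x + y) \<in> borel_measurable borel"
    by (intro borel_measurable_continuous_onI continuous_intros)
  then have "(\<lambda>x. x + y) -` E \<inter> space borel \<in> sets borel" using E by (rule measurable_sets)
  then show ?thesis by (simp add: vimage_def)
qed

text \<open>Local compactness enters the proof in this form; the Hausdorff property upgrades it to a
  base of compact neighbourhoods at each point.\<close>

lemma compact_nbhd_subset:
  assumes lc: "locally_compact_space (euclidean :: 'a::t2_space topology)" and "open W" "(x::'a) \<in> W"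
  obtains U K where "open U" "compact K" "x \<in> U" "U \<subseteq> K" "K \<subseteq> W"
proof -
  have "Hausdorff_space (euclidean :: 'a topology)"
    unfolding Hausdorff_space_def using hausdorff by (fastforce simp: disjnt_def)
  then have "neighbourhood_base_of (compactin euclidean) (euclidean :: 'a topology)"
    using lc locally_compact_space_neighbourhood_base by blast
  moreover have "openin euclidean W \<and> x \<in> W" using assms open_openin by blast
  ultimately obtain U V where "openin euclidean U" "compactin euclidean V" "x \<in> U" "U \<subseteq> V" "V \<subseteq> W"
    unfolding neighbourhood_base_of by meson
  then show thesis using that[of U V] by (simp add: compactin_euclidean_iff)
qed

lemma tube_translate:
  fixes C U :: "'a::topological_group_add set"
  assumes "compact C" "open U" "\<And>x. x \<in> C ==> x + y \<in> U"
  obtains V where "open V" "y \<in> V" "\<And>x z. x \<in> C ==> z \<in> V ==> x + z \<in> U"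
proof -
  have "open ((\<lambda>p::'a\<times>'a. snd p + fst p) -` U)"
    by (intro open_vimage[OF assms(2)] continuous_intros)
  moreover have "{y} \<times> C \<subseteq> (\<lambda>p::'a\<times>'a. snd p + fst p) -` U" using assms(3) by auto
  ultimately obtain V where "y \<in> V" "open V" "V \<times> C \<subseteq> (\<lambda>p::'a\<times>'a. snd p + fst p) -` U"
    using Elementary_Topology.tube_lemma[OF assms(1), of "(\<lambda>p::'a\<times>'a. snd p + fst p) -` U" y] by blast
  then show thesis using that by fastforce
qed

text \<open>For open sets the translate function is lower semicontinuous, since compact subsets carry
  almost all the mass; Dynkin's lemma extends measurability to Borel sets.\<close>

lemma measurable_emeasure_rtrans [measurable]:
  fixes m :: "'a::{topological_group_add,t2_space} measure"
  assumes m: "radon m" and E: "E \<in> sets borel"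
  shows "(\<lambda>y. emeasure m (rtrans E y)) \<in> borel_measurable borel"
proof -
  interpret finite_measure m by (rule radon_finite[OF m])
  note s = radon_sets[OF m]
  have "Int_stable {S::'a set. open S}" "{S::'a set. open S} \<subseteq> Pow UNIV" by (auto simp: Int_stable_def)
  moreover have "E \<in> sigma_sets UNIV {S::'a set. open S}" using E unfolding sets_borel .
  ultimately show ?thesis
  proof (induction rule: sigma_sets_induct_disjoint)
    case (basic U)
    then have U: "open U" by simp
    have "(\<lambda>y. measure m (rtrans U y)) \<in> borel_measurable borel"
      unfolding borel_measurable_iff_greater
    proof
      fix c
      have "open {y. c < measure m (rtrans U y)}"
      proof (subst open_subopen, safe)
        fix y assume y: "c < measure m (rtrans U y)"
        obtain K where K: "compact K" "K \<subseteq> rtrans U y" "measure m (rtrans U y - K) < measure m (rtrans U y) - c"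
          using radonE[OF m, of "rtrans U y" "measure m (rtrans U y) - c"] y U by auto
        have "measure m (rtrans U y - K) = measure m (rtrans U y) - measure m K"
          using K U s by (intro finite_measure_Diff) auto
        then have cK: "c < measure m K" using K(3) by simp
        obtain V where V: "open V" "y \<in> V" "\<And>x z. x \<in> K ==> z \<in> V ==> x + z \<in> U"
          using tube_translate[OF K(1) U, of y] K(2) by auto
        have "c < measure m (rtrans U z)" if "z \<in> V" for z
          using cK finite_measure_mono[of K "rtrans U z"] V(3) that U s by (auto simp: subset_eq)
        then show "\<exists>T. open T \<and> y \<in> T \<and> T \<subseteq> {y. c < measure m (rtrans U y)}" using V by blast
      qed
      then show "{w \<in> space borel. c < measure m (rtrans U w)} \<in> sets borel" by simp
    qed
    then show ?case by (simp add: emeasure_eq_measure)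
  next
    case empty then show ?case by simp
  next
    case (compl A)
    then have A: "A \<in> sets borel" by (simp add: sets_borel)
    have "emeasure m (rtrans (UNIV - A) y) = emeasure m UNIV - emeasure m (rtrans A y)" for y
    proof -
      have "rtrans (UNIV - A) y = UNIV - rtrans A y" by auto
      then show ?thesis using A s by (simp add: emeasure_Diff)
    qed
    then show ?case using compl by simp
  next
    case (union A)
    then have A: "A i \<in> sets borel" for i by (auto simp: sets_borel)
    have "emeasure m (rtrans (\<Union>i. A i) y) = (\<Sum>i. emeasure m (rtrans (A i) y))" for y
    proof -
      have "rtrans (\<Union>i. A i) y = (\<Union>i. rtrans (A i) y)" by auto
      moreover have "disjoint_family (\<lambda>i. rtrans (A i) y)" using union(1) unfolding disjoint_family_on_def by blast
      ultimately show ?thesis using A s by (subst suminf_emeasure) auto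
    qed
    then show ?case using union by simp
  qed
qed

text \<open>Integrated translates take the place of the image of a product measure: without second
  countability, addition need not be measurable for the product of the two Borel
  sigma-algebras.\<close>

definition conv_measure :: "'a::topological_group_add measure \<Rightarrow> 'a measure \<Rightarrow> 'a measure" where
  "conv_measure m n = measure_of UNIV (sets borel) (\<lambda>E. \<integral>\<^sup>+y. emeasure m (rtrans E y) \<partial>n)"

lemma sets_conv_measure [simp]: "sets (conv_measure m n) = sets borel"
  unfolding conv_measure_def by simp

lemma space_conv_measure [simp]: "space (conv_measure m n) = UNIV"
  unfolding conv_measure_def by simp

lemma emeasure_conv_measure:
  fixes m n :: "'a::{topological_group_add,t2_space} measure"
  assumes m: "radon m" and n: "radon n" and E: "E \<in> sets borel"
  shows "emeasure (conv_measure m n) E = (\<integral>\<^sup>+y. emeasure m (rtrans E y) \<partial>n)"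
  unfolding conv_measure_def
proof (rule emeasure_borel_measure_of[OF _ _ E])
  fix A :: "nat \<Rightarrow> 'a set" assume A: "range A \<subseteq> sets borel" "disjoint_family A"
  note [simp] = radon_measurable[OF n]
  have "(\<Sum>i. \<integral>\<^sup>+y. emeasure m (rtrans (A i) y) \<partial>n) = (\<integral>\<^sup>+y. (\<Sum>i. emeasure m (rtrans (A i) y)) \<partial>n)"
    using A measurable_emeasure_rtrans[OF m] by (intro nn_integral_suminf[symmetric]) auto
  also have "\<dots> = (\<integral>\<^sup>+y. emeasure m (rtrans (\<Union>i. A i) y) \<partial>n)"
  proof (intro nn_integral_cong)
    fix y
    have "rtrans (\<Union>i. A i) y = (\<Union>i. rtrans (A i) y)" by auto
    moreover have "disjoint_family (\<lambda>i. rtrans (A i) y)" using A(2) unfolding disjoint_family_on_def by blast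
    ultimately show "(\<Sum>i. emeasure m (rtrans (A i) y)) = emeasure m (rtrans (\<Union>i. A i) y)"
      using A radon_sets[OF m] by (subst suminf_emeasure) auto
  qed
  finally show "(\<Sum>i. \<integral>\<^sup>+y. emeasure m (rtrans (A i) y) \<partial>n) = (\<integral>\<^sup>+y. emeasure m (rtrans (\<Union>i. A i) y) \<partial>n)" .
qed simp

text \<open>Measurability of the inner integral is carried through the same induction, since each
  step integrates it against \<open>n\<close>.\<close>

lemma nn_integral_conv_measure:
  fixes m n :: "'a::{topological_group_add,t2_space} measure"
  assumes m: "radon m" and n: "radon n" and f: "f \<in> borel_measurable borel"
  shows "(\<lambda>y. \<integral>\<^sup>+x. f (x + y) \<partial>m) \<in> borel_measurable borel \<and>
    integral\<^sup>N (conv_measure m n) f = (\<integral>\<^sup>+y. \<integral>\<^sup>+x. f (x + y) \<partial>m \<partial>n)"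
  using f
proof (induction rule: borel_measurable_induct)
  case (cong f g)
  then have "f = g" by auto
  then show ?case using cong by simp
next
  case (set A)
  have "(\<integral>\<^sup>+x. indicator A (x + y) \<partial>m) = emeasure m (rtrans A y)" for y
  proof -
    have "(\<integral>\<^sup>+x. indicator A (x + y) \<partial>m) = (\<integral>\<^sup>+x. indicator (rtrans A y) x \<partial>m)"
      by (intro nn_integral_cong) (auto split: split_indicator)
    then show ?thesis using set radon_sets[OF m] by simp
  qed
  then show ?case
    using set measurable_emeasure_rtrans[OF m set] emeasure_conv_measure[OF m n set] by simp
next
  case (mult u c)
  note [simp] = radon_measurable[OF n] radon_measurable[OF m]
  have "(\<lambda>x. u (x + y)) \<in> borel_measurable borel" for y
    by (rule measurable_compose[OF borel_measurable_continuous_onI mult(2)]) (intro continuous_intros)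
  then have "(\<integral>\<^sup>+x. c * u (x + y) \<partial>m) = c * (\<integral>\<^sup>+x. u (x + y) \<partial>m)" for y
    by (intro nn_integral_cmult) simp
  then show ?case using mult by (auto simp: nn_integral_cmult measurable_cong_sets[OF sets_conv_measure refl])
next
  case (add u v)
  note [simp] = radon_measurable[OF n] radon_measurable[OF m]
  have "(\<lambda>x. u (x + y)) \<in> borel_measurable borel" "(\<lambda>x. v (x + y)) \<in> borel_measurable borel" for y
    by (rule measurable_compose[OF borel_measurable_continuous_onI add(1)], intro continuous_intros)
      (rule measurable_compose[OF borel_measurable_continuous_onI add(3)], intro continuous_intros)
  then have "(\<integral>\<^sup>+x. v (x + y) + u (x + y) \<partial>m) = (\<integral>\<^sup>+x. v (x + y) \<partial>m) + (\<integral>\<^sup>+x. u (x + y) \<partial>m)" for y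
    by (intro nn_integral_add) simp_all
  then show ?case using add by (auto simp: nn_integral_add measurable_cong_sets[OF sets_conv_measure refl])
next
  case (seq U)
  have INC: "incseq U" by fact
  note IH = seq.IH
  note [simp] = radon_measurable[OF n] radon_measurable[OF m]
  have U: "(\<lambda>x. U i (x + y)) \<in> borel_measurable borel" for y i
    by (rule measurable_compose[OF borel_measurable_continuous_onI seq.hyps(1)]) (intro continuous_intros)
  have inc: "incseq (\<lambda>i x. U i (x + y))" for y using INC by (auto simp: incseq_def le_fun_def)
  have 1: "(\<integral>\<^sup>+x. (SUP i. U i) (x + y) \<partial>m) = (SUP i. \<integral>\<^sup>+x. U i (x + y) \<partial>m)" for y
    using U inc by (subst nn_integral_monotone_convergence_SUP[symmetric]) (auto simp: image_comp comp_def)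
  have inc': "incseq (\<lambda>i y. \<integral>\<^sup>+x. U i (x + y) \<partial>m)"
    using INC by (auto simp: incseq_def le_fun_def intro!: nn_integral_mono)
  have 2: "(\<integral>\<^sup>+y. (SUP i. \<integral>\<^sup>+x. U i (x + y) \<partial>m) \<partial>n) = (SUP i. \<integral>\<^sup>+y. \<integral>\<^sup>+x. U i (x + y) \<partial>m \<partial>n)"
    using IH inc' by (intro nn_integral_monotone_convergence_SUP) auto
  have eq: "(SUP i. U i) = (\<lambda>x. SUP i. U i x)" by (rule ext) (simp add: image_comp comp_def)
  have 3: "integral\<^sup>N (conv_measure m n) (SUP i. U i) = (SUP i. integral\<^sup>N (conv_measure m n) (U i))"
    unfolding eq using seq.hyps(1) INC
    by (intro nn_integral_monotone_convergence_SUP) (auto simp: measurable_cong_sets[OF sets_conv_measure refl])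
  have "(\<lambda>y. SUP i. \<integral>\<^sup>+x. U i (x + y) \<partial>m) \<in> borel_measurable borel"
    using IH by (intro borel_measurable_SUP) auto
  then show ?case using IH unfolding 1 2 3 by auto
qed

text \<open>The sets that lie between a closed and an open set of nearly equal mass form a
  sigma-algebra, and it contains the open sets by assumption. A compact set carrying almost all mass
  then turns the closed inner set into a compact one.\<close>

lemma radon_of_open:
  fixes m :: "'a::t2_space measure"
  assumes s: "sets m = sets borel" and fin: "finite_measure m"
    and op: "\<And>U \<epsilon>. open U ==> \<epsilon> > 0 ==> \<exists>K. compact K \<and> K \<subseteq> U \<and> measure m (U - K) < \<epsilon>"
  shows "radon m"
proof -
  interpret finite_measure m by fact
  have cl: "\<forall>\<epsilon>>0. \<exists>F U. closed F \<and> open U \<and> F \<subseteq> E \<and> E \<subseteq> U \<and> measure m (U - F) < \<epsilon>" if "E \<in> sets borel" for E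
  proof -
    have "E \<in> sigma_sets UNIV {S::'a set. open S}" using that unfolding sets_borel .
    then show ?thesis
    proof induction
      case (Basic U)
      then show ?case using op[of U] compact_imp_closed by (metis mem_Collect_eq order_refl)
    next
      case Empty
      then show ?case by (intro allI impI exI[of _ "{}"]) auto
    next
      case (Compl A)
      show ?case
      proof (intro allI impI)
        fix \<epsilon> :: real assume "\<epsilon> > 0"
        then obtain F U where "closed F" "open U" "F \<subseteq> A" "A \<subseteq> U" "measure m (U - F) < \<epsilon>" using Compl by metis
        moreover have "- F - (- U) = U - F" by auto
        ultimately show "\<exists>F U. closed F \<and> open U \<and> F \<subseteq> UNIV - A \<and> UNIV - A \<subseteq> U \<and> measure m (U - F) < \<epsilon>"
          by (intro exI[of _ "- U"] exI[of _ "- F"]) auto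
      qed
    next
      case (Union A)
      show ?case
      proof (intro allI impI)
        fix \<epsilon> :: real assume \<epsilon>: "\<epsilon> > 0"
        \<comment> \<open>The bounds sum to \<epsilon>/2; the other half is left for truncating the
          union of the inner sets.\<close>
        have "\<exists>F U. closed F \<and> open U \<and> F \<subseteq> A i \<and> A i \<subseteq> U \<and> measure m (U - F) < \<epsilon> / 2 * (1/2)^Suc i" for i
          using Union(2)[of i] \<epsilon> by (metis half_gt_zero mult_pos_pos zero_less_divide_1_iff zero_less_numeral zero_less_power)
        then obtain F U where FU: "\<And>i. closed (F i)" "\<And>i. open (U i)" "\<And>i. F i \<subseteq> A i" "\<And>i. A i \<subseteq> U i"
          "\<And>i. measure m (U i - F i) < \<epsilon> / 2 * (1/2)^Suc i" by metis
        \<comment> \<open>An infinite union of closed sets need not be closed, so only finitely many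
          inner sets are kept; continuity from above makes the loss small.\<close>
        define G where "G N = (\<Union>i\<le>N. F i)" for N :: nat
        have Gc: "closed (G N)" for N unfolding G_def using FU by auto
        have Uo: "open (\<Union>i. U i)" using FU by auto
        have sm: "(\<lambda>i. \<epsilon> / 2 * (1/2)^Suc i) sums (\<epsilon> / 2 * 1)"
          by (intro sums_mult power_half_series)
        have "measure m (\<Union>i. U i - F i) \<le> (\<Sum>i. measure m (U i - F i))"
          using FU s sums_summable[OF sm]
          by (intro finite_measure_subadditive_countably summable_comparison_test'[OF sums_summable[OF sm], of 0])
            (auto intro: less_imp_le)
        also have "\<dots> \<le> (\<Sum>i. \<epsilon> / 2 * (1/2)^Suc i)"
          using FU(5)[THEN less_imp_le] by (intro suminf_le summable_comparison_test'[OF sums_summable[OF sm], of 0] sums_summable[OF sm]) auto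
        also have "\<dots> = \<epsilon> / 2" using sums_unique[OF sm] by simp
        finally have half: "measure m (\<Union>i. U i - F i) \<le> \<epsilon> / 2" .
        have "(\<lambda>N. measure m ((\<Union>i. U i) - G N)) \<longlonglongrightarrow> measure m (\<Inter>N. (\<Union>i. U i) - G N)"
        proof (rule finite_Lim_measure_decseq)
          show "range (\<lambda>N. (\<Union>i. U i) - G N) \<subseteq> sets m" using Gc Uo s by auto
          show "decseq (\<lambda>N. (\<Union>i. U i) - G N)" by (auto simp: decseq_def G_def)
        qed
        moreover have "measure m (\<Inter>N. (\<Union>i. U i) - G N) \<le> measure m (\<Union>i. U i - F i)"
        proof (rule finite_measure_mono)
          show "(\<Inter>N. (\<Union>i. U i) - G N) \<subseteq> (\<Union>i. U i - F i)" 
          proof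
            fix x assume x: "x \<in> (\<Inter>N. (\<Union>i. U i) - G N)"
            then obtain i where i: "x \<in> U i" by auto
            have "x \<notin> G i" using x by auto
            then show "x \<in> (\<Union>i. U i - F i)" using i by (auto simp: G_def)
          qed
        qed (use FU s in auto)
        then have "measure m (\<Inter>N. (\<Union>i. U i) - G N) < \<epsilon>" using half \<epsilon> by linarith
        ultimately have "\<forall>\<^sub>F N in sequentially. measure m ((\<Union>i. U i) - G N) < \<epsilon>" by (rule order_tendstoD)
        then obtain N where "measure m ((\<Union>i. U i) - G N) < \<epsilon>" using eventually_happens'[OF sequentially_bot] by blast
        moreover have "G N \<subseteq> \<Union>(range A)" "\<Union>(range A) \<subseteq> (\<Union>i. U i)" using FU(3,4) unfolding G_def by blast+
        ultimately show "\<exists>F U. closed F \<and> open U \<and> F \<subseteq> \<Union>(range A) \<and> \<Union>(range A) \<subseteq> U \<and> measure m (U - F) < \<epsilon>"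
          using Gc[of N] Uo by blast
      qed
    qed
  qed
  show ?thesis
    unfolding radon_def
  proof (intro conjI s fin ballI allI impI)
    fix E :: "'a set" and \<epsilon> :: real assume E: "E \<in> sets borel" and \<epsilon>: "\<epsilon> > 0"
    then obtain F U where FU: "closed F" "open U" "F \<subseteq> E" "E \<subseteq> U" "measure m (U - F) < \<epsilon> / 2"
      using cl[OF E] half_gt_zero by metis
    obtain K where K: "compact K" "measure m (UNIV - K) < \<epsilon> / 2" using op[OF open_UNIV half_gt_zero[OF \<epsilon>]] by auto
    have "measure m (E - F \<inter> K) \<le> measure m ((U - F) \<union> (UNIV - K))"
      using FU K E s by (intro finite_measure_mono) auto
    also have "\<dots> \<le> measure m (U - F) + measure m (UNIV - K)"
      using FU K s by (intro measure_Un_le) auto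
    also have "\<dots> < \<epsilon>" using FU K by simp
    finally show "\<exists>K. compact K \<and> K \<subseteq> E \<and> measure m (E - K) < \<epsilon>"
      using FU K by (intro exI[of _ "F \<inter> K"]) (auto intro: closed_Int_compact)
  qed
qed

text \<open>One compact subset of \<open>U\<close> must serve almost all translates. The function y
  \<mapsto> m(U - y) is merely lower semicontinuous, so it gives no upper bound near a point; the
  group is therefore cut into level sets of height \<eta>, and these into compact pieces. Near a
  point of such a piece one compact subset exhausts every translate from that piece up to 2 \<eta>,
  and finitely many points cover the piece.\<close>

lemma radon_conv_measure:
  fixes m n :: "'a::{topological_group_add,t2_space} measure"
  assumes lc: "locally_compact_space (euclidean :: 'a topology)" and m: "radon m" and n: "radon n"
  shows "radon (conv_measure m n)"
proof (rule radon_of_open)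
  note sm = radon_sets[OF m] and sn = radon_sets[OF n]
  note [simp] = radon_measurable[OF n]
  interpret m: finite_measure m by (rule radon_finite[OF m])
  interpret n: finite_measure n by (rule radon_finite[OF n])
  define B where "B = measure m UNIV"
  have mB: "measure m A \<le> B" for A
    unfolding B_def using m.bounded_measure[of A] radon_space[OF m] by simp
  have "B \<ge> 0" by (simp add: B_def)
  show fin: "finite_measure (conv_measure m n)"
  proof
    have "(\<integral>\<^sup>+y. emeasure m (rtrans UNIV y) \<partial>n) = emeasure m UNIV * emeasure n (space n)" by simp
    then show "emeasure (conv_measure m n) (space (conv_measure m n)) \<noteq> \<infinity>"
      using m.emeasure_finite n.emeasure_finite
      by (simp add: emeasure_conv_measure[OF m n] ennreal_mult_eq_top_iff)
  qed
  interpret T: finite_measure "conv_measure m n" by (rule fin)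
  fix U :: "'a set" and \<epsilon> :: real assume U: "open U" and \<epsilon>: "\<epsilon> > 0"
  \<comment> \<open>The total error will be \<eta> times 2 n(G) + B, with \<open>B\<close> the mass
    of \<open>m\<close>; the summand 1 makes it strictly smaller than \<epsilon>.\<close>
  define \<eta> where "\<eta> = \<epsilon> / (2 * measure n UNIV + B + 1)"
  have den: "2 * measure n UNIV + B + 1 > 0" using \<open>B \<ge> 0\<close> by (simp add: add_nonneg_pos)
  have \<eta>: "\<eta> > 0" using \<epsilon> den by (simp add: \<eta>_def)
  define \<phi> where "\<phi> y = measure m (rtrans U y)" for y
  have \<phi>m [measurable]: "\<phi> \<in> borel_measurable borel"
    using measurable_emeasure_rtrans[OF m, of U] U unfolding \<phi>_def measure_def by auto
  obtain N :: nat where N: "B / \<eta> < N" using reals_Archimedean2 by blast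
  define D where "D k = {y. k * \<eta> \<le> \<phi> y \<and> \<phi> y < (k + 1) * \<eta>}" for k :: nat
  have D: "D k \<in> sets borel" for k unfolding D_def by measurable
  have UD: "(\<Union>k\<in>{..<N}. D k) = UNIV"
  proof (intro set_eqI iffI UNIV_I)
    fix y :: 'a
    define k where "k = nat \<lfloor>\<phi> y / \<eta>\<rfloor>"
    have "\<phi> y / \<eta> \<ge> 0" using \<eta> by (simp add: \<phi>_def)
    then have k: "real k \<le> \<phi> y / \<eta>" "\<phi> y / \<eta> < real k + 1" unfolding k_def by linarith+
    have "\<phi> y / \<eta> \<le> B / \<eta>" using mB \<eta> by (simp add: \<phi>_def divide_right_mono)
    then have "k < N" using k(1) N by linarith
    moreover have "y \<in> D k" using k \<eta> by (simp add: D_def field_simps)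
    ultimately show "y \<in> (\<Union>k\<in>{..<N}. D k)" by auto
  qed
  have "\<exists>L. compact L \<and> L \<subseteq> D k \<and> measure n (D k - L) < \<eta> / (N + 1)" for k
  proof -
    have "\<eta> / (N + 1) > 0" using \<eta> by simp
    then show ?thesis by (rule radonE[OF n D]) auto
  qed
  then obtain L where L: "\<And>k. compact (L k)" "\<And>k. L k \<subseteq> D k" "\<And>k. measure n (D k - L k) < \<eta> / (N + 1)" by metis
  define L' where "L' = (\<Union>k<N. L k)"
  have L': "L' \<in> sets borel" unfolding L'_def using L by auto
  have nL: "measure n (UNIV - L') \<le> \<eta>"
  proof -
    have "measure n (UNIV - L') \<le> measure n (\<Union>k\<in>{..<N}. D k - L k)"
    proof (rule n.finite_measure_mono)
      show "UNIV - L' \<subseteq> (\<Union>k\<in>{..<N}. D k - L k)"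
      proof
        fix x assume x: "x \<in> UNIV - L'"
        obtain k where k: "k < N" "x \<in> D k" using UD by blast
        then have "x \<notin> L k" using x by (auto simp: L'_def)
        then show "x \<in> (\<Union>k\<in>{..<N}. D k - L k)" using k by auto
      qed
    qed (use D L sn in auto)
    also have "\<dots> \<le> (\<Sum>k<N. measure n (D k - L k))"
      using D L sn by (intro n.finite_measure_subadditive_finite) auto
    also have "\<dots> \<le> (\<Sum>k<N. \<eta> / (N + 1))" using L(3) by (intro sum_mono less_imp_le)
    also have "\<dots> \<le> \<eta>" using \<eta> by (simp add: field_simps)
    finally show ?thesis .
  qed
  have "\<exists>C. compact C \<and> C \<subseteq> U \<and> (\<forall>y\<in>L k. measure m (rtrans (U - C) y) \<le> 2 * \<eta>)" for k
  proof -
    have "\<exists>W C. open W \<and> y0 \<in> W \<and> compact C \<and> C \<subseteq> U \<and> (\<forall>y\<in>L k \<inter> W. measure m (rtrans (U - C) y) \<le> 2 * \<eta>)"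
      if y0: "y0 \<in> L k" for y0
    proof -
      obtain C where C: "compact C" "C \<subseteq> rtrans U y0" "measure m (rtrans U y0 - C) < \<eta>"
        using radonE[OF m, of "rtrans U y0" \<eta>] \<eta> U by auto
      obtain V where V: "open V" "y0 \<in> V" "\<And>x z. x \<in> C ==> z \<in> V ==> x + z \<in> U"
        using tube_translate[OF C(1) U, of y0] C(2) by auto
      obtain W K where W: "open W" "compact K" "y0 \<in> W" "W \<subseteq> K" "K \<subseteq> V"
        using compact_nbhd_subset[OF lc V(1,2)] by metis
      \<comment> \<open>With the compact neighbourhood \<open>K\<close> of \<open>y0\<close> the set
        \<open>C + K\<close> is compact, lies in \<open>U\<close>, and contains the translate of
        \<open>C\<close> by every \<open>y\<close> in \<open>W\<close>.\<close>
      define S where "S = (\<lambda>p. fst p + snd p) ` (C \<times> K)"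
      have S: "compact S" unfolding S_def using C W
        by (intro compact_continuous_image compact_Times continuous_intros)
      have SU: "S \<subseteq> U" unfolding S_def using V(3) W(5) by auto
      have "measure m (rtrans (U - S) y) \<le> 2 * \<eta>" if y: "y \<in> L k \<inter> W" for y
      proof -
        have CU: "C \<subseteq> rtrans U y" using V(3) W y by auto
        have "x + y \<in> S" if "x \<in> C" for x
          unfolding S_def using that W y by (intro rev_image_eqI[of "(x, y)"]) auto
        then have "rtrans (U - S) y \<subseteq> rtrans U y - C" by blast
        then have "measure m (rtrans (U - S) y) \<le> measure m (rtrans U y - C)"
          using U C sm by (intro m.finite_measure_mono) auto
        also have "\<dots> = \<phi> y - measure m C"
          unfolding \<phi>_def using U C CU sm by (intro m.finite_measure_Diff) auto
        also have "\<dots> \<le> 2 * \<eta>"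
        proof -
          have "measure m (rtrans U y0 - C) = \<phi> y0 - measure m C"
            unfolding \<phi>_def using U C sm by (intro m.finite_measure_Diff) auto
          moreover have "y \<in> D k" "y0 \<in> D k" using y y0 L(2)[of k] by auto
          ultimately show ?thesis using C(3) by (simp add: D_def algebra_simps)
        qed
        finally show ?thesis .
      qed
      then show ?thesis using W S SU by blast
    qed
    then obtain W C where WC: "\<And>y0. y0 \<in> L k ==> open (W y0) \<and> y0 \<in> W y0 \<and> compact (C y0) \<and> C y0 \<subseteq> U \<and>
        (\<forall>y\<in>L k \<inter> W y0. measure m (rtrans (U - C y0) y) \<le> 2 * \<eta>)" by metis
    obtain I where I: "I \<subseteq> L k" "finite I" "L k \<subseteq> (\<Union>y0\<in>I. W y0)"
      by (rule compactE_image[OF L(1)[of k], of "L k" W]) (use WC in auto)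
    have "measure m (rtrans (U - (\<Union>y0\<in>I. C y0)) y) \<le> 2 * \<eta>" if y: "y \<in> L k" for y
    proof -
      obtain y0 where y0: "y0 \<in> I" "y \<in> W y0" using I y by auto
      have "compact (C y0)" using WC I y0 by blast
      have "measure m (rtrans (U - (\<Union>y0\<in>I. C y0)) y) \<le> measure m (rtrans (U - C y0) y)"
      proof (intro m.finite_measure_mono)
        show "rtrans (U - (\<Union>y0\<in>I. C y0)) y \<subseteq> rtrans (U - C y0) y" using y0(1) by blast
        have "U - C y0 \<in> sets borel" using \<open>compact (C y0)\<close> U by auto
        then show "rtrans (U - C y0) y \<in> sets m" unfolding sm by (rule rtrans_borel)
      qed
      also have "\<dots> \<le> 2 * \<eta>" using WC[of y0] I(1) y0 y by blast
      finally show ?thesis .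
    qed
    moreover have "compact (\<Union>y0\<in>I. C y0)" "(\<Union>y0\<in>I. C y0) \<subseteq> U" using WC I by (auto intro!: compact_UN)
    ultimately show ?thesis by blast
  qed
  then obtain C where C: "\<And>k. compact (C k)" "\<And>k. C k \<subseteq> U" "\<And>k y. y \<in> L k ==> measure m (rtrans (U - C k) y) \<le> 2 * \<eta>" by metis
  define K where "K = (\<Union>k<N. C k)"
  have K: "compact K" "K \<subseteq> U" unfolding K_def using C by auto
  have "emeasure (conv_measure m n) (U - K) = (\<integral>\<^sup>+y. emeasure m (rtrans (U - K) y) \<partial>n)"
    using U K by (intro emeasure_conv_measure m n) auto
  also have "\<dots> \<le> (\<integral>\<^sup>+y. ennreal (2 * \<eta>) + ennreal B * indicator (UNIV - L') y \<partial>n)"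
  proof (rule nn_integral_mono)
    fix y
    show "emeasure m (rtrans (U - K) y) \<le> ennreal (2 * \<eta>) + ennreal B * indicator (UNIV - L') y"
    proof (cases "y \<in> L'")
      case True
      then obtain k where k: "k < N" "y \<in> L k" by (auto simp: L'_def)
      have "measure m (rtrans (U - K) y) \<le> measure m (rtrans (U - C k) y)"
      proof (intro m.finite_measure_mono)
        show "rtrans (U - K) y \<subseteq> rtrans (U - C k) y" using k(1) unfolding K_def by blast
        have "U - C k \<in> sets borel" using C(1)[of k] U by auto
        then show "rtrans (U - C k) y \<in> sets m" unfolding sm by (rule rtrans_borel)
      qed
      then have "measure m (rtrans (U - K) y) \<le> 2 * \<eta>" using C(3)[OF k(2)] by simp
      then show ?thesis using True by (simp add: m.emeasure_eq_measure ennreal_leI)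
    next
      case False
      then show ?thesis using mB[of "rtrans (U - K) y"] by (simp add: m.emeasure_eq_measure ennreal_leI add_increasing)
    qed
  qed
  also have "\<dots> = ennreal (2 * \<eta>) * emeasure n UNIV + ennreal B * emeasure n (UNIV - L')"
    using L' sn radon_space[OF n] by (subst nn_integral_add) (auto simp: nn_integral_cmult_indicator)
  also have "\<dots> = ennreal (2 * \<eta> * measure n UNIV + B * measure n (UNIV - L'))"
    using \<eta> \<open>B \<ge> 0\<close> by (simp add: n.emeasure_eq_measure ennreal_mult'' ennreal_plus)
  also have "\<dots> \<le> ennreal (2 * \<eta> * measure n UNIV + B * \<eta>)"
    using nL \<open>B \<ge> 0\<close> by (intro ennreal_leI add_left_mono mult_left_mono)
  finally have "measure (conv_measure m n) (U - K) \<le> 2 * \<eta> * measure n UNIV + B * \<eta>"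
    using \<eta> \<open>B \<ge> 0\<close> by (subst (asm) T.emeasure_eq_measure, subst (asm) ennreal_le_iff) auto
  also have "\<dots> = \<eta> * (2 * measure n UNIV + B)" by (simp add: algebra_simps)
  also have "\<dots> < \<eta> * (2 * measure n UNIV + B + 1)" using \<eta> by simp
  also have "\<dots> = \<epsilon>" using den by (simp add: \<eta>_def)
  finally show "\<exists>K. compact K \<and> K \<subseteq> U \<and> measure (conv_measure m n) (U - K) < \<epsilon>" using K by blast
qed simp

section \<open>Convolution of weighted complex measures\<close>

context weighted_group
begin

text \<open>The positive and negative parts of the real and imaginary parts of \<open>g\<close> are
  densities of Radon measures, for which the translate function is already known to be
  measurable.\<close>

lemma dens_rtrans_measurable [measurable]:
  assumes g: "rep m g" and E: "E \<in> sets borel"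
  shows "(\<lambda>y. dens m g (rtrans E y)) \<in> borel_measurable borel"
proof -
  note r = repD[OF g]
  have *: "(\<lambda>y. LINT x:rtrans E y|m. max 0 (k x)) \<in> borel_measurable borel" if k: "integrable m k" for k :: "'a \<Rightarrow> real"
  proof -
    have k0: "integrable m (\<lambda>x. max 0 (k x))" using k by auto
    have "(LINT x:rtrans E y|m. max 0 (k x)) = measure (density m (\<lambda>x. ennreal (max 0 (k x)))) (rtrans E y)" for y
    proof -
      have "emeasure (density m (\<lambda>x. ennreal (max 0 (k x)))) (rtrans E y) = ennreal (LINT x:rtrans E y|m. max 0 (k x))"
        using emeasure_density_norm[OF k0, of "rtrans E y"] E r(2) by (simp add: abs_of_nonneg[OF max.cobounded1])
      moreover have "0 \<le> (LINT x:rtrans E y|m. max 0 (k x))"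
        unfolding set_lebesgue_integral_def by (intro Bochner_Integration.integral_nonneg) auto
      ultimately show ?thesis by (simp add: measure_def)
    qed
    then show ?thesis
      using measurable_emeasure_rtrans[OF radon_density[OF r(1) k0] E] unfolding measure_def by simp
  qed
  have split: "(LINT x:A|m. k x) = (LINT x:A|m. max 0 (k x)) - (LINT x:A|m. max 0 (- k x))"
    if "integrable m k" "A \<in> sets borel" for k :: "'a \<Rightarrow> real" and A
  proof -
    have "(LINT x:A|m. max 0 (k x)) - (LINT x:A|m. max 0 (- k x)) = (LINT x:A|m. max 0 (k x) - max 0 (- k x))"
      using that r(2) by (intro set_integral_diff(2)[symmetric] set_integrable_of_integrable) auto
    also have "(\<lambda>x. max 0 (k x) - max 0 (- k x)) = k" by (auto simp: max_def)
    finally show ?thesis by simp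
  qed
  have "dens m g (rtrans E y) =
     complex_of_real ((LINT x:rtrans E y|m. max 0 (Re (g x))) - (LINT x:rtrans E y|m. max 0 (- Re (g x)))) +
     \<i> * complex_of_real ((LINT x:rtrans E y|m. max 0 (Im (g x))) - (LINT x:rtrans E y|m. max 0 (- Im (g x))))" for y
    using r(8) rtrans_borel[OF E, of y] Re_dens[OF r(8,2), of "rtrans E y"] Im_dens[OF r(8,2), of "rtrans E y"]
    by (simp add: split[symmetric] complex_eq_iff)
  moreover have "integrable m (\<lambda>x. Re (g x))" "integrable m (\<lambda>x. Im (g x))" using r(8) by auto
  ultimately show ?thesis
    using *[of "\<lambda>x. Re (g x)"] *[of "\<lambda>x. - Re (g x)"] *[of "\<lambda>x. Im (g x)"] *[of "\<lambda>x. - Im (g x)"] by simp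
qed

lemma M_rtrans_measurable [measurable]:
  "\<mu> \<in> M ==> E \<in> sets borel ==> (\<lambda>y. \<mu> (rtrans E y)) \<in> borel_measurable borel"
  using M_rep[of \<mu>] dens_rtrans_measurable by metis

lemma nrm_variation: "\<mu> \<in> M ==> nrm \<mu> = (\<integral>x. \<omega> x \<partial>variation_measure \<mu>)"
  by (metis (no_types, lifting) M_polar repD(11) Bochner_Integration.integral_cong mult.right_neutral)

lemma M_radon: "\<mu> \<in> M ==> radon (variation_measure \<mu>)"
  using M_polar repD(1) by metis

lemma norm_M_le: "\<mu> \<in> M ==> E \<in> sets borel ==> cmod (\<mu> E) \<le> measure (variation_measure \<mu>) E"
proof -
  assume \<mu>: "\<mu> \<in> M" and E: "E \<in> sets borel"
  obtain h where h: "rep (variation_measure \<mu>) h" "\<And>x. cmod (h x) = 1" "\<mu> = dens (variation_measure \<mu>) h"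
    using M_polar[OF \<mu>] by metis
  note r = repD[OF h(1)]
  have "cmod (\<mu> E) = cmod (LINT x:E|variation_measure \<mu>. h x)"
    by (subst h(3)) (simp add: dens_def E)
  also have "\<dots> \<le> (LINT x:E|variation_measure \<mu>. cmod (h x))"
    using E r by (intro norm_set_integral_le) auto
  also have "\<dots> = measure (variation_measure \<mu>) E"
    using E r finite_measure.emeasure_finite[OF r(3), of E] by (simp add: h(2) set_lebesgue_integral_def)
  finally show ?thesis .
qed

lemma norm_M_le_nrm: "\<mu> \<in> M ==> cmod (\<mu> E) \<le> nrm \<mu>"
proof (cases "E \<in> sets borel")
  case True
  assume \<mu>: "\<mu> \<in> M"
  obtain h where h: "rep (variation_measure \<mu>) h" "integrable (variation_measure \<mu>) \<omega>"
    using M_polar[OF \<mu>] by metis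
  interpret finite_measure "variation_measure \<mu>" by (rule repD(3)[OF h(1)])
  have "cmod (\<mu> E) \<le> measure (variation_measure \<mu>) (space (variation_measure \<mu>))"
    using norm_M_le[OF \<mu> True] bounded_measure[of E] by linarith
  also have "\<dots> = (\<integral>x. 1 \<partial>variation_measure \<mu>)" by simp
  also have "\<dots> \<le> nrm \<mu>"
    unfolding nrm_variation[OF \<mu>] using weight_ge_1 h by (intro integral_mono) auto
  finally show ?thesis .
next
  case False
  assume "\<mu> \<in> M"
  then have "\<mu> E = 0" using M_complex_borel_measure False by (auto simp: complex_borel_measure_def)
  then show ?thesis by (simp add: nrm_nonneg)
qed

end

locale weighted_lc_group = weighted_group +
  assumes lc: "locally_compact_space (euclidean :: 'a topology)"
begin

lemma convolution_outside: "E \<notin> sets borel ==> convolution \<mu> \<nu> E = 0"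
  by (simp add: convolution_def)

text \<open>Countable additivity of \<mu> on the translated sets holds pointwise in
  \<open>y\<close>; dominated convergence carries it through the integral, the dominating function
  being a multiple of the density of \<nu>.\<close>

lemma complex_borel_measure_convolution:
  assumes \<mu>: "\<mu> \<in> M" and \<nu>: "\<nu> \<in> M"
  shows "complex_borel_measure (convolution \<mu> \<nu>)"
  unfolding complex_borel_measure_def
proof (intro conjI allI impI)
  fix A :: "nat \<Rightarrow> 'a set" assume A: "range A \<subseteq> sets borel" "disjoint_family A"
  obtain m k where *: "rep m k" "\<nu> = dens m k" using M_rep[OF \<nu>] by metis
  note r = repD[OF *(1)]
  note [simp] = r(5)
  have sa: "sigma_additive \<mu>" using M_complex_borel_measure[OF \<mu>] by (simp add: complex_borel_measure_alt)
  have conv: "convolution \<mu> \<nu> E = (\<integral>y. \<mu> (rtrans E y) * k y \<partial>m)" if "E \<in> sets borel" for E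
    using that cm_integral_M(1)[OF *(1) M_rtrans_measurable[OF \<mu> that] norm_M_le_nrm[OF \<mu>]] *(2)
    by (simp add: convolution_def)
  have int: "integrable m (\<lambda>y. \<mu> (rtrans E y) * k y)" if "E \<in> sets borel" for E
    by (rule cm_integral_M(2)[OF *(1) M_rtrans_measurable[OF \<mu> that] norm_M_le_nrm[OF \<mu>]])
  have UA: "(\<Union>n. A n) \<in> sets borel" and fA: "(\<Union>i<n. A i) \<in> sets borel" and Ab: "A n \<in> sets borel" for n using A by auto
  have fin: "\<mu> (rtrans (\<Union>i<n. A i) y) = (\<Sum>i<n. \<mu> (rtrans (A i) y))" for n y
  proof (induction n)
    case 0 then show ?case using sigma_additive_empty[OF sa] by simp
  next
    case (Suc n)
    have "rtrans (\<Union>i<Suc n. A i) y = rtrans (\<Union>i<n. A i) y \<union> rtrans (A n) y" by (auto simp: lessThan_Suc)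
    moreover have "A i \<inter> A n = {}" if "i < n" for i using disjoint_family_onD[OF A(2), of i n] that by auto
    then have "rtrans (\<Union>i<n. A i) y \<inter> rtrans (A n) y = {}" by blast
    ultimately show ?case using Suc sigma_additive_Un[OF sa rtrans_borel[OF fA] rtrans_borel[OF Ab]] by simp
  qed
  have pt: "(\<lambda>n. \<mu> (rtrans (\<Union>i<n. A i) y)) \<longlonglongrightarrow> \<mu> (rtrans (\<Union>n. A n) y)" for y
  proof -
    have "disjoint_family (\<lambda>n. rtrans (A n) y)" using A(2) unfolding disjoint_family_on_def by blast
    then have "(\<lambda>n. \<mu> (rtrans (A n) y)) sums \<mu> (\<Union>n. rtrans (A n) y)"
      using Ab by (intro sigma_additiveD[OF sa]) auto
    moreover have "(\<Union>n. rtrans (A n) y) = rtrans (\<Union>n. A n) y" by auto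
    ultimately show ?thesis unfolding sums_def fin by simp
  qed
  have "(\<lambda>n. \<integral>y. \<mu> (rtrans (\<Union>i<n. A i) y) * k y \<partial>m) \<longlonglongrightarrow> (\<integral>y. \<mu> (rtrans (\<Union>n. A n) y) * k y \<partial>m)"
  proof (rule integral_dominated_convergence[where w = "\<lambda>y. nrm \<mu> * cmod (k y)"])
    show "AE y in m. (\<lambda>n. \<mu> (rtrans (\<Union>i<n. A i) y) * k y) \<longlonglongrightarrow> \<mu> (rtrans (\<Union>n. A n) y) * k y"
      by (intro AE_I2 tendsto_mult pt tendsto_const)
    show "AE y in m. cmod (\<mu> (rtrans (\<Union>i<n. A i) y) * k y) \<le> nrm \<mu> * cmod (k y)" for n
      unfolding norm_mult by (intro AE_I2 mult_right_mono norm_M_le_nrm[OF \<mu>]) auto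
    show "integrable m (\<lambda>y. nrm \<mu> * cmod (k y))" using r(8) by auto
  qed (use borel_measurable_integrable[OF int[OF UA]] borel_measurable_integrable[OF int[OF fA]] in auto)
  moreover have "(\<integral>y. \<mu> (rtrans (\<Union>i<n. A i) y) * k y \<partial>m) = (\<Sum>i<n. convolution \<mu> \<nu> (A i))" for n
    unfolding fin sum_distrib_right using int[OF Ab] by (simp add: conv[OF Ab])
  ultimately show "(\<lambda>n. convolution \<mu> \<nu> (A n)) sums convolution \<mu> \<nu> (\<Union>n. A n)"
    unfolding sums_def using conv[OF UA] by simp
qed (simp add: convolution_outside)

lemma variation_convolution_le:
  assumes \<mu>: "\<mu> \<in> M" and \<nu>: "\<nu> \<in> M"
  shows "variation (convolution \<mu> \<nu>) E \<le> emeasure (conv_measure (variation_measure \<mu>) (variation_measure \<nu>)) E"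
proof (rule variation_le)
  fix E :: "'a set" assume E: "E \<in> sets borel"
  obtain k where *: "rep (variation_measure \<nu>) k" "\<And>x. cmod (k x) = 1" "\<nu> = dens (variation_measure \<nu>) k"
    using M_polar[OF \<nu>] by metis
  let ?V = "variation_measure \<mu>" and ?W = "variation_measure \<nu>"
  note r = repD[OF *(1)]
  interpret V: finite_measure ?V by (rule radon_finite[OF M_radon[OF \<mu>]])
  have int: "integrable ?W (\<lambda>y. \<mu> (rtrans E y) * k y)"
    by (rule cm_integral_M(2)[OF *(1) M_rtrans_measurable[OF \<mu> E] norm_M_le_nrm[OF \<mu>]])
  have "convolution \<mu> \<nu> E = (\<integral>y. \<mu> (rtrans E y) * k y \<partial>?W)"
    using E cm_integral_M(1)[OF *(1) M_rtrans_measurable[OF \<mu> E] norm_M_le_nrm[OF \<mu>]] *(3)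
    by (simp add: convolution_def)
  then have "ennreal (cmod (convolution \<mu> \<nu> E)) \<le> (\<integral>\<^sup>+y. cmod (\<mu> (rtrans E y) * k y) \<partial>?W)"
    using integral_norm_bound_ennreal[OF int] by simp
  also have "\<dots> \<le> (\<integral>\<^sup>+y. emeasure ?V (rtrans E y) \<partial>?W)"
    using norm_M_le[OF \<mu> rtrans_borel[OF E]]
    by (intro nn_integral_mono) (simp add: norm_mult *(2) V.emeasure_eq_measure ennreal_leI)
  also have "\<dots> = emeasure (conv_measure ?V ?W) E"
    by (rule emeasure_conv_measure[symmetric, OF M_radon[OF \<mu>] M_radon[OF \<nu>] E])
  finally show "ennreal (cmod (convolution \<mu> \<nu> E)) \<le> emeasure (conv_measure ?V ?W) E" .
qed simp

lemma nn_integral_weight: "\<mu> \<in> M ==> (\<integral>\<^sup>+x. \<omega> x \<partial>variation_measure \<mu>) = ennreal (nrm \<mu>)"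
proof -
  assume \<mu>: "\<mu> \<in> M"
  then have "integrable (variation_measure \<mu>) \<omega>" using M_polar by metis
  then show ?thesis
    using weight_pos less_imp_le by (subst nrm_variation[OF \<mu>]) (intro nn_integral_eq_integral AE_I2, auto intro: less_imp_le)
qed

text \<open>The variation of the convolution is dominated by the convolution of the variations. This
  gives absolute continuity with respect to a Radon measure, hence regularity, and integrating
  \<omega>(x+y) \<le> \<omega>(x) \<omega>(y) gives the norm estimate.\<close>

lemma M_convolution: "\<mu> \<in> M ==> \<nu> \<in> M ==> convolution \<mu> \<nu> \<in> M"
  and nrm_convolution: "\<mu> \<in> M ==> \<nu> \<in> M ==> nrm (convolution \<mu> \<nu>) \<le> nrm \<mu> * nrm \<nu>"
proof -
  assume \<mu>: "\<mu> \<in> M" and \<nu>: "\<nu> \<in> M"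
  let ?V = "variation_measure \<mu>" and ?W = "variation_measure \<nu>" and ?c = "convolution \<mu> \<nu>"
  let ?T = "conv_measure ?V ?W" and ?C = "variation_measure ?c"
  note V = M_radon[OF \<mu>] and W = M_radon[OF \<nu>]
  note c = complex_borel_measure_convolution[OF \<mu> \<nu>]
  have T: "radon ?T" by (rule radon_conv_measure[OF lc V W])
  note C = sets_variation_measure[OF c] finite_variation_measure[OF c]
  have le: "emeasure ?C E \<le> emeasure ?T E" if "E \<in> sets borel" for E
    using emeasure_variation_measure[OF c that] variation_convolution_le[OF \<mu> \<nu>] by simp
  have "absolutely_continuous ?T ?C"
    unfolding absolutely_continuous_def null_sets_def using le C by (auto simp: le_zero_eq) (metis le_zero_eq)
  then have radC: "radon ?C" by (intro radon_absolutely_continuous[OF T C])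
  have "?C \<le> ?T" using le C by (subst le_measure) auto
  then have "(\<integral>\<^sup>+x. \<omega> x \<partial>?C) \<le> (\<integral>\<^sup>+x. \<omega> x \<partial>?T)"
    using C by (intro nn_integral_mono_measure) auto
  also have "\<dots> = (\<integral>\<^sup>+y. \<integral>\<^sup>+x. \<omega> (x + y) \<partial>?V \<partial>?W)"
    using nn_integral_conv_measure[OF V W, of "\<lambda>x. ennreal (\<omega> x)"] by simp
  also have "\<dots> \<le> (\<integral>\<^sup>+y. \<integral>\<^sup>+x. ennreal (\<omega> x) * ennreal (\<omega> y) \<partial>?V \<partial>?W)"
    using weight_add weight_pos[THEN less_imp_le]
    by (intro nn_integral_mono) (simp add: ennreal_mult[symmetric] ennreal_leI)
  also have "\<dots> = (\<integral>\<^sup>+y. ennreal (nrm \<mu>) * ennreal (\<omega> y) \<partial>?W)"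
  proof (rule nn_integral_cong)
    fix y
    have "(\<lambda>x. ennreal (\<omega> x)) \<in> borel_measurable ?V" by (simp add: radon_measurable[OF V])
    then show "(\<integral>\<^sup>+x. ennreal (\<omega> x) * ennreal (\<omega> y) \<partial>?V) = ennreal (nrm \<mu>) * ennreal (\<omega> y)"
      by (simp add: nn_integral_multc nn_integral_weight[OF \<mu>])
  qed
  also have "\<dots> = ennreal (nrm \<mu>) * ennreal (nrm \<nu>)"
  proof -
    have "(\<lambda>x. ennreal (\<omega> x)) \<in> borel_measurable ?W" by (simp add: radon_measurable[OF W])
    then show ?thesis by (simp add: nn_integral_cmult nn_integral_weight[OF \<nu>])
  qed
  also have "\<dots> = ennreal (nrm \<mu> * nrm \<nu>)" by (simp add: ennreal_mult nrm_nonneg)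
  finally have bd: "(\<integral>\<^sup>+x. \<omega> x \<partial>?C) \<le> ennreal (nrm \<mu> * nrm \<nu>)" .
  have i: "integrable ?C \<omega>"
  proof (rule integrableI_nonneg)
    show "\<omega> \<in> borel_measurable ?C" unfolding radon_measurable[OF radC] by (rule weight_measurable)
    show "AE x in ?C. 0 \<le> \<omega> x" using weight_pos[THEN less_imp_le] by simp
    show "(\<integral>\<^sup>+x. \<omega> x \<partial>?C) < \<infinity>" using bd by (rule le_less_trans) simp
  qed
  obtain h where h: "h\<in>borel_measurable borel" "\<forall>x. cmod (h x) = 1" "?c = dens ?C h" using ex_polar[OF c] by auto
  have rep: "rep ?C h" using h radC i by (simp add: rep_def)
  show cM: "?c \<in> M" using repD(10)[OF rep] h(3) by simp
  show "nrm ?c \<le> nrm \<mu> * nrm \<nu>"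
    using bd unfolding nn_integral_weight[OF cM] by (simp add: ennreal_le_iff nrm_nonneg)
qed

lemma convolution_add_left: "\<mu> \<in> M ==> \<mu>' \<in> M ==> \<nu> \<in> M ==> convolution (\<mu> + \<mu>') \<nu> = convolution \<mu> \<nu> + convolution \<mu>' \<nu>"
proof
  fix E assume *: "\<mu> \<in> M" "\<mu>' \<in> M" "\<nu> \<in> M"
  show "convolution (\<mu> + \<mu>') \<nu> E = (convolution \<mu> \<nu> + convolution \<mu>' \<nu>) E"
  proof (cases "E \<in> sets borel")
    case True
    then show ?thesis
      using cm_integral_add[OF *(3) M_rtrans_measurable[OF *(1) True] norm_M_le_nrm[OF *(1)]
          M_rtrans_measurable[OF *(2) True] norm_M_le_nrm[OF *(2)]]
      by (simp add: convolution_def)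
  qed (simp add: convolution_def)
qed

lemma convolution_scale_left: "\<mu> \<in> M ==> \<nu> \<in> M ==> convolution (scale c \<mu>) \<nu> = scale c (convolution \<mu> \<nu>)"
proof
  fix E assume *: "\<mu> \<in> M" "\<nu> \<in> M"
  show "convolution (scale c \<mu>) \<nu> E = scale c (convolution \<mu> \<nu>) E"
  proof (cases "E \<in> sets borel")
    case True
    then show ?thesis
      using cm_integral_cmult[OF *(2) M_rtrans_measurable[OF *(1) True] norm_M_le_nrm[OF *(1)]]
      by (simp add: convolution_def scale_def)
  qed (simp add: convolution_def scale_def)
qed

lemma convolution_add_right: "\<mu> \<in> M ==> \<nu> \<in> M ==> \<nu>' \<in> M ==> convolution \<mu> (\<nu> + \<nu>') = convolution \<mu> \<nu> + convolution \<mu> \<nu>'"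
proof
  fix E assume *: "\<mu> \<in> M" "\<nu> \<in> M" "\<nu>' \<in> M"
  show "convolution \<mu> (\<nu> + \<nu>') E = (convolution \<mu> \<nu> + convolution \<mu> \<nu>') E"
  proof (cases "E \<in> sets borel")
    case True
    then show ?thesis
      using cm_integral_add_measure[OF *(2,3) M_rtrans_measurable[OF *(1) True] norm_M_le_nrm[OF *(1)]]
      by (simp add: convolution_def)
  qed (simp add: convolution_def)
qed

lemma convolution_scale_right: "\<mu> \<in> M ==> \<nu> \<in> M ==> convolution \<mu> (scale c \<nu>) = scale c (convolution \<mu> \<nu>)"
proof
  fix E assume *: "\<mu> \<in> M" "\<nu> \<in> M"
  show "convolution \<mu> (scale c \<nu>) E = scale c (convolution \<mu> \<nu>) E"
  proof (cases "E \<in> sets borel")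
    case True
    then show ?thesis
      using cm_integral_scale_measure[OF *(2) M_rtrans_measurable[OF *(1) True] norm_M_le_nrm[OF *(1)]]
      by (simp add: convolution_def scale_def)
  qed (simp add: convolution_def scale_def)
qed

end

section \<open>Point masses, supports and atoms of convolutions\<close>

definition dirac :: "'a::topological_space \<Rightarrow> 'a set \<Rightarrow> complex" where
  "dirac x = (\<lambda>E. if E \<in> sets borel then indicator E x else 0)"

lemma variation_zeroI:
  assumes "\<And>E. E \<in> sets borel ==> E \<subseteq> K ==> \<mu> E = 0"
  shows "variation \<mu> K = 0"
proof -
  have "variation \<mu> K \<le> emeasure (null_measure borel) K"
    by (rule variation_le) (use assms in auto)
  then show ?thesis by simp
qed

context weighted_group
begin

lemma variation_zeroD:
  assumes \<mu>: "\<mu> \<in> M" and K: "K \<in> sets borel" "variation \<mu> K = 0" and E: "E \<in> sets borel" "E \<subseteq> K"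
  shows "\<mu> E = 0"
proof -
  note c = M_complex_borel_measure[OF \<mu>]
  have "emeasure (variation_measure \<mu>) E \<le> emeasure (variation_measure \<mu>) K"
    using E K sets_variation_measure[OF c] by (intro emeasure_mono) auto
  then have "measure (variation_measure \<mu>) E = 0"
    using emeasure_variation_measure[OF c K(1)] K(2) by (simp add: measure_def)
  then show ?thesis using norm_M_le[OF \<mu> E(1)] by simp
qed

lemma ex_rep_dirac: "\<exists>m. rep m (\<lambda>_. 1) \<and> dirac x = dens m (\<lambda>_. 1) \<and> measure m UNIV = 1 \<and> (AE y in m. y = x)"
proof -
  define m :: "'a measure" where "m = measure_of UNIV (sets borel) (\<lambda>E. indicator E x)"
  have s: "sets m = sets borel" and sp: "space m = UNIV" by (simp_all add: m_def)
  have e: "emeasure m E = indicator E x" if "E \<in> sets borel" for E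
    unfolding m_def
  proof (rule emeasure_borel_measure_of[OF _ _ that])
    fix A :: "nat \<Rightarrow> 'a set" assume "disjoint_family A"
    then show "(\<Sum>i. indicator (A i) x) = (indicator (\<Union>i. A i) x :: ennreal)" by (rule suminf_indicator)
  qed simp
  have fin: "finite_measure m" by (intro finite_measureI) (simp add: sp e)
  have me: "measure m E = indicator E x" if "E \<in> sets borel" for E
    using e[OF that] by (simp add: measure_def indicator_def)
  have rad: "radon m"
    unfolding radon_def
  proof (intro conjI s fin ballI allI impI)
    fix E :: "'a set" and \<epsilon> :: real assume E: "E \<in> sets borel" and \<epsilon>: "\<epsilon> > 0"
    show "\<exists>K. compact K \<and> K \<subseteq> E \<and> measure m (E - K) < \<epsilon>"
      using E \<epsilon> me[of "E - {x}"] me[OF E] by (cases "x \<in> E") (auto intro: exI[of _ "{x}"] exI[of _ "{}"])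
  qed
  interpret finite_measure m by (rule fin)
  have ae: "AE y in m. y = x"
  proof (rule AE_I')
    show "UNIV - {x} \<in> null_sets m" using e[of "UNIV - {x}"] s by (auto simp: null_sets_def)
  qed auto
  note [simp] = radon_measurable[OF rad]
  have "integrable m (\<lambda>y. \<omega> x)" by simp
  then have "integrable m \<omega>"
    by (rule integrable_cong_AE_imp) (use ae in auto)
  then have "rep m (\<lambda>_. 1)" using rad by (simp add: rep_def)
  moreover have "dirac x = dens m (\<lambda>_. 1)"
  proof
    fix E
    have "(LINT y:E|m. (1::complex)) = of_real (measure m E)" if "E \<in> sets borel"
    proof -
      have "(LINT y:E|m. (1::complex)) = (\<integral>y. indicat_real E y \<partial>m) *\<^sub>R 1"
        unfolding set_lebesgue_integral_def
        by (rule integral_scaleR_left) (use that s in \<open>simp add: less_top[symmetric]\<close>)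
      then show ?thesis using that s sp by (simp add: of_real_def)
    qed
    then show "dirac x E = dens m (\<lambda>_. 1) E" by (simp add: dirac_def dens_def me indicator_def)
  qed
  moreover have "measure m UNIV = 1" by (simp add: me)
  ultimately show ?thesis using ae by blast
qed

lemma dirac_M: "dirac x \<in> M"
  and nrm_dirac: "nrm (dirac x) = \<omega> x"
  and cm_integral_dirac: "f \<in> borel_measurable borel ==> (\<And>y. cmod (f y) \<le> B) ==> cm_integral (dirac x) f = f x"
proof -
  obtain m where m: "rep m (\<lambda>_. 1)" "dirac x = dens m (\<lambda>_. 1)" "measure m UNIV = 1" "AE y in m. y = x"
    using ex_rep_dirac by metis
  note r = repD[OF m(1)]
  note [simp] = r(5)
  show "dirac x \<in> M" using r m by simp
  have "nrm (dirac x) = (\<integral>y. \<omega> y \<partial>m)" using r m by simp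
  also have "\<dots> = (\<integral>y. \<omega> x \<partial>m)" by (intro integral_cong_AE) (use m in auto)
  also have "\<dots> = \<omega> x" using m r by simp
  finally show "nrm (dirac x) = \<omega> x" .
  assume f: "f \<in> borel_measurable borel" "\<And>y. cmod (f y) \<le> B"
  have "cm_integral (dirac x) f = (\<integral>y. f y \<partial>m)" using cm_integral_M(1)[OF m(1) f] m by simp
  also have "\<dots> = (\<integral>y. f x \<partial>m)" by (intro integral_cong_AE) (use m f in auto)
  also have "\<dots> = f x" using m r by simp
  finally show "cm_integral (dirac x) f = f x" .
qed

lemma dirac_point: "dirac (x :: 'a) {z} = (if x = z then 1 else 0)"
  using borel_closed[OF closed_singleton[of z]] by (simp add: dirac_def)

lemma cm_integral_indicator:
  assumes \<mu>: "\<mu> \<in> M" and E: "E \<in> sets borel"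
  shows "cm_integral \<mu> (indicator E) = \<mu> E"
proof -
  obtain m g where *: "rep m g" "\<mu> = dens m g" using M_rep[OF \<mu>] by metis
  have "cm_integral \<mu> (indicator E) = (\<integral>x. indicator E x * g x \<partial>m)"
    unfolding *(2) using E by (intro cm_integral_M(1)[OF *(1), where B=1]) (auto split: split_indicator)
  also have "\<dots> = (LINT x:E|m. g x)"
    unfolding set_lebesgue_integral_def
    by (intro Bochner_Integration.integral_cong) (auto split: split_indicator)
  finally show ?thesis using * E by (simp add: dens_def)
qed

end

context weighted_lc_group
begin

lemma convolution_dirac_zero: "\<mu> \<in> M ==> convolution \<mu> (dirac 0) = \<mu>"
proof
  fix E assume \<mu>: "\<mu> \<in> M"
  show "convolution \<mu> (dirac 0) E = \<mu> E"
  proof (cases "E \<in> sets borel")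
    case True
    then show ?thesis
      using cm_integral_dirac[OF M_rtrans_measurable[OF \<mu> True] norm_M_le_nrm[OF \<mu>], of 0]
      by (simp add: convolution_def)
  next
    case False
    then show ?thesis using M_complex_borel_measure[OF \<mu>] by (auto simp: convolution_def complex_borel_measure_def)
  qed
qed

lemma compact_sums:
  assumes "compact A" "compact B"
  shows "compact {- a + b |a b. a \<in> A \<and> b \<in> (B :: 'a set)}" "compact {a + - b |a b. a \<in> A \<and> b \<in> (B :: 'a set)}"
proof -
  have "{- a + b |a b. a \<in> A \<and> b \<in> B} = (\<lambda>p. - fst p + snd p) ` (A \<times> B)" by force
  also have "compact \<dots>" using assms by (intro compact_continuous_image compact_Times continuous_intros)
  finally show "compact {- a + b |a b. a \<in> A \<and> b \<in> B}" .
  have "{a + - b |a b. a \<in> A \<and> b \<in> B} = (\<lambda>p. fst p + - snd p) ` (A \<times> B)" by force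
  also have "compact \<dots>" using assms by (intro compact_continuous_image compact_Times continuous_intros)
  finally show "compact {a + - b |a b. a \<in> A \<and> b \<in> B}" .
qed

text \<open>If x lies in \<open>K1\<close> and x + y in \<open>K\<close>, then y lies in
  -\<open>K1\<close> + \<open>K\<close>, a compact set that \<nu> does not charge. Vanishing at
  infinity is preserved by the action of measures for this reason.\<close>

lemma convolution_null_left:
  assumes \<mu>: "\<mu> \<in> M" and \<nu>: "\<nu> \<in> M" and K: "compact K1" "compact K"
    and null: "variation \<nu> {- a + b |a b. a \<in> K1 \<and> b \<in> K} = 0"
  shows "variation (convolution (restr K1 \<mu>) \<nu>) K = 0"
proof (rule variation_zeroI)
  let ?L = "{- a + b |a b. a \<in> K1 \<and> b \<in> K}"
  have L: "?L \<in> sets borel" using compact_sums(1)[OF K] by auto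
  fix E assume E: "E \<in> sets borel" "E \<subseteq> K"
  have r: "restr K1 \<mu> \<in> M" using K by (intro M_restr \<mu>) auto
  have \<nu>0: "restr ?L \<nu> = (\<lambda>_. 0)"
    by (rule ext) (auto simp: restr_def intro!: variation_zeroD[OF \<nu> L null] L)
  have z: "restr K1 \<mu> (rtrans E y) = 0" if "y \<notin> ?L" for y
  proof -
    have "rtrans E y \<inter> K1 = {}"
    proof (intro set_eqI iffI; clarsimp)
      fix x assume x: "x + y \<in> E" "x \<in> K1"
      then have "- x + (x + y) \<in> ?L" using E(2) by blast
      then show False using that by (simp add: add.assoc[symmetric])
    qed
    moreover have "\<mu> {} = 0" using M_complex_borel_measure[OF \<mu>] sigma_additive_empty by (auto simp: complex_borel_measure_alt)
    ultimately show ?thesis by (simp add: restr_def)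
  qed
  obtain m g where *: "rep m g" "\<nu> = dens m g" using M_rep[OF \<nu>] by metis
  note rr = repD[OF *(1)]
  let ?f = "\<lambda>y. restr K1 \<mu> (rtrans E y)"
  have f: "?f \<in> borel_measurable borel" "\<And>y. cmod (?f y) \<le> nrm (restr K1 \<mu>)"
    using M_rtrans_measurable[OF r E(1)] norm_M_le_nrm[OF r] by auto
  have mL: "- ?L \<in> sets borel" using L by auto
  have eq: "\<nu> = restr (- ?L) \<nu>"
  proof -
    have "restr ?L \<nu> + restr (- ?L) \<nu> = restr (- ?L) \<nu>" by (simp add: \<nu>0 plus_fun_def)
    then show ?thesis using restr_split[OF \<nu> L] by (simp only:)
  qed
  have "convolution (restr K1 \<mu>) \<nu> E = cm_integral (restr (- ?L) \<nu>) ?f"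
    by (subst eq[symmetric]) (simp add: convolution_def E)
  also have "cm_integral (restr (- ?L) \<nu>) ?f = (\<integral>y. ?f y * (indicator (- ?L) y * g y) \<partial>m)"
    unfolding *(2) restr_dens[OF rr(2) mL] by (rule cm_integral_M(1)[OF rep_indicator[OF *(1) mL] f])
  also have "\<dots> = (\<integral>y. 0 \<partial>m)"
    using z by (intro Bochner_Integration.integral_cong refl) (auto split: split_indicator)
  finally show "convolution (restr K1 \<mu>) \<nu> E = 0" by simp
qed

text \<open>The mirror image: y in \<open>K2\<close> and x + y in \<open>K\<close> force x into
  \<open>K\<close> - \<open>K2\<close>.\<close>

lemma convolution_null_right:
  assumes \<mu>: "\<mu> \<in> M" and \<nu>: "\<nu> \<in> M" and K: "compact K2" "compact K"
    and null: "variation \<mu> {a + - b |a b. a \<in> K \<and> b \<in> K2} = 0"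
  shows "variation (convolution \<mu> (restr K2 \<nu>)) K = 0"
proof (rule variation_zeroI)
  let ?L = "{a + - b |a b. a \<in> K \<and> b \<in> K2}"
  have L: "?L \<in> sets borel" using compact_sums(2)[OF K(2,1)] by auto
  fix E assume E: "E \<in> sets borel" "E \<subseteq> K"
  have z: "\<mu> (rtrans E y) = 0" if "y \<in> K2" for y
  proof (rule variation_zeroD[OF \<mu> L null rtrans_borel[OF E(1)]])
    show "rtrans E y \<subseteq> ?L"
    proof clarsimp
      fix x assume "x + y \<in> E"
      then show "\<exists>a b. x = a - b \<and> a \<in> K \<and> b \<in> K2"
        using that E(2) by (intro exI[of _ "x + y"] exI[of _ y]) auto
    qed
  qed
  obtain m g where *: "rep m g" "\<nu> = dens m g" using M_rep[OF \<nu>] by metis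
  note rr = repD[OF *(1)]
  have K2: "K2 \<in> sets borel" using K by auto
  let ?f = "\<lambda>y. \<mu> (rtrans E y)"
  have f: "?f \<in> borel_measurable borel" "\<And>y. cmod (?f y) \<le> nrm \<mu>"
    using M_rtrans_measurable[OF \<mu> E(1)] norm_M_le_nrm[OF \<mu>] by auto
  have "convolution \<mu> (restr K2 \<nu>) E = cm_integral (restr K2 \<nu>) ?f" by (simp add: convolution_def E)
  also have "\<dots> = (\<integral>y. ?f y * (indicator K2 y * g y) \<partial>m)"
    unfolding *(2) restr_dens[OF rr(2) K2] by (rule cm_integral_M(1)[OF rep_indicator[OF *(1) K2] f])
  also have "\<dots> = (\<integral>y. 0 \<partial>m)"
    using z by (intro Bochner_Integration.integral_cong refl) (auto split: split_indicator)
  finally show "convolution \<mu> (restr K2 \<nu>) E = 0" by simp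
qed

lemma finite_large_points:
  assumes \<mu>: "\<mu> \<in> M" and \<epsilon>: "\<epsilon> > 0"
  shows "finite {z. \<epsilon> \<le> cmod (\<mu> {z})}"
proof (rule ccontr)
  assume "infinite {z. \<epsilon> \<le> cmod (\<mu> {z})}"
  moreover obtain N :: nat where N: "nrm \<mu> / \<epsilon> < N" using reals_Archimedean2 by blast
  ultimately obtain F where F: "F \<subseteq> {z. \<epsilon> \<le> cmod (\<mu> {z})}" "finite F" "card F = N"
    using infinite_arbitrarily_large by blast
  have "N * \<epsilon> = (\<Sum>z\<in>F. \<epsilon>)" using F by simp
  also have "\<dots> \<le> (\<Sum>z\<in>F. \<omega> z * cmod (\<mu> {z}))"
  proof (rule sum_mono)
    fix z assume "z \<in> F"
    then have "\<epsilon> \<le> cmod (\<mu> {z})" using F by auto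
    then show "\<epsilon> \<le> \<omega> z * cmod (\<mu> {z})"
      using mult_right_mono[OF weight_ge_1[of z], of "cmod (\<mu> {z})"] by simp
  qed
  also have "\<dots> \<le> nrm \<mu>" by (rule sum_points_le[OF \<mu> F(2)])
  finally show False using N \<epsilon> by (simp add: field_simps)
qed

text \<open>Atoms of a convolution come from atoms, because \<open>\<mu> {x - y}\<close> is uniformly close to
  a finite combination of point indicators in \<open>y\<close>.\<close>

lemma convolution_point:
  assumes \<mu>: "\<mu> \<in> M" and \<epsilon>: "\<epsilon> > 0"
  obtains F0 where "finite F0" "\<And>F \<nu>. finite F ==> F0 \<subseteq> F ==> \<nu> \<in> M ==>
     cmod (convolution \<mu> \<nu> {x} - (\<Sum>z\<in>F. \<mu> {z} * \<nu> {- z + x})) \<le> \<epsilon> * nrm \<nu>"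
proof -
  \<comment> \<open>This finite set depends on \<mu> and \<epsilon> but not on \<nu>; the estimate
    is therefore one for the norm of a functional of \<nu>.\<close>
  define F0 where "F0 = {z. \<epsilon> \<le> cmod (\<mu> {z})}"
  have "cmod (convolution \<mu> \<nu> {x} - (\<Sum>z\<in>F. \<mu> {z} * \<nu> {- z + x})) \<le> \<epsilon> * nrm \<nu>"
    if F: "finite F" "F0 \<subseteq> F" and \<nu>: "\<nu> \<in> M" for F \<nu>
  proof -
    have tr: "rtrans {x} y = {x - y}" for y :: 'a
      by (auto simp: eq_diff_eq)
    let ?f = "\<lambda>y. \<mu> (rtrans {x} y)" and ?s = "\<lambda>y. \<Sum>z\<in>F. \<mu> {z} * indicator {- z + x} y"
    have f: "?f \<in> borel_measurable borel" "\<And>y. cmod (?f y) \<le> nrm \<mu>"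
      using M_rtrans_measurable[OF \<mu>, of "{x}"] norm_M_le_nrm[OF \<mu>] by auto
    have s: "?s \<in> borel_measurable borel" by measurable
    have sx: "?s y = (if x - y \<in> F then \<mu> {x - y} else 0)" for y
    proof -
      have "y = - z + x \<longleftrightarrow> z + y = x" for z by (metis add_minus_cancel minus_add_cancel)
      then have eq: "y = - z + x \<longleftrightarrow> z = x - y" for z by (simp add: eq_diff_eq)
      have "?s y = (\<Sum>z\<in>F. if z = x - y then \<mu> {z} else 0)"
        by (intro sum.cong refl) (simp add: indicator_def eq)
      then show ?thesis using F(1) by (simp add: sum.delta)
    qed
    have sb: "cmod (?s y) \<le> nrm \<mu>" for y
      unfolding sx using norm_M_le_nrm[OF \<mu>] nrm_nonneg by auto
    have d: "cmod (?f y - ?s y) \<le> \<epsilon>" for y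
    proof (cases "x - y \<in> F")
      case True
      then show ?thesis unfolding sx tr using \<epsilon> by simp
    next
      case False
      then have "\<not> \<epsilon> \<le> cmod (\<mu> {x - y})" using F(2) by (auto simp: F0_def)
      then show ?thesis unfolding sx tr using False by simp
    qed
    have si: "cm_integral \<nu> (\<lambda>y. \<Sum>z\<in>G. \<mu> {z} * indicator {- z + x} y) = (\<Sum>z\<in>G. \<mu> {z} * \<nu> {- z + x})"
      if "finite G" for G using that
    proof induction
      case empty
      show ?case using cm_integral_cmult[OF \<nu>, of "\<lambda>_. 0" 0 0] by simp
    next
      case (insert z G)
      have 1: "cmod (\<Sum>z\<in>G. \<mu> {z} * indicator {- z + x} y) \<le> (\<Sum>z\<in>G. cmod (\<mu> {z}))" for y
        by (rule order_trans[OF norm_sum]) (auto intro!: sum_mono simp: norm_mult indicator_def)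
      have 2: "cmod (\<mu> {z} * indicator {- z + x} y) \<le> cmod (\<mu> {z})" for y
        by (simp add: norm_mult indicator_def)
      have "cm_integral \<nu> (\<lambda>y. \<mu> {z} * indicator {- z + x} y + (\<Sum>z\<in>G. \<mu> {z} * indicator {- z + x} y)) =
        cm_integral \<nu> (\<lambda>y. \<mu> {z} * indicator {- z + x} y) + cm_integral \<nu> (\<lambda>y. \<Sum>z\<in>G. \<mu> {z} * indicator {- z + x} y)"
        by (rule cm_integral_add[OF \<nu> _ 2 _ 1]) measurable
      also have "cm_integral \<nu> (\<lambda>y. \<mu> {z} * indicator {- z + x} y) = \<mu> {z} * cm_integral \<nu> (indicator {- z + x})"
        by (rule cm_integral_cmult[OF \<nu>, where B = 1]) (auto simp: indicator_def)
      also have "cm_integral \<nu> (indicator {- z + x}) = \<nu> {- z + x}" by (rule cm_integral_indicator[OF \<nu>]) simp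
      finally show ?case by (simp only: sum.insert[OF insert(1,2)] insert(3))
    qed
    have "cm_integral \<nu> (\<lambda>y. (?f y - ?s y) + ?s y) = cm_integral \<nu> (\<lambda>y. ?f y - ?s y) + cm_integral \<nu> ?s"
      by (rule cm_integral_add[OF \<nu> borel_measurable_diff[OF f(1) s] d s sb])
    then have "convolution \<mu> \<nu> {x} - (\<Sum>z\<in>F. \<mu> {z} * \<nu> {- z + x}) = cm_integral \<nu> (\<lambda>y. ?f y - ?s y)"
      using si[OF F(1)] by (simp add: convolution_def)
    also have "cmod \<dots> \<le> \<epsilon> * nrm \<nu>"
      by (rule cm_integral_bound[OF \<nu> borel_measurable_diff[OF f(1) s] d])
    finally show ?thesis .
  qed
  then show thesis using that finite_large_points[OF \<mu> \<epsilon>] unfolding F0_def by blast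
qed

end

section \<open>Dual spaces and the first Arens action\<close>

text \<open>With the seminorm axioms alone, one set of lemmas serves \<open>M\<close>,
  \<open>M\<^sub>*\<close>, their duals and the abstract algebras further on.\<close>

definition seminormed :: "('i, 'z) nspace_scheme \<Rightarrow> bool" where
  "seminormed E \<longleftrightarrow> 0 \<in> Carrier E \<and>
     (\<forall>u\<in>Carrier E. \<forall>v\<in>Carrier E. u + v \<in> Carrier E \<and> Norm E (u + v) \<le> Norm E u + Norm E v) \<and>
     (\<forall>c. \<forall>u\<in>Carrier E. scale c u \<in> Carrier E \<and> Norm E (scale c u) = cmod c * Norm E u) \<and>
     (\<forall>u\<in>Carrier E. 0 \<le> Norm E u)"

lemma scale_simps [simp]:
  "scale 0 u = 0" "scale 1 u = u" "scale c 0 = 0" "scale a (scale b u) = scale (a * b) u"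
  "scale (- 1) u = - u"
  by (auto simp: scale_def fun_eq_iff)

lemma scale_apply: "scale c u i = c * u i"
  by (simp add: scale_def)

lemma scale_add_right: "scale c (u + v) = scale c u + scale c v"
  and scale_add_left: "scale (a + b) u = scale a u + scale b u"
  and scale_diff_right: "scale c (u - v) = scale c u - scale c v"
  by (auto simp: scale_def fun_eq_iff algebra_simps)

lemma seminormedD:
  assumes "seminormed E"
  shows "0 \<in> Carrier E" "u \<in> Carrier E ==> v \<in> Carrier E ==> u + v \<in> Carrier E"
    "u \<in> Carrier E ==> scale c u \<in> Carrier E"
    "u \<in> Carrier E ==> v \<in> Carrier E ==> Norm E (u + v) \<le> Norm E u + Norm E v"
    "u \<in> Carrier E ==> Norm E (scale c u) = cmod c * Norm E u"
    "u \<in> Carrier E ==> 0 \<le> Norm E u" "Norm E 0 = 0"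
proof -
  have "Norm E (scale 0 0) = cmod 0 * Norm E 0" using assms unfolding seminormed_def by blast
  then show "Norm E 0 = 0" by simp
qed (use assms in \<open>unfold seminormed_def, blast+\<close>)

lemma seminormed_sum:
  assumes "seminormed E" "finite F" "\<And>x. x \<in> F ==> f x \<in> Carrier E"
  shows "sum f F \<in> Carrier E"
  using assms(2,3) by induction (auto simp: seminormedD[OF assms(1)])

lemma seminormed_uminus:
  assumes E: "seminormed E" and u: "u \<in> Carrier E"
  shows "- u \<in> Carrier E" "Norm E (- u) = Norm E u"
  using seminormedD(3)[OF E u, of "-1"] seminormedD(5)[OF E u, of "-1"] by auto

lemma seminormed_diff:
  assumes E: "seminormed E" and u: "u \<in> Carrier E" "v \<in> Carrier E"
  shows "u - v \<in> Carrier E" "Norm E (u - v) \<le> Norm E u + Norm E v" "Norm E (u - v) = Norm E (v - u)"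
proof -
  show d: "u - v \<in> Carrier E" "Norm E (u - v) \<le> Norm E u + Norm E v"
    using seminormedD(2,4)[OF E u(1) seminormed_uminus(1)[OF E u(2)]] seminormed_uminus[OF E u(2)] by auto
  show "Norm E (u - v) = Norm E (v - u)" using seminormed_uminus(2)[OF E d(1)] by simp
qed

lemma bounded_functionalD:
  assumes "bounded_functional E f"
  shows "u \<in> Carrier E ==> v \<in> Carrier E ==> f (u + v) = f u + f v"
    "u \<in> Carrier E ==> f (scale c u) = c * f u"
  using assms unfolding bounded_functional_def by blast+

lemma dualD:
  assumes "f \<in> Carrier (dual E)"
  shows "bounded_functional E f" "u \<in> Carrier E ==> v \<in> Carrier E ==> f (u + v) = f u + f v"
    "u \<in> Carrier E ==> f (scale c u) = c * f u" "u \<notin> Carrier E ==> f u = 0"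
  using assms bounded_functionalD[of E f] unfolding dual_def by auto

lemma dualI:
  assumes "\<And>u v. u \<in> Carrier E ==> v \<in> Carrier E ==> f (u + v) = f u + f v"
    "\<And>c u. u \<in> Carrier E ==> f (scale c u) = c * f u"
    "\<And>u. u \<in> Carrier E ==> cmod (f u) \<le> B * Norm E u" "\<And>u. u \<notin> Carrier E ==> f u = 0"
  shows "f \<in> Carrier (dual E)"
proof -
  have "bounded_functional E f" unfolding bounded_functional_def using assms(1-3) by blast
  then show ?thesis using assms(4) by (simp add: dual_def)
qed

lemma Norm_dual: "Norm (dual E) f = (SUP u\<in>{u\<in>Carrier E. Norm E u \<le> 1}. cmod (f u))"
  by (simp add: dual_def)

context
  fixes E :: "('i, 'z) nspace_scheme"
  assumes E: "seminormed E"
begin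

lemma dual_zero: "f \<in> Carrier (dual E) ==> f 0 = 0"
  using dualD(3)[of f E 0 0] seminormedD(1)[OF E] by simp

lemma dual_bdd: "f \<in> Carrier (dual E) ==> bdd_above ((\<lambda>u. cmod (f u)) ` {u\<in>Carrier E. Norm E u \<le> 1})"
proof -
  assume "f \<in> Carrier (dual E)"
  then obtain B where B: "\<And>u. u \<in> Carrier E ==> cmod (f u) \<le> B * Norm E u"
    using dualD(1) unfolding bounded_functional_def by blast
  show ?thesis
  proof (rule bdd_aboveI2)
    fix u assume u: "u \<in> {u\<in>Carrier E. Norm E u \<le> 1}"
    then have "cmod (f u) \<le> \<bar>B\<bar> * Norm E u"
      using B[of u] seminormedD(6)[OF E, of u] mult_right_mono[OF abs_ge_self[of B], of "Norm E u"] by auto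
    also have "\<dots> \<le> \<bar>B\<bar> * 1" using u by (intro mult_left_mono) auto
    finally show "cmod (f u) \<le> \<bar>B\<bar>" by simp
  qed
qed

lemma dual_norm_upper: "f \<in> Carrier (dual E) ==> u \<in> Carrier E ==> Norm E u \<le> 1 ==> cmod (f u) \<le> Norm (dual E) f"
  unfolding Norm_dual by (rule cSUP_upper[OF _ dual_bdd]) auto

lemma dual_norm_nonneg: "f \<in> Carrier (dual E) ==> 0 \<le> Norm (dual E) f"
  using dual_norm_upper[of f 0] seminormedD(1,7)[OF E] by (auto simp: dual_zero)

lemma dual_le: "f \<in> Carrier (dual E) ==> u \<in> Carrier E ==> cmod (f u) \<le> Norm (dual E) f * Norm E u"
proof -
  assume f: "f \<in> Carrier (dual E)" and u: "u \<in> Carrier E"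
  show ?thesis
  \<comment> \<open>An element of norm 0 cannot be normalized; the bound in the definition of a
    bounded functional forces \<open>f u = 0\<close>.\<close>
  proof (cases "Norm E u = 0")
    case True
    obtain B where "cmod (f u) \<le> B * Norm E u"
      using dualD(1)[OF f] u unfolding bounded_functional_def by blast
    then show ?thesis using True by simp
  next
    case False
    then have p: "Norm E u > 0" using seminormedD(6)[OF E u] by simp
    let ?v = "scale (complex_of_real (1 / Norm E u)) u"
    have v: "?v \<in> Carrier E" "Norm E ?v = 1"
      using p u seminormedD(5)[OF E u] by (auto intro: seminormedD(3)[OF E] simp: norm_divide)
    have "cmod (f u) / Norm E u = cmod (f ?v)" using dualD(3)[OF f u] p by (simp add: norm_divide)
    also have "\<dots> \<le> Norm (dual E) f" using dual_norm_upper[OF f v(1)] v by simp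
    finally show ?thesis using p by (simp add: field_simps)
  qed
qed

lemma dual_norm_le:
  assumes "\<And>u. u \<in> Carrier E ==> cmod (f u) \<le> B * Norm E u" "0 \<le> B"
  shows "Norm (dual E) f \<le> B"
  unfolding Norm_dual
proof (rule cSUP_least)
  show "{u \<in> Carrier E. Norm E u \<le> 1} \<noteq> {}" using seminormedD(1,7)[OF E] by auto
  fix u assume u: "u \<in> {u \<in> Carrier E. Norm E u \<le> 1}"
  then have "cmod (f u) \<le> B * Norm E u" using assms by auto
  also have "\<dots> \<le> B * 1" using u assms by (intro mult_left_mono) auto
  finally show "cmod (f u) \<le> B" by simp
qed

lemma dual_add:
  assumes f: "f \<in> Carrier (dual E)" and g: "g \<in> Carrier (dual E)"
  shows "f + g \<in> Carrier (dual E)" "Norm (dual E) (f + g) \<le> Norm (dual E) f + Norm (dual E) g"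
proof -
  have b: "cmod ((f + g) u) \<le> (Norm (dual E) f + Norm (dual E) g) * Norm E u" if "u \<in> Carrier E" for u
    using dual_le[OF f that] dual_le[OF g that] norm_triangle_ineq[of "f u" "g u"] by (simp add: distrib_right)
  show "f + g \<in> Carrier (dual E)"
    by (rule dualI[OF _ _ b]) (auto simp: dualD[OF f] dualD[OF g] algebra_simps)
  show "Norm (dual E) (f + g) \<le> Norm (dual E) f + Norm (dual E) g"
    by (rule dual_norm_le[OF b]) (auto simp: dual_norm_nonneg f g)
qed

lemma dual_scale:
  assumes f: "f \<in> Carrier (dual E)"
  shows "scale c f \<in> Carrier (dual E)" "Norm (dual E) (scale c f) = cmod c * Norm (dual E) f"
proof -
  have b: "cmod (scale c f u) \<le> (cmod c * Norm (dual E) f) * Norm E u" if "u \<in> Carrier E" for u c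
    using mult_left_mono[OF dual_le[OF f that], of "cmod c"] by (simp add: scale_def norm_mult mult.assoc)
  show s: "scale c f \<in> Carrier (dual E)" for c
    by (rule dualI[OF _ _ b]) (auto simp: dualD[OF f] algebra_simps scale_apply)
  have le: "Norm (dual E) (scale c f) \<le> cmod c * Norm (dual E) f" for c
    by (rule dual_norm_le[OF b]) (auto simp: dual_norm_nonneg f)
  show "Norm (dual E) (scale c f) = cmod c * Norm (dual E) f"
  proof (cases "c = 0")
    case True
    then show ?thesis using le[of 0] dual_norm_nonneg[OF s[of 0]] by simp
  next
    case False
    have "cmod (f u) \<le> (inverse (cmod c) * Norm (dual E) (scale c f)) * Norm E u" if u: "u \<in> Carrier E" for u
      using dual_le[OF s[of c] u] False by (simp add: scale_def norm_mult field_simps)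
    then have "Norm (dual E) f \<le> inverse (cmod c) * Norm (dual E) (scale c f)"
      by (intro dual_norm_le) (auto simp: dual_norm_nonneg[OF s])
    then have "cmod c * Norm (dual E) f \<le> Norm (dual E) (scale c f)" using False by (simp add: field_simps)
    then show ?thesis using le[of c] by simp
  qed
qed

lemma seminormed_dual: "seminormed (dual E)"
proof -
  have "0 \<in> Carrier (dual E)" by (rule dualI[where B = 0]) auto
  then show ?thesis by (simp add: seminormed_def dual_add dual_scale dual_norm_nonneg)
qed

lemma dual_norm_eq_0: "f \<in> Carrier (dual E) ==> Norm (dual E) f = 0 ==> f = 0"
proof
  fix u assume f: "f \<in> Carrier (dual E)" "Norm (dual E) f = 0"
  show "f u = 0 u" using dual_le[OF f(1), of u] dualD(4)[OF f(1), of u] f(2) by (cases "u \<in> Carrier E") auto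
qed

text \<open>Cauchy sequences converge pointwise, and the Cauchy estimate survives the pointwise
  limit. Completeness of \<open>M\<^sub>*\<close> dual is later transferred to the C*-norm when
  \<open>G\<close> is finite.\<close>

lemma banach_space_dual: "banach_space (dual E)"
  unfolding banach_space_def
proof (intro conjI allI impI)
  note D = seminormedD[OF seminormed_dual]
  show "0 \<in> Carrier (dual E)" by (rule D)
  show "\<forall>u\<in>Carrier (dual E). \<forall>v\<in>Carrier (dual E). u + v \<in> Carrier (dual E)" using D by blast
  show "\<forall>u\<in>Carrier (dual E). scale c u \<in> Carrier (dual E)" for c using D by blast
  show "norm_on (Carrier (dual E)) (Norm (dual E))"
    unfolding norm_on_def using D dual_norm_eq_0 by blast
  fix s assume s: "\<forall>n::nat. s n \<in> Carrier (dual E)"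
    and cauchy: "\<forall>e>0. \<exists>N. \<forall>m\<ge>N. \<forall>n\<ge>N. Norm (dual E) (s m - s n) < e"
  have sd: "s m - s n \<in> Carrier (dual E)" for m n using s seminormed_diff(1)[OF seminormed_dual] by blast
  have ptw: "cmod (s m u - s n u) \<le> Norm (dual E) (s m - s n) * Norm E u" if "u \<in> Carrier E" for m n u
    using dual_le[OF sd that, of m n] by simp
  have conv: "convergent (\<lambda>n. s n u)" if u: "u \<in> Carrier E" for u
  proof (rule Cauchy_convergent, rule CauchyI)
    fix e :: real assume e: "e > 0"
    have p: "Norm E u + 1 > 0" using seminormedD(6)[OF E u] by simp
    then obtain N where N: "\<And>m n. m \<ge> N ==> n \<ge> N ==> Norm (dual E) (s m - s n) < e / (Norm E u + 1)"
      using cauchy e by (metis divide_pos_pos)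
    have "norm (s m u - s n u) < e" if "m \<ge> N" "n \<ge> N" for m n
    proof -
      have "norm (s m u - s n u) \<le> Norm (dual E) (s m - s n) * Norm E u" by (rule ptw[OF u])
      also have "\<dots> \<le> Norm (dual E) (s m - s n) * (Norm E u + 1)"
        using dual_norm_nonneg[OF sd] by (intro mult_left_mono) auto
      also have "\<dots> < e / (Norm E u + 1) * (Norm E u + 1)" using N[OF that] p by (intro mult_strict_right_mono)
      finally show ?thesis using p by simp
    qed
    then show "\<exists>M. \<forall>m\<ge>M. \<forall>n\<ge>M. norm (s m u - s n u) < e" by blast
  qed
  define l where "l u = (if u \<in> Carrier E then lim (\<lambda>n. s n u) else 0)" for u
  have lim: "(\<lambda>n. s n u) \<longlonglongrightarrow> l u" if "u \<in> Carrier E" for u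
    using conv[OF that] that by (simp add: l_def convergent_LIMSEQ_iff)
  have close: "cmod (s n u - l u) \<le> e * Norm E u"
    if N: "\<And>m n. m \<ge> N ==> n \<ge> N ==> Norm (dual E) (s m - s n) < e" and "n \<ge> N" "u \<in> Carrier E" for e N n u
  proof (rule LIMSEQ_le_const2)
    show "(\<lambda>m. cmod (s n u - s m u)) \<longlonglongrightarrow> cmod (s n u - l u)"
      by (intro tendsto_intros lim that)
    have "cmod (s n u - s m u) \<le> e * Norm E u" if "m \<ge> N" for m
      using ptw[OF \<open>u \<in> Carrier E\<close>, of n m] N[OF \<open>n \<ge> N\<close> that] seminormedD(6)[OF E \<open>u \<in> Carrier E\<close>]
      by (meson less_imp_le mult_right_mono order_trans)
    then show "\<exists>N. \<forall>m\<ge>N. cmod (s n u - s m u) \<le> e * Norm E u" by blast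
  qed
  obtain N1 where N1: "\<And>m n. m \<ge> N1 ==> n \<ge> N1 ==> Norm (dual E) (s m - s n) < 1"
    using cauchy by (metis zero_less_one)
  have l: "l \<in> Carrier (dual E)"
  proof (rule dualI)
    fix u assume u: "u \<in> Carrier E"
    show "cmod (l u) \<le> (Norm (dual E) (s N1) + 1) * Norm E u"
      using close[of N1 1, OF N1 order_refl u] dual_le[OF s[rule_format, of N1] u] norm_triangle_ineq3[of "l u" "s N1 u"]
      by (simp add: distrib_right norm_minus_commute)
    fix v assume v: "v \<in> Carrier E"
    have "(\<lambda>n. s n (u + v)) \<longlonglongrightarrow> l u + l v"
      using tendsto_add[OF lim[OF u] lim[OF v]] by (simp add: dualD(2)[OF s[rule_format] u v])
    then show "l (u + v) = l u + l v" using lim[OF seminormedD(2)[OF E u v]] LIMSEQ_unique by blast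
  next
    fix c u assume u: "u \<in> Carrier E"
    have "(\<lambda>n. s n (scale c u)) \<longlonglongrightarrow> c * l u"
      using tendsto_mult_left[OF lim[OF u]] by (simp add: dualD(3)[OF s[rule_format] u])
    then show "l (scale c u) = c * l u" using lim[OF seminormedD(3)[OF E u]] LIMSEQ_unique by blast
  qed (simp add: l_def)
  have "(\<lambda>n. Norm (dual E) (s n - l)) \<longlonglongrightarrow> 0"
  proof (rule LIMSEQ_I)
    fix e :: real assume e: "e > 0"
    then obtain N where N: "\<And>m n. m \<ge> N ==> n \<ge> N ==> Norm (dual E) (s m - s n) < e / 2"
      using cauchy half_gt_zero by metis
    have "norm (Norm (dual E) (s n - l) - 0) < e" if "n \<ge> N" for n
    proof -
      have d: "s n - l \<in> Carrier (dual E)" using seminormed_diff(1)[OF seminormed_dual] s l by blast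
      have "Norm (dual E) (s n - l) \<le> e / 2"
        using close[OF N that] e by (intro dual_norm_le) auto
      then show ?thesis using e dual_norm_nonneg[OF d] by simp
    qed
    then show "\<exists>no. \<forall>n\<ge>no. norm (Norm (dual E) (s n - l) - 0) < e" by blast
  qed
  then show "\<exists>l\<in>Carrier (dual E). (\<lambda>n. Norm (dual E) (s n - l)) \<longlonglongrightarrow> 0" using l by blast
qed

end

lemma dual_sum:
  assumes E: "seminormed E" and f: "f \<in> Carrier (dual E)" and F: "finite F" "\<And>x. x \<in> F ==> g x \<in> Carrier E"
  shows "f (sum g F) = (\<Sum>x\<in>F. f (g x))"
  using F by induction (auto simp: dual_zero[OF E f] dualD(2)[OF f] seminormed_sum[OF E])

lemma dual_diff:
  assumes E: "seminormed E" and f: "f \<in> Carrier (dual E)" and u: "u \<in> Carrier E" "v \<in> Carrier E"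
  shows "f (u - v) = f u - f v"
  using dualD(2)[OF f seminormed_diff(1)[OF E u] u(2)] by simp

definition normed_algebra :: "('i, 'z) nalg_scheme \<Rightarrow> bool" where
  "normed_algebra A \<longleftrightarrow> seminormed A \<and>
     (\<forall>u\<in>Carrier A. \<forall>v\<in>Carrier A. Mult A u v \<in> Carrier A \<and> Norm A (Mult A u v) \<le> Norm A u * Norm A v) \<and>
     (\<forall>u\<in>Carrier A. \<forall>v\<in>Carrier A. \<forall>w\<in>Carrier A.
        Mult A (u + v) w = Mult A u w + Mult A v w \<and> Mult A u (v + w) = Mult A u v + Mult A u w) \<and>
     (\<forall>c. \<forall>u\<in>Carrier A. \<forall>v\<in>Carrier A.
        Mult A (scale c u) v = scale c (Mult A u v) \<and> Mult A u (scale c v) = scale c (Mult A u v))"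

lemma normed_algebraD:
  assumes "normed_algebra A"
  shows "seminormed A" "u \<in> Carrier A ==> v \<in> Carrier A ==> Mult A u v \<in> Carrier A"
    "u \<in> Carrier A ==> v \<in> Carrier A ==> Norm A (Mult A u v) \<le> Norm A u * Norm A v"
    "u \<in> Carrier A ==> v \<in> Carrier A ==> w \<in> Carrier A ==> Mult A (u + v) w = Mult A u w + Mult A v w"
    "u \<in> Carrier A ==> v \<in> Carrier A ==> w \<in> Carrier A ==> Mult A u (v + w) = Mult A u v + Mult A u w"
    "u \<in> Carrier A ==> v \<in> Carrier A ==> Mult A (scale c u) v = scale c (Mult A u v)"
    "u \<in> Carrier A ==> v \<in> Carrier A ==> Mult A u (scale c v) = scale c (Mult A u v)"
  using assms unfolding normed_algebra_def by blast+

lemma functional_act_in_dual: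
  assumes A: "normed_algebra A" and f: "f \<in> Carrier (dual A)" and a: "a \<in> Carrier A"
  shows "functional_act A f a \<in> Carrier (dual A)"
    "Norm (dual A) (functional_act A f a) \<le> Norm (dual A) f * Norm A a"
proof -
  note D = normed_algebraD[OF A]
  have b: "cmod (functional_act A f a b) \<le> (Norm (dual A) f * Norm A a) * Norm A b" if "b \<in> Carrier A" for b
    using dual_le[OF D(1) f D(2)[OF a that]] mult_left_mono[OF D(3)[OF a that] dual_norm_nonneg[OF D(1) f]] that
    by (simp add: functional_act_def mult.assoc)
  show "functional_act A f a \<in> Carrier (dual A)"
    by (rule dualI[OF _ _ b])
      (auto simp: functional_act_def D a dualD[OF f] seminormedD(2,3)[OF D(1)])
  show "Norm (dual A) (functional_act A f a) \<le> Norm (dual A) f * Norm A a"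
    by (rule dual_norm_le[OF D(1) b]) (auto simp: dual_norm_nonneg[OF D(1) f] seminormedD(6)[OF D(1) a])
qed

lemma functional_act_linear:
  assumes A: "normed_algebra A" and f: "f \<in> Carrier (dual A)" and a: "a \<in> Carrier A" "b \<in> Carrier A"
  shows "functional_act A f (a + b) = functional_act A f a + functional_act A f b"
    "functional_act A f (scale c a) = scale c (functional_act A f a)"
proof -
  note D = normed_algebraD[OF A]
  show "functional_act A f (a + b) = functional_act A f a + functional_act A f b"
  proof
    fix c show "functional_act A f (a + b) c = (functional_act A f a + functional_act A f b) c"
      using D(2,4) dualD(2)[OF f] a by (cases "c \<in> Carrier A") (simp_all add: functional_act_def)
  qed
  show "functional_act A f (scale c a) = scale c (functional_act A f a)"
  proof
    fix b show "functional_act A f (scale c a) b = scale c (functional_act A f a) b"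
      using D(2,6) dualD(3)[OF f] a by (cases "b \<in> Carrier A") (simp_all add: functional_act_def scale_apply)
  qed
qed

section \<open>Functionals vanishing at infinity and the algebra of their dual\<close>

context weighted_lc_group
begin

abbreviation MS where "MS \<equiv> Carrier (M_star \<omega>)"
abbreviation nS where "nS \<equiv> Norm (dual (M_alg \<omega>))"
abbreviation A where "A \<equiv> M_star_dual \<omega>"

lemma seminormed_M: "seminormed (M_alg \<omega>)"
proof -
  have "0 \<in> M" using M_scale[OF dirac_M[of 0], of 0] by simp
  then show ?thesis by (simp add: seminormed_def M_add M_scale nrm_triangle nrm_scale nrm_nonneg)
qed

lemma Mult_M_alg: "Mult (M_alg \<omega>) = convolution"
  by (simp add: M_alg_def)

lemma normed_algebra_M: "normed_algebra (M_alg \<omega>)"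
  unfolding normed_algebra_def Mult_M_alg
  by (simp add: seminormed_M M_convolution nrm_convolution convolution_add_left convolution_add_right
      convolution_scale_left convolution_scale_right)

lemma Norm_M_star [simp]: "Norm (M_star \<omega>) = nS"
  by (simp add: M_star_def)

lemma MS_dual: "f \<in> MS ==> f \<in> Carrier (dual (M_alg \<omega>))"
  by (simp add: M_star_def)

lemma MSI:
  assumes f: "f \<in> Carrier (dual (M_alg \<omega>))"
    and "\<And>\<epsilon>. \<epsilon> > 0 ==> \<exists>K. compact K \<and> (\<forall>\<mu>\<in>M. variation \<mu> K = 0 \<longrightarrow> cmod (f \<mu>) \<le> \<epsilon> * nrm \<mu>)"
  shows "f \<in> MS"
proof -
  have "vanishes_at_infinity \<omega> f"
    unfolding vanishes_at_infinity_def
  proof (intro allI impI)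
    fix e :: real assume e: "e > 0"
    obtain K where "compact K" "\<forall>\<mu>\<in>M. variation \<mu> K = 0 \<longrightarrow> cmod (f \<mu>) \<le> e/2 * nrm \<mu>"
      using assms(2)[OF half_gt_zero[OF e]] by blast
    then show "\<exists>K. compact K \<and> (\<forall>\<mu>\<in>M. variation \<mu> K = 0 \<longrightarrow> nrm \<mu> = 1 \<longrightarrow> cmod (f \<mu>) < e)"
      using e by (intro exI[of _ K]) fastforce
  qed
  then show ?thesis using f by (simp add: M_star_def)
qed

lemma variation_scale_zero:
  assumes "\<mu> \<in> M" "K \<in> sets borel" "variation \<mu> K = 0" shows "variation (scale c \<mu>) K = 0"
  by (rule variation_zeroI) (simp add: scale_apply variation_zeroD[OF assms])

text \<open>Scaling gives the homogeneous form of vanishing at infinity; measures of norm 0, which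
  cannot be scaled to norm 1, are covered by boundedness of \<open>f\<close>.\<close>

lemma MSD:
  assumes f: "f \<in> MS" and \<epsilon>: "\<epsilon> > 0"
  obtains K where "compact K" "\<And>\<mu>. \<mu> \<in> M ==> variation \<mu> K = 0 ==> cmod (f \<mu>) \<le> \<epsilon> * nrm \<mu>"
proof -
  obtain K where K: "compact K" "\<And>\<mu>. \<mu> \<in> M ==> variation \<mu> K = 0 ==> nrm \<mu> = 1 ==> cmod (f \<mu>) < \<epsilon>"
    using f \<epsilon> by (auto simp: M_star_def vanishes_at_infinity_def)
  note fd = MS_dual[OF f]
  have "cmod (f \<mu>) \<le> \<epsilon> * nrm \<mu>" if \<mu>: "\<mu> \<in> M" "variation \<mu> K = 0" for \<mu>
  proof (cases "nrm \<mu> = 0")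
    case True
    then show ?thesis using dual_le[OF seminormed_M fd \<mu>(1)] by simp
  next
    case False
    then have p: "nrm \<mu> > 0" using nrm_nonneg[of \<mu>] by simp
    let ?c = "complex_of_real (1 / nrm \<mu>)"
    have "cmod (f (scale ?c \<mu>)) < \<epsilon>"
      using p K(1) \<mu> by (intro K variation_scale_zero) (auto simp: M_scale nrm_scale norm_divide)
    moreover have "cmod (f (scale ?c \<mu>)) = cmod (f \<mu>) / nrm \<mu>"
      unfolding dualD(3)[OF fd \<mu>(1)] using p by (simp add: norm_divide)
    ultimately have "cmod (f \<mu>) / nrm \<mu> < \<epsilon>" by (simp only:)
    then show ?thesis using p by (simp add: pos_divide_less_eq)
  qed
  then show thesis using that K(1) by blast
qed

lemma variation_Un_zero:
  assumes "\<mu> \<in> M" "K \<in> sets borel" "L \<in> sets borel" "L \<subseteq> K" "variation \<mu> K = 0"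
  shows "variation \<mu> L = 0"
  using assms by (intro variation_zeroI variation_zeroD[OF assms(1,2,5)]) auto

lemma MS_add: "f \<in> MS ==> g \<in> MS ==> f + g \<in> MS"
proof (rule MSI)
  assume f: "f \<in> MS" and g: "g \<in> MS"
  show "f + g \<in> Carrier (dual (M_alg \<omega>))" by (rule dual_add[OF seminormed_M MS_dual[OF f] MS_dual[OF g]])
  fix \<epsilon> :: real assume "\<epsilon> > 0"
  then have e: "\<epsilon>/2 > 0" by simp
  obtain K where K: "compact K" "\<And>\<mu>. \<mu> \<in> M ==> variation \<mu> K = 0 ==> cmod (f \<mu>) \<le> \<epsilon>/2 * nrm \<mu>" using MSD[OF f e] by metis
  obtain L where L: "compact L" "\<And>\<mu>. \<mu> \<in> M ==> variation \<mu> L = 0 ==> cmod (g \<mu>) \<le> \<epsilon>/2 * nrm \<mu>" using MSD[OF g e] by metis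
  have "cmod ((f + g) \<mu>) \<le> \<epsilon> * nrm \<mu>" if \<mu>: "\<mu> \<in> M" "variation \<mu> (K \<union> L) = 0" for \<mu>
  proof -
    have "variation \<mu> K = 0" "variation \<mu> L = 0"
      using K L by (auto intro!: variation_Un_zero[OF \<mu>(1) _ _ _ \<mu>(2)])
    then show ?thesis using K(2)[OF \<mu>(1)] L(2)[OF \<mu>(1)] norm_triangle_ineq[of "f \<mu>" "g \<mu>"] by (simp add: algebra_simps)
  qed
  then show "\<exists>K. compact K \<and> (\<forall>\<mu>\<in>M. variation \<mu> K = 0 \<longrightarrow> cmod ((f + g) \<mu>) \<le> \<epsilon> * nrm \<mu>)"
    using K L by (intro exI[of _ "K \<union> L"]) auto
qed

lemma MS_scale: "f \<in> MS ==> scale c f \<in> MS"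
proof (rule MSI)
  assume f: "f \<in> MS"
  show "scale c f \<in> Carrier (dual (M_alg \<omega>))" by (rule dual_scale[OF seminormed_M MS_dual[OF f]])
  fix \<epsilon> :: real assume "\<epsilon> > 0"
  then have e: "\<epsilon> / (cmod c + 1) > 0" by (simp add: add_nonneg_pos)
  obtain K where K: "compact K" "\<And>\<mu>. \<mu> \<in> M ==> variation \<mu> K = 0 ==> cmod (f \<mu>) \<le> \<epsilon> / (cmod c + 1) * nrm \<mu>" using MSD[OF f e] by metis
  have "cmod (scale c f \<mu>) \<le> \<epsilon> * nrm \<mu>" if \<mu>: "\<mu> \<in> M" "variation \<mu> K = 0" for \<mu>
  proof -
    have "cmod (scale c f \<mu>) \<le> (cmod c + 1) * (\<epsilon> / (cmod c + 1) * nrm \<mu>)"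
      unfolding scale_apply norm_mult using K(2)[OF \<mu>] by (intro mult_mono) auto
    also have "\<dots> = \<epsilon> * nrm \<mu>"
    proof -
      have "cmod c + 1 \<noteq> 0" using norm_ge_zero[of c] by linarith
      then show ?thesis by simp
    qed
    finally show ?thesis .
  qed
  then show "\<exists>K. compact K \<and> (\<forall>\<mu>\<in>M. variation \<mu> K = 0 \<longrightarrow> cmod (scale c f \<mu>) \<le> \<epsilon> * nrm \<mu>)"
    using K by blast
qed

lemma MS_zero: "0 \<in> MS"
proof (rule MSI)
  show "0 \<in> Carrier (dual (M_alg \<omega>))" by (rule seminormedD(1)[OF seminormed_dual[OF seminormed_M]])
qed (auto intro!: exI[of _ "{}"] simp: nrm_nonneg)

lemma seminormed_MS: "seminormed (M_star \<omega>)"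
  by (auto simp: seminormed_def MS_zero MS_add MS_scale dual_scale(2)[OF seminormed_M MS_dual]
      dual_norm_nonneg[OF seminormed_M MS_dual] intro: dual_add(2)[OF seminormed_M MS_dual MS_dual])

lemma MS_le: "f \<in> MS ==> \<mu> \<in> M ==> cmod (f \<mu>) \<le> nS f * nrm \<mu>"
  by (rule dual_le[OF seminormed_M MS_dual])

lemma nS_nonneg: "f \<in> MS ==> 0 \<le> nS f"
  by (rule dual_norm_nonneg[OF seminormed_M MS_dual])

text \<open>The transpose of \<open>restr K\<close>: it plays the role of multiplying a functional
  by the indicator of \<open>K\<close>.\<close>

definition cut :: "'a set \<Rightarrow> (('a set \<Rightarrow> complex) \<Rightarrow> complex) \<Rightarrow> ('a set \<Rightarrow> complex) \<Rightarrow> complex" where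
  "cut K f = (\<lambda>\<mu>. if \<mu> \<in> M then f (restr K \<mu>) else 0)"

lemma cut_MS: "f \<in> MS ==> K \<in> sets borel ==> cut K f \<in> MS"
  and nS_cut: "f \<in> MS ==> K \<in> sets borel ==> nS (cut K f) \<le> nS f"
proof -
  assume f: "f \<in> MS" and K: "K \<in> sets borel"
  note fd = MS_dual[OF f]
  have b: "cmod (cut K f \<mu>) \<le> nS f * nrm \<mu>" if \<mu>: "\<mu> \<in> M" for \<mu>
    using order_trans[OF MS_le[OF f M_restr[OF \<mu> K]] mult_left_mono[OF nrm_restr_le[OF \<mu> K] nS_nonneg[OF f]]] \<mu>
    by (simp add: cut_def)
  show "cut K f \<in> MS"
  proof (rule MSI)
    show "cut K f \<in> Carrier (dual (M_alg \<omega>))"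
      by (rule dualI[OF _ _ b])
        (use K in \<open>auto simp: cut_def M_add M_scale restr_add restr_scale M_restr dualD[OF fd]\<close>)
    fix \<epsilon> :: real assume "\<epsilon> > 0"
    then obtain L where L: "compact L" "\<And>\<mu>. \<mu> \<in> M ==> variation \<mu> L = 0 ==> cmod (f \<mu>) \<le> \<epsilon> * nrm \<mu>" using MSD[OF f] by metis
    have "cmod (cut K f \<mu>) \<le> \<epsilon> * nrm \<mu>" if \<mu>: "\<mu> \<in> M" "variation \<mu> L = 0" for \<mu>
    proof -
      have "variation (restr K \<mu>) L = 0"
        using K L(1) by (intro variation_zeroI) (auto simp: restr_def intro!: variation_zeroD[OF \<mu>(1) _ \<mu>(2)])
      then have "cmod (cut K f \<mu>) \<le> \<epsilon> * nrm (restr K \<mu>)" using L(2)[OF M_restr[OF \<mu>(1) K]] \<mu> by (simp add: cut_def)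
      also have "\<dots> \<le> \<epsilon> * nrm \<mu>" using nrm_restr_le[OF \<mu>(1) K] \<open>\<epsilon> > 0\<close> by (intro mult_left_mono) auto
      finally show ?thesis .
    qed
    then show "\<exists>L. compact L \<and> (\<forall>\<mu>\<in>M. variation \<mu> L = 0 \<longrightarrow> cmod (cut K f \<mu>) \<le> \<epsilon> * nrm \<mu>)" using L by blast
  qed
  show "nS (cut K f) \<le> nS f" by (rule dual_norm_le[OF seminormed_M b nS_nonneg[OF f]])
qed

lemma cut_split: "f \<in> MS ==> K \<in> sets borel ==> f = cut K f + cut (- K) f"
proof
  fix \<mu> assume f: "f \<in> MS" and K: "K \<in> sets borel"
  have mK: "- K \<in> sets borel" using K by auto
  show "f \<mu> = (cut K f + cut (- K) f) \<mu>"
  proof (cases "\<mu> \<in> M")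
    case True
    then have "f \<mu> = f (restr K \<mu> + restr (- K) \<mu>)" using restr_split[OF True K] by simp
    also have "\<dots> = f (restr K \<mu>) + f (restr (- K) \<mu>)"
      by (rule dualD(2)[OF MS_dual[OF f] M_restr[OF True K] M_restr[OF True mK]])
    finally show ?thesis using True by (simp add: cut_def)
  qed (simp add: cut_def dualD(4)[OF MS_dual[OF f]])
qed

text \<open>Elements of \<open>M\<^sub>*\<close> carried by disjoint sets add up with the maximum norm. Hence a functional \<open>\<Psi>\<close> nearly attains its norm on a compact set and is small off it.\<close>

lemma functional_concentrated:
  assumes \<Psi>: "\<Psi> \<in> Carrier (dual (M_star \<omega>))" and \<epsilon>: "\<epsilon> > 0"
  obtains K where "compact K" "\<And>g. g \<in> MS ==> cmod (\<Psi> (cut (- K) g)) \<le> \<epsilon> * nS g"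
proof -
  let ?N = "Norm (dual (M_star \<omega>)) \<Psi>"
  have N0: "?N \<ge> 0" by (rule dual_norm_nonneg[OF seminormed_MS \<Psi>])
  have "\<exists>u\<in>{u \<in> MS. Norm (M_star \<omega>) u \<le> 1}. ?N - \<epsilon>/2 < cmod (\<Psi> u)"
    using \<epsilon> MS_zero seminormedD(7)[OF seminormed_MS]
    by (subst less_cSUP_iff[OF _ dual_bdd[OF seminormed_MS \<Psi>], symmetric]) (auto simp: Norm_dual)
  then obtain f0 where f0: "f0 \<in> MS" "nS f0 \<le> 1" "?N - \<epsilon>/2 < cmod (\<Psi> f0)" by auto
  \<comment> \<open>Half of \<epsilon> is spent on nearly attaining the norm at \<open>f0\<close>,
    the other half on cutting \<open>f0\<close> down to \<open>K\<close>; together they give |\<Psi>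
    f1| > N - \<epsilon> for a functional \<open>f1\<close> carried by \<open>K\<close>.\<close>
  define \<eta> where "\<eta> = \<epsilon> / 2 / (?N + 1)"
  have \<eta>: "\<eta> > 0" using \<epsilon> N0 by (simp add: \<eta>_def)
  obtain K where K: "compact K" "\<And>\<mu>. \<mu> \<in> M ==> variation \<mu> K = 0 ==> cmod (f0 \<mu>) \<le> \<eta> * nrm \<mu>" using MSD[OF f0(1) \<eta>] by metis
  have Kb: "K \<in> sets borel" and mK: "- K \<in> sets borel" using K by auto
  define f1 where "f1 = cut K f0"
  have f1: "f1 \<in> MS" unfolding f1_def by (rule cut_MS[OF f0(1) Kb])
  have "nS (cut (- K) f0) \<le> \<eta>"
  proof (rule dual_norm_le[OF seminormed_M])
    fix \<mu> assume \<mu>: "\<mu> \<in> M"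
    have "cmod (f0 (restr (- K) \<mu>)) \<le> \<eta> * nrm (restr (- K) \<mu>)"
      by (intro K(2) M_restr[OF \<mu> mK] variation_restr[OF \<mu> mK Kb]) auto
    also have "\<dots> \<le> \<eta> * nrm \<mu>" using nrm_restr_le[OF \<mu> mK] \<eta> by (intro mult_left_mono) auto
    finally show "cmod (cut (- K) f0 \<mu>) \<le> \<eta> * nrm \<mu>" using \<mu> by (simp add: cut_def)
  qed (use \<eta> in auto)
  then have "?N * nS (cut (- K) f0) \<le> ?N * \<eta>" using N0 by (rule mult_left_mono)
  also have "\<dots> \<le> \<epsilon>/2" using N0 \<epsilon> by (simp add: \<eta>_def field_simps)
  finally have "cmod (\<Psi> (cut (- K) f0)) \<le> \<epsilon>/2"
    using dual_le[OF seminormed_MS \<Psi> cut_MS[OF f0(1) mK]] by simp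
  moreover have "\<Psi> f0 = \<Psi> f1 + \<Psi> (cut (- K) f0)"
    unfolding f1_def using cut_split[OF f0(1) Kb] dualD(2)[OF \<Psi> cut_MS[OF f0(1) Kb] cut_MS[OF f0(1) mK]] by simp
  ultimately have big: "?N - \<epsilon> < cmod (\<Psi> f1)"
    using f0(3) norm_triangle_ineq[of "\<Psi> f1" "\<Psi> (cut (- K) f0)"] by simp
  have "cmod (\<Psi> (cut (- K) g)) \<le> \<epsilon> * nS g" if g: "g \<in> MS" for g
  proof -
    let ?g = "cut (- K) g" and ?n = "complex_of_real (nS g)"
    note gM = cut_MS[OF g mK]
    \<comment> \<open>A phase that aligns the value on the part off \<open>K\<close> with the value
      at \<open>f1\<close>, so that the moduli add. Since the two parts live on disjoint sets their
      combination has norm at most \<open>nS g\<close>, and the excess over (N - \<epsilon>)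
      \<open>nS g\<close> is all that remains for the part off \<open>K\<close>.\<close>
    define \<theta> where "\<theta> = (if \<Psi> ?g = 0 \<or> \<Psi> f1 = 0 then 1 else sgn (\<Psi> f1) / sgn (\<Psi> ?g))"
    have \<theta>: "cmod \<theta> = 1" by (simp add: \<theta>_def norm_divide norm_sgn)
    have al: "cmod (?n * \<Psi> f1 + \<theta> * \<Psi> ?g) = nS g * cmod (\<Psi> f1) + cmod (\<Psi> ?g)"
    proof (cases "\<Psi> ?g = 0 \<or> \<Psi> f1 = 0")
      case True then show ?thesis using \<theta> nS_nonneg[OF g] by (auto simp: norm_mult)
    next
      case False
      have "\<theta> * \<Psi> ?g = sgn (\<Psi> f1) * cmod (\<Psi> ?g)" using False by (simp add: \<theta>_def sgn_eq)
      moreover have "?n * \<Psi> f1 = sgn (\<Psi> f1) * (nS g * cmod (\<Psi> f1))" using False by (simp add: sgn_eq)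
      ultimately have "?n * \<Psi> f1 + \<theta> * \<Psi> ?g = sgn (\<Psi> f1) * complex_of_real (nS g * cmod (\<Psi> f1) + cmod (\<Psi> ?g))"
        by (simp add: algebra_simps)
      then show ?thesis using False nS_nonneg[OF g] by (simp add: norm_mult norm_sgn del: of_real_add of_real_mult)
    qed
    let ?h = "scale ?n f1 + scale \<theta> ?g"
    have h: "?h \<in> MS" by (intro MS_add MS_scale f1 gM)
    have "nS ?h \<le> nS g"
    proof (rule dual_norm_le[OF seminormed_M _ nS_nonneg[OF g]])
      fix \<mu> assume \<mu>: "\<mu> \<in> M"
      have 1: "cmod (f1 \<mu>) \<le> nrm (restr K \<mu>)"
        using MS_le[OF f0(1) M_restr[OF \<mu> Kb]] mult_right_mono[OF f0(2) nrm_nonneg[of "restr K \<mu>"]] \<mu>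
        by (simp add: f1_def cut_def)
      have 2: "cmod (?g \<mu>) \<le> nS g * nrm (restr (- K) \<mu>)"
        using MS_le[OF g M_restr[OF \<mu> mK]] \<mu> by (simp add: cut_def)
      have "cmod (?h \<mu>) \<le> nS g * cmod (f1 \<mu>) + cmod (?g \<mu>)"
        using norm_triangle_ineq[of "?n * f1 \<mu>" "\<theta> * ?g \<mu>"] \<theta> nS_nonneg[OF g] by (simp add: scale_apply norm_mult)
      also have "\<dots> \<le> nS g * nrm (restr K \<mu>) + nS g * nrm (restr (- K) \<mu>)"
        using 1 2 nS_nonneg[OF g] by (intro add_mono mult_left_mono)
      also have "\<dots> = nS g * nrm \<mu>" using nrm_restr_split[OF \<mu> Kb] by (simp add: distrib_left[symmetric])
      finally show "cmod (?h \<mu>) \<le> nS g * nrm \<mu>" .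
    qed
    then have "cmod (\<Psi> ?h) \<le> ?N * nS g"
      using dual_le[OF seminormed_MS \<Psi> h] mult_left_mono[OF _ N0, of "nS ?h" "nS g"] by simp
    moreover have "\<Psi> ?h = ?n * \<Psi> f1 + \<theta> * \<Psi> ?g"
      using f1 gM by (simp add: dualD(2,3)[OF \<Psi>] MS_scale)
    ultimately have "nS g * cmod (\<Psi> f1) + cmod (\<Psi> ?g) \<le> ?N * nS g" using al by simp
    moreover have "nS g * (?N - \<epsilon>) \<le> nS g * cmod (\<Psi> f1)" using big nS_nonneg[OF g] by (intro mult_left_mono) auto
    ultimately show ?thesis by (simp add: algebra_simps)
  qed
  then show thesis using that K(1) by blast
qed

text \<open>Up to a small norm \<mu> lives on a compact \<open>K1\<close>. If \<nu> does not charge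
  -\<open>K1\<close> + \<open>K\<close>, its convolution with that part does not charge
  \<open>K\<close>, where \<open>f\<close> is essentially carried.\<close>

lemma functional_act_MS:
  assumes f: "f \<in> MS" and \<mu>: "\<mu> \<in> M"
  shows "functional_act (M_alg \<omega>) f \<mu> \<in> MS" "nS (functional_act (M_alg \<omega>) f \<mu>) \<le> nS f * nrm \<mu>"
proof -
  let ?g = "functional_act (M_alg \<omega>) f \<mu>"
  note fd = MS_dual[OF f]
  note D = functional_act_in_dual[OF normed_algebra_M fd \<mu>]
  show "nS ?g \<le> nS f * nrm \<mu>" by (rule D(2))
  show "?g \<in> MS"
  proof (rule MSI[OF D(1)])
    fix \<epsilon> :: real assume \<epsilon>: "\<epsilon> > 0"
    define \<eta> where "\<eta> = \<epsilon> / (nrm \<mu> + nS f + 1)"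
    have p: "nrm \<mu> + nS f + 1 > 0" using nrm_nonneg[of \<mu>] nS_nonneg[OF f] by linarith
    then have \<eta>: "\<eta> > 0" using \<epsilon> by (simp add: \<eta>_def)
    obtain K where K: "compact K" "\<And>\<mu>. \<mu> \<in> M ==> variation \<mu> K = 0 ==> cmod (f \<mu>) \<le> \<eta> * nrm \<mu>" using MSD[OF f \<eta>] by metis
    obtain K1 where K1: "compact K1" "nrm (restr (- K1) \<mu>) < \<eta>" using nrm_tight[OF \<mu> \<eta>] by metis
    have b: "K1 \<in> sets borel" "- K1 \<in> sets borel" using K1 by auto
    note r = M_restr[OF \<mu> b(1)] and r' = M_restr[OF \<mu> b(2)]
    let ?L = "{- a + b |a b. a \<in> K1 \<and> b \<in> K}"
    have "cmod (?g \<nu>) \<le> \<epsilon> * nrm \<nu>" if \<nu>: "\<nu> \<in> M" "variation \<nu> ?L = 0" for \<nu>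
    proof -
      have "?g \<nu> = f (convolution (restr K1 \<mu> + restr (- K1) \<mu>) \<nu>)"
        using restr_split[OF \<mu> b(1)] \<nu> by (simp add: functional_act_def Mult_M_alg)
      also have "\<dots> = f (convolution (restr K1 \<mu>) \<nu>) + f (convolution (restr (- K1) \<mu>) \<nu>)"
        using r r' \<nu> by (simp add: convolution_add_left dualD(2)[OF fd] M_convolution)
      finally have "cmod (?g \<nu>) \<le> cmod (f (convolution (restr K1 \<mu>) \<nu>)) + cmod (f (convolution (restr (- K1) \<mu>) \<nu>))"
        using norm_triangle_ineq by simp
      also have "cmod (f (convolution (restr K1 \<mu>) \<nu>)) \<le> \<eta> * nrm (convolution (restr K1 \<mu>) \<nu>)"
        by (intro K(2) M_convolution r \<nu> convolution_null_left[OF \<mu> \<nu>(1) K1(1) K(1) \<nu>(2)])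
      also have "nrm (convolution (restr K1 \<mu>) \<nu>) \<le> nrm \<mu> * nrm \<nu>"
        using nrm_convolution[OF r \<nu>(1)] mult_right_mono[OF nrm_restr_le[OF \<mu> b(1)] nrm_nonneg[of \<nu>]] by linarith
      also have "cmod (f (convolution (restr (- K1) \<mu>) \<nu>)) \<le> nS f * nrm (convolution (restr (- K1) \<mu>) \<nu>)"
        by (rule MS_le[OF f M_convolution[OF r' \<nu>(1)]])
      also have "nrm (convolution (restr (- K1) \<mu>) \<nu>) \<le> \<eta> * nrm \<nu>"
        using nrm_convolution[OF r' \<nu>(1)] mult_right_mono[OF less_imp_le[OF K1(2)] nrm_nonneg[of \<nu>]] by linarith
      finally have "cmod (?g \<nu>) \<le> \<eta> * (nrm \<mu> * nrm \<nu>) + nS f * (\<eta> * nrm \<nu>)"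
        using \<eta> nS_nonneg[OF f] by (simp add: mult_left_mono)
      also have "\<dots> = \<eta> * (nrm \<mu> + nS f) * nrm \<nu>" by (simp add: algebra_simps)
      also have "\<eta> * (nrm \<mu> + nS f) \<le> \<eta> * (nrm \<mu> + nS f + 1)" using \<eta> by (intro mult_left_mono) auto
      also have "\<dots> = \<epsilon>" using p by (simp add: \<eta>_def)
      finally show ?thesis using nrm_nonneg[of \<nu>] by (simp add: mult_right_mono)
    qed
    then show "\<exists>K. compact K \<and> (\<forall>\<nu>\<in>M. variation \<nu> K = 0 \<longrightarrow> cmod (?g \<nu>) \<le> \<epsilon> * nrm \<nu>)"
      using compact_sums(1)[OF K1(1) K(1)] by blast
  qed
qed

text \<open>This is the left introversion of \<open>M\<^sub>*\<close>, which gives its dual a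
  product. \<Psi> is an arbitrary functional, not a measure; being concentrated on a compact
  \<open>K2\<close> up to \<eta> lets it be treated like one, with \<open>K\<close> -
  \<open>K2\<close> as the set off which the result is small.\<close>

lemma bidual_act_MS:
  assumes \<Psi>: "\<Psi> \<in> Carrier (dual (M_star \<omega>))" and f: "f \<in> MS"
  shows "bidual_act (M_alg \<omega>) \<Psi> f \<in> MS"
    "nS (bidual_act (M_alg \<omega>) \<Psi> f) \<le> Norm (dual (M_star \<omega>)) \<Psi> * nS f"
proof -
  let ?h = "bidual_act (M_alg \<omega>) \<Psi> f" and ?N = "Norm (dual (M_star \<omega>)) \<Psi>"
  let ?f = "functional_act (M_alg \<omega>) f"
  note fd = MS_dual[OF f]
  have N0: "?N \<ge> 0" by (rule dual_norm_nonneg[OF seminormed_MS \<Psi>])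
  have b: "cmod (?h \<mu>) \<le> (?N * nS f) * nrm \<mu>" if \<mu>: "\<mu> \<in> M" for \<mu>
    using dual_le[OF seminormed_MS \<Psi> functional_act_MS(1)[OF f \<mu>]]
      mult_left_mono[OF functional_act_MS(2)[OF f \<mu>] N0] \<mu>
    by (simp add: bidual_act_def mult.assoc)
  have hd: "?h \<in> Carrier (dual (M_alg \<omega>))"
    by (rule dualI[OF _ _ b])
      (auto simp: bidual_act_def M_add M_scale functional_act_linear[OF normed_algebra_M fd]
        functional_act_MS[OF f] dualD[OF \<Psi>])
  show "nS ?h \<le> ?N * nS f"
    by (rule dual_norm_le[OF seminormed_M b]) (auto simp: N0 nS_nonneg[OF f])
  show "?h \<in> MS"
  proof (rule MSI[OF hd])
    fix \<epsilon> :: real assume \<epsilon>: "\<epsilon> > 0"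
    define \<eta> where "\<eta> = \<epsilon> / (?N + nS f + 1)"
    have p: "?N + nS f + 1 > 0" using N0 nS_nonneg[OF f] by linarith
    then have \<eta>: "\<eta> > 0" using \<epsilon> by (simp add: \<eta>_def)
    obtain K2 where K2: "compact K2" "\<And>g. g \<in> MS ==> cmod (\<Psi> (cut (- K2) g)) \<le> \<eta> * nS g"
      using functional_concentrated[OF \<Psi> \<eta>] by metis
    obtain K where K: "compact K" "\<And>\<mu>. \<mu> \<in> M ==> variation \<mu> K = 0 ==> cmod (f \<mu>) \<le> \<eta> * nrm \<mu>" using MSD[OF f \<eta>] by metis
    have bb: "K2 \<in> sets borel" "- K2 \<in> sets borel" using K2 by auto
    let ?L = "{a + - b |a b. a \<in> K \<and> b \<in> K2}"
    have "cmod (?h \<mu>) \<le> \<epsilon> * nrm \<mu>" if \<mu>: "\<mu> \<in> M" "variation \<mu> ?L = 0" for \<mu>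
    proof -
      note fm = functional_act_MS[OF f \<mu>(1)]
      have "?h \<mu> = \<Psi> (cut K2 (?f \<mu>) + cut (- K2) (?f \<mu>))"
        using cut_split[OF fm(1) bb(1)] \<mu> by (simp add: bidual_act_def)
      also have "\<dots> = \<Psi> (cut K2 (?f \<mu>)) + \<Psi> (cut (- K2) (?f \<mu>))"
        by (rule dualD(2)[OF \<Psi> cut_MS[OF fm(1) bb(1)] cut_MS[OF fm(1) bb(2)]])
      finally have "cmod (?h \<mu>) \<le> cmod (\<Psi> (cut K2 (?f \<mu>))) + cmod (\<Psi> (cut (- K2) (?f \<mu>)))"
        using norm_triangle_ineq by simp
      also have "cmod (\<Psi> (cut (- K2) (?f \<mu>))) \<le> \<eta> * nS (?f \<mu>)" by (rule K2(2)[OF fm(1)])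
      also have "nS (?f \<mu>) \<le> nS f * nrm \<mu>" by (rule fm(2))
      also have "cmod (\<Psi> (cut K2 (?f \<mu>))) \<le> ?N * nS (cut K2 (?f \<mu>))"
        using dual_le[OF seminormed_MS \<Psi> cut_MS[OF fm(1) bb(1)]] by simp
      also have "nS (cut K2 (?f \<mu>)) \<le> \<eta> * nrm \<mu>"
      proof (rule dual_norm_le[OF seminormed_M])
        fix \<nu> assume \<nu>: "\<nu> \<in> M"
        note r = M_restr[OF \<nu> bb(1)]
        have "cut K2 (?f \<mu>) \<nu> = f (convolution \<mu> (restr K2 \<nu>))"
          using \<nu> r by (simp add: cut_def functional_act_def Mult_M_alg)
        also have "cmod \<dots> \<le> \<eta> * nrm (convolution \<mu> (restr K2 \<nu>))"
          by (intro K(2) M_convolution r \<mu> convolution_null_right[OF \<mu>(1) \<nu> K2(1) K(1) \<mu>(2)])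
        also have "\<dots> \<le> \<eta> * (nrm \<mu> * nrm \<nu>)"
          using nrm_convolution[OF \<mu>(1) r] mult_left_mono[OF nrm_restr_le[OF \<nu> bb(1)] nrm_nonneg[of \<mu>]] \<eta>
          by (intro mult_left_mono) auto
        finally show "cmod (cut K2 (?f \<mu>) \<nu>) \<le> \<eta> * nrm \<mu> * nrm \<nu>" by (simp add: mult.assoc)
      qed (use \<eta> nrm_nonneg in simp)
      finally have "cmod (?h \<mu>) \<le> ?N * (\<eta> * nrm \<mu>) + \<eta> * (nS f * nrm \<mu>)"
        using \<eta> N0 by (simp add: mult_left_mono)
      also have "\<dots> = \<eta> * (?N + nS f) * nrm \<mu>" by (simp add: algebra_simps)
      also have "\<eta> * (?N + nS f) \<le> \<eta> * (?N + nS f + 1)" using \<eta> by (intro mult_left_mono) auto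
      also have "\<dots> = \<epsilon>" using p by (simp add: \<eta>_def)
      finally show ?thesis using nrm_nonneg[of \<mu>] by (simp add: mult_right_mono)
    qed
    then show "\<exists>K. compact K \<and> (\<forall>\<mu>\<in>M. variation \<mu> K = 0 \<longrightarrow> cmod (?h \<mu>) \<le> \<epsilon> * nrm \<mu>)"
      using compact_sums(2)[OF K(1) K2(1)] by blast
  qed
qed

lemma Carrier_A [simp]: "Carrier A = Carrier (dual (M_star \<omega>))"
  and Norm_A [simp]: "Norm A = Norm (dual (M_star \<omega>))"
  and Mult_A: "Mult A = arens_prod (M_alg \<omega>) MS"
  by (simp_all add: M_star_dual_def)

abbreviation nA where "nA \<equiv> Norm (dual (M_star \<omega>))"

lemma Mult_A_apply: "f \<in> MS ==> Mult A \<Phi> \<Psi> f = \<Phi> (bidual_act (M_alg \<omega>) \<Psi> f)"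
  by (simp add: Mult_A arens_prod_def)

lemma bidual_act_add_left: "bidual_act B (\<Psi> + \<Psi>') f = bidual_act B \<Psi> f + bidual_act B \<Psi>' f"
  and bidual_act_scale_left: "bidual_act B (scale c \<Psi>) f = scale c (bidual_act B \<Psi> f)"
  by (auto simp: bidual_act_def fun_eq_iff scale_apply)

lemma bidual_act_add_right:
  assumes \<Psi>: "\<Psi> \<in> Carrier (dual (M_star \<omega>))" and f: "f \<in> MS" "g \<in> MS"
  shows "bidual_act (M_alg \<omega>) \<Psi> (f + g) = bidual_act (M_alg \<omega>) \<Psi> f + bidual_act (M_alg \<omega>) \<Psi> g"
proof
  fix \<mu>
  have "functional_act (M_alg \<omega>) (f + g) \<mu> = functional_act (M_alg \<omega>) f \<mu> + functional_act (M_alg \<omega>) g \<mu>"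
    by (rule ext) (simp add: functional_act_def)
  then show "bidual_act (M_alg \<omega>) \<Psi> (f + g) \<mu> = (bidual_act (M_alg \<omega>) \<Psi> f + bidual_act (M_alg \<omega>) \<Psi> g) \<mu>"
    using dualD(2)[OF \<Psi>] functional_act_MS(1)[OF f(1)] functional_act_MS(1)[OF f(2)] by (simp add: bidual_act_def)
qed

lemma bidual_act_scale_right:
  assumes \<Psi>: "\<Psi> \<in> Carrier (dual (M_star \<omega>))" and f: "f \<in> MS"
  shows "bidual_act (M_alg \<omega>) \<Psi> (scale c f) = scale c (bidual_act (M_alg \<omega>) \<Psi> f)"
proof
  fix \<mu>
  have "functional_act (M_alg \<omega>) (scale c f) \<mu> = scale c (functional_act (M_alg \<omega>) f \<mu>)"
    by (rule ext) (simp add: functional_act_def scale_apply)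
  then show "bidual_act (M_alg \<omega>) \<Psi> (scale c f) \<mu> = scale c (bidual_act (M_alg \<omega>) \<Psi> f) \<mu>"
    using dualD(3)[OF \<Psi>] functional_act_MS(1)[OF f] by (simp add: bidual_act_def scale_apply)
qed

lemma normed_algebra_A: "normed_algebra A"
proof -
  note S = seminormed_dual[OF seminormed_MS]
  have SA: "seminormed A" using S by (simp add: seminormed_def)
  have mult: "Mult A \<Phi> \<Psi> \<in> Carrier (dual (M_star \<omega>))" "nA (Mult A \<Phi> \<Psi>) \<le> nA \<Phi> * nA \<Psi>"
    if \<Phi>: "\<Phi> \<in> Carrier (dual (M_star \<omega>))" and \<Psi>: "\<Psi> \<in> Carrier (dual (M_star \<omega>))" for \<Phi> \<Psi>
  proof -
    have b: "cmod (Mult A \<Phi> \<Psi> f) \<le> (nA \<Phi> * nA \<Psi>) * Norm (M_star \<omega>) f" if f: "f \<in> MS" for f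
      using dual_le[OF seminormed_MS \<Phi> bidual_act_MS(1)[OF \<Psi> f]]
        mult_left_mono[OF bidual_act_MS(2)[OF \<Psi> f] dual_norm_nonneg[OF seminormed_MS \<Phi>]] f
      by (simp add: Mult_A_apply mult.assoc)
    show "Mult A \<Phi> \<Psi> \<in> Carrier (dual (M_star \<omega>))"
      by (rule dualI[OF _ _ b])
        (auto simp: Mult_A_apply MS_add MS_scale bidual_act_add_right[OF \<Psi>] bidual_act_scale_right[OF \<Psi>]
          bidual_act_MS[OF \<Psi>] dualD[OF \<Phi>], simp add: Mult_A arens_prod_def)
    show "nA (Mult A \<Phi> \<Psi>) \<le> nA \<Phi> * nA \<Psi>"
      by (rule dual_norm_le[OF seminormed_MS b]) (auto simp: dual_norm_nonneg[OF seminormed_MS] \<Phi> \<Psi>)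
  qed
  have l: "Mult A (\<Phi> + \<Phi>') \<Psi> = Mult A \<Phi> \<Psi> + Mult A \<Phi>' \<Psi>" "Mult A (scale c \<Phi>) \<Psi> = scale c (Mult A \<Phi> \<Psi>)" for \<Phi> \<Phi>' \<Psi> c
    by (auto simp: Mult_A arens_prod_def fun_eq_iff scale_apply)
  have r1: "Mult A \<Phi> (\<Psi> + \<Psi>') = Mult A \<Phi> \<Psi> + Mult A \<Phi> \<Psi>'"
    if "\<Phi> \<in> Carrier (dual (M_star \<omega>))" "\<Psi> \<in> Carrier (dual (M_star \<omega>))" "\<Psi>' \<in> Carrier (dual (M_star \<omega>))" for \<Phi> \<Psi> \<Psi>'
    by (rule ext) (simp add: Mult_A arens_prod_def bidual_act_add_left dualD(2)[OF that(1)] bidual_act_MS that)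
  have r2: "Mult A \<Phi> (scale c \<Psi>) = scale c (Mult A \<Phi> \<Psi>)"
    if "\<Phi> \<in> Carrier (dual (M_star \<omega>))" "\<Psi> \<in> Carrier (dual (M_star \<omega>))" for \<Phi> \<Psi> c
    by (rule ext) (simp add: Mult_A arens_prod_def bidual_act_scale_left dualD(3)[OF that(1)] bidual_act_MS that scale_apply)
  show ?thesis
    unfolding normed_algebra_def by (simp add: SA mult l r1 r2)
qed

end

section \<open>The homomorphism to functions on the group\<close>

context weighted_lc_group
begin

definition ev :: "'a \<Rightarrow> ('a set \<Rightarrow> complex) \<Rightarrow> complex" where
  "ev x = (\<lambda>\<mu>. if \<mu> \<in> M then \<mu> {x} else 0)"

text \<open>The map called \<open>q\<close> in the overview, in coordinates: each point evaluation
  \<open>ev x\<close> sees only the compact set {x} and hence belongs to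
  \<open>M\<^sub>*\<close>.\<close>

definition point_coeff :: "((('a set \<Rightarrow> complex) \<Rightarrow> complex) \<Rightarrow> complex) \<Rightarrow> 'a \<Rightarrow> complex" where
  "point_coeff \<Phi> x = \<Phi> (ev x)"

definition delta :: "'a \<Rightarrow> (('a set \<Rightarrow> complex) \<Rightarrow> complex) \<Rightarrow> complex" where
  "delta x = (\<lambda>f. if f \<in> MS then f (dirac x) else 0)"

lemma point_combination_le:
  assumes \<mu>: "\<mu> \<in> M" and F: "finite F" and B: "\<And>x. x \<in> F ==> cmod (c x) \<le> B * \<omega> x" "0 \<le> B"
  shows "cmod (\<Sum>x\<in>F. c x * \<mu> {x}) \<le> B * nrm \<mu>"
proof -
  have "cmod (\<Sum>x\<in>F. c x * \<mu> {x}) \<le> (\<Sum>x\<in>F. B * (\<omega> x * cmod (\<mu> {x})))"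
    by (rule sum_norm_le) (simp add: norm_mult mult.assoc[symmetric] mult_right_mono B)
  also have "\<dots> = B * (\<Sum>x\<in>F. \<omega> x * cmod (\<mu> {x}))" by (simp add: sum_distrib_left)
  also have "\<dots> \<le> B * nrm \<mu>" by (intro mult_left_mono sum_points_le \<mu> F B)
  finally show ?thesis .
qed

lemma ev_MS: "ev x \<in> MS"
proof (rule MSI)
  have b: "cmod (ev x \<mu>) \<le> 1 * nrm \<mu>" if "\<mu> \<in> M" for \<mu>
    using norm_M_le_nrm[OF that] that by (simp add: ev_def)
  show "ev x \<in> Carrier (dual (M_alg \<omega>))"
    by (rule dualI[OF _ _ b]) (auto simp: ev_def M_add M_scale scale_apply)
  fix \<epsilon> :: real assume "\<epsilon> > 0"
  then show "\<exists>K. compact K \<and> (\<forall>\<mu>\<in>M. variation \<mu> K = 0 \<longrightarrow> cmod (ev x \<mu>) \<le> \<epsilon> * nrm \<mu>)"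
    using nrm_nonneg by (intro exI[of _ "{x}"]) (auto simp: ev_def variation_zeroD[of _ "{x}" "{x}"])
qed

lemma ev_sum_MS: "finite F ==> (\<Sum>x\<in>F. scale (c x) (ev x)) \<in> MS"
  by (intro seminormed_sum[OF seminormed_MS] MS_scale ev_MS)

lemma ev_sum_apply: "\<mu> \<in> M ==> (\<Sum>x\<in>F. scale (c x) (ev x)) \<mu> = (\<Sum>x\<in>F. c x * \<mu> {x})"
  by (induction F rule: infinite_finite_induct) (auto simp: scale_apply ev_def)

lemma nS_ev_sum:
  assumes "finite F" "\<And>x. x \<in> F ==> cmod (c x) \<le> B * \<omega> x" "0 \<le> B"
  shows "nS (\<Sum>x\<in>F. scale (c x) (ev x)) \<le> B"
  by (rule dual_norm_le[OF seminormed_M _ assms(3)]) (simp add: ev_sum_apply point_combination_le assms)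

lemma functional_ev_sum:
  assumes \<Phi>: "\<Phi> \<in> Carrier (dual (M_star \<omega>))" and F: "finite F"
  shows "\<Phi> (\<Sum>x\<in>F. scale (c x) (ev x)) = (\<Sum>x\<in>F. c x * point_coeff \<Phi> x)"
  by (subst dual_sum[OF seminormed_MS \<Phi> F]) (auto simp: MS_scale ev_MS dualD(3)[OF \<Phi>] point_coeff_def)

text \<open>Duality between weighted l^1 and weighted sup norm: the combination of point evaluations
  with coefficients \<omega> times conjugate phases has norm at most 1, and \<Phi> takes the sum as
  value on it.\<close>

lemma sum_point_coeff_le:
  assumes \<Phi>: "\<Phi> \<in> Carrier (dual (M_star \<omega>))" and F: "finite F"
  shows "(\<Sum>x\<in>F. \<omega> x * cmod (point_coeff \<Phi> x)) \<le> nA \<Phi>"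
proof -
  define c where "c x = complex_of_real (\<omega> x) * cnj (sgn (point_coeff \<Phi> x))" for x
  have c: "cmod (c x) \<le> 1 * \<omega> x" for x
    using weight_pos[of x] by (simp add: c_def norm_mult norm_sgn)
  have "c x * point_coeff \<Phi> x = complex_of_real (\<omega> x * cmod (point_coeff \<Phi> x))" for x
    by (simp add: c_def sgn_eq complex_norm_square[symmetric] field_simps power2_eq_square)
  then have "\<Phi> (\<Sum>x\<in>F. scale (c x) (ev x)) = complex_of_real (\<Sum>x\<in>F. \<omega> x * cmod (point_coeff \<Phi> x))"
    using functional_ev_sum[OF \<Phi> F] by simp
  then have "\<bar>\<Sum>x\<in>F. \<omega> x * cmod (point_coeff \<Phi> x)\<bar> \<le> nA \<Phi> * nS (\<Sum>x\<in>F. scale (c x) (ev x))"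
    using dual_le[OF seminormed_MS \<Phi> ev_sum_MS[OF F, of c]] by (metis Norm_M_star norm_of_real)
  also have "\<dots> \<le> nA \<Phi> * 1"
    using nS_ev_sum[OF F c] dual_norm_nonneg[OF seminormed_MS \<Phi>] by (intro mult_left_mono) auto
  finally show ?thesis by simp
qed

lemma sum_point_coeff_le':
  assumes \<Phi>: "\<Phi> \<in> Carrier (dual (M_star \<omega>))" and F: "finite F"
  shows "(\<Sum>x\<in>F. cmod (point_coeff \<Phi> x)) \<le> nA \<Phi>"
proof -
  have "(\<Sum>x\<in>F. cmod (point_coeff \<Phi> x)) \<le> (\<Sum>x\<in>F. \<omega> x * cmod (point_coeff \<Phi> x))"
    using weight_ge_1 mult_right_mono[OF weight_ge_1 norm_ge_zero] by (intro sum_mono) simp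
  then show ?thesis using sum_point_coeff_le[OF assms] by linarith
qed

lemma point_coeff_tail:
  assumes \<Phi>: "\<Phi> \<in> Carrier (dual (M_star \<omega>))" and \<epsilon>: "\<epsilon> > 0"
  obtains F0 where "finite F0" "\<And>x. x \<notin> F0 ==> cmod (point_coeff \<Phi> x) < \<epsilon>"
proof -
  have "finite {x. \<epsilon> \<le> cmod (point_coeff \<Phi> x)}"
  proof (rule ccontr)
    assume inf: "infinite {x. \<epsilon> \<le> cmod (point_coeff \<Phi> x)}"
    obtain N :: nat where N: "nA \<Phi> / \<epsilon> < N" using reals_Archimedean2 by blast
    obtain F where F: "F \<subseteq> {x. \<epsilon> \<le> cmod (point_coeff \<Phi> x)}" "finite F" "card F = N"
      using infinite_arbitrarily_large[OF inf] by blast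
    have "N * \<epsilon> = (\<Sum>x\<in>F. \<epsilon>)" using F by simp
    also have "\<dots> \<le> (\<Sum>x\<in>F. cmod (point_coeff \<Phi> x))" using F by (intro sum_mono) auto
    also have "\<dots> \<le> nA \<Phi>" by (rule sum_point_coeff_le'[OF \<Phi> F(2)])
    finally show False using N \<epsilon> by (simp add: field_simps)
  qed
  then show thesis using that[of "{x. \<epsilon> \<le> cmod (point_coeff \<Phi> x)}"] by auto
qed

lemma point_coeff_add: "point_coeff (\<Phi> + \<Psi>) x = point_coeff \<Phi> x + point_coeff \<Psi> x"
  and point_coeff_scale: "point_coeff (scale c \<Phi>) x = c * point_coeff \<Phi> x"
  by (simp_all add: point_coeff_def scale_apply)

lemma delta_in_A: "delta x \<in> Carrier (dual (M_star \<omega>))" "nA (delta x) \<le> \<omega> x"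
proof -
  have b: "cmod (delta x f) \<le> \<omega> x * Norm (M_star \<omega>) f" if "f \<in> MS" for f
    using MS_le[OF that dirac_M[of x]] that by (simp add: delta_def nrm_dirac mult.commute)
  show "delta x \<in> Carrier (dual (M_star \<omega>))"
    by (rule dualI[OF _ _ b]) (auto simp: delta_def MS_add MS_scale scale_apply)
  show "nA (delta x) \<le> \<omega> x"
    by (rule dual_norm_le[OF seminormed_MS b]) (simp_all add: weight_pos less_imp_le)
qed

lemma point_coeff_delta: "point_coeff (delta x) y = (if x = y then 1 else 0)"
proof -
  have "ev y (dirac x) = dirac x {y}" by (simp add: ev_def dirac_M)
  then show ?thesis by (simp add: point_coeff_def delta_def ev_MS dirac_point)
qed

lemma Mult_delta_zero:
  assumes \<Phi>: "\<Phi> \<in> Carrier (dual (M_star \<omega>))"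
  shows "Mult A \<Phi> (delta 0) = \<Phi>"
proof
  fix f
  show "Mult A \<Phi> (delta 0) f = \<Phi> f"
  proof (cases "f \<in> MS")
    case True
    have "bidual_act (M_alg \<omega>) (delta 0) f = f"
    proof
      fix \<mu> show "bidual_act (M_alg \<omega>) (delta 0) f \<mu> = f \<mu>"
        using True functional_act_MS(1)[OF True] dualD(4)[OF MS_dual[OF True]]
        by (simp add: bidual_act_def delta_def functional_act_def dirac_M Mult_M_alg convolution_dirac_zero)
    qed
    then show ?thesis using True by (simp add: Mult_A_apply)
  next
    case False
    then show ?thesis using dualD(4)[OF \<Phi>] by (simp add: Mult_A arens_prod_def)
  qed
qed

text \<open>The action of \<Psi> on \<open>ev x\<close> is close to a finite combination of point
  evaluations in norm, the error being governed by the largest coefficient of \<Psi> left out. Norm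
  closeness is what allows an arbitrary \<Phi> to be applied to it afterwards.\<close>

lemma bidual_act_ev_approx:
  assumes \<Psi>: "\<Psi> \<in> Carrier (dual (M_star \<omega>))" and F: "finite F" and \<epsilon>: "\<epsilon> \<ge> 0"
    and tail: "\<And>z. z \<notin> F ==> cmod (point_coeff \<Psi> (- z + x)) \<le> \<epsilon>"
  shows "nS (bidual_act (M_alg \<omega>) \<Psi> (ev x) - (\<Sum>z\<in>F. scale (point_coeff \<Psi> (- z + x)) (ev z))) \<le> \<epsilon>"
proof (rule dual_norm_le[OF seminormed_M _ \<epsilon>])
  fix \<mu> assume \<mu>: "\<mu> \<in> M"
  define c where "c z = point_coeff \<Psi> (- z + x)" for z
  have N0: "nA \<Psi> \<ge> 0" by (rule dual_norm_nonneg[OF seminormed_MS \<Psi>])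
  show "cmod ((bidual_act (M_alg \<omega>) \<Psi> (ev x) - (\<Sum>z\<in>F. scale (point_coeff \<Psi> (- z + x)) (ev z))) \<mu>) \<le> \<epsilon> * nrm \<mu>"
  \<comment> \<open>\<open>F0\<close> below depends on \<mu> and \<open>e\<close>, while
    \<open>F\<close> and \<epsilon> do not. Letting \<open>e\<close> tend to 0 for each \<mu>
    separately yields a bound uniform in \<mu>; the extra points outside \<open>F\<close> cost at
    most \<epsilon> times the norm of \<mu>.\<close>
  proof (rule field_le_epsilon)
    fix e :: real assume e: "e > 0"
    define e' where "e' = e / (nA \<Psi> + 1)"
    have e': "e' > 0" using e N0 by (simp add: e'_def)
    obtain F0 where F0: "finite F0" "\<And>F \<nu>. finite F ==> F0 \<subseteq> F ==> \<nu> \<in> M ==>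
        cmod (convolution \<mu> \<nu> {x} - (\<Sum>z\<in>F. \<mu> {z} * \<nu> {- z + x})) \<le> e' * nrm \<nu>"
      by (rule convolution_point[OF \<mu> e', of x]) (rule that; assumption)
    let ?G = "F \<union> F0"
    have G: "finite ?G" using F F0 by auto
    let ?f = "functional_act (M_alg \<omega>) (ev x) \<mu>"
    let ?s = "\<Sum>w\<in>(\<lambda>z. - z + x) ` ?G. scale (\<mu> {x - w}) (ev w)"
    have fS: "?f \<in> MS" by (rule functional_act_MS[OF ev_MS \<mu>])
    have sS: "?s \<in> MS" using G by (intro ev_sum_MS) auto
    have inj: "inj_on (\<lambda>z. - z + x) ?G" by (auto simp: inj_on_def)
    have xz: "x - (- z + x) = z" for z using eq_diff_eq[of z x "- z + x"] by simp
    have "nS (?f - ?s) \<le> e'"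
    proof (rule dual_norm_le[OF seminormed_M])
      fix \<nu> assume \<nu>: "\<nu> \<in> M"
      have "?s \<nu> = (\<Sum>z\<in>?G. \<mu> {z} * \<nu> {- z + x})"
        unfolding ev_sum_apply[OF \<nu>] using inj by (simp add: sum.reindex xz)
      then have "(?f - ?s) \<nu> = convolution \<mu> \<nu> {x} - (\<Sum>z\<in>?G. \<mu> {z} * \<nu> {- z + x})"
        using \<nu> \<mu> by (simp add: functional_act_def ev_def M_convolution Mult_M_alg)
      then show "cmod ((?f - ?s) \<nu>) \<le> e' * nrm \<nu>" using F0(2)[OF G _ \<nu>] by simp
    qed (use e' in simp)
    then have "cmod (\<Psi> (?f - ?s)) \<le> nA \<Psi> * e'"
      using dual_le[OF seminormed_MS \<Psi> seminormed_diff(1)[OF seminormed_MS fS sS]] N0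
      by (smt (verit) Norm_M_star mult_left_mono)
    also have "\<dots> \<le> e" using N0 e by (simp add: e'_def field_simps)
    finally have "cmod (\<Psi> (?f - ?s)) \<le> e" .
    moreover have "\<Psi> (?f - ?s) = \<Psi> ?f - (\<Sum>z\<in>?G. \<mu> {z} * c z)"
      unfolding dual_diff[OF seminormed_MS \<Psi> fS sS] functional_ev_sum[OF \<Psi> finite_imageI[OF G]]
      using inj by (simp add: sum.reindex xz c_def)
    ultimately have 1: "cmod (\<Psi> ?f - (\<Sum>z\<in>?G. \<mu> {z} * c z)) \<le> e" by simp
    have "(\<Sum>z\<in>?G. \<mu> {z} * c z) = (\<Sum>z\<in>F. \<mu> {z} * c z) + (\<Sum>z\<in>F0 - F. \<mu> {z} * c z)"
      using F F0 by (subst sum.union_disjoint[symmetric]) auto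
    moreover have "cmod (\<Sum>z\<in>F0 - F. c z * \<mu> {z}) \<le> \<epsilon> * nrm \<mu>"
    proof (rule point_combination_le[OF \<mu> _ _ \<epsilon>])
      fix z assume "z \<in> F0 - F"
      then have "cmod (c z) \<le> \<epsilon>" using tail by (simp add: c_def)
      also have "\<dots> \<le> \<epsilon> * \<omega> z" using weight_ge_1[of z] \<epsilon> mult_left_mono[of 1 "\<omega> z" \<epsilon>] by simp
      finally show "cmod (c z) \<le> \<epsilon> * \<omega> z" .
    qed (use F0 in auto)
    ultimately have "cmod (\<Psi> ?f - (\<Sum>z\<in>F. \<mu> {z} * c z)) \<le> \<epsilon> * nrm \<mu> + e"
      using 1 norm_triangle_ineq[of "\<Psi> ?f - (\<Sum>z\<in>?G. \<mu> {z} * c z)" "\<Sum>z\<in>F0 - F. c z * \<mu> {z}"]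
      by (simp add: mult.commute)
    then show "cmod ((bidual_act (M_alg \<omega>) \<Psi> (ev x) - (\<Sum>z\<in>F. scale (point_coeff \<Psi> (- z + x)) (ev z))) \<mu>) \<le> \<epsilon> * nrm \<mu> + e"
      using \<mu> by (simp add: ev_sum_apply[OF \<mu>] bidual_act_def c_def mult.commute)
  qed
qed

text \<open>\<Phi> is only norm continuous, so the convolution formula cannot be taken from
  pointwise limits. It follows from norm approximation by finite combinations, because the
  coefficients of \<Psi> tend to 0 along finite subsets.\<close>

lemma point_coeff_Mult:
  assumes \<Phi>: "\<Phi> \<in> Carrier (dual (M_star \<omega>))" and \<Psi>: "\<Psi> \<in> Carrier (dual (M_star \<omega>))"
  shows "((\<lambda>z. point_coeff \<Phi> z * point_coeff \<Psi> (- z + x)) has_sum point_coeff (Mult A \<Phi> \<Psi>) x) UNIV"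
  unfolding has_sum_def tendsto_iff
proof (intro allI impI)
  fix e :: real assume e: "e > 0"
  have N0: "nA \<Phi> \<ge> 0" by (rule dual_norm_nonneg[OF seminormed_MS \<Phi>])
  define \<epsilon> where "\<epsilon> = e / (nA \<Phi> + 1)"
  have \<epsilon>: "\<epsilon> > 0" using e N0 by (simp add: \<epsilon>_def)
  obtain F0 where F0: "finite F0" "\<And>w. w \<notin> F0 ==> cmod (point_coeff \<Psi> w) < \<epsilon>" using point_coeff_tail[OF \<Psi> \<epsilon>] by metis
  let ?F1 = "(\<lambda>w. x - w) ` F0"
  have "dist (\<Sum>z\<in>F. point_coeff \<Phi> z * point_coeff \<Psi> (- z + x)) (point_coeff (Mult A \<Phi> \<Psi>) x) < e"
    if F: "finite F" "?F1 \<subseteq> F" for F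
  proof -
    let ?g = "bidual_act (M_alg \<omega>) \<Psi> (ev x)" and ?s = "\<Sum>z\<in>F. scale (point_coeff \<Psi> (- z + x)) (ev z)"
    have gS: "?g \<in> MS" by (rule bidual_act_MS[OF \<Psi> ev_MS])
    have sS: "?s \<in> MS" by (rule ev_sum_MS[OF F(1)])
    have "nS (?g - ?s) \<le> \<epsilon>"
    proof (rule bidual_act_ev_approx[OF \<Psi> F(1) less_imp_le[OF \<epsilon>]])
      fix z assume z: "z \<notin> F"
      have "x - (- z + x) = z" using eq_diff_eq[of z x "- z + x"] by simp
      then have "- z + x \<notin> F0" using z F(2) by (metis image_eqI subsetD)
      then show "cmod (point_coeff \<Psi> (- z + x)) \<le> \<epsilon>" using F0(2) less_imp_le by blast
    qed
    then have "cmod (\<Phi> (?g - ?s)) \<le> nA \<Phi> * \<epsilon>"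
      using dual_le[OF seminormed_MS \<Phi> seminormed_diff(1)[OF seminormed_MS gS sS]] N0
      by (smt (verit) Norm_M_star mult_left_mono)
    also have "\<dots> < (nA \<Phi> + 1) * \<epsilon>" using \<epsilon> by simp
    also have "\<dots> = e" using N0 by (simp add: \<epsilon>_def)
    finally have "cmod (\<Phi> ?g - \<Phi> ?s) < e" by (simp add: dual_diff[OF seminormed_MS \<Phi> gS sS])
    moreover have "\<Phi> ?g = point_coeff (Mult A \<Phi> \<Psi>) x" by (simp add: point_coeff_def Mult_A_apply ev_MS)
    ultimately show ?thesis
      using functional_ev_sum[OF \<Phi> F(1), of "\<lambda>z. point_coeff \<Psi> (- z + x)"]
      by (simp add: dist_norm norm_minus_commute mult.commute)
  qed
  then show "\<forall>\<^sub>F F in finite_subsets_at_top UNIV.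
      dist (\<Sum>z\<in>F. point_coeff \<Phi> z * point_coeff \<Psi> (- z + x)) (point_coeff (Mult A \<Phi> \<Psi>) x) < e"
    unfolding eventually_finite_subsets_at_top using F0(1) by (intro exI[of _ ?F1]) auto
qed

lemma point_coeff_Mult_delta_left:
  assumes \<Psi>: "\<Psi> \<in> Carrier (dual (M_star \<omega>))"
  shows "point_coeff (Mult A (delta y) \<Psi>) x = point_coeff \<Psi> (- y + x)"
proof (rule has_sum_unique[OF point_coeff_Mult[OF delta_in_A(1) \<Psi>]])
  have "((\<lambda>z. point_coeff (delta y) z * point_coeff \<Psi> (- z + x)) has_sum point_coeff \<Psi> (- y + x)) {y}"
    by (intro has_sum_finiteI) (auto simp: point_coeff_delta)
  then show "((\<lambda>z. point_coeff (delta y) z * point_coeff \<Psi> (- z + x)) has_sum point_coeff \<Psi> (- y + x)) UNIV"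
    by (rule has_sum_cong_neutral[THEN iffD1, rotated -1]) (auto simp: point_coeff_delta)
qed

end

section \<open>Ultrafilter limits, reflexivity and Arens regularity\<close>

text \<open>A free ultrafilter on the naturals: lying below \<open>sequentially\<close> excludes the
  principal ones.\<close>

definition ultra :: "nat filter \<Rightarrow> bool" where
  "ultra U \<longleftrightarrow> U \<noteq> bot \<and> U \<le> sequentially \<and> (\<forall>P. eventually P U \<or> eventually (\<lambda>n. \<not> P n) U)"

text \<open>Zorn's lemma, with finer filters counted as larger. The infimum of a chain stays proper,
  as whatever holds eventually in it already does so in a member. A maximal filter decides
  \<open>P\<close>: meeting it with \<open>{n. P n}\<close> gives either the trivial filter or the
  filter itself.\<close>

lemma ex_ultra: "\<exists>U. ultra U"
proof -
  define S where "S = {F :: nat filter. F \<noteq> bot \<and> F \<le> sequentially}"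
  define R where "R F G \<longleftrightarrow> G \<le> (F :: nat filter)" for F G
  have "\<exists>m\<in>S. \<forall>a\<in>S. R m a \<longrightarrow> a = m"
  proof (rule predicate_Zorn)
    show "partial_order_on S (relation_of R S)"
      by (auto simp: R_def partial_order_on_def preorder_on_def refl_on_def trans_def antisym_def relation_of_def)
    fix C assume C: "C \<in> Chains (relation_of R S)"
    have CS: "C \<subseteq> S" using C by (auto simp: Chains_def relation_of_def)
    show "\<exists>u\<in>S. \<forall>a\<in>C. R a u"
    proof (cases "C = {}")
      case True
      then show ?thesis by (intro bexI[of _ sequentially]) (auto simp: S_def)
    next
      case False
      have "\<exists>x\<in>C. x \<le> inf F G" if "F \<in> C" "G \<in> C" for F G
        using C that by (force simp: Chains_def relation_of_def R_def)
      then have ev: "eventually P (Inf C) \<longleftrightarrow> (\<exists>b\<in>C. eventually P b)" for P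
        using False by (rule eventually_Inf_base[rotated])
      have "Inf C \<noteq> bot"
        unfolding trivial_limit_def ev using CS by (auto simp: S_def trivial_limit_def)
      moreover obtain F where "F \<in> C" using False by auto
      then have "Inf C \<le> sequentially" using CS by (auto simp: S_def intro: Inf_lower2)
      ultimately show ?thesis by (intro bexI[of _ "Inf C"]) (auto simp: S_def R_def intro: Inf_lower)
    qed
  qed
  then obtain U where U: "U \<noteq> bot" "U \<le> sequentially"
    and max: "\<And>F. F \<noteq> bot ==> F \<le> sequentially ==> F \<le> U ==> F = U"
    by (auto simp: S_def R_def)
  have "eventually P U \<or> eventually (\<lambda>n. \<not> P n) U" for P
  proof (cases "inf U (principal {n. P n}) = bot")
    case True
    then have "eventually (\<lambda>n. \<not> P n) U"
      by (simp add: trivial_limit_def eventually_inf_principal)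
    then show ?thesis ..
  next
    case False
    then have "inf U (principal {n. P n}) = U" using U by (intro max) (auto intro: le_infI1)
    then have "U \<le> principal {n. P n}" by (metis inf.cobounded2)
    then show ?thesis by (simp add: le_principal)
  qed
  then show ?thesis using U by (auto simp: ultra_def)
qed

text \<open>Compactness of a disc provides a cluster point, and an ultrafilter converges to each of
  its cluster points.\<close>

lemma ultra_convergent:
  fixes s :: "nat \<Rightarrow> complex"
  assumes U: "ultra U" and B: "\<And>n. cmod (s n) \<le> B"
  shows "(s \<longlongrightarrow> Lim U s) U"
proof -
  have "filtermap s U \<noteq> bot" using U by (simp add: ultra_def filtermap_bot_iff)
  moreover have "eventually (\<lambda>z. z \<in> cball 0 B) (filtermap s U)" using B by (simp add: eventually_filtermap)
  ultimately obtain l where l: "inf (nhds l) (filtermap s U) \<noteq> bot"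
    using compact_cball[of "0::complex" B] unfolding compact_filter by blast
  have "(s \<longlongrightarrow> l) U"
  proof (rule topological_tendstoI, rule ccontr)
    fix S assume S: "open S" "l \<in> S" "\<not> (\<forall>\<^sub>F n in U. s n \<in> S)"
    then have "\<forall>\<^sub>F n in U. s n \<notin> S" using U by (auto simp: ultra_def)
    then have "eventually (\<lambda>z. z \<notin> S) (filtermap s U)" by (simp add: eventually_filtermap)
    moreover have "eventually (\<lambda>z. z \<in> S) (nhds l)" using S eventually_nhds by blast
    ultimately have "eventually (\<lambda>_. False) (inf (nhds l) (filtermap s U))"
      unfolding eventually_inf by blast
    then show False using l by (simp add: trivial_limit_def)
  qed
  then show ?thesis using tendsto_Lim[of U s l] U by (simp add: ultra_def)
qed

lemma ultra_eventually: "ultra U ==> (\<And>n. n \<ge> N ==> P n) ==> eventually P U"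
  unfolding ultra_def using eventually_sequentiallyI[of N P] le_filter_def by blast

text \<open>A weak* cluster point, in the bidual, of the bounded sequence \<open>a\<close>.\<close>

definition ultra_functional :: "nat filter \<Rightarrow> ('i, 'z) nspace_scheme \<Rightarrow> (nat \<Rightarrow> 'i \<Rightarrow> complex) \<Rightarrow>
    (('i \<Rightarrow> complex) \<Rightarrow> complex) \<Rightarrow> complex" where
  "ultra_functional U E a f = (if f \<in> Carrier (dual E) then Lim U (\<lambda>n. f (a n)) else 0)"

lemma ultra_functional:
  assumes U: "ultra U" and E: "seminormed E" and a: "\<And>n. a n \<in> Carrier E" "\<And>n. Norm E (a n) \<le> 1"
  shows "f \<in> Carrier (dual E) ==> ((\<lambda>n. f (a n)) \<longlongrightarrow> ultra_functional U E a f) U"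
    and "ultra_functional U E a \<in> Carrier (dual (dual E))"
proof -
  have U0: "U \<noteq> bot" using U by (simp add: ultra_def)
  have b: "cmod (f (a n)) \<le> Norm (dual E) f" if "f \<in> Carrier (dual E)" for f n
    by (rule dual_norm_upper[OF E that a])
  show lim: "((\<lambda>n. f (a n)) \<longlongrightarrow> ultra_functional U E a f) U" if f: "f \<in> Carrier (dual E)" for f
    using ultra_convergent[OF U b[OF f]] f by (simp add: ultra_functional_def)
  show "ultra_functional U E a \<in> Carrier (dual (dual E))"
  proof (rule dualI[where B = 1])
    fix f assume f: "f \<in> Carrier (dual E)"
    have "cmod (ultra_functional U E a f) \<le> Norm (dual E) f"
      by (rule tendsto_upperbound[OF tendsto_norm[OF lim[OF f]] _ U0]) (simp add: b[OF f])
    then show "cmod (ultra_functional U E a f) \<le> 1 * Norm (dual E) f" by simp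
    show "ultra_functional U E a (scale c f) = c * ultra_functional U E a f" for c
    proof -
      have "((\<lambda>n. c * f (a n)) \<longlongrightarrow> ultra_functional U E a (scale c f)) U"
        using lim[OF dual_scale(1)[OF E f, of c]] by (simp add: scale_apply)
      from tendsto_unique[OF U0 this tendsto_mult_left[OF lim[OF f]]] show ?thesis .
    qed
    fix g assume g: "g \<in> Carrier (dual E)"
    show "ultra_functional U E a (f + g) = ultra_functional U E a f + ultra_functional U E a g"
    proof -
      have "((\<lambda>n. f (a n) + g (a n)) \<longlongrightarrow> ultra_functional U E a (f + g)) U"
        using lim[OF dual_add(1)[OF E f g]] by simp
      from tendsto_unique[OF U0 this tendsto_add[OF lim[OF f] lim[OF g]]] show ?thesis .
    qed
  qed (simp add: ultra_functional_def)
qed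

lemma topspace_weak_star [simp]: "topspace (weak_star E) = Carrier (dual E)"
  by (auto simp: weak_star_def topspace_pullback_topology)

lemma continuous_map_weak_star_eval:
  "u \<in> Carrier E ==> continuous_map (weak_star E) euclidean (\<lambda>f. f u)"
proof -
  assume u: "u \<in> Carrier E"
  have "continuous_map (weak_star E) euclidean ((\<lambda>g. g u) \<circ> (\<lambda>f. restrict f (Carrier E)))"
    unfolding weak_star_def using u by (intro continuous_map_pullback continuous_map_product_projection)
  then show ?thesis by (rule continuous_map_eq) (use u in auto)
qed

lemma continuous_map_into_weak_star:
  assumes "\<And>x. x \<in> topspace X ==> T x \<in> Carrier (dual E)"
    and "\<And>u. u \<in> Carrier E ==> continuous_map X euclidean (\<lambda>x. T x u)"
  shows "continuous_map X (weak_star E) T"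
  unfolding weak_star_def
proof (rule continuous_map_pullback')
  show "continuous_map X (product_topology (\<lambda>_. euclidean) (Carrier E)) ((\<lambda>f. restrict f (Carrier E)) \<circ> T)"
    unfolding continuous_map_componentwise using assms(2) by auto
qed (use assms in auto)

lemma limitin_weak_star:
  assumes "l \<in> Carrier (dual E)" "\<And>n. g n \<in> Carrier (dual E)" "\<And>u. u \<in> Carrier E ==> ((\<lambda>n. g n u) \<longlongrightarrow> l u) F"
  shows "limitin (weak_star E) g l F"
  unfolding limitin_def
proof (intro conjI allI impI)
  fix V assume V: "openin (weak_star E) V \<and> l \<in> V"
  then obtain W where W: "openin (product_topology (\<lambda>_. euclidean) (Carrier E)) W"
    "V = (\<lambda>f. restrict f (Carrier E)) -` W \<inter> Carrier (dual E)"
    by (auto simp: weak_star_def openin_pullback_topology)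
  have "limitin (product_topology (\<lambda>_. euclidean) (Carrier E)) (\<lambda>n. restrict (g n) (Carrier E)) (restrict l (Carrier E)) F"
    unfolding limitin_componentwise using assms(3) by auto
  then have "\<forall>\<^sub>F n in F. restrict (g n) (Carrier E) \<in> W"
    using W V by (auto simp: limitin_def)
  then show "\<forall>\<^sub>F n in F. g n \<in> V" using W(2) assms(2) by (auto elim: eventually_mono)
qed (use assms in simp)

lemma bidual_act_in_dual:
  assumes A: "normed_algebra A" and \<Psi>: "\<Psi> \<in> Carrier (dual (dual A))" and f: "f \<in> Carrier (dual A)"
  shows "bidual_act A \<Psi> f \<in> Carrier (dual A)"
    "Norm (dual A) (bidual_act A \<Psi> f) \<le> Norm (dual (dual A)) \<Psi> * Norm (dual A) f"
proof -
  note D = normed_algebraD[OF A] and S = seminormed_dual[OF normed_algebraD(1)[OF A]]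
  note fa = functional_act_in_dual[OF A f]
  have N0: "0 \<le> Norm (dual (dual A)) \<Psi>" by (rule dual_norm_nonneg[OF S \<Psi>])
  have b: "cmod (bidual_act A \<Psi> f a) \<le> (Norm (dual (dual A)) \<Psi> * Norm (dual A) f) * Norm A a" if a: "a \<in> Carrier A" for a
    using dual_le[OF S \<Psi> fa(1)[OF a]] mult_left_mono[OF fa(2)[OF a] N0] a
    by (simp add: bidual_act_def mult.assoc)
  show "bidual_act A \<Psi> f \<in> Carrier (dual A)"
    by (rule dualI[OF _ _ b])
      (auto simp: bidual_act_def seminormedD(2,3)[OF D(1)] functional_act_linear[OF A f] fa dualD[OF \<Psi>])
  show "Norm (dual A) (bidual_act A \<Psi> f) \<le> Norm (dual (dual A)) \<Psi> * Norm (dual A) f"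
    by (rule dual_norm_le[OF D(1) b]) (auto simp: N0 dual_norm_nonneg[OF D(1) f])
qed

lemma arens_prod_in_bidual:
  assumes A: "normed_algebra A" and \<Phi>: "\<Phi> \<in> Carrier (dual (dual A))" and \<Psi>: "\<Psi> \<in> Carrier (dual (dual A))"
  shows "arens_prod A (Carrier (dual A)) \<Phi> \<Psi> \<in> Carrier (dual (dual A))"
proof -
  note S = seminormed_dual[OF normed_algebraD(1)[OF A]]
  let ?P = "arens_prod A (Carrier (dual A)) \<Phi> \<Psi>"
  have b: "cmod (?P f) \<le> (Norm (dual (dual A)) \<Phi> * Norm (dual (dual A)) \<Psi>) * Norm (dual A) f" if f: "f \<in> Carrier (dual A)" for f
    using dual_le[OF S \<Phi> bidual_act_in_dual(1)[OF A \<Psi> f]]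
      mult_left_mono[OF bidual_act_in_dual(2)[OF A \<Psi> f] dual_norm_nonneg[OF S \<Phi>]] f
    by (simp add: arens_prod_def mult.assoc)
  have add: "bidual_act A \<Psi> (f + g) = bidual_act A \<Psi> f + bidual_act A \<Psi> g"
    if "f \<in> Carrier (dual A)" "g \<in> Carrier (dual A)" for f g
  proof
    fix a
    have "functional_act A (f + g) a = functional_act A f a + functional_act A g a"
      by (rule ext) (simp add: functional_act_def)
    then show "bidual_act A \<Psi> (f + g) a = (bidual_act A \<Psi> f + bidual_act A \<Psi> g) a"
      using dualD(2)[OF \<Psi>] functional_act_in_dual(1)[OF A] that by (simp add: bidual_act_def)
  qed
  have sc: "bidual_act A \<Psi> (scale c f) = scale c (bidual_act A \<Psi> f)" if "f \<in> Carrier (dual A)" for f c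
  proof
    fix a
    have "functional_act A (scale c f) a = scale c (functional_act A f a)"
      by (rule ext) (simp add: functional_act_def scale_apply)
    then show "bidual_act A \<Psi> (scale c f) a = scale c (bidual_act A \<Psi> f) a"
      using dualD(3)[OF \<Psi>] functional_act_in_dual(1)[OF A] that by (simp add: bidual_act_def scale_apply)
  qed
  note D2 = seminormedD(2,3)[OF S]
  show ?thesis
    by (rule dualI[OF _ _ b])
      (auto simp: arens_prod_def D2 add sc bidual_act_in_dual[OF A \<Psi>] dualD[OF \<Phi>])
qed

text \<open>If \<Phi> is evaluation at \<open>a\<close>, then the product with \<Psi>, taken at
  \<open>f\<close>, is the value of \<Psi> at the functional \<open>f a\<close>, which is weak*
  continuous in \<Psi>.\<close>

lemma reflexive_imp_arens_regular:
  assumes A: "normed_algebra A" and refl: "reflexive_space A"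
  shows "arens_regular A"
  unfolding arens_regular_def
proof
  fix \<Phi> assume \<Phi>: "\<Phi> \<in> Carrier (dual (dual A))"
  then obtain a where a: "a \<in> Carrier A" "\<And>f. f \<in> Carrier (dual A) ==> \<Phi> f = f a"
    using refl unfolding reflexive_space_def by blast
  show "continuous_map (weak_star (dual A)) (weak_star (dual A)) (arens_prod A (Carrier (dual A)) \<Phi>)"
  proof (rule continuous_map_into_weak_star)
    show "arens_prod A (Carrier (dual A)) \<Phi> \<Psi> \<in> Carrier (dual (dual A))"
      if "\<Psi> \<in> topspace (weak_star (dual A))" for \<Psi>
      using arens_prod_in_bidual[OF A \<Phi>] that by simp
    fix f assume f: "f \<in> Carrier (dual A)"
    have "continuous_map (weak_star (dual A)) euclidean (\<lambda>\<Psi>. \<Psi> (functional_act A f a))"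
      by (intro continuous_map_weak_star_eval functional_act_in_dual[OF A f a(1)])
    then show "continuous_map (weak_star (dual A)) euclidean (\<lambda>\<Psi>. arens_prod A (Carrier (dual A)) \<Phi> \<Psi> f)"
    proof (rule continuous_map_eq)
      fix \<Psi> assume "\<Psi> \<in> topspace (weak_star (dual A))"
      then have "\<Phi> (bidual_act A \<Psi> f) = bidual_act A \<Psi> f a"
        using bidual_act_in_dual(1)[OF A _ f] by (intro a(2)) simp
      then show "\<Psi> (functional_act A f a) = arens_prod A (Carrier (dual A)) \<Phi> \<Psi> f"
        using f a(1) by (simp add: arens_prod_def bidual_act_def)
    qed
  qed
qed

text \<open>The iterated limit criterion: Arens regularity forces iterated limits to agree, so it fails when
  \<open>f (a n \<cdot> b m)\<close> vanishes below the diagonal and stays away from \<open>0\<close> above it.\<close>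

lemma not_arens_regularI:
  assumes A: "normed_algebra A" and f: "f \<in> Carrier (dual A)"
    and a: "\<And>n. a n \<in> Carrier A" "\<And>n::nat. Norm A (a n) \<le> 1"
    and b: "\<And>n. b n \<in> Carrier A" "\<And>n::nat. Norm A (b n) \<le> 1"
    and low: "\<And>n m. m \<le> n ==> f (Mult A (a n) (b m)) = 0"
    and up: "\<And>n m. n < m ==> \<delta> \<le> Re (f (Mult A (a n) (b m)))" and \<delta>: "\<delta> > 0"
  shows "\<not> arens_regular A"
proof
  assume reg: "arens_regular A"
  note D = normed_algebraD[OF A] and S = seminormed_dual[OF normed_algebraD(1)[OF A]]
  obtain U where U: "ultra U" using ex_ultra by blast
  have U0: "U \<noteq> bot" using U by (simp add: ultra_def)
  define \<Phi> where "\<Phi> = ultra_functional U A a"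
  define \<Psi> where "\<Psi> = ultra_functional U A b"
  note \<Phi> = ultra_functional[where a = a, OF U D(1) a, folded \<Phi>_def] and \<Psi> = ultra_functional[where a = b, OF U D(1) b, folded \<Psi>_def]
  \<comment> \<open>The images of the \<open>b m\<close> in the bidual; they converge weak* to
    \<Psi> along \<open>U\<close>, so regularity identifies the product with \<Psi> as the limit of
    the products with them.\<close>
  define b' where "b' m = (\<lambda>f. if f \<in> Carrier (dual A) then f (b m) else 0)" for m
  have b': "b' m \<in> Carrier (dual (dual A))" for m
  proof (rule dualI[where B = 1])
    show "cmod (b' m f) \<le> 1 * Norm (dual A) f" if "f \<in> Carrier (dual A)" for f
      using dual_norm_upper[OF D(1) that b] that by (simp add: b'_def)
  qed (auto simp: b'_def seminormedD(2,3)[OF S] scale_apply)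
  let ?T = "arens_prod A (Carrier (dual A)) \<Phi>"
  have "limitin (weak_star (dual A)) b' \<Psi> U"
  proof (rule limitin_weak_star)
    show "\<Psi> \<in> Carrier (dual (dual A))" by (rule \<Psi>(2))
    show "b' n \<in> Carrier (dual (dual A))" for n by (rule b')
    show "((\<lambda>n. b' n f) \<longlongrightarrow> \<Psi> f) U" if "f \<in> Carrier (dual A)" for f
      using \<Psi>(1)[OF that] that by (simp add: b'_def)
  qed
  moreover have "continuous_map (weak_star (dual A)) euclidean (\<lambda>X. ?T X f)"
  proof -
    have "continuous_map (weak_star (dual A)) (weak_star (dual A)) ?T"
      using reg \<Phi>(2) by (simp add: arens_regular_def)
    from continuous_map_compose[OF this continuous_map_weak_star_eval[OF f]] show ?thesis by (simp add: comp_def)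
  qed
  ultimately have "limitin euclidean ((\<lambda>X. ?T X f) \<circ> b') (?T \<Psi> f) U"
    by (intro continuous_map_limit)
  then have "((\<lambda>m. ?T (b' m) f) \<longlongrightarrow> ?T \<Psi> f) U" by (simp add: comp_def)
  \<comment> \<open>The order of limits with \<open>n\<close> inside: for fixed \<open>m\<close> all
    large \<open>n\<close> lie on or below the diagonal.\<close>
  moreover have "?T (b' m) f = 0" for m
  proof -
    let ?k = "bidual_act A (b' m) f"
    have k: "?k \<in> Carrier (dual A)" by (rule bidual_act_in_dual[OF A b' f])
    have "?k (a n) = 0" if "n \<ge> m" for n
      using a b low[OF that] functional_act_in_dual(1)[OF A f a(1)] by (simp add: bidual_act_def b'_def functional_act_def)
    then have "\<forall>\<^sub>F n in U. ?k (a n) = 0" by (intro ultra_eventually[OF U, of m])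
    then have "((\<lambda>n. ?k (a n)) \<longlongrightarrow> 0) U" by (rule tendsto_eventually)
    then have "\<Phi> ?k = 0" using tendsto_unique[OF U0 \<Phi>(1)[OF k]] by blast
    then show ?thesis using f by (simp add: arens_prod_def)
  qed
  ultimately have 0: "?T \<Psi> f = 0" using tendsto_unique[OF U0 _ tendsto_const] by fastforce
  let ?h = "bidual_act A \<Psi> f"
  have h: "?h \<in> Carrier (dual A)" by (rule bidual_act_in_dual[OF A \<Psi>(2) f])
  \<comment> \<open>The opposite order: for fixed \<open>n\<close> all large \<open>m\<close> lie
    above the diagonal.\<close>
  have "\<delta> \<le> Re (?h (a n))" for n
  proof -
    have fa: "functional_act A f (a n) \<in> Carrier (dual A)" by (rule functional_act_in_dual[OF A f a(1)])
    have "((\<lambda>m. functional_act A f (a n) (b m)) \<longlongrightarrow> ?h (a n)) U"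
      using \<Psi>(1)[OF fa] a by (simp add: bidual_act_def)
    then have "((\<lambda>m. Re (functional_act A f (a n) (b m))) \<longlongrightarrow> Re (?h (a n))) U" by (rule tendsto_Re)
    then show ?thesis
    proof (rule tendsto_lowerbound[OF _ _ U0])
      show "\<forall>\<^sub>F m in U. \<delta> \<le> Re (functional_act A f (a n) (b m))"
        using up[of n] b by (intro ultra_eventually[OF U, of "Suc n"]) (simp add: functional_act_def)
    qed
  qed
  then have "\<delta> \<le> Re (\<Phi> ?h)"
    by (intro tendsto_lowerbound[OF tendsto_Re[OF \<Phi>(1)[OF h]] _ U0]) simp
  then show False using 0 f \<delta> by (simp add: arens_prod_def)
qed

lemma ex_avoiding_sequence:
  assumes inf: "infinite (UNIV :: 'a set)" and fin: "\<And>S. finite S ==> finite (Bad S)"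
  shows "\<exists>s :: nat \<Rightarrow> 'a. \<forall>k. s k \<notin> Bad (s ` {..<k})"
proof (rule dependent_wf_choice[of "less_than" "\<lambda>s k r. r \<notin> Bad (s ` {..<k})"])
  fix f g :: "nat \<Rightarrow> 'a" and k r assume "\<And>z. (z, k) \<in> less_than ==> f z = g z"
  then have "f ` {..<k} = g ` {..<k}" by (intro image_cong) auto
  then show "(r \<notin> Bad (f ` {..<k})) = (r \<notin> Bad (g ` {..<k}))" by simp
next
  fix k and f :: "nat \<Rightarrow> 'a"
  show "\<exists>r. r \<notin> Bad (f ` {..<k})" using ex_new_if_finite[OF inf fin] by simp
qed simp

text \<open>In an equation between four terms of one sequence, the term of largest index is
  determined by the other three. Choosing each term outside the finitely many values so determined
  excludes all such equations.\<close>

lemma ex_separated_sequences: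
  assumes inf: "infinite (UNIV :: 'a::group_add set)"
  obtains x y :: "nat \<Rightarrow> 'a::group_add" where "\<And>n m n' m'. n < m ==> m' \<le> n' ==> x n + y m \<noteq> x n' + y m'"
proof -
  \<comment> \<open>Two forms are listed because the group may be noncommutative: the unknown may
    stand as left or as right summand. \<open>S\<close> itself is included to make the sequence
    injective.\<close>
  define Bad where "Bad S = S \<union> (\<lambda>(a, b, c). a + b - c) ` (S \<times> S \<times> S) \<union> (\<lambda>(a, b, c). - a + (b + c)) ` (S \<times> S \<times> S)"
    for S :: "'a set"
  have "finite S ==> finite (Bad S)" for S by (simp add: Bad_def)
  then have "\<exists>s :: nat \<Rightarrow> 'a. \<forall>k. s k \<notin> Bad (s ` {..<k})" by (rule ex_avoiding_sequence[OF inf])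
  then obtain s where s: "\<And>k :: nat. s k \<notin> Bad (s ` {..<k})" by metis
  have s1: "s k \<noteq> s i" if "i < k" for i k using s[of k] that by (auto simp: Bad_def)
  have s2: "s k \<noteq> s a + s b - s c" if "a < k" "b < k" "c < k" for a b c k
  proof
    assume "s k = s a + s b - s c"
    then have "s k \<in> (\<lambda>(a, b, c). a + b - c) ` ((s ` {..<k}) \<times> (s ` {..<k}) \<times> (s ` {..<k}))"
      using that by (intro image_eqI[of _ _ "(s a, s b, s c)"]) auto
    then show False using s[of k] by (auto simp: Bad_def)
  qed
  have s3: "s k \<noteq> - s a + (s b + s c)" if "a < k" "b < k" "c < k" for a b c k
  proof
    assume "s k = - s a + (s b + s c)"
    then have "s k \<in> (\<lambda>(a, b, c). - a + (b + c)) ` ((s ` {..<k}) \<times> (s ` {..<k}) \<times> (s ` {..<k}))"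
      using that by (intro image_eqI[of _ _ "(s a, s b, s c)"]) auto
    then show False using s[of k] by (auto simp: Bad_def)
  qed
  \<comment> \<open>Even terms for \<open>x\<close> and odd terms for \<open>y\<close>: no index is
    shared between the two sequences.\<close>
  define x y where "x n = s (2 * n)" and "y n = s (2 * n + 1)" for n
  have "x n + y m \<noteq> x n' + y m'" if nm: "n < m" "m' \<le> n'" for n m n' m'
  proof
    assume eq: "x n + y m = x n' + y m'"
    have e1: "y m = - x n + (x n' + y m')" using eq by (metis minus_add_cancel)
    have e2: "y m' = - x n' + (x n + y m)" using eq by (metis minus_add_cancel)
    have e3: "x n' = x n + y m - y m'" using eq by (simp add: eq_diff_eq)
    \<comment> \<open>The cases locate the largest of the indices 2n, 2m+1, 2n', 2m'+1; for m' = m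
      the \<open>y\<close>-terms cancel and injectivity of the sequence decides.\<close>
    consider "m' < m" "n' \<le> m" | "m' < m" "m < n'" | "m' = m" | "m < m'" "n' = m'" | "m < m'" "m' < n'"
      using nm by linarith
    then show False
    proof cases
      case 1 then show ?thesis using s3[of "2*n" "2*m+1" "2*n'" "2*m'+1"] e1 nm by (simp add: x_def y_def)
    next
      case 2 then show ?thesis using s2[of "2*n" "2*n'" "2*m+1" "2*m'+1"] e3 nm by (simp add: x_def y_def)
    next
      case 3 then show ?thesis using s1[of "2*n" "2*n'"] eq nm by (simp add: x_def y_def)
    next
      case 4 then show ?thesis using s3[of "2*n'" "2*m'+1" "2*n" "2*m+1"] e2 nm by (simp add: x_def y_def)
    next
      case 5 then show ?thesis using s2[of "2*n" "2*n'" "2*m+1" "2*m'+1"] e3 nm by (simp add: x_def y_def)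
    qed
  qed
  then show thesis using that by blast
qed

section \<open>Infinite groups: failure of reflexivity and of Arens regularity\<close>

context weighted_lc_group
begin

lemma point_coeff_abs_summable:
  assumes \<Phi>: "\<Phi> \<in> Carrier (dual (M_star \<omega>))"
  shows "(\<lambda>z. cmod (complex_of_real (\<omega> z) * point_coeff \<Phi> z)) summable_on S"
proof (rule nonneg_bdd_above_summable_on)
  show "bdd_above (sum (\<lambda>z. norm (complex_of_real (\<omega> z) * point_coeff \<Phi> z)) ` {F. F \<subseteq> S \<and> finite F})"
    using sum_point_coeff_le[OF \<Phi>] weight_pos
    by (intro bdd_aboveI2[where M = "nA \<Phi>"]) (auto simp: norm_mult abs_of_pos)
qed auto

text \<open>The weighted coefficients paired with the indicator of \<open>S\<close>, as a bounded
  functional on the algebra. The factor \<omega> is matched to the normalization of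
  \<open>ndelta\<close>, so that its values on normalized point masses are 0 and 1.\<close>

definition coeff_sum :: "'a set \<Rightarrow> ((('a set \<Rightarrow> complex) \<Rightarrow> complex) \<Rightarrow> complex) \<Rightarrow> complex" where
  "coeff_sum S \<Phi> = (if \<Phi> \<in> Carrier A then \<Sum>\<^sub>\<infinity>z\<in>S. complex_of_real (\<omega> z) * point_coeff \<Phi> z else 0)"

lemma coeff_sum_dual: "coeff_sum S \<in> Carrier (dual A)"
proof (rule dualI)
  note sm = abs_summable_summable[OF point_coeff_abs_summable]
  note SA = normed_algebraD(1)[OF normed_algebra_A]
  fix \<Phi> assume "\<Phi> \<in> Carrier A"
  then have \<Phi>: "\<Phi> \<in> Carrier (dual (M_star \<omega>))" by simp
  have "cmod (coeff_sum S \<Phi>) \<le> (\<Sum>\<^sub>\<infinity>z\<in>S. cmod (complex_of_real (\<omega> z) * point_coeff \<Phi> z))"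
    using \<Phi> norm_infsum_bound[OF point_coeff_abs_summable[OF \<Phi>]] by (simp add: coeff_sum_def)
  also have "\<dots> \<le> nA \<Phi>"
    using sum_point_coeff_le[OF \<Phi>] weight_pos
    by (intro infsum_le_finite_sums point_coeff_abs_summable[OF \<Phi>]) (simp add: norm_mult abs_of_pos)
  finally show "cmod (coeff_sum S \<Phi>) \<le> 1 * Norm A \<Phi>" by simp
  show "coeff_sum S (scale c \<Phi>) = c * coeff_sum S \<Phi>" for c
    using \<Phi> infsum_cmult_right'[of c] seminormedD(3)[OF SA, of \<Phi> c]
    by (simp add: coeff_sum_def point_coeff_scale mult.left_commute)
  fix \<Psi> assume "\<Psi> \<in> Carrier A"
  then have \<Psi>: "\<Psi> \<in> Carrier (dual (M_star \<omega>))" by simp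
  show "coeff_sum S (\<Phi> + \<Psi>) = coeff_sum S \<Phi> + coeff_sum S \<Psi>"
    using \<Phi> \<Psi> infsum_add[OF sm[OF \<Phi>] sm[OF \<Psi>]] seminormedD(2)[OF SA, of \<Phi> \<Psi>]
    by (simp add: coeff_sum_def point_coeff_add distrib_left)
qed (auto simp: coeff_sum_def)

lemma infsum_single: "(\<Sum>\<^sub>\<infinity>z\<in>S. c z * (if z = w then d else 0)) = (if w \<in> S then c w * (d :: complex) else 0)"
proof -
  have "(\<Sum>\<^sub>\<infinity>z\<in>S. c z * (if z = w then d else 0)) = (\<Sum>\<^sub>\<infinity>z\<in>S \<inter> {w}. c z * d)"
    by (intro infsum_cong_neutral) auto
  also have "S \<inter> {w} = (if w \<in> S then {w} else {})" by auto
  finally show ?thesis by (simp add: infsum_finite)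
qed

definition ndelta :: "'a \<Rightarrow> (('a set \<Rightarrow> complex) \<Rightarrow> complex) \<Rightarrow> complex" where
  "ndelta x = scale (complex_of_real (1 / \<omega> x)) (delta x)"

lemma ndelta: "ndelta x \<in> Carrier A" "Norm A (ndelta x) \<le> 1"
proof -
  note SA = normed_algebraD(1)[OF normed_algebra_A]
  have d: "delta x \<in> Carrier A" by (simp add: delta_in_A)
  show "ndelta x \<in> Carrier A" unfolding ndelta_def by (rule seminormedD(3)[OF SA d])
  have "Norm A (ndelta x) = 1 / \<omega> x * nA (delta x)"
    unfolding ndelta_def using seminormedD(5)[OF SA d] weight_pos[of x] by (simp add: norm_divide)
  also have "\<dots> \<le> 1" using delta_in_A(2)[of x] weight_pos[of x] by (simp add: field_simps)
  finally show "Norm A (ndelta x) \<le> 1" .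
qed

lemma coeff_sum_ndelta: "coeff_sum S (ndelta x) = (if x \<in> S then 1 else 0)"
proof -
  have "coeff_sum S (ndelta x) = (\<Sum>\<^sub>\<infinity>z\<in>S. complex_of_real (\<omega> z) * (if z = x then complex_of_real (1 / \<omega> x) else 0))"
    using ndelta(1)[of x] unfolding coeff_sum_def ndelta_def
    by (auto simp: point_coeff_scale point_coeff_delta intro!: infsum_cong)
  then show ?thesis unfolding infsum_single using weight_pos[of x] by simp
qed

lemma coeff_sum_ndelta_Mult:
  "coeff_sum S (Mult A (ndelta x) (ndelta y)) =
    (if x + y \<in> S then complex_of_real (\<omega> (x + y) / (\<omega> x * \<omega> y)) else 0)"
proof -
  note D = normed_algebraD[OF normed_algebra_A]
  have d: "delta w \<in> Carrier A" for w by (simp add: delta_in_A)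
  have sd: "scale c (delta w) \<in> Carrier A" for c w by (rule seminormedD(3)[OF D(1) d])
  have m: "Mult A (ndelta x) (ndelta y) = scale (complex_of_real (1 / \<omega> x) * complex_of_real (1 / \<omega> y)) (Mult A (delta x) (delta y))"
    unfolding ndelta_def by (simp add: D(6)[OF d sd] D(7)[OF d d])
  have eq: "y = - x + z \<longleftrightarrow> z = x + y" for z by (metis add_minus_cancel minus_add_cancel)
  have pc: "point_coeff (Mult A (ndelta x) (ndelta y)) z =
      (if z = x + y then complex_of_real (1 / (\<omega> x * \<omega> y)) else 0)" for z
    unfolding m point_coeff_scale point_coeff_Mult_delta_left[OF delta_in_A(1)] point_coeff_delta eq by simp
  have "Mult A (ndelta x) (ndelta y) \<in> Carrier A" by (rule D(2)[OF ndelta(1) ndelta(1)])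
  then have "coeff_sum S (Mult A (ndelta x) (ndelta y)) =
      (\<Sum>\<^sub>\<infinity>z\<in>S. complex_of_real (\<omega> z) * (if z = x + y then complex_of_real (1 / (\<omega> x * \<omega> y)) else 0))"
    unfolding coeff_sum_def pc by simp
  then show ?thesis unfolding infsum_single by simp
qed

text \<open>An element representing the limit of normalized point masses at distinct points would
  have every coefficient 0, while its weighted coefficients would sum to 1: mass escapes from every
  single point but not from the whole group.\<close>

theorem reflexive_imp_finite:
  assumes refl: "reflexive_space A"
  shows "finite (UNIV :: 'a set)"
proof (rule ccontr)
  assume inf: "infinite (UNIV :: 'a set)"
  then obtain x :: "nat \<Rightarrow> 'a" where x: "inj x" using infinite_countable_subset by blast
  note SA = normed_algebraD(1)[OF normed_algebra_A]
  obtain U where U: "ultra U" using ex_ultra by blast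
  have U0: "U \<noteq> bot" using U by (simp add: ultra_def)
  define F where "F = ultra_functional U A (\<lambda>n. ndelta (x n))"
  have nd: "ndelta (x n) \<in> Carrier A" "Norm A (ndelta (x n)) \<le> 1" for n by (rule ndelta)+
  note F = ultra_functional[where a = "\<lambda>n. ndelta (x n)", OF U SA nd, folded F_def]
  obtain u where u: "u \<in> Carrier A" "\<And>f. f \<in> Carrier (dual A) ==> F f = f u"
    using refl[unfolded reflexive_space_def, rule_format, OF F(2)] by metis
  have lim: "((\<lambda>n. coeff_sum S (ndelta (x n))) \<longlongrightarrow> coeff_sum S u) U" for S
    using F(1)[OF coeff_sum_dual, of S] u(2)[OF coeff_sum_dual] by simp
  have "point_coeff u z = 0" for z
  proof -
    have "\<exists>N. \<forall>n\<ge>N. x n \<noteq> z"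
    proof (cases "\<exists>n. x n = z")
      case True
      then obtain k where "x k = z" by blast
      then have "x n \<noteq> z" if "n \<ge> Suc k" for n using injD[OF x, of n k] that by auto
      then show ?thesis by blast
    qed auto
    then obtain N where "\<And>n. n \<ge> N ==> x n \<noteq> z" by blast
    then have "\<forall>\<^sub>F n in U. coeff_sum {z} (ndelta (x n)) = 0"
      by (intro ultra_eventually[OF U, of N]) (simp add: coeff_sum_ndelta)
    then have "coeff_sum {z} u = 0" using tendsto_unique[OF U0 lim tendsto_eventually] by blast
    then show ?thesis using u(1) weight_pos[of z] by (simp add: coeff_sum_def infsum_finite)
  qed
  then have "coeff_sum UNIV u = 0" using u(1) by (simp add: coeff_sum_def)
  moreover have "coeff_sum UNIV u = 1"
  proof -
    have "((\<lambda>n. coeff_sum UNIV (ndelta (x n))) \<longlongrightarrow> 1) U" by (simp add: coeff_sum_ndelta)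
    with tendsto_unique[OF U0 lim[of UNIV]] show ?thesis .
  qed
  ultimately show False by simp
qed

theorem arens_regular_imp_finite:
  assumes reg: "arens_regular A" and bd: "bounded (range (weight_star \<omega>))"
  shows "finite (UNIV :: 'a set)"
proof (rule ccontr)
  assume inf: "infinite (UNIV :: 'a set)"
  obtain x y :: "nat \<Rightarrow> 'a" where xy: "\<And>n m n' m'. n < m ==> m' \<le> n' ==> x n + y m \<noteq> x n' + y m'"
    using ex_separated_sequences[OF inf] by blast
  obtain C where C: "\<And>z. \<omega> z * \<omega> (- z) \<le> C" "C > 0"
  proof -
    obtain C where "\<forall>t\<in>range (weight_star \<omega>). norm t \<le> C" using bd unfolding bounded_iff by blast
    then have le: "\<omega> z * \<omega> (- z) \<le> C" for z
      using order_trans[OF abs_ge_self] by (auto simp: weight_star_def)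
    moreover have "C > 0" using le[of 0] by (simp add: weight_zero)
    ultimately show thesis using that by blast
  qed
  define S where "S = {x n + y m |n m. n < m}"
  have "\<not> arens_regular A"
  proof (rule not_arens_regularI[OF normed_algebra_A coeff_sum_dual[of S] ndelta ndelta, of "\<lambda>n. x n" "\<lambda>n. y n" "1 / C"])
    fix n m :: nat
    show "coeff_sum S (Mult A (ndelta (x n)) (ndelta (y m))) = 0" if "m \<le> n"
      using xy that by (fastforce simp: coeff_sum_ndelta_Mult S_def)
    show "1 / C \<le> Re (coeff_sum S (Mult A (ndelta (x n)) (ndelta (y m))))" if "n < m"
    proof -
      \<comment> \<open>Undoing the translation by y m. Together with \<omega>(y) \<omega>(-y) \<le>
        C this bounds the normalized product below by 1/C.\<close>
      have "\<omega> (x n) \<le> \<omega> (x n + y m) * \<omega> (- y m)" using weight_add[of "x n + y m" "- y m"] by (simp add: add.assoc)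
      then have "\<omega> (x n) * \<omega> (y m) \<le> \<omega> (x n + y m) * \<omega> (- y m) * \<omega> (y m)"
        using weight_pos[of "y m"] by (intro mult_right_mono) auto
      also have "\<dots> \<le> \<omega> (x n + y m) * C"
        using C(1)[of "y m"] weight_pos[of "x n + y m"] by (simp add: mult.assoc mult.commute[of "\<omega> (- y m)"])
      finally have "1 / C \<le> \<omega> (x n + y m) / (\<omega> (x n) * \<omega> (y m))"
        using C(2) weight_pos[of "x n"] weight_pos[of "y m"] by (simp add: field_simps)
      moreover have "x n + y m \<in> S" using that by (auto simp: S_def)
      ultimately show ?thesis by (simp add: coeff_sum_ndelta_Mult)
    qed
  qed (use C in auto)
  then show False using reg by blast
qed

end

section \<open>Inequalities for polynomials and for the l^1 norm\<close>

definition l1 :: "('g \<Rightarrow> complex) \<Rightarrow> real" where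
  "l1 f = (\<Sum>\<^sub>\<infinity>x. cmod (f x))"

text \<open>Cauchy's estimate at 0: the derivative of order i there is i! times the
  coefficient.\<close>

lemma coeff_bound_on_circle:
  fixes P :: "complex poly"
  assumes "\<And>z. cmod z = 1 ==> cmod (poly P z) \<le> B"
  shows "cmod (coeff P i) \<le> B"
proof -
  have "norm ((deriv ^^ i) (poly P) 0) \<le> fact i * B / 1 ^ i"
    using assms by (intro Cauchy_inequality) (auto intro!: holomorphic_intros continuous_intros)
  moreover have "(deriv ^^ i) (poly P) 0 = fact i * coeff P i"
  proof -
    have "(deriv ^^ i) (poly P) = poly ((pderiv ^^ i) P)"
    proof (induction i)
      case (Suc i)
      have "deriv (poly Q) = poly (pderiv Q)" for Q :: "complex poly"
        by (rule ext) (intro DERIV_imp_deriv poly_DERIV)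
      then show ?case using Suc by simp
    qed simp
    moreover have "coeff ((pderiv ^^ i) P) 0 = fact i * coeff P i"
      by (simp add: coeff_higher_pderiv pochhammer_fact)
    ultimately show ?thesis by (simp add: poly_0_coeff_0)
  qed
  ultimately show ?thesis by (simp add: norm_mult)
qed

text \<open>Bernoulli's inequality for half the exponent, squared, gives quadratic growth. The
  number \<open>c\<close> is chosen so that the quadratic term exceeds (2d + 1) m with m =
  2^j.\<close>

lemma exp_beats_linear:
  fixes r :: real
  assumes "r > 1" shows "\<exists>k. real d * 2 ^ k + 1 < r ^ (2 ^ k)"
proof -
  define c where "c = (2 * real d + 1) / (r - 1)^2"
  obtain j where j: "c < 2 ^ j" using real_arch_pow[of 2 c] by auto
  define m :: nat where "m = 2 ^ j"
  have m: "real m > c" "m \<ge> 1" using j by (auto simp: m_def)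
  have "1 + real m * (r - 1) \<le> (1 + (r - 1)) ^ m" using assms by (intro Bernoulli_inequality) auto
  then have "real m * (r - 1) \<le> r ^ m" by simp
  then have "(real m * (r - 1))^2 \<le> (r ^ m)^2" using assms by (intro power_mono) auto
  moreover have "(2 * real d + 1) * real m < (real m * (r - 1))^2"
  proof -
    have "2 * real d + 1 < real m * (r - 1)^2" using m assms by (simp add: c_def pos_divide_less_eq)
    then have "(2 * real d + 1) * real m < real m * (r - 1)^2 * real m" using m by (intro mult_strict_right_mono) auto
    then show ?thesis by (simp add: power2_eq_square mult_ac)
  qed
  moreover have "real d * 2 ^ Suc j + 1 \<le> (2 * real d + 1) * real m" using m by (simp add: m_def algebra_simps)
  moreover have "(r ^ m)^2 = r ^ (2 ^ Suc j)" by (simp add: m_def power_mult[symmetric] mult.commute)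
  ultimately show ?thesis by (intro exI[of _ "Suc j"]) linarith
qed

text \<open>After division by \<open>s\<close> only b = a/s matters. The pair 1 + b, 1 - b controls
  the imaginary part of \<open>b\<close> and the pair with \<i> its real part; adding the two square
  roots costs the factor 1/4.\<close>

lemma unimodular_average:
  fixes s a :: complex
  shows "4 * sqrt ((cmod s)^2 + (cmod a)^2 / 4) \<le> cmod (s + a) + cmod (s - a) + cmod (s + \<i> * a) + cmod (s - \<i> * a)"
proof (cases "s = 0")
  case True
  then show ?thesis by (simp add: norm_mult real_sqrt_divide)
next
  case False
  have two: "2 * sqrt (1 + (Im b)^2) \<le> cmod (1 + b) + cmod (1 - b)" for b
  proof -
    \<comment> \<open>Conjugating one summand leaves its modulus but makes the real parts of
      \<open>b\<close> cancel and the imaginary parts add.\<close>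
    have "cmod (1 + b) + cmod (1 - b) = cmod (1 + b) + cmod (cnj (1 - b))" by (simp only: complex_mod_cnj)
    also have "\<dots> \<ge> cmod ((1 + b) + cnj (1 - b))" by (rule norm_triangle_ineq)
    also have "(1 + b) + cnj (1 - b) = 2 * Complex 1 (Im b)" by (simp add: complex_eq_iff)
    finally show ?thesis by (simp add: norm_mult complex_norm)
  qed
  have one: "4 * sqrt (1 + (cmod b)^2 / 4) \<le> cmod (1 + b) + cmod (1 - b) + cmod (1 + \<i> * b) + cmod (1 - \<i> * b)" for b
  proof -
    define x y where "x = Re b" and "y = Im b"
    have "4 * sqrt (1 + (cmod b)^2 / 4) = 2 * cmod (Complex 2 (cmod b))"
    proof -
      have "2^2 + (cmod b)^2 = 2^2 * (1 + (cmod b)^2 / 4)" by simp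
      then have "cmod (Complex 2 (cmod b)) = sqrt (2^2) * sqrt (1 + (cmod b)^2 / 4)"
        by (simp only: complex_norm real_sqrt_mult)
      then show ?thesis by simp
    qed
    also have "cmod (Complex 2 (cmod b)) \<le> sqrt (1 + x^2) + sqrt (1 + y^2)"
    proof (rule power2_le_imp_le)
      have "1 \<le> sqrt (1 + x^2) * sqrt (1 + y^2)"
        unfolding real_sqrt_mult[symmetric] by (intro real_le_rsqrt) (simp add: algebra_simps)
      then show "(cmod (Complex 2 (cmod b)))^2 \<le> (sqrt (1 + x^2) + sqrt (1 + y^2))^2"
        by (simp add: complex_norm power2_sum cmod_power2 x_def y_def)
    qed simp
    finally show ?thesis using two[of b] two[of "\<i> * b"] by (simp add: x_def y_def)
  qed
  define b where "b = a / s"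
  have a: "a = s * b" using False by (simp add: b_def)
  have "sqrt ((cmod s)^2 + (cmod a)^2 / 4) = cmod s * sqrt (1 + (cmod b)^2 / 4)"
  proof -
    have "(cmod s)^2 + (cmod a)^2 / 4 = (cmod s)^2 * (1 + (cmod b)^2 / 4)"
      by (simp add: a norm_mult power_mult_distrib algebra_simps)
    then show ?thesis by (simp add: real_sqrt_mult)
  qed
  moreover have "cmod (s + a) = cmod s * cmod (1 + b)" "cmod (s - a) = cmod s * cmod (1 - b)"
    "cmod (s + \<i> * a) = cmod s * cmod (1 + \<i> * b)" "cmod (s - \<i> * a) = cmod s * cmod (1 - \<i> * b)"
    unfolding a norm_mult[symmetric] by (simp_all add: algebra_simps)
  ultimately show ?thesis
    using mult_left_mono[OF one[of b], of "cmod s"] by (simp add: algebra_simps)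
qed

text \<open>Cotype 2 of \<open>l\<^sup>1\<close>: the phases are chosen one after the other, each time doing at least as well as
  the average over the four fourth roots of unity.\<close>

lemma l1_cotype:
  fixes a :: "nat \<Rightarrow> 'g \<Rightarrow> complex"
  assumes X: "finite X"
  shows "\<exists>\<theta>. (\<forall>i. cmod (\<theta> i) = 1) \<and>
     (\<Sum>i<n. (\<Sum>x\<in>X. cmod (a i x))^2 / 4) \<le> (\<Sum>x\<in>X. cmod (\<Sum>i<n. \<theta> i * a i x))^2"
proof (induction n)
  case 0
  show ?case by (intro exI[of _ "\<lambda>_. 1"]) simp
next
  case (Suc n)
  then obtain \<theta> where \<theta>: "\<And>i. cmod (\<theta> i) = 1"
    "(\<Sum>i<n. (\<Sum>x\<in>X. cmod (a i x))^2 / 4) \<le> (\<Sum>x\<in>X. cmod (\<Sum>i<n. \<theta> i * a i x))^2" by blast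
  define s where "s x = (\<Sum>i<n. \<theta> i * a i x)" for x
  define S T where "S = (\<Sum>x\<in>X. cmod (s x))" and "T = (\<Sum>x\<in>X. cmod (a n x))"
  define f where "f c = (\<Sum>x\<in>X. cmod (s x + c * a n x))" for c
  have "4 * sqrt (S^2 + T^2 / 4) \<le> f 1 + f (- 1) + f \<i> + f (- \<i>)"
  proof -
    \<comment> \<open>The square root is the modulus of a sum of complex numbers with parts |s x|
      and |a n x| / 2, so the triangle inequality moves it inside the sum over
      \<open>X\<close>.\<close>
    have "sqrt (S^2 + T^2 / 4) = cmod (\<Sum>x\<in>X. Complex (cmod (s x)) (cmod (a n x) / 2))"
      by (simp add: S_def T_def cmod_def power_divide sum_divide_distrib[symmetric])
    also have "\<dots> \<le> (\<Sum>x\<in>X. cmod (Complex (cmod (s x)) (cmod (a n x) / 2)))" by (rule norm_sum)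
    also have "\<dots> = (\<Sum>x\<in>X. sqrt ((cmod (s x))^2 + (cmod (a n x))^2 / 4))" by (simp add: complex_norm power_divide)
    finally have "4 * sqrt (S^2 + T^2 / 4) \<le> (\<Sum>x\<in>X. 4 * sqrt ((cmod (s x))^2 + (cmod (a n x))^2 / 4))"
      by (simp only: sum_distrib_left[symmetric])
    also have "\<dots> \<le> (\<Sum>x\<in>X. cmod (s x + a n x) + cmod (s x - a n x) + cmod (s x + \<i> * a n x) + cmod (s x - \<i> * a n x))"
      by (intro sum_mono unimodular_average)
    also have "\<dots> = f 1 + f (- 1) + f \<i> + f (- \<i>)" by (simp add: f_def sum.distrib)
    finally show ?thesis .
  qed
  then have "\<exists>c\<in>{1, - 1, \<i>, - \<i>}. sqrt (S^2 + T^2 / 4) \<le> f c"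
    by (rule contrapos_pp) (simp add: not_le)
  then obtain c where c': "c \<in> {1, - 1, \<i>, - \<i>}" and "sqrt (S^2 + T^2 / 4) \<le> f c" by blast
  then have c: "cmod c = 1" "sqrt (S^2 + T^2 / 4) \<le> f c" by auto
  have "S^2 + T^2 / 4 \<le> (f c)^2" by (rule sqrt_le_D[OF c(2)])
  moreover have "f c = (\<Sum>x\<in>X. cmod (\<Sum>i<Suc n. (\<theta>(n := c)) i * a i x))" by (simp add: f_def s_def)
  ultimately show ?case
    using \<theta> c(1) unfolding S_def s_def T_def by (intro exI[of _ "\<theta>(n := c)"]) (auto simp: less_Suc_eq)
qed

section \<open>C*-algebras with a bounded map into l^1\<close>

text \<open>The group law on the index set has disappeared: of the convolution there remains only
  the l^1 estimate for products, which makes the kernel of \<open>q\<close> a two-sided ideal. The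
  constant \<open>C\<close> absorbs the passage between equivalent norms.\<close>

locale cstar_l1 =
  fixes A :: "('i, 'z) nalg_scheme" and star :: "('i \<Rightarrow> complex) \<Rightarrow> 'i \<Rightarrow> complex" and e :: "'i \<Rightarrow> complex"
    and q :: "('i \<Rightarrow> complex) \<Rightarrow> 'g \<Rightarrow> complex" and C :: real
  assumes cstar: "cstar_algebra A star"
    and e_closed: "e \<in> Carrier A" and right_unit: "\<And>a. a \<in> Carrier A ==> Mult A a e = a"
    and q_add: "\<And>a b. a \<in> Carrier A ==> b \<in> Carrier A ==> q (a + b) = q a + q b"
    and q_scale: "\<And>c a. a \<in> Carrier A ==> q (scale c a) = scale c (q a)"
    and q_summable: "\<And>a. a \<in> Carrier A ==> (\<lambda>x. cmod (q a x)) summable_on UNIV"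
    and q_le: "\<And>a. a \<in> Carrier A ==> l1 (q a) \<le> C * Norm A a"
    and q_mul: "\<And>a b. a \<in> Carrier A ==> b \<in> Carrier A ==> l1 (q (Mult A a b)) \<le> l1 (q a) * l1 (q b)"
    and q_e: "q e \<noteq> 0"
begin

abbreviation V where "V \<equiv> Carrier A"
abbreviation N where "N \<equiv> Norm A"
abbreviation mul (infixl "\<otimes>" 70) where "a \<otimes> b \<equiv> Mult A a b"

lemma banach: "banach_algebra A" and banach_space: "banach_space A"
  using cstar by (auto simp: cstar_algebra_def banach_algebra_def)

lemma zero_closed [simp]: "0 \<in> V"
  and add_closed [simp]: "a \<in> V ==> b \<in> V ==> a + b \<in> V"
  and scale_closed [simp]: "a \<in> V ==> scale c a \<in> V"
  using banach_space by (auto simp: banach_space_def)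

lemma norm_on: "norm_on V N"
  using banach_space by (simp add: banach_space_def)

lemma N_nonneg [simp]: "a \<in> V ==> 0 \<le> N a"
  and N_eq_0: "a \<in> V ==> N a = 0 \<longleftrightarrow> a = 0"
  and N_scale: "a \<in> V ==> N (scale c a) = cmod c * N a"
  and N_triangle: "a \<in> V ==> b \<in> V ==> N (a + b) \<le> N a + N b"
  using norm_on unfolding norm_on_def by blast+

lemma seminormed_A: "seminormed A"
  by (simp add: seminormed_def N_triangle N_scale)

lemma mul_closed [simp]: "a \<in> V ==> b \<in> V ==> a \<otimes> b \<in> V"
  and N_mul: "a \<in> V ==> b \<in> V ==> N (a \<otimes> b) \<le> N a * N b"
  and mul_assoc: "a \<in> V ==> b \<in> V ==> c \<in> V ==> a \<otimes> b \<otimes> c = a \<otimes> (b \<otimes> c)"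
  and mul_add_left: "a \<in> V ==> b \<in> V ==> c \<in> V ==> (a + b) \<otimes> c = a \<otimes> c + b \<otimes> c"
  and mul_add_right: "a \<in> V ==> b \<in> V ==> c \<in> V ==> a \<otimes> (b + c) = a \<otimes> b + a \<otimes> c"
  and mul_scale_left: "a \<in> V ==> b \<in> V ==> scale t a \<otimes> b = scale t (a \<otimes> b)"
  and mul_scale_right: "a \<in> V ==> b \<in> V ==> a \<otimes> scale t b = scale t (a \<otimes> b)"
  using banach unfolding banach_algebra_def by blast+

lemma star_closed [simp]: "a \<in> V ==> star a \<in> V"
  and star_star [simp]: "a \<in> V ==> star (star a) = a"
  and star_add: "a \<in> V ==> b \<in> V ==> star (a + b) = star a + star b"
  and star_scale: "a \<in> V ==> star (scale c a) = scale (cnj c) (star a)"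
  and star_mul: "a \<in> V ==> b \<in> V ==> star (a \<otimes> b) = star b \<otimes> star a"
  and N_star_mul: "a \<in> V ==> N (star a \<otimes> a) = (N a)^2"
  using cstar unfolding cstar_algebra_def by blast+

lemma minus_closed [simp]: "a \<in> V ==> - a \<in> V"
  and diff_closed [simp]: "a \<in> V ==> b \<in> V ==> a - b \<in> V"
  using seminormed_uminus[OF seminormed_A] seminormed_diff[OF seminormed_A] by auto

lemma sum_closed [simp]: "(\<And>i. i \<in> I ==> f i \<in> V) ==> sum f I \<in> V"
  by (induction I rule: infinite_finite_induct) auto

lemma mul_zero [simp]: "a \<in> V ==> a \<otimes> 0 = 0" "a \<in> V ==> 0 \<otimes> a = 0"
  using mul_scale_left[of 0 a 0] mul_scale_right[of a 0 0] by auto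

lemma mul_minus_left: "a \<in> V ==> b \<in> V ==> (- a) \<otimes> b = - (a \<otimes> b)"
  and mul_minus_right: "a \<in> V ==> b \<in> V ==> a \<otimes> (- b) = - (a \<otimes> b)"
  using mul_scale_left[of a b "- 1"] mul_scale_right[of a b "- 1"] by auto

lemma mul_diff_left: "a \<in> V ==> b \<in> V ==> c \<in> V ==> (a - b) \<otimes> c = a \<otimes> c - b \<otimes> c"
  and mul_diff_right: "a \<in> V ==> b \<in> V ==> c \<in> V ==> a \<otimes> (b - c) = a \<otimes> b - a \<otimes> c"
  using mul_add_left[of a "- b" c] mul_add_right[of a b "- c"] by (auto simp: mul_minus_left mul_minus_right)

lemma mul_sum_left: "(\<And>i. i \<in> I ==> f i \<in> V) ==> b \<in> V ==> sum f I \<otimes> b = (\<Sum>i\<in>I. f i \<otimes> b)"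
  and mul_sum_right: "(\<And>i. i \<in> I ==> f i \<in> V) ==> b \<in> V ==> b \<otimes> sum f I = (\<Sum>i\<in>I. b \<otimes> f i)"
  by (induction I rule: infinite_finite_induct) (auto simp: mul_add_left mul_add_right)

lemma star_zero [simp]: "star 0 = 0"
  using star_scale[of 0 0] by simp

lemma star_minus: "a \<in> V ==> star (- a) = - star a"
  using star_scale[of a "- 1"] by simp

lemma star_diff: "a \<in> V ==> b \<in> V ==> star (a - b) = star a - star b"
  using star_add[of a "- b"] by (simp add: star_minus)

lemma star_sum: "(\<And>i. i \<in> I ==> f i \<in> V) ==> star (sum f I) = (\<Sum>i\<in>I. star (f i))"
  by (induction I rule: infinite_finite_induct) (auto simp: star_add)

text \<open>The involution turns the right unit into a left unit.\<close>

lemma star_e [simp]: "star e = e"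
  and left_unit [simp]: "a \<in> V ==> e \<otimes> a = a"
proof -
  have l: "star e \<otimes> a = a" if "a \<in> V" for a
    using star_mul[of "star a" e] right_unit[of "star a"] e_closed that by simp
  show s: "star e = e" using l[OF e_closed] right_unit[of "star e"] e_closed by simp
  show "a \<in> V ==> e \<otimes> a = a" using l s by simp
qed

declare e_closed [simp] right_unit [simp]

lemma N_star: "a \<in> V ==> N (star a) = N a"
proof -
  have le: "N a \<le> N (star a)" if a: "a \<in> V" for a
  proof (cases "N a = 0")
    case False
    then have "N a > 0" using a by (simp add: order_less_le)
    moreover have "N a * N a \<le> N (star a) * N a"
      using N_star_mul[OF a] N_mul[of "star a" a] a by (simp add: power2_eq_square)
    ultimately show ?thesis by simp
  qed (use a in simp)
  assume "a \<in> V"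
  then show ?thesis using le[of a] le[of "star a"] by simp
qed

lemma N_e [simp]: "N e = 1"
proof -
  have "e \<noteq> 0" using q_scale[of 0 0] q_e by auto
  then have "N e \<noteq> 0" by (simp add: N_eq_0)
  moreover have "N e = (N e)^2" using N_star_mul[of e] by simp
  ultimately show ?thesis by (simp add: power2_eq_square)
qed

lemma q_minus: "a \<in> V ==> q (- a) = - q a"
  using q_scale[of a "- 1"] by simp

lemma q_diff: "a \<in> V ==> b \<in> V ==> q (a - b) = q a - q b"
  using q_add[of a "- b"] by (simp add: q_minus)

lemma q_zero [simp]: "q 0 = 0"
  using q_scale[of 0 0] by simp

lemma q_sum: "(\<And>i. i \<in> I ==> f i \<in> V) ==> q (sum f I) = (\<Sum>i\<in>I. q (f i))"
  by (induction I rule: infinite_finite_induct) (auto simp: q_add)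

lemma l1_nonneg: "0 \<le> l1 f"
  by (simp add: l1_def infsum_nonneg)

lemma q_eq_0_iff: "a \<in> V ==> q a = 0 \<longleftrightarrow> l1 (q a) = 0"
proof
  assume a: "a \<in> V" and "l1 (q a) = 0"
  then have "cmod (q a x) = 0" for x
    using nonneg_infsum_le_0D[OF _ q_summable[OF a], of x] by (simp add: l1_def)
  then show "q a = 0" by (intro ext) simp
qed (simp add: l1_def)

lemma q_mul_0: "a \<in> V ==> b \<in> V ==> q a = 0 \<or> q b = 0 ==> q (a \<otimes> b) = 0"
proof -
  assume a: "a \<in> V" "b \<in> V" "q a = 0 \<or> q b = 0"
  then have "l1 (q (a \<otimes> b)) \<le> 0" using q_mul[of a b] q_eq_0_iff[of a] q_eq_0_iff[of b] by auto
  then show ?thesis using q_eq_0_iff[of "a \<otimes> b"] l1_nonneg[of "q (a \<otimes> b)"] a by simp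
qed

text \<open>The kernel is a two-sided ideal, so products may be computed modulo it; this takes the
  place of a quotient algebra.\<close>

lemma q_mul_cong: "a \<in> V ==> a' \<in> V ==> b \<in> V ==> b' \<in> V ==> q a = q a' ==> q b = q b' ==> q (a \<otimes> b) = q (a' \<otimes> b')"
proof -
  assume *: "a \<in> V" "a' \<in> V" "b \<in> V" "b' \<in> V" "q a = q a'" "q b = q b'"
  have "q ((a - a') \<otimes> b) = 0" "q (a' \<otimes> (b - b')) = 0" using * by (auto intro!: q_mul_0 simp: q_diff)
  then show ?thesis using * by (simp add: mul_diff_left mul_diff_right q_diff)
qed

lemma C_pos: "0 < C"
proof -
  have "l1 (q e) \<le> C" using q_le[of e] by simp
  moreover have "l1 (q e) \<noteq> 0" using q_eq_0_iff[of e] q_e by simp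
  ultimately show ?thesis using l1_nonneg[of "q e"] by linarith
qed

text \<open>Closedness of the kernel, phrased for the later use in which the small elements are
  obtained by subtracting elements of the kernel.\<close>

lemma q_closed_ker:
  assumes a: "a \<in> V" and ap: "\<And>\<epsilon>. \<epsilon> > 0 ==> \<exists>b\<in>V. q b = q a \<and> N b \<le> \<epsilon>"
  shows "q a = 0"
proof -
  have "l1 (q a) \<le> 0 + \<epsilon>" if \<epsilon>: "\<epsilon> > 0" for \<epsilon>
  proof -
    have "\<epsilon> / C > 0" using \<epsilon> C_pos by simp
    then obtain b where b: "b \<in> V" "q b = q a" "N b \<le> \<epsilon> / C" using ap by blast
    have "l1 (q a) \<le> C * N b" using q_le[OF b(1)] b(2) by simp
    also have "\<dots> \<le> C * (\<epsilon> / C)" using b(3) C_pos by (intro mult_left_mono) auto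
    finally show ?thesis using C_pos by simp
  qed
  then have "l1 (q a) \<le> 0" by (rule field_le_epsilon)
  then show ?thesis using q_eq_0_iff[OF a] l1_nonneg[of "q a"] by simp
qed

end

lemma sum_fun_app: "(sum f I) i = (\<Sum>j\<in>I. f j i)" for f :: "'b \<Rightarrow> 'i \<Rightarrow> complex"
  by (induction I rule: infinite_finite_induct) auto

lemma scale_sum: "scale c (sum f I) = (\<Sum>i\<in>I. scale c (f i))"
  by (rule ext) (simp only: sum_fun_app scale_apply sum_distrib_left)

section \<open>Continuous functional calculus of a unitary\<close>

locale cstar_unitary = cstar_l1 A star e q C
  for A :: "('i, 'z) nalg_scheme" and star e and q :: "('i \<Rightarrow> complex) \<Rightarrow> 'g \<Rightarrow> complex" and C +
  fixes v :: "'i \<Rightarrow> complex"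
  assumes v_closed [simp]: "v \<in> V" and star_v_v: "star v \<otimes> v = e" and v_star_v: "v \<otimes> star v = e"
begin

primrec pw :: "nat \<Rightarrow> 'i \<Rightarrow> complex" where
  "pw 0 = e"
| "pw (Suc n) = v \<otimes> pw n"

definition pe :: "complex poly \<Rightarrow> 'i \<Rightarrow> complex" where
  "pe P = (\<Sum>i\<le>degree P. scale (coeff P i) (pw i))"

lemma pw_closed [simp]: "pw n \<in> V"
  by (induction n) auto

lemma pe_closed [simp]: "pe P \<in> V"
  by (simp add: pe_def)

lemma pe_eq: "degree P \<le> n ==> pe P = (\<Sum>i\<le>n. scale (coeff P i) (pw i))"
  unfolding pe_def by (rule sum.mono_neutral_left) (auto simp: coeff_eq_0)

lemma pe_add: "pe (P + Q) = pe P + pe Q"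
proof -
  let ?n = "max (degree P) (degree Q)"
  have "degree (P + Q) \<le> ?n" by (rule degree_add_le_max)
  then show ?thesis
    using pe_eq[of "P + Q" ?n] pe_eq[of P ?n] pe_eq[of Q ?n] by (simp add: scale_add_left sum.distrib)
qed

lemma pe_pCons: "pe (pCons c P) = scale c e + v \<otimes> pe P"
proof -
  have "pe (pCons c P) = (\<Sum>i\<le>Suc (degree P). scale (coeff (pCons c P) i) (pw i))"
    by (rule pe_eq) (simp add: degree_pCons_le)
  also have "\<dots> = scale c e + (\<Sum>i\<le>degree P. scale (coeff P i) (v \<otimes> pw i))"
    by (subst sum.atMost_Suc_shift) simp
  also have "(\<Sum>i\<le>degree P. scale (coeff P i) (v \<otimes> pw i)) = v \<otimes> pe P"
    unfolding pe_def by (subst mul_sum_right) (auto simp: mul_scale_right)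
  finally show ?thesis .
qed

lemma pe_0 [simp]: "pe 0 = 0"
  by (simp add: pe_def)

lemma pe_smult: "pe (smult c P) = scale c (pe P)"
  by (cases "c = 0") (auto simp: pe_def scale_sum)

lemma pe_mult: "pe (P * Q) = pe P \<otimes> pe Q"
proof (induction P)
  case 0
  have "pe (0 * Q) = pe 0 \<otimes> pe Q" by simp
  then show ?case .
next
  case (pCons c P)
  have "pe (pCons c P * Q) = pe (smult c Q) + pe (pCons 0 (P * Q))" by (simp add: pe_add)
  also have "\<dots> = scale c (pe Q) + v \<otimes> (pe P \<otimes> pe Q)" by (simp add: pe_smult pe_pCons pCons.IH)
  also have "\<dots> = pe (pCons c P) \<otimes> pe Q" by (simp add: pe_pCons mul_add_left mul_scale_left mul_assoc)
  finally show ?case .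
qed

lemma pe_1 [simp]: "pe 1 = e"
  using pe_pCons[of 1 0] by (simp add: one_pCons)

lemma pe_X [simp]: "pe [:0, 1:] = v"
  using pe_pCons[of 0 "[:1:]"] pe_1 by (simp add: one_pCons)

lemma pw_pe: "pw n = pe ([:0, 1:] ^ n)"
  by (induction n) (simp_all add: pe_mult del: mult_pCons_left)

lemma N_v: "N v = 1"
  using N_star_mul[of v] star_v_v by (simp add: power2_eq_1_iff) (metis N_nonneg v_closed neg_0_le_iff_le not_one_le_zero)

lemma N_pw: "N (pw n) \<le> 1"
proof (induction n)
  case (Suc n)
  show ?case using N_mul[of v "pw n"] Suc N_v by simp
qed simp

lemma N_pe_coeffs: "N (pe P) \<le> (\<Sum>i\<le>degree P. cmod (coeff P i))"
proof -
  have "N (sum f I) \<le> (\<Sum>i\<in>I. N (f i))" if "\<And>i. f i \<in> V" for f :: "nat \<Rightarrow> _" and I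
    using that by (induction I rule: infinite_finite_induct)
      (auto simp: seminormedD(7)[OF seminormed_A] intro: order_trans[OF N_triangle])
  then have "N (pe P) \<le> (\<Sum>i\<le>degree P. N (scale (coeff P i) (pw i)))" unfolding pe_def by simp
  also have "\<dots> \<le> (\<Sum>i\<le>degree P. cmod (coeff P i))"
    by (intro sum_mono) (simp add: N_scale mult_left_le N_pw)
  finally show ?thesis .
qed

lemma commute_pe:
  assumes x: "x \<in> V" "x \<otimes> v = v \<otimes> x" shows "x \<otimes> pe P = pe P \<otimes> x"
proof (induction P)
  case (pCons c P)
  have "x \<otimes> (v \<otimes> pe P) = v \<otimes> pe P \<otimes> x"
    using x pCons.IH by (metis mul_assoc pe_closed v_closed)
  then have "x \<otimes> pe (pCons c P) = pe (pCons c P) \<otimes> x"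
    using x by (simp add: pe_pCons mul_add_left mul_add_right mul_scale_left mul_scale_right)
  then show ?case .
next
  case 0
  have "x \<otimes> pe 0 = pe 0 \<otimes> x" using x by simp
  then show ?case .
qed

text \<open>\<open>star v\<close> is the inverse of \<open>v\<close> and so commutes with
  polynomials in \<open>v\<close>; taking adjoints, \<open>v\<close> commutes with
  \<open>star (pe P)\<close>.\<close>

lemma pe_normal: "star (pe P) \<otimes> pe P = pe P \<otimes> star (pe P)"
proof (rule commute_pe)
  have "star v \<otimes> pe P = pe P \<otimes> star v" by (rule commute_pe) (simp_all add: star_v_v v_star_v)
  then have "star (star v \<otimes> pe P) = star (pe P \<otimes> star v)" by simp
  then show "star (pe P) \<otimes> v = v \<otimes> star (pe P)" by (simp add: star_mul)
qed simp

text \<open>The C*-identity applied to the square of \<open>y\<close>, to the selfadjoint element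
  \<open>star y \<otimes> y\<close>, and to \<open>y\<close> itself.\<close>

lemma N_square_normal:
  assumes y: "y \<in> V" "star y \<otimes> y = y \<otimes> star y" shows "N (y \<otimes> y) = (N y)^2"
proof -
  let ?h = "star y \<otimes> y"
  have h: "star ?h = ?h" using y by (simp add: star_mul)
  have "star (y \<otimes> y) \<otimes> (y \<otimes> y) = star y \<otimes> (star y \<otimes> y \<otimes> y)" using y(1) by (simp add: star_mul mul_assoc)
  also have "star y \<otimes> y \<otimes> y = y \<otimes> (star y \<otimes> y)" using y by (metis mul_assoc star_closed)
  also have "star y \<otimes> (y \<otimes> (star y \<otimes> y)) = ?h \<otimes> ?h" using y(1) by (simp add: mul_assoc)
  finally have "(N (y \<otimes> y))^2 = N (?h \<otimes> ?h)" using N_star_mul[of "y \<otimes> y"] y by simp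
  also have "\<dots> = (N ?h)^2" using N_star_mul[of ?h] h y by simp
  also have "\<dots> = ((N y)^2)^2" using N_star_mul[OF y(1)] by simp
  finally show ?thesis by (rule power2_eq_imp_eq) (use y in auto)
qed

lemma N_pe_power: "N (pe (P ^ (2 ^ k))) = N (pe P) ^ (2 ^ k)"
proof (induction k)
  case (Suc k)
  have "P ^ (2 ^ Suc k) = P ^ (2 ^ k) * P ^ (2 ^ k)" by (simp add: power_add[symmetric] mult_2)
  then have "N (pe (P ^ (2 ^ Suc k))) = (N (pe (P ^ (2 ^ k))))^2"
    using N_square_normal[OF pe_closed pe_normal] by (simp only: pe_mult)
  then show ?case using Suc by (simp add: power_mult[symmetric] mult.commute)
qed simp

text \<open>The crude bound by coefficients loses a factor linear in the degree, which disappears after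
  passing to high powers.\<close>

lemma N_pe_le:
  assumes B: "\<And>z. cmod z = 1 ==> cmod (poly P z) \<le> B" and B0: "B > 0"
  shows "N (pe P) \<le> B"
proof (rule ccontr)
  assume "\<not> N (pe P) \<le> B"
  then have r: "N (pe P) / B > 1" using B0 by simp
  obtain k where k: "real (degree P) * 2 ^ k + 1 < (N (pe P) / B) ^ (2 ^ k)" using exp_beats_linear[OF r] by blast
  let ?Q = "P ^ (2 ^ k)"
  have "cmod (coeff ?Q i) \<le> B ^ (2 ^ k)" for i
    by (rule coeff_bound_on_circle) (simp add: poly_power norm_power B power_mono)
  then have "(\<Sum>i\<le>degree ?Q. cmod (coeff ?Q i)) \<le> (\<Sum>i\<le>degree ?Q. B ^ (2 ^ k))" by (intro sum_mono)
  also have "\<dots> = (real (degree ?Q) + 1) * B ^ (2 ^ k)" by simp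
  also have "\<dots> \<le> (real (degree P) * 2 ^ k + 1) * B ^ (2 ^ k)"
  proof -
    have "degree ?Q \<le> degree P * 2 ^ k" using degree_power_le[of P "2 ^ k"] by simp
    then have "real (degree ?Q) \<le> real (degree P) * 2 ^ k" by (metis of_nat_le_iff of_nat_mult of_nat_numeral of_nat_power)
    then show ?thesis using B0 by (intro mult_right_mono) auto
  qed
  also have "\<dots> < (N (pe P) / B) ^ (2 ^ k) * B ^ (2 ^ k)" using k B0 by (intro mult_strict_right_mono) auto
  also have "\<dots> = N (pe P) ^ (2 ^ k)" using B0 by (simp add: power_divide)
  also have "\<dots> = N (pe ?Q)" by (simp add: N_pe_power)
  finally show False using N_pe_coeffs[of ?Q] by simp
qed

text \<open>Polynomials in z and its conjugate together with the elements they yield. A relation is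
  used because different expressions can agree on the circle; that they then yield the same element
  follows from the norm estimate.\<close>

inductive laurent :: "(complex \<Rightarrow> complex) \<Rightarrow> ('i \<Rightarrow> complex) \<Rightarrow> bool" where
  const: "laurent (\<lambda>_. c) (scale c e)"
| ident: "laurent (\<lambda>z. z) v"
| conj: "laurent cnj (star v)"
| add: "laurent f a ==> laurent g b ==> laurent (\<lambda>z. f z + g z) (a + b)"
| mult: "laurent f a ==> laurent g b ==> laurent (\<lambda>z. f z * g z) (a \<otimes> b)"

lemma laurent_closed: "laurent f a ==> a \<in> V"
proof (induction rule: laurent.induct)
  case (add f a g b)
  have "a + b \<in> V" using add by simp
  then show ?case .
qed auto

lemma laurent_star: "laurent f a ==> laurent (\<lambda>z. cnj (f z)) (star a)"
proof (induction rule: laurent.induct)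
  case (const c) then show ?case using laurent.const[of "cnj c"] by (simp add: star_scale)
next
  case ident then show ?case using laurent.conj by simp
next
  case conj then show ?case using laurent.ident by simp
next
  case (add f a g b)
  then have "laurent (\<lambda>z. cnj (f z + g z)) (star (a + b))"
    using laurent.add[OF add.IH] by (simp add: star_add laurent_closed)
  then show ?case .
next
  case (mult f a g b)
  then show ?case using laurent.mult[OF mult.IH(2,1)] by (simp add: star_mul laurent_closed mult.commute)
qed

lemma laurent_bounded: "laurent f a ==> \<exists>B. \<forall>z. cmod z = 1 \<longrightarrow> cmod (f z) \<le> B"
proof (induction rule: laurent.induct)
  case (add f a g b)
  then obtain B D where "\<forall>z. cmod z = 1 \<longrightarrow> cmod (f z) \<le> B" "\<forall>z. cmod z = 1 \<longrightarrow> cmod (g z) \<le> D" by blast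
  then show ?case using norm_triangle_mono by blast
next
  case (mult f a g b)
  then obtain B D where "\<forall>z. cmod z = 1 \<longrightarrow> cmod (f z) \<le> B" "\<forall>z. cmod z = 1 \<longrightarrow> cmod (g z) \<le> D" by blast
  then show ?case
    by (intro exI[of _ "\<bar>B\<bar> * \<bar>D\<bar>"]) (auto simp: norm_mult intro!: mult_mono intro: order_trans[OF _ abs_ge_self])
qed auto

lemma pw_mul_pe: "pw n \<otimes> pe P = pe ([:0, 1:] ^ n * P)"
  by (simp add: pw_pe pe_mult)

lemma pw_add: "pw (n + m) = pw n \<otimes> pw m"
  by (simp add: pw_pe power_add pe_mult)

text \<open>On the unit circle the conjugate of z is 1/z, and correspondingly \<open>star v\<close>
  is the inverse of \<open>v\<close>; a large power clears all conjugates on both sides at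
  once.\<close>

lemma laurent_rep: "laurent f a ==> \<exists>n P. pw n \<otimes> a = pe P \<and> (\<forall>z. cmod z = 1 \<longrightarrow> z ^ n * f z = poly P z)"
proof (induction rule: laurent.induct)
  case (const c)
  show ?case by (intro exI[of _ 0] exI[of _ "[:c:]"]) (simp add: pe_pCons)
next
  case ident
  show ?case by (intro exI[of _ 0] exI[of _ "[:0, 1:]"]) simp
next
  case conj
  have "z * cnj z = 1" if "cmod z = 1" for z using that by (simp add: complex_norm_square[symmetric])
  then show ?case by (intro exI[of _ 1] exI[of _ 1]) (simp add: v_star_v)
next
  case (add f a g b)
  then obtain n P m Q where *: "pw n \<otimes> a = pe P" "\<And>z. cmod z = 1 ==> z ^ n * f z = poly P z"
    "pw m \<otimes> b = pe Q" "\<And>z. cmod z = 1 ==> z ^ m * g z = poly Q z" by blast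
  note cl = laurent_closed[OF add(1)] laurent_closed[OF add(2)]
  have "pw (n + m) \<otimes> (a + b) = pw m \<otimes> (pw n \<otimes> a) + pw n \<otimes> (pw m \<otimes> b)"
  proof -
    have "pw (n + m) \<otimes> a = pw m \<otimes> (pw n \<otimes> a)" using cl pw_add[of m n] by (simp add: mul_assoc add.commute[of m n])
    moreover have "pw (n + m) \<otimes> b = pw n \<otimes> (pw m \<otimes> b)" using cl by (simp add: mul_assoc pw_add)
    ultimately show ?thesis using cl by (simp add: mul_add_right)
  qed
  also have "\<dots> = pe ([:0, 1:] ^ m * P + [:0, 1:] ^ n * Q)" by (simp add: * pw_mul_pe pe_add)
  finally have "pw (n + m) \<otimes> (a + b) = pe ([:0, 1:] ^ m * P + [:0, 1:] ^ n * Q)" .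
  moreover have "z ^ (n + m) * (f z + g z) = poly ([:0, 1:] ^ m * P + [:0, 1:] ^ n * Q) z" if "cmod z = 1" for z
    using *(2,4)[OF that, symmetric] by (simp add: power_add algebra_simps)
  ultimately show ?case by blast
next
  case (mult f a g b)
  then obtain n P m Q where *: "pw n \<otimes> a = pe P" "\<And>z. cmod z = 1 ==> z ^ n * f z = poly P z"
    "pw m \<otimes> b = pe Q" "\<And>z. cmod z = 1 ==> z ^ m * g z = poly Q z" by blast
  note cl = laurent_closed[OF mult(1)] laurent_closed[OF mult(2)]
  have "pw (n + m) \<otimes> (a \<otimes> b) = pw m \<otimes> (pw n \<otimes> a) \<otimes> b"
    using cl pw_add[of m n] by (simp add: mul_assoc add.commute[of m n])
  also have "pw m \<otimes> (pw n \<otimes> a) = pe P \<otimes> pw m" unfolding *(1) by (simp only: pw_pe pe_mult[symmetric] mult.commute)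
  also have "pe P \<otimes> pw m \<otimes> b = pe (P * Q)" using cl by (simp add: mul_assoc * pe_mult)
  finally have "pw (n + m) \<otimes> (a \<otimes> b) = pe (P * Q)" .
  moreover have "z ^ (n + m) * (f z * g z) = poly (P * Q) z" if "cmod z = 1" for z
    using *(2,4)[OF that, symmetric] by (simp add: power_add algebra_simps)
  ultimately show ?case by blast
qed

text \<open>Multiplication by the unitary \<open>pw n\<close> can be undone without raising the
  norm, and z^n has modulus 1 on the circle, so the estimate for polynomials carries over.\<close>

lemma laurent_le:
  assumes f: "laurent f a" and B: "\<And>z. cmod z = 1 ==> cmod (f z) \<le> B" and B0: "B > 0"
  shows "N a \<le> B"
proof -
  obtain n P where *: "pw n \<otimes> a = pe P" "\<And>z. cmod z = 1 ==> z ^ n * f z = poly P z" using laurent_rep[OF f] by blast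
  have a: "a \<in> V" by (rule laurent_closed[OF f])
  have "star (pw n) \<otimes> pw n = e" for n
  proof (induction n)
    case (Suc n)
    have "star (pw (Suc n)) \<otimes> pw (Suc n) = star (pw n) \<otimes> ((star v \<otimes> v) \<otimes> pw n)" by (simp add: star_mul mul_assoc)
    then show ?case using Suc star_v_v by simp
  qed simp
  then have "a = star (pw n) \<otimes> pe P" using a by (simp add: *(1)[symmetric] mul_assoc[symmetric])
  then have "N a \<le> N (star (pw n)) * N (pe P)" using N_mul[of "star (pw n)" "pe P"] by simp
  also have "\<dots> \<le> 1 * N (pe P)" using N_pw[of n] by (intro mult_right_mono) (simp_all add: N_star)
  also have "N (pe P) \<le> B"
    using B by (intro N_pe_le B0) (simp add: *(2)[symmetric] norm_mult norm_power)
  finally show ?thesis by simp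
qed

lemma laurent_cmult: "laurent f a ==> laurent (\<lambda>z. c * f z) (scale c a)"
  using laurent.mult[OF laurent.const[of c]] by (auto simp: mul_scale_left laurent_closed)

lemma laurent_diff: "laurent f a ==> laurent g b ==> laurent (\<lambda>z. f z - g z) (a - b)"
  using laurent.add[OF _ laurent_cmult[of g b "- 1"], of f a] by simp

text \<open>Stone-Weierstrass for the real and imaginary parts separately; each real polynomial
  function on the plane is a polynomial in z and its conjugate.\<close>

lemma laurent_approx:
  assumes f: "continuous_on UNIV f" and \<epsilon>: "\<epsilon> > 0"
  shows "\<exists>g a. laurent g a \<and> (\<forall>z. cmod z = 1 \<longrightarrow> cmod (f z - g z) \<le> \<epsilon>)"
proof -
  have poly: "\<exists>g a. laurent g a \<and> (\<forall>z. cmod z = 1 \<longrightarrow> complex_of_real (h z) = g z)"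
    if "real_polynomial_function h" for h :: "complex \<Rightarrow> real" using that
  proof induction
    case (linear h)
    interpret bounded_linear h by fact
    \<comment> \<open>The coefficients of the real-linear map \<open>h\<close> in terms of z and its
      conjugate, found by matching the values at 1 and \<i>.\<close>
    let ?\<alpha> = "(h 1 - \<i> * h \<i>) / 2" and ?\<beta> = "(h 1 + \<i> * h \<i>) / 2"
    have "complex_of_real (h z) = ?\<alpha> * z + ?\<beta> * cnj z" for z
    proof -
      have "z = Re z *\<^sub>R 1 + Im z *\<^sub>R \<i>" by (simp add: complex_eq_iff)
      then have "h z = Re z * h 1 + Im z * h \<i>" using add[of "Re z *\<^sub>R 1" "Im z *\<^sub>R \<i>"] by (simp add: scaleR)
      then show ?thesis by (simp add: complex_eq_iff field_simps)
    qed
    moreover have "laurent (\<lambda>z. ?\<alpha> * z + ?\<beta> * cnj z) (scale ?\<alpha> v + scale ?\<beta> (star v))"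
      by (intro laurent.add laurent_cmult laurent.ident laurent.conj)
    ultimately show ?case by blast
  next
    case (const c)
    show ?case using laurent.const[of "complex_of_real c"] by blast
  next
    case (add h k)
    then obtain g a g' a' where *: "laurent g a" "\<forall>z. cmod z = 1 \<longrightarrow> complex_of_real (h z) = g z"
      "laurent g' a'" "\<forall>z. cmod z = 1 \<longrightarrow> complex_of_real (k z) = g' z" by blast
    show ?case using laurent.add[OF *(1,3)] * by (intro exI conjI) auto
  next
    case (mult h k)
    then obtain g a g' a' where *: "laurent g a" "\<forall>z. cmod z = 1 \<longrightarrow> complex_of_real (h z) = g z"
      "laurent g' a'" "\<forall>z. cmod z = 1 \<longrightarrow> complex_of_real (k z) = g' z" by blast
    show ?case using laurent.mult[OF *(1,3)] * by (intro exI conjI) auto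
  qed
  have ap: "\<exists>h. real_polynomial_function h \<and> (\<forall>z. cmod z = 1 \<longrightarrow> \<bar>k z - h z\<bar> \<le> \<epsilon> / 2)"
    if "continuous_on UNIV k" for k :: "complex \<Rightarrow> real"
  proof -
    have "continuous_on (sphere 0 1) k" by (rule continuous_on_subset[OF that]) simp
    then obtain h where "real_polynomial_function h" "\<And>z. z \<in> sphere 0 1 ==> \<bar>k z - h z\<bar> < \<epsilon> / 2"
      using Stone_Weierstrass_real_polynomial_function[OF compact_sphere _ half_gt_zero[OF \<epsilon>]] by blast
    then show ?thesis by (intro exI[of _ h]) (auto intro: less_imp_le)
  qed
  obtain h1 where h1: "real_polynomial_function h1" "\<forall>z. cmod z = 1 \<longrightarrow> \<bar>Re (f z) - h1 z\<bar> \<le> \<epsilon> / 2"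
    using ap[of "\<lambda>z. Re (f z)"] f continuous_on_Re by blast
  obtain h2 where h2: "real_polynomial_function h2" "\<forall>z. cmod z = 1 \<longrightarrow> \<bar>Im (f z) - h2 z\<bar> \<le> \<epsilon> / 2"
    using ap[of "\<lambda>z. Im (f z)"] f continuous_on_Im by blast
  obtain g1 a1 where g1: "laurent g1 a1" "\<forall>z. cmod z = 1 \<longrightarrow> complex_of_real (h1 z) = g1 z" using poly[OF h1(1)] by blast
  obtain g2 a2 where g2: "laurent g2 a2" "\<forall>z. cmod z = 1 \<longrightarrow> complex_of_real (h2 z) = g2 z" using poly[OF h2(1)] by blast
  have "laurent (\<lambda>z. g1 z + \<i> * g2 z) (a1 + scale \<i> a2)" by (intro laurent.add laurent_cmult g1 g2)
  moreover have "cmod (f z - (g1 z + \<i> * g2 z)) \<le> \<epsilon>" if z: "cmod z = 1" for z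
  proof -
    have "f z - (g1 z + \<i> * g2 z) = Complex (Re (f z) - h1 z) (Im (f z) - h2 z)"
      using g1(2)[rule_format, OF z, symmetric] g2(2)[rule_format, OF z, symmetric] by (simp add: complex_eq_iff)
    then show ?thesis
      using cmod_le[of "Complex (Re (f z) - h1 z) (Im (f z) - h2 z)"] h1(2)[rule_format, OF z] h2(2)[rule_format, OF z]
      by simp
  qed
  ultimately show ?thesis by blast
qed

text \<open>The relation a = f(v), closed under limits: one Laurent pair approximates the function
  uniformly on the circle and the element in norm simultaneously. Only the values of
  \<open>f\<close> on the circle enter.\<close>

definition fcalc :: "(complex \<Rightarrow> complex) \<Rightarrow> ('i \<Rightarrow> complex) \<Rightarrow> bool" where
  "fcalc f a \<longleftrightarrow> a \<in> V \<and> (\<forall>\<epsilon>>0. \<exists>g b. laurent g b \<and> (\<forall>z. cmod z = 1 \<longrightarrow> cmod (f z - g z) \<le> \<epsilon>) \<and> N (a - b) \<le> \<epsilon>)"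

lemma fcalc_closed: "fcalc f a ==> a \<in> V"
  by (simp add: fcalc_def)

lemma fcalc_laurent: "laurent f a ==> fcalc f a"
  unfolding fcalc_def using laurent_closed[of f a] seminormedD(7)[OF seminormed_A]
  by (auto intro!: exI[of _ f] exI[of _ a])

lemma fcalcE:
  assumes "fcalc f a" "\<epsilon> > 0"
  obtains g b where "laurent g b" "b \<in> V" "\<And>z. cmod z = 1 ==> cmod (f z - g z) \<le> \<epsilon>" "N (a - b) \<le> \<epsilon>"
  using assms laurent_closed unfolding fcalc_def by blast

lemma fcalc_le:
  assumes f: "fcalc f a" and B: "\<And>z. cmod z = 1 ==> cmod (f z) \<le> B" and B0: "B \<ge> 0"
  shows "N a \<le> B"
proof (rule field_le_epsilon)
  fix \<epsilon> :: real assume "\<epsilon> > 0"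
  then have e: "\<epsilon> / 2 > 0" by simp
  obtain g b where g: "laurent g b" "b \<in> V" "\<And>z. cmod z = 1 ==> cmod (f z - g z) \<le> \<epsilon>/2" "N (a - b) \<le> \<epsilon>/2"
    using fcalcE[OF f e] by metis
  have "N b \<le> B + \<epsilon>/2"
  proof (rule laurent_le[OF g(1)])
    fix z :: complex assume "cmod z = 1"
    then show "cmod (g z) \<le> B + \<epsilon>/2" using B[of z] g(3)[of z] norm_triangle_sub[of "g z" "f z"] by (simp add: norm_minus_commute)
  qed (use e B0 in simp)
  then show "N a \<le> B + \<epsilon>" using N_triangle[of "a - b" b] g fcalc_closed[OF f] by simp
qed

lemma fcalc_bounded:
  assumes f: "fcalc f a" shows "\<exists>B\<ge>0. \<forall>z. cmod z = 1 \<longrightarrow> cmod (f z) \<le> B"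
proof -
  obtain g b where g: "laurent g b" "\<And>z. cmod z = 1 ==> cmod (f z - g z) \<le> 1" using fcalcE[OF f zero_less_one] by metis
  obtain B where B: "\<And>z. cmod z = 1 ==> cmod (g z) \<le> B" using laurent_bounded[OF g(1)] by blast
  have "cmod (f z) \<le> B + 1" if "cmod z = 1" for z using B[OF that] g(2)[OF that] norm_triangle_sub[of "f z" "g z"] by simp
  moreover have "B + 1 \<ge> 0" using order_trans[OF norm_ge_zero B[of 1]] by simp
  ultimately show ?thesis by blast
qed

lemma fcalc_add:
  assumes f: "fcalc f a" and g: "fcalc g b" shows "fcalc (\<lambda>z. f z + g z) (a + b)"
  unfolding fcalc_def
proof (intro conjI allI impI)
  note cl = fcalc_closed[OF f] fcalc_closed[OF g]
  show "a + b \<in> V" using cl by simp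
  fix \<epsilon> :: real assume "\<epsilon> > 0"
  then have e: "\<epsilon> / 2 > 0" by simp
  obtain f' a' where f': "laurent f' a'" "a' \<in> V" "\<And>z. cmod z = 1 ==> cmod (f z - f' z) \<le> \<epsilon>/2" "N (a - a') \<le> \<epsilon>/2"
    using fcalcE[OF f e] by metis
  obtain g' b' where g': "laurent g' b'" "b' \<in> V" "\<And>z. cmod z = 1 ==> cmod (g z - g' z) \<le> \<epsilon>/2" "N (b - b') \<le> \<epsilon>/2"
    using fcalcE[OF g e] by metis
  have "N ((a + b) - (a' + b')) \<le> \<epsilon>"
    using N_triangle[of "a - a'" "b - b'"] cl f' g' by (simp add: algebra_simps)
  moreover have "cmod ((f z + g z) - (f' z + g' z)) \<le> \<epsilon>" if "cmod z = 1" for z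
    using norm_triangle_ineq[of "f z - f' z" "g z - g' z"] f'(3)[OF that] g'(3)[OF that] by (simp add: algebra_simps)
  ultimately show "\<exists>h c. laurent h c \<and> (\<forall>z. cmod z = 1 \<longrightarrow> cmod (f z + g z - h z) \<le> \<epsilon>) \<and> N (a + b - c) \<le> \<epsilon>"
    using laurent.add[OF f'(1) g'(1)] by blast
qed

lemma fcalc_mult:
  assumes f: "fcalc f a" and g: "fcalc g b" shows "fcalc (\<lambda>z. f z * g z) (a \<otimes> b)"
  unfolding fcalc_def
proof (intro conjI allI impI)
  note cl = fcalc_closed[OF f] fcalc_closed[OF g]
  show "a \<otimes> b \<in> V" using cl by simp
  obtain B where B: "B \<ge> 0" "\<And>z. cmod z = 1 ==> cmod (f z) \<le> B" using fcalc_bounded[OF f] by blast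
  obtain D where D: "D \<ge> 0" "\<And>z. cmod z = 1 ==> cmod (g z) \<le> D" using fcalc_bounded[OF g] by blast
  have Na: "N a \<le> B" by (rule fcalc_le[OF f B(2,1)])
  have Nb: "N b \<le> D" by (rule fcalc_le[OF g D(2,1)])
  fix \<epsilon> :: real assume \<epsilon>: "\<epsilon> > 0"
  \<comment> \<open>The cap 1 allows D + d to be replaced by D + 1, so that the quadratic error
    becomes linear in \<open>d\<close>.\<close>
  define d where "d = min 1 (\<epsilon> / (B + D + 1))"
  have d: "d > 0" "d \<le> 1" using \<epsilon> B D by (auto simp: d_def)
  have dB: "d * (B + D + 1) \<le> \<epsilon>"
  proof -
    have "d \<le> \<epsilon> / (B + D + 1)" by (simp add: d_def)
    then show ?thesis using B D by (simp add: pos_le_divide_eq)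
  qed
  have key: "B * d + (D + d) * d \<le> \<epsilon>"
  proof -
    have "B * d + (D + d) * d \<le> B * d + (D + 1) * d" using d by (intro add_left_mono mult_right_mono) auto
    then show ?thesis using dB by (simp add: algebra_simps)
  qed
  obtain f' a' where f': "laurent f' a'" "a' \<in> V" "\<And>z. cmod z = 1 ==> cmod (f z - f' z) \<le> d" "N (a - a') \<le> d"
    using fcalcE[OF f d(1)] by metis
  obtain g' b' where g': "laurent g' b'" "b' \<in> V" "\<And>z. cmod z = 1 ==> cmod (g z - g' z) \<le> d" "N (b - b') \<le> d"
    using fcalcE[OF g d(1)] by metis
  have "N (a \<otimes> b - a' \<otimes> b') \<le> \<epsilon>"
  proof -
    have "a \<otimes> b - a' \<otimes> b' = a \<otimes> (b - b') + (a - a') \<otimes> b'" using cl f' g' by (simp add: mul_diff_left mul_diff_right)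
    then have "N (a \<otimes> b - a' \<otimes> b') \<le> N a * N (b - b') + N (a - a') * N b'"
      using N_triangle[of "a \<otimes> (b - b')" "(a - a') \<otimes> b'"] N_mul[of a "b - b'"] N_mul[of "a - a'" b'] cl f' g' by simp
    also have "\<dots> \<le> B * d + d * (D + d)"
    proof (intro add_mono mult_mono)
      have "N b' \<le> N b + N (b - b')" using seminormed_diff(2,3)[OF seminormed_A, of b "b - b'"] cl g' by simp
      then show "N b' \<le> D + d" using Nb g' by linarith
    qed (use Na f' g' cl d B in auto)
    finally show ?thesis using key by (simp add: mult.commute)
  qed
  moreover have "cmod (f z * g z - f' z * g' z) \<le> \<epsilon>" if z: "cmod z = 1" for z
  proof -
    have "f z * g z - f' z * g' z = f z * (g z - g' z) + g' z * (f z - f' z)" by (simp add: algebra_simps)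
    then have "cmod (f z * g z - f' z * g' z) \<le> cmod (f z) * cmod (g z - g' z) + cmod (g' z) * cmod (f z - f' z)"
      by (metis norm_mult norm_triangle_ineq)
    also have "\<dots> \<le> B * d + (D + d) * d"
    proof (intro add_mono mult_mono)
      show "cmod (g' z) \<le> D + d" using D(2)[OF z] g'(3)[OF z] norm_triangle_sub[of "g' z" "g z"] by (simp add: norm_minus_commute)
    qed (use B D d f'(3)[OF z] g'(3)[OF z] z in auto)
    finally show ?thesis using key by simp
  qed
  ultimately show "\<exists>h c. laurent h c \<and> (\<forall>z. cmod z = 1 \<longrightarrow> cmod (f z * g z - h z) \<le> \<epsilon>) \<and> N (a \<otimes> b - c) \<le> \<epsilon>"
    using laurent.mult[OF f'(1) g'(1)] by blast
qed

lemma fcalc_cmult: "fcalc f a ==> fcalc (\<lambda>z. c * f z) (scale c a)"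
  using fcalc_mult[OF fcalc_laurent[OF laurent.const[of c]], of f a] by (simp add: mul_scale_left fcalc_closed)

lemma fcalc_diff: "fcalc f a ==> fcalc g b ==> fcalc (\<lambda>z. f z - g z) (a - b)"
  using fcalc_add[OF _ fcalc_cmult[of g b "- 1"], of f a] by simp

lemma fcalc_star: "fcalc f a ==> fcalc (\<lambda>z. cnj (f z)) (star a)"
  unfolding fcalc_def
proof (intro conjI allI impI; clarify)
  fix \<epsilon> :: real assume a: "a \<in> V" and H: "\<forall>\<epsilon>>0. \<exists>g b. laurent g b \<and> (\<forall>z. cmod z = 1 \<longrightarrow> cmod (f z - g z) \<le> \<epsilon>) \<and> N (a - b) \<le> \<epsilon>"
    and \<epsilon>: "\<epsilon> > 0"
  then obtain g b where g: "laurent g b" "\<forall>z. cmod z = 1 \<longrightarrow> cmod (f z - g z) \<le> \<epsilon>" "N (a - b) \<le> \<epsilon>" by blast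
  have b: "b \<in> V" by (rule laurent_closed[OF g(1)])
  have "N (star a - star b) \<le> \<epsilon>" using g(3) N_star[of "a - b"] a b by (simp add: star_diff)
  moreover have "\<forall>z. cmod z = 1 \<longrightarrow> cmod (cnj (f z) - cnj (g z)) \<le> \<epsilon>"
    using g(2) by (metis complex_cnj_diff complex_mod_cnj)
  ultimately show "\<exists>g b. laurent g b \<and> (\<forall>z. cmod z = 1 \<longrightarrow> cmod (cnj (f z) - g z) \<le> \<epsilon>) \<and> N (star a - b) \<le> \<epsilon>"
    using laurent_star[OF g(1)] by blast
qed simp

lemma fcalc_unique:
  assumes f: "fcalc f a" and g: "fcalc g b" and eq: "\<And>z. cmod z = 1 ==> f z = g z"
  shows "a = b"
proof -
  note cl = fcalc_closed[OF f] fcalc_closed[OF g]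
  have "N (a - b) \<le> 0" by (rule fcalc_le[OF fcalc_diff[OF f g]]) (simp_all add: eq)
  moreover have "0 \<le> N (a - b)" using N_nonneg[of "a - b"] cl by simp
  ultimately have "N (a - b) = 0" by linarith
  then show ?thesis using N_eq_0[of "a - b"] cl by simp
qed

text \<open>Laurent approximations with error 1/(n+1) form a Cauchy sequence, by the norm estimate
  for their differences; completeness of the algebra supplies the element.\<close>

lemma fcalc_exists:
  assumes f: "continuous_on UNIV f" shows "\<exists>a. fcalc f a"
proof -
  have "\<exists>g b. laurent g b \<and> (\<forall>z. cmod z = 1 \<longrightarrow> cmod (f z - g z) \<le> inverse (real (Suc n)))" for n
    by (rule laurent_approx[OF f]) simp
  then obtain g b where g: "\<And>n. laurent (g n) (b n)" "\<And>n z. cmod z = 1 ==> cmod (f z - g n z) \<le> inverse (real (Suc n))" by metis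
  have b: "b n \<in> V" for n by (rule laurent_closed[OF g(1)])
  have close: "N (b m - b n) \<le> inverse (real (Suc m)) + inverse (real (Suc n))" for m n
  proof (rule laurent_le[OF laurent_diff[OF g(1) g(1)]])
    fix z :: complex assume z: "cmod z = 1"
    show "cmod (g m z - g n z) \<le> inverse (real (Suc m)) + inverse (real (Suc n))"
      using g(2)[OF z, of m] g(2)[OF z, of n] norm_triangle_ineq4[of "f z - g n z" "f z - g m z"] by simp
  qed (simp add: add_pos_pos)
  have small: "\<exists>N0. \<forall>n\<ge>N0. inverse (real (Suc n)) < \<epsilon>" if \<epsilon>: "\<epsilon> > 0" for \<epsilon> :: real
  proof -
    obtain N0 where N0: "inverse (real (Suc N0)) < \<epsilon>" using reals_Archimedean[OF \<epsilon>] by blast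
    have "inverse (real (Suc n)) < \<epsilon>" if "n \<ge> N0" for n
    proof -
      have "inverse (real (Suc n)) \<le> inverse (real (Suc N0))" using that by (intro le_imp_inverse_le) auto
      then show ?thesis using N0 by linarith
    qed
    then show ?thesis by blast
  qed
  have "\<exists>l\<in>V. (\<lambda>n. N (b n - l)) \<longlonglongrightarrow> 0"
  proof -
    have "\<exists>N0. \<forall>m\<ge>N0. \<forall>n\<ge>N0. N (b m - b n) < \<epsilon>" if \<epsilon>: "\<epsilon> > 0" for \<epsilon> :: real
    proof -
      obtain N0 where N0: "\<And>n. n \<ge> N0 ==> inverse (real (Suc n)) < \<epsilon>/2" using small[OF half_gt_zero[OF \<epsilon>]] by blast
      have "N (b m - b n) < \<epsilon>" if "m \<ge> N0" "n \<ge> N0" for m n using close[of m n] N0[OF that(1)] N0[OF that(2)] by linarith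
      then show ?thesis by blast
    qed
    then show ?thesis using banach_space b unfolding banach_space_def by blast
  qed
  then obtain a where a: "a \<in> V" "(\<lambda>n. N (b n - a)) \<longlonglongrightarrow> 0" by blast
  have "fcalc f a"
    unfolding fcalc_def
  proof (intro conjI a allI impI)
    fix \<epsilon> :: real assume \<epsilon>: "\<epsilon> > 0"
    obtain N0 where N0: "\<And>n. n \<ge> N0 ==> inverse (real (Suc n)) < \<epsilon>" using small[OF \<epsilon>] by blast
    have "\<forall>\<^sub>F n in sequentially. N (b n - a) < \<epsilon> \<and> n \<ge> N0"
      using order_tendstoD(2)[OF a(2) \<epsilon>] eventually_ge_at_top[of N0] by (rule eventually_conj)
    then obtain n where n: "N (b n - a) < \<epsilon>" "n \<ge> N0" using eventually_happens'[OF sequentially_bot] by blast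
    have "N (a - b n) \<le> \<epsilon>" using n(1) seminormed_diff(3)[OF seminormed_A a(1) b] by simp
    moreover have "cmod (f z - g n z) \<le> \<epsilon>" if "cmod z = 1" for z using g(2)[OF that, of n] N0[OF n(2)] by linarith
    ultimately show "\<exists>g b. laurent g b \<and> (\<forall>z. cmod z = 1 \<longrightarrow> cmod (f z - g z) \<le> \<epsilon>) \<and> N (a - b) \<le> \<epsilon>"
      using g(1) by blast
  qed
  then show "\<exists>a. fcalc f a" by blast
qed

end

section \<open>The part of the spectrum seen by the map into l^1\<close>

lemma ex_separation:
  fixes S :: "'a::metric_space set"
  assumes "finite S"
  obtains \<delta> where "\<delta> > 0" "\<And>s t. s \<in> S ==> t \<in> S ==> s \<noteq> t ==> \<delta> \<le> dist s t"
proof -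
  let ?D = "insert 1 ((\<lambda>p. dist (fst p) (snd p)) ` {p \<in> S \<times> S. fst p \<noteq> snd p})"
  have fin: "finite ?D" using assms by simp
  have "Min ?D > 0" using fin by (subst Min_gr_iff) auto
  moreover have "Min ?D \<le> dist s t" if "s \<in> S" "t \<in> S" "s \<noteq> t" for s t
    using that fin by (intro Min_le) (auto intro!: rev_image_eqI[of "(s, t)"])
  ultimately show ?thesis using that by blast
qed

text \<open>A tent of height 1 and radius \<delta>; the \<open>plateau\<close> below equals 1 on
  that disc and vanishes outside the disc of twice the radius, so it acts as a unit on the
  tent.\<close>

definition bump :: "real \<Rightarrow> complex \<Rightarrow> complex \<Rightarrow> real" where
  "bump \<delta> t z = max 0 (1 - cmod (z - t) / \<delta>)"

definition plateau :: "real \<Rightarrow> complex \<Rightarrow> complex \<Rightarrow> real" where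
  "plateau \<delta> t z = max 0 (min 1 (2 - cmod (z - t) / \<delta>))"

lemma continuous_bump: "continuous_on UNIV (\<lambda>z. complex_of_real (bump \<delta> t z))"
  and continuous_plateau: "continuous_on UNIV (\<lambda>z. complex_of_real (plateau \<delta> t z))"
proof -
  have "continuous_on UNIV (\<lambda>z::complex. cmod (z - t) / \<delta>)"
    by (simp only: divide_inverse) (intro continuous_intros)
  then show "continuous_on UNIV (\<lambda>z. complex_of_real (bump \<delta> t z))"
    "continuous_on UNIV (\<lambda>z. complex_of_real (plateau \<delta> t z))"
    unfolding bump_def plateau_def by (auto intro!: continuous_intros)
qed

lemma bump_self [simp]: "bump \<delta> t t = 1"
  by (simp add: bump_def)

lemma bump_far: "\<delta> > 0 ==> \<delta> \<le> dist s t ==> bump \<delta> t s = 0"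
  by (simp add: bump_def dist_norm)

lemma plateau_le: "0 \<le> plateau \<delta> t z" "plateau \<delta> t z \<le> 1"
  by (auto simp: plateau_def)

lemma plateau_bump: "\<delta> > 0 ==> plateau \<delta> t z * bump \<delta> t z = bump \<delta> t z"
  by (auto simp: plateau_def bump_def max_def min_def field_simps)

lemma plateau_disjoint:
  assumes "\<delta> > 0" "4 * \<delta> \<le> dist s t" "plateau \<delta> s z \<noteq> 0"
  shows "plateau \<delta> t z = 0"
proof -
  have "cmod (z - s) / \<delta> < 2" using assms(3) by (auto simp: plateau_def max_def min_def split: if_splits)
  then have "cmod (z - s) < 2 * \<delta>" using assms(1) by (simp add: field_simps)
  moreover have "dist s t \<le> cmod (z - s) + cmod (z - t)" using dist_triangle3[of s t z] by (simp add: dist_norm)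
  ultimately have "cmod (z - t) \<ge> 2 * \<delta>" using assms(2) by linarith
  then have "cmod (z - t) / \<delta> \<ge> 2" using assms(1) by (simp add: field_simps)
  then show ?thesis by (simp add: plateau_def)
qed

context cstar_unitary
begin

lemma fcalc_sum:
  assumes "finite I" "\<And>i. i \<in> I ==> fcalc (f i) (a i)"
  shows "fcalc (\<lambda>z. \<Sum>i\<in>I. f i z) (\<Sum>i\<in>I. a i)"
  using assms
proof (induction I rule: finite_induct)
  case empty
  have "fcalc (\<lambda>z. \<Sum>i\<in>{}. f i z) (\<Sum>i\<in>{}. a i)" using fcalc_laurent[OF laurent.const[of 0]] by simp
  then show ?case .
next
  case (insert i I)
  have "fcalc (\<lambda>z. f i z + (\<Sum>i\<in>I. f i z)) (a i + (\<Sum>i\<in>I. a i))" using insert by (intro fcalc_add) auto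
  then have "fcalc (\<lambda>z. \<Sum>i\<in>insert i I. f i z) (\<Sum>i\<in>insert i I. a i)" using insert.hyps by simp
  then show ?case .
qed

text \<open>The hull of the kernel: the common zeros on the circle of all functions whose elements
  are annihilated by \<open>q\<close>. It stands for the spectrum of \<open>v\<close> modulo the
  kernel.\<close>

definition spec :: "complex set" where
  "spec = {t. cmod t = 1 \<and> (\<forall>f a. continuous_on UNIV f \<longrightarrow> fcalc f a \<longrightarrow> q a = 0 \<longrightarrow> f t = 0)}"

text \<open>The plateau element reproduces the bump element, whose image is nonzero;
  submultiplicativity of the l^1 norm then forces the plateau to have image of norm at least
  1.\<close>

lemma plateau_l1:
  assumes t: "t \<in> spec" and \<delta>: "\<delta> > 0" and a: "fcalc (\<lambda>z. complex_of_real (plateau \<delta> t z)) a"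
  shows "1 \<le> l1 (q a)"
proof -
  obtain b where b: "fcalc (\<lambda>z. complex_of_real (bump \<delta> t z)) b" using fcalc_exists[OF continuous_bump] by blast
  note cl = fcalc_closed[OF a] fcalc_closed[OF b]
  have "a \<otimes> b = b"
    by (rule fcalc_unique[OF fcalc_mult[OF a b] b]) (simp add: plateau_bump[OF \<delta>] flip: of_real_mult)
  then have "l1 (q b) \<le> l1 (q a) * l1 (q b)" using q_mul[OF cl] by simp
  moreover have "q b \<noteq> 0"
  proof
    assume "q b = 0"
    then have "complex_of_real (bump \<delta> t t) = 0" using t b continuous_bump unfolding spec_def by blast
    then show False by simp
  qed
  then have "l1 (q b) > 0" using q_eq_0_iff[OF cl(2)] l1_nonneg[of "q b"] by simp
  ultimately show ?thesis by simp
qed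

text \<open>Plateaus around n points have disjoint supports, so every unimodular combination has
  norm at most 1 and image of l^1 norm at most C. Each image has at least 1/2 of its mass on a
  common finite set; cotype provides a combination whose squared l^1 norm is at least n (1/2)^2 / 4
  = n/16.\<close>

lemma card_spec_subset:
  assumes "finite S" "S \<subseteq> spec"
  shows "real (card S) \<le> 16 * C^2"
proof -
  obtain \<delta>0 where \<delta>0: "\<delta>0 > 0" "\<And>s t. s \<in> S ==> t \<in> S ==> s \<noteq> t ==> \<delta>0 \<le> dist s t"
    using ex_separation[OF assms(1)] by blast
  \<comment> \<open>Plateaus reach out to 2 \<delta>, so centres at distance at least 4 \<delta>
    keep them disjoint.\<close>
  define \<delta> where "\<delta> = \<delta>0 / 4"
  have \<delta>: "\<delta> > 0" using \<delta>0 by (simp add: \<delta>_def)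
  obtain t where t: "bij_betw t {..<card S} S" using ex_bij_betw_nat_finite[OF assms(1)] by (auto simp: atLeast0LessThan)
  let ?n = "card S"
  have tS: "t i \<in> S" if "i < ?n" for i using t that by (auto simp: bij_betw_def)
  have tinj: "t i \<noteq> t j" if "i < ?n" "j < ?n" "i \<noteq> j" for i j using t that by (auto simp: bij_betw_def inj_on_def)
  have "\<forall>i. \<exists>a. fcalc (\<lambda>z. complex_of_real (plateau \<delta> (t i) z)) a" using fcalc_exists[OF continuous_plateau] by blast
  then obtain a where a: "\<And>i. fcalc (\<lambda>z. complex_of_real (plateau \<delta> (t i) z)) (a i)" by metis
  have aV: "a i \<in> V" for i by (rule fcalc_closed[OF a])
  have "\<exists>X. finite X \<and> 1/2 \<le> (\<Sum>x\<in>X. cmod (q (a i) x))" if "i < ?n" for i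
  proof -
    have "1 \<le> l1 (q (a i))" using plateau_l1[OF _ \<delta> a] tS[OF that] assms(2) by blast
    moreover have "((\<lambda>x. cmod (q (a i) x)) has_sum l1 (q (a i))) UNIV"
      unfolding l1_def using q_summable[OF aV] by (rule has_sum_infsum)
    then have "\<forall>\<^sub>F X in finite_subsets_at_top UNIV. dist (\<Sum>x\<in>X. cmod (q (a i) x)) (l1 (q (a i))) < 1/2"
      unfolding has_sum_def by (rule tendstoD) simp
    then obtain X where "finite X" "dist (\<Sum>x\<in>X. cmod (q (a i) x)) (l1 (q (a i))) < 1/2"
      unfolding eventually_finite_subsets_at_top by blast
    moreover have "1/2 \<le> s" if "1 \<le> l" "dist s l < 1/2" for s l :: real using that unfolding dist_real_def by linarith
    ultimately show ?thesis by blast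
  qed
  then obtain X where X: "\<And>i. i < ?n ==> finite (X i)" "\<And>i. i < ?n ==> 1/2 \<le> (\<Sum>x\<in>X i. cmod (q (a i) x))"
    by metis
  define Y where "Y = (\<Union>i<?n. X i)"
  have Y: "finite Y" using X(1) by (auto simp: Y_def)
  have XY: "1/2 \<le> (\<Sum>x\<in>Y. cmod (q (a i) x))" if "i < ?n" for i
    using X(2)[OF that] sum_mono2[of Y "X i" "\<lambda>x. cmod (q (a i) x)"] Y that by (force simp: Y_def)
  obtain \<theta> where \<theta>: "\<And>i. cmod (\<theta> i) = 1"
    "(\<Sum>i<?n. (\<Sum>x\<in>Y. cmod (q (a i) x))^2 / 4) \<le> (\<Sum>x\<in>Y. cmod (\<Sum>i<?n. \<theta> i * q (a i) x))^2"
    using l1_cotype[OF Y, where n = ?n and a = "\<lambda>i. q (a i)"] by blast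
  define b where "b = (\<Sum>i<?n. scale (\<theta> i) (a i))"
  have bV: "b \<in> V" by (simp add: b_def aV)
  have "fcalc (\<lambda>z. \<Sum>i<?n. \<theta> i * complex_of_real (plateau \<delta> (t i) z)) b"
    unfolding b_def by (intro fcalc_sum fcalc_cmult a) simp
  then have "N b \<le> 1"
  proof (rule fcalc_le)
    fix z :: complex
    show "cmod (\<Sum>i<?n. \<theta> i * complex_of_real (plateau \<delta> (t i) z)) \<le> 1"
    proof (cases "\<exists>i<?n. plateau \<delta> (t i) z \<noteq> 0")
      case True
      then obtain i where i: "i < ?n" "plateau \<delta> (t i) z \<noteq> 0" by blast
      have "plateau \<delta> (t j) z = 0" if "j < ?n" "j \<noteq> i" for j
        using plateau_disjoint[OF \<delta> _ i(2), of "t j"] \<delta>0(2)[OF tS[OF i(1)] tS[OF that(1)] tinj[OF i(1) that(1)]] that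
        by (simp add: \<delta>_def)
      then have "(\<Sum>j<?n. \<theta> j * complex_of_real (plateau \<delta> (t j) z)) = \<theta> i * complex_of_real (plateau \<delta> (t i) z)"
        using i(1) by (subst sum.remove[of _ i]) (auto intro!: sum.neutral)
      then show ?thesis using \<theta>(1)[of i] plateau_le[of \<delta> "t i" z] by (simp add: norm_mult)
    next
      case False
      then have "(\<Sum>i<?n. \<theta> i * complex_of_real (plateau \<delta> (t i) z)) = 0" by (intro sum.neutral) auto
      then show ?thesis by simp
    qed
  qed simp
  have qb: "q b x = (\<Sum>i<?n. \<theta> i * q (a i) x)" for x
    unfolding b_def by (subst q_sum) (simp_all add: aV q_scale sum_fun_app scale_apply)
  have "(\<Sum>x\<in>Y. cmod (q b x)) \<le> l1 (q b)"
    unfolding l1_def using q_summable[OF bV] Y by (intro finite_sum_le_infsum) auto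
  also have "\<dots> \<le> C * N b" by (rule q_le[OF bV])
  also have "\<dots> \<le> C" using \<open>N b \<le> 1\<close> C_pos by (simp add: mult_left_le)
  finally have "(\<Sum>x\<in>Y. cmod (q b x))^2 \<le> C^2" by (intro power_mono sum_nonneg) auto
  moreover have "real ?n / 16 \<le> (\<Sum>i<?n. (\<Sum>x\<in>Y. cmod (q (a i) x))^2 / 4)"
  proof -
    have "1/16 \<le> (\<Sum>x\<in>Y. cmod (q (a i) x))^2 / 4" if "i < ?n" for i
      using power_mono[OF XY[OF that], of 2] by (simp add: power2_eq_square)
    then have "(\<Sum>i<?n. 1/16) \<le> (\<Sum>i<?n. (\<Sum>x\<in>Y. cmod (q (a i) x))^2 / 4)" by (intro sum_mono) auto
    then show ?thesis by simp
  qed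
  ultimately show ?thesis using \<theta>(2) by (simp add: qb)
qed

lemma finite_spec: "finite spec" and card_spec: "card spec \<le> nat \<lfloor>16 * C^2\<rfloor>"
proof -
  have "card S \<le> nat \<lfloor>16 * C^2\<rfloor>" if "S \<subseteq> spec" "finite S" for S
    using card_spec_subset[OF that(2,1)] by (simp add: le_nat_floor)
  then show "finite spec" "card spec \<le> nat \<lfloor>16 * C^2\<rfloor>"
    using finite_if_finite_subsets_card_bdd[of spec] by blast+
qed

text \<open>A partition-of-unity argument: away from \<open>spec\<close>, finitely many functions that are
  annihilated by \<open>q\<close> have no common zero.\<close>

lemma q_fcalc_zero:
  assumes f: "continuous_on UNIV f" and zero: "\<And>t. t \<in> spec ==> f t = 0" and a: "fcalc f a"
  shows "q a = 0"
proof (rule q_closed_ker)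
  show aV: "a \<in> V" by (rule fcalc_closed[OF a])
  fix \<epsilon> :: real assume \<epsilon>: "\<epsilon> > 0"
  define K where "K = {z \<in> sphere 0 1. \<epsilon> \<le> cmod (f z)}"
  have "closed {z. \<epsilon> \<le> cmod (f z)}" by (intro closed_Collect_le continuous_intros f)
  then have "compact (sphere 0 1 \<inter> {z. \<epsilon> \<le> cmod (f z)})" by (rule compact_Int_closed[OF compact_sphere])
  moreover have "K = sphere 0 1 \<inter> {z. \<epsilon> \<le> cmod (f z)}" by (auto simp: K_def)
  ultimately have K: "compact K" by simp
  have "\<exists>g b. continuous_on UNIV g \<and> fcalc g b \<and> q b = 0 \<and> g t \<noteq> 0" if "t \<in> K" for t
  proof -
    have "f t \<noteq> 0" "cmod t = 1" using that \<epsilon> by (auto simp: K_def)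
    then have "t \<notin> spec" using zero by blast
    then show ?thesis using \<open>cmod t = 1\<close> by (auto simp: spec_def)
  qed
  then obtain g b where g: "\<And>t. t \<in> K ==> continuous_on UNIV (g t)" "\<And>t. t \<in> K ==> fcalc (g t) (b t)"
    "\<And>t. t \<in> K ==> q (b t) = 0" "\<And>t. t \<in> K ==> g t t \<noteq> 0"
    by metis
  have "open {z. g t z \<noteq> 0}" if "t \<in> K" for t
    by (rule open_Collect_neq) (use g(1)[OF that] in auto)
  moreover have "K \<subseteq> (\<Union>t\<in>K. {z. g t z \<noteq> 0})" using g(4) by blast
  ultimately obtain T where T: "T \<subseteq> K" "finite T" "K \<subseteq> (\<Union>t\<in>T. {z. g t z \<noteq> 0})"
    using compactE_image[OF K, of K "\<lambda>t. {z. g t z \<noteq> 0}"] by metis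
  define s where "s z = (\<Sum>t\<in>T. (cmod (g t z))^2)" for z
  have s_cont: "continuous_on UNIV s"
    unfolding s_def using g(1) T(1) by (intro continuous_intros) auto
  have s_pos: "s z > 0" if z: "z \<in> K" for z
  proof -
    obtain t where "t \<in> T" "g t z \<noteq> 0" using T z by blast
    then show ?thesis unfolding s_def using T(2) by (intro sum_pos2[of _ t]) auto
  qed
  have s_nonneg: "0 \<le> s z" for z by (simp add: s_def sum_nonneg)
  obtain \<sigma> where \<sigma>: "\<sigma> > 0" "\<And>z. z \<in> K ==> \<sigma> \<le> s z"
  proof (cases "K = {}")
    case False
    then obtain z where "z \<in> K" "\<forall>y\<in>K. s z \<le> s y"
      using continuous_attains_inf[OF K, of s] continuous_on_subset[OF s_cont] by blast
    then show ?thesis using that[of "s z"] s_pos by blast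
  qed (use that[of 1] in auto)
  \<comment> \<open>Each summand contains a factor from the kernel, so \<open>S\<close> lies in the
    kernel; its function is the sum of squared moduli and hence positive on
    \<open>K\<close>.\<close>
  define S where "S = (\<Sum>t\<in>T. star (b t) \<otimes> b t)"
  have bV: "b t \<in> V" if "t \<in> T" for t using fcalc_closed[OF g(2)] T(1) that by blast
  have S: "fcalc (\<lambda>z. complex_of_real (s z)) S"
  proof -
    have "fcalc (\<lambda>z. \<Sum>t\<in>T. cnj (g t z) * g t z) S"
      unfolding S_def by (intro fcalc_sum fcalc_mult fcalc_star T(2) g(2)) (use T(1) in auto)
    moreover have "(\<lambda>z. \<Sum>t\<in>T. cnj (g t z) * g t z) = (\<lambda>z. complex_of_real (s z))"
      by (simp add: s_def complex_norm_square mult.commute del: of_real_power)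
    ultimately show ?thesis by simp
  qed
  have SV: "S \<in> V" by (rule fcalc_closed[OF S])
  have qS: "q S = 0"
    unfolding S_def using T(1) g(3) by (subst q_sum) (auto intro!: sum.neutral q_mul_0 simp: bV)
  \<comment> \<open>On \<open>K\<close> the maximum is \<open>s z\<close>, so h s = f there. Off
    \<open>K\<close> the difference f - h s is no larger than |f|, which is at most \<epsilon>;
    cutting at \<sigma> keeps \<open>h\<close> continuous on the whole plane.\<close>
  define h where "h z = f z * complex_of_real (inverse (max (s z) \<sigma>))" for z
  have pos: "max (s z) \<sigma> > 0" for z using \<sigma>(1) by (simp add: less_max_iff_disj)
  have "continuous_on UNIV (\<lambda>z. inverse (max (s z) \<sigma>))"
    using pos by (intro continuous_intros s_cont) (metis less_irrefl)
  then have "continuous_on UNIV h" unfolding h_def by (intro continuous_on_mult f continuous_on_of_real)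
  then obtain d where d: "fcalc h d" using fcalc_exists by blast
  have dV: "d \<in> V" by (rule fcalc_closed[OF d])
  have "N (a - d \<otimes> S) \<le> \<epsilon>"
  proof (rule fcalc_le[OF fcalc_diff[OF a fcalc_mult[OF d S]]])
    fix z :: complex assume z: "cmod z = 1"
    define r where "r = s z / max (s z) \<sigma>"
    have r: "0 \<le> r" "r \<le> 1" using pos[of z] s_nonneg[of z] by (auto simp: r_def divide_le_eq)
    have "f z - h z * complex_of_real (s z) = f z * complex_of_real (1 - r)"
      by (simp add: h_def r_def divide_inverse algebra_simps)
    then have eq: "cmod (f z - h z * complex_of_real (s z)) = cmod (f z) * (1 - r)"
      using r by (simp only: norm_mult norm_of_real abs_of_nonneg diff_ge_0_iff_ge)
    show "cmod (f z - h z * complex_of_real (s z)) \<le> \<epsilon>"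
    proof (cases "z \<in> K")
      case True
      then have "r = 1" using \<sigma>(2)[OF True] s_pos[OF True] by (simp add: r_def max_def)
      then show ?thesis using eq \<epsilon> by simp
    next
      case False
      then have "cmod (f z) \<le> \<epsilon>" using z by (auto simp: K_def)
      then have "cmod (f z) * (1 - r) \<le> \<epsilon> * 1" using r \<epsilon> by (intro mult_mono) auto
      then show ?thesis using eq by simp
    qed
  qed (use \<epsilon> in simp)
  moreover have "q (a - d \<otimes> S) = q a" using q_mul_0[OF dV SV] qS aV dV SV by (simp add: q_diff)
  ultimately show "\<exists>b\<in>V. q b = q a \<and> N b \<le> \<epsilon>" using aV dV SV by (intro bexI[of _ "a - d \<otimes> S"]) auto
qed

lemma q_fcalc_cong:
  assumes "continuous_on UNIV f" "continuous_on UNIV g" "fcalc f a" "fcalc g b" "\<And>t. t \<in> spec ==> f t = g t"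
  shows "q a = q b"
proof -
  have "q (a - b) = 0"
    by (rule q_fcalc_zero[OF _ _ fcalc_diff[OF assms(3,4)]]) (use assms in \<open>auto intro!: continuous_intros\<close>)
  then show ?thesis using q_diff[OF fcalc_closed[OF assms(3)] fcalc_closed[OF assms(4)]] by simp
qed

text \<open>\<open>q\<close> sees only the values of a function on the finite set
  \<open>spec\<close>, where sufficiently narrow bumps are the indicators of single points. The
  idempotent relations are therefore read off from functions on a finite set.\<close>

lemma unitary_spectral:
  obtains E where "\<And>t. E t \<in> V" "\<And>t. star (E t) = E t" "\<And>t. t \<in> spec ==> q (E t) \<noteq> 0"
    "\<And>s t. s \<in> spec ==> t \<in> spec ==> q (E s \<otimes> E t) = (if s = t then q (E t) else 0)"
    "q e = (\<Sum>t\<in>spec. q (E t))"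
    "\<And>t. t \<in> spec ==> q (v \<otimes> E t) = scale t (q (E t))"
    "\<And>t. t \<in> spec ==> q (E t \<otimes> v) = scale t (q (E t))"
proof -
  obtain \<delta> where \<delta>: "\<delta> > 0" "\<And>s t. s \<in> spec ==> t \<in> spec ==> s \<noteq> t ==> \<delta> \<le> dist s t"
    using ex_separation[OF finite_spec] by blast
  define f where "f t z = complex_of_real (bump \<delta> t z)" for t z
  have f_cont: "continuous_on UNIV (f t)" for t using continuous_bump[of \<delta> t] by (simp add: f_def[abs_def])
  have f_spec: "f t s = (if s = t then 1 else 0)" if "s \<in> spec" "t \<in> spec" for s t
    using \<delta> that by (auto simp: f_def bump_far)
  obtain E where E: "\<And>t. fcalc (f t) (E t)" using fcalc_exists[OF f_cont] by metis
  have EV: "E t \<in> V" for t by (rule fcalc_closed[OF E])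
  show ?thesis
  proof
    show "E t \<in> V" for t by (rule EV)
    show "star (E t) = E t" for t
      by (rule fcalc_unique[OF fcalc_star[OF E] E]) (simp add: f_def)
    show "q (E t) \<noteq> 0" if t: "t \<in> spec" for t
    proof
      assume "q (E t) = 0"
      then have "f t t = 0" using t f_cont[of t] E[of t] unfolding spec_def by blast
      then show False by (simp add: f_def)
    qed
    show "q (E s \<otimes> E t) = (if s = t then q (E t) else 0)" if st: "s \<in> spec" "t \<in> spec" for s t
    proof -
      have "q (E s \<otimes> E t) = q (scale (if s = t then 1 else 0) (E t))"
        by (rule q_fcalc_cong[OF _ _ fcalc_mult[OF E E] fcalc_cmult[OF E]])
          (use st in \<open>auto intro!: continuous_intros f_cont simp: f_spec\<close>)
      then show ?thesis by simp
    qed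
    show "q e = (\<Sum>t\<in>spec. q (E t))"
    proof -
      have "q (\<Sum>t\<in>spec. E t) = q (scale 1 e)"
      proof (rule q_fcalc_cong[OF _ _ fcalc_sum[OF finite_spec E] fcalc_laurent[OF laurent.const]])
        fix s assume "s \<in> spec"
        then show "(\<Sum>t\<in>spec. f t s) = 1" using finite_spec by (simp add: f_spec sum.delta cong: sum.cong)
      qed (auto intro!: continuous_intros f_cont)
      then show ?thesis using q_sum[of spec E] EV by simp
    qed
    show "q (v \<otimes> E t) = scale t (q (E t))" if t: "t \<in> spec" for t
    proof -
      have "q (v \<otimes> E t) = q (scale t (E t))"
        by (rule q_fcalc_cong[OF _ _ fcalc_mult[OF fcalc_laurent[OF laurent.ident] E] fcalc_cmult[OF E]])
          (use t in \<open>auto intro!: continuous_intros f_cont simp: f_spec\<close>)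
      then show ?thesis using EV by (simp add: q_scale)
    qed
    show "q (E t \<otimes> v) = scale t (q (E t))" if t: "t \<in> spec" for t
    proof -
      have "q (E t \<otimes> v) = q (scale t (E t))"
        by (rule q_fcalc_cong[OF _ _ fcalc_mult[OF E fcalc_laurent[OF laurent.ident]] fcalc_cmult[OF E]])
          (use t in \<open>auto intro!: continuous_intros f_cont simp: f_spec\<close>)
      then show ?thesis using EV by (simp add: q_scale)
    qed
  qed
qed

end

section \<open>From unitaries to selfadjoint elements\<close>

lemma scale_minus: "scale (- c) u = - scale c u"
  by (rule ext) (simp add: scale_apply)

context cstar_l1
begin

lemma N_zero [simp]: "N 0 = 0"
  by (rule seminormedD(7)[OF seminormed_A])

primrec pow :: "('i \<Rightarrow> complex) \<Rightarrow> nat \<Rightarrow> 'i \<Rightarrow> complex" where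
  "pow x 0 = e"
| "pow x (Suc n) = x \<otimes> pow x n"

lemma pow_closed [simp]: "x \<in> V ==> pow x n \<in> V"
  by (induction n) auto

lemma pow_commute: "x \<in> V ==> pow x n \<otimes> x = x \<otimes> pow x n"
  by (induction n) (auto simp: mul_assoc)

lemma N_pow: "x \<in> V ==> N x \<le> 1/2 ==> N (pow x n) \<le> (1/2) ^ n"
proof (induction n)
  case (Suc n)
  then have "N (pow x (Suc n)) \<le> N x * N (pow x n)" using N_mul[of x "pow x n"] by simp
  also have "\<dots> \<le> 1/2 * (1/2) ^ n" using Suc by (intro mult_mono) auto
  finally show ?case by simp
qed simp

text \<open>The partial sums of the geometric series telescope against e - x from either side,
  leaving the power of \<open>x\<close> that tends to 0.\<close>

lemma neumann:
  assumes x: "x \<in> V" and Nx: "N x \<le> 1/2"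
  shows "\<exists>w\<in>V. (e - x) \<otimes> w = e \<and> w \<otimes> (e - x) = e"
proof -
  define s where "s n = (\<Sum>k<n. pow x k)" for n
  have sV: "s n \<in> V" for n using x by (simp add: s_def)
  have diff: "N (s (n + d) - s n) \<le> 2 * (1/2) ^ n - 2 * (1/2) ^ (n + d)" for n d
  proof (induction d)
    case (Suc d)
    have "s (n + Suc d) - s n = (s (n + d) - s n) + pow x (n + d)" by (simp add: s_def)
    moreover have "N ((s (n + d) - s n) + pow x (n + d)) \<le> N (s (n + d) - s n) + N (pow x (n + d))"
      using sV x by (intro N_triangle) auto
    ultimately have "N (s (n + Suc d) - s n) \<le> N (s (n + d) - s n) + N (pow x (n + d))" by metis
    moreover have "N (s (n + d) - s n) \<le> 2 * (1/2) ^ n - 2 * (1/2) ^ (n + d)" by (rule Suc.IH)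
    ultimately have "N (s (n + Suc d) - s n) \<le> 2 * (1/2) ^ n - 2 * (1/2) ^ (n + Suc d)"
      using N_pow[OF x Nx, of "n + d"] by simp
    then show ?case .
  next
    case 0
    have "N (s (n + 0) - s n) \<le> 2 * (1/2) ^ n - 2 * (1/2) ^ (n + 0)" by simp
    then show ?case .
  qed
  have cau: "N (s m - s n) \<le> 2 * (1/2) ^ k" if "k \<le> n" "n \<le> m" for m n k
  proof -
    have "N (s m - s n) \<le> 2 * (1/2) ^ n" using diff[of n "m - n"] that by (simp add: order_trans)
    also have "\<dots> \<le> 2 * (1/2) ^ k" using that by (simp add: power_decreasing)
    finally show ?thesis .
  qed
  have small: "\<exists>k. 2 * (1/2) ^ k < \<epsilon>" if "\<epsilon> > 0" for \<epsilon> :: real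
    using real_arch_pow_inv[of "\<epsilon> / 2" "1/2"] that by (auto simp: field_simps)
  have "\<exists>k. \<forall>m\<ge>k. \<forall>n\<ge>k. N (s m - s n) < \<epsilon>" if \<epsilon>: "\<epsilon> > 0" for \<epsilon> :: real
  proof -
    obtain k where k: "2 * (1/2) ^ k < \<epsilon>" using small[OF \<epsilon>] by blast
    have "N (s m - s n) < \<epsilon>" if "m \<ge> k" "n \<ge> k" for m n
    proof (cases "n \<le> m")
      case True then show ?thesis using cau[OF that(2) True] k by linarith
    next
      case False
      then have "N (s n - s m) < \<epsilon>" using cau[OF that(1), of n] k by simp
      then show ?thesis using seminormed_diff(3)[OF seminormed_A sV sV, of n m] by simp
    qed
    then show ?thesis by blast
  qed
  then obtain w where w: "w \<in> V" "(\<lambda>n. N (s n - w)) \<longlonglongrightarrow> 0"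
    using banach_space sV unfolding banach_space_def by blast
  have tel: "(e - x) \<otimes> s n = e - pow x n" "s n \<otimes> (e - x) = e - pow x n" for n
  proof -
    show "(e - x) \<otimes> s n = e - pow x n"
    proof (induction n)
      case (Suc n)
      have IH: "(e - x) \<otimes> s n = e - pow x n" by (rule Suc.IH)
      have "(e - x) \<otimes> s (Suc n) = (e - x) \<otimes> s n + (e - x) \<otimes> pow x n" using x sV by (simp add: s_def mul_add_right)
      also have "\<dots> = e - pow x (Suc n)" using x by (simp add: IH mul_diff_left)
      finally show ?case .
    next
      case 0
      have "(e - x) \<otimes> s 0 = e - pow x 0" using x by (simp add: s_def)
      then show ?case .
    qed
    show "s n \<otimes> (e - x) = e - pow x n"
    proof (induction n)
      case (Suc n)
      have IH: "s n \<otimes> (e - x) = e - pow x n" by (rule Suc.IH)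
      have "s (Suc n) \<otimes> (e - x) = s n \<otimes> (e - x) + pow x n \<otimes> (e - x)" using x sV by (simp add: s_def mul_add_left)
      also have "\<dots> = e - pow x (Suc n)" using x by (simp add: IH mul_diff_right pow_commute)
      finally show ?case .
    next
      case 0
      have "s 0 \<otimes> (e - x) = e - pow x 0" using x by (simp add: s_def)
      then show ?case .
    qed
  qed
  have lim: "(\<lambda>n. N (e - x) * N (s n - w) + (1/2) ^ n) \<longlonglongrightarrow> N (e - x) * 0 + 0"
    by (intro tendsto_intros w(2) LIMSEQ_power_zero) simp
  have "(e - x) \<otimes> w - e = 0"
  proof -
    have "N ((e - x) \<otimes> w - e) \<le> N (e - x) * N (s n - w) + (1/2) ^ n" for n
    proof -
      have "(e - x) \<otimes> w - e = - ((e - x) \<otimes> (s n - w)) + - pow x n"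
        using x sV w(1) tel(1)[of n] by (simp add: mul_diff_right)
      then have "N ((e - x) \<otimes> w - e) \<le> N (- ((e - x) \<otimes> (s n - w))) + N (- pow x n)"
        using N_triangle[of "- ((e - x) \<otimes> (s n - w))" "- pow x n"] x sV w(1) by simp
      also have "\<dots> = N ((e - x) \<otimes> (s n - w)) + N (pow x n)"
        using seminormed_uminus(2)[OF seminormed_A] x sV w(1) by simp
      also have "\<dots> \<le> N (e - x) * N (s n - w) + (1/2) ^ n"
        using N_mul[of "e - x" "s n - w"] N_pow[OF x Nx, of n] x sV w(1) by (intro add_mono) auto
      finally show ?thesis .
    qed
    then have "N ((e - x) \<otimes> w - e) \<le> 0" using LIMSEQ_le_const[OF lim] by simp
    moreover have "0 \<le> N ((e - x) \<otimes> w - e)" using x w(1) by (intro N_nonneg) auto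
    ultimately have "N ((e - x) \<otimes> w - e) = 0" by linarith
    then show ?thesis using x w(1) by (subst (asm) N_eq_0) auto
  qed
  moreover have "w \<otimes> (e - x) - e = 0"
  proof -
    have "N (w \<otimes> (e - x) - e) \<le> N (e - x) * N (s n - w) + (1/2) ^ n" for n
    proof -
      have "w \<otimes> (e - x) - e = - ((s n - w) \<otimes> (e - x)) + - pow x n"
        using x sV w(1) tel(2)[of n] by (simp add: mul_diff_left)
      then have "N (w \<otimes> (e - x) - e) \<le> N (- ((s n - w) \<otimes> (e - x))) + N (- pow x n)"
        using N_triangle[of "- ((s n - w) \<otimes> (e - x))" "- pow x n"] x sV w(1) by simp
      also have "\<dots> = N ((s n - w) \<otimes> (e - x)) + N (pow x n)"
        using seminormed_uminus(2)[OF seminormed_A] x sV w(1) by simp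
      also have "\<dots> \<le> N (e - x) * N (s n - w) + (1/2) ^ n"
        using N_mul[of "s n - w" "e - x"] N_pow[OF x Nx, of n] x sV w(1) by (intro add_mono) (auto simp: mult.commute)
      finally show ?thesis .
    qed
    then have "N (w \<otimes> (e - x) - e) \<le> 0" using LIMSEQ_le_const[OF lim] by simp
    moreover have "0 \<le> N (w \<otimes> (e - x) - e)" using x w(1) by (intro N_nonneg) auto
    ultimately have "N (w \<otimes> (e - x) - e) = 0" by linarith
    then show ?thesis using x w(1) by (subst (asm) N_eq_0) auto
  qed
  ultimately show ?thesis using w(1) by auto
qed

text \<open>v = (e + \<i> h) (e - \<i> h)^(-1), the inverse coming from the Neumann series. The
  relation is recorded without inverses and with \<open>h\<close> on either side, the form in which
  eigenvalue equations for \<open>v\<close> translate into ones for \<open>h\<close>.\<close>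

lemma cayley:
  assumes h: "h \<in> V" "star h = h" "N h \<le> 1/2"
  obtains v where "v \<in> V" "star v \<otimes> v = e" "v \<otimes> star v = e"
    "v - e = scale \<i> (h + v \<otimes> h)" "v - e = scale \<i> (h + h \<otimes> v)"
proof -
  let ?u = "e - scale \<i> h" and ?u' = "e + scale \<i> h"
  have "N (scale \<i> h) \<le> 1/2" using h by (simp add: N_scale)
  then obtain w where w: "w \<in> V" "?u \<otimes> w = e" "w \<otimes> ?u = e" using neumann[of "scale \<i> h"] h(1) by auto
  have u: "?u \<in> V" "?u' \<in> V" using h by simp_all
  have star_u: "star ?u = ?u'" "star ?u' = ?u" using h by (simp_all add: star_diff star_add star_scale scale_minus)
  have comm: "?u \<otimes> ?u' = ?u' \<otimes> ?u" using h by (simp add: mul_diff_left mul_diff_right mul_add_left mul_add_right)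
  have sw: "?u' \<otimes> star w = e" "star w \<otimes> ?u' = e"
    using star_mul[OF w(1) u(1)] star_mul[OF u(1) w(1)] w star_u by simp_all
  define v where "v = ?u' \<otimes> w"
  have vV: "v \<in> V" using u w by (simp add: v_def)
  have v2: "v = w \<otimes> ?u'"
  proof -
    have "v = (w \<otimes> ?u) \<otimes> (?u' \<otimes> w)" using vV w by (simp add: v_def)
    also have "\<dots> = w \<otimes> ((?u \<otimes> ?u') \<otimes> w)" using u w(1) by (simp only: mul_assoc mul_closed)
    also have "\<dots> = w \<otimes> ((?u' \<otimes> ?u) \<otimes> w)" by (simp only: comm)
    also have "\<dots> = w \<otimes> (?u' \<otimes> (?u \<otimes> w))" using u w(1) by (simp only: mul_assoc mul_closed)
    also have "\<dots> = w \<otimes> ?u'" using u by (simp add: w(2))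
    finally show ?thesis .
  qed
  have sv: "star v = star w \<otimes> ?u" using star_mul[OF u(2) w(1)] star_u by (simp add: v_def)
  have sv2: "star v = ?u \<otimes> star w" using star_mul[OF w(1) u(2)] star_u v2 by simp
  show ?thesis
  proof
    show "v \<in> V" by (rule vV)
    have "star v \<otimes> v = (star w \<otimes> ?u) \<otimes> (w \<otimes> ?u')" using sv v2 by simp
    also have "\<dots> = star w \<otimes> ((?u \<otimes> w) \<otimes> ?u')" using u w(1) by (simp only: mul_assoc mul_closed star_closed)
    also have "\<dots> = e" using u by (simp add: w(2) sw)
    finally show "star v \<otimes> v = e" .
    have "v \<otimes> star v = (?u' \<otimes> w) \<otimes> (?u \<otimes> star w)" using sv2 by (simp add: v_def)
    also have "\<dots> = ?u' \<otimes> ((w \<otimes> ?u) \<otimes> star w)" using u w(1) by (simp only: mul_assoc mul_closed star_closed)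
    also have "\<dots> = e" using w(1) by (simp add: w(3) sw)
    finally show "v \<otimes> star v = e" .
    have "v \<otimes> ?u = ?u' \<otimes> (w \<otimes> ?u)" using u w(1) by (simp only: v_def mul_assoc)
    then have "v \<otimes> ?u = ?u'" using u by (simp add: w(3))
    then have "v - scale \<i> (v \<otimes> h) = e + scale \<i> h" using vV h(1) by (simp add: mul_diff_right mul_scale_right)
    then show "v - e = scale \<i> (h + v \<otimes> h)" by (simp add: scale_add_right algebra_simps)
    have "?u \<otimes> v = (?u \<otimes> w) \<otimes> ?u'" using u w(1) by (simp only: v2 mul_assoc)
    then have "?u \<otimes> v = ?u'" using u by (simp add: w(2))
    then have "v - scale \<i> (h \<otimes> v) = e + scale \<i> h" using vV h(1) by (simp add: mul_diff_left mul_scale_left)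
    then show "v - e = scale \<i> (h + h \<otimes> v)" by (simp add: scale_add_right algebra_simps)
  qed
qed

lemma selfadjoint_spectral_small:
  assumes h: "h \<in> V" "star h = h" "N h \<le> 1/2"
  obtains F :: "complex set" and E lm where "finite F" "card F \<le> nat \<lfloor>16 * C^2\<rfloor>"
    "\<And>t. E t \<in> V" "\<And>t. star (E t) = E t" "\<And>t. t \<in> F ==> q (E t) \<noteq> 0"
    "\<And>s t. s \<in> F ==> t \<in> F ==> q (E s \<otimes> E t) = (if s = t then q (E t) else 0)"
    "q e = (\<Sum>t\<in>F. q (E t))"
    "\<And>t. t \<in> F ==> q (h \<otimes> E t) = scale (lm t) (q (E t))"
    "\<And>t. t \<in> F ==> q (E t \<otimes> h) = scale (lm t) (q (E t))"
proof -
  obtain v where v: "v \<in> V" "star v \<otimes> v = e" "v \<otimes> star v = e"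
    "v - e = scale \<i> (h + v \<otimes> h)" "v - e = scale \<i> (h + h \<otimes> v)" by (rule cayley[OF h]) (rule that; assumption)
  interpret cstar_unitary A star e q C v using v(1-3) by unfold_locales
  obtain E where E: "\<And>t. E t \<in> V" "\<And>t. star (E t) = E t" "\<And>t. t \<in> spec ==> q (E t) \<noteq> 0"
    "\<And>s t. s \<in> spec ==> t \<in> spec ==> q (E s \<otimes> E t) = (if s = t then q (E t) else 0)"
    "q e = (\<Sum>t\<in>spec. q (E t))"
    "\<And>t. t \<in> spec ==> q (v \<otimes> E t) = scale t (q (E t))"
    "\<And>t. t \<in> spec ==> q (E t \<otimes> v) = scale t (q (E t))"
    by (rule unitary_spectral) (rule that; assumption)
  \<comment> \<open>The inverse Cayley transform of the point t.\<close>
  define lm where "lm t = (t - 1) / (\<i> * (1 + t))" for t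
  have solve: "y = scale (lm t) x" if eq: "scale t x - x = scale \<i> (y + scale t y)" and x: "x \<noteq> 0" for x y :: "'g \<Rightarrow> complex" and t
  proof -
    have eq': "(t - 1) * x i = \<i> * (1 + t) * y i" for i
      using fun_cong[OF eq, of i] by (simp add: scale_apply algebra_simps)
    \<comment> \<open>At t = -1 the right side of the eigenvalue equation vanishes while the left is
      -2x, which is impossible for nonzero x.\<close>
    have "t \<noteq> - 1"
    proof
      assume t: "t = - 1"
      have "x i = 0" for i using eq'[of i] t by simp
      then show False using x by (auto simp: fun_eq_iff)
    qed
    then have "\<i> * (1 + t) \<noteq> 0" by (metis add_eq_0_iff2 add.inverse_inverse complex_i_not_zero mult_eq_0_iff)
    then show ?thesis using eq' by (auto simp: fun_eq_iff scale_apply lm_def field_simps)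
  qed
  show ?thesis
  proof (rule that[of spec E lm])
    fix t assume t: "t \<in> spec"
    note EV = E(1)[of t]
    have "q (h \<otimes> v \<otimes> E t) = q (h \<otimes> scale t (E t))"
      using q_mul_cong[of h h "v \<otimes> E t" "scale t (E t)"] h v(1) EV E(6)[OF t] by (simp add: mul_assoc q_scale)
    moreover have "(v - e) \<otimes> E t = scale \<i> (h + h \<otimes> v) \<otimes> E t" using v(5) by simp
    then have "v \<otimes> E t - E t = scale \<i> (h \<otimes> E t + h \<otimes> v \<otimes> E t)"
      using h(1) v(1) EV by (simp add: mul_diff_left mul_scale_left mul_add_left)
    then have "q (v \<otimes> E t - E t) = q (scale \<i> (h \<otimes> E t + h \<otimes> v \<otimes> E t))" by simp
    ultimately have "scale t (q (E t)) - q (E t) = scale \<i> (q (h \<otimes> E t) + scale t (q (h \<otimes> E t)))"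
      using h(1) v(1) EV E(6)[OF t] by (simp add: q_diff q_add q_scale mul_scale_right)
    then show "q (h \<otimes> E t) = scale (lm t) (q (E t))" by (rule solve) (rule E(3)[OF t])
    have "q (E t \<otimes> (v \<otimes> h)) = q (scale t (E t) \<otimes> h)"
      using q_mul_cong[of "E t \<otimes> v" "scale t (E t)" h h] h v(1) EV E(7)[OF t] by (simp add: mul_assoc q_scale)
    moreover have "E t \<otimes> (v - e) = E t \<otimes> scale \<i> (h + v \<otimes> h)" using v(4) by simp
    then have "E t \<otimes> v - E t = scale \<i> (E t \<otimes> h + E t \<otimes> (v \<otimes> h))"
      using h(1) v(1) EV by (simp add: mul_diff_right mul_scale_right mul_add_right)
    then have "q (E t \<otimes> v - E t) = q (scale \<i> (E t \<otimes> h + E t \<otimes> (v \<otimes> h)))" by simp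
    ultimately have "scale t (q (E t)) - q (E t) = scale \<i> (q (E t \<otimes> h) + scale t (q (E t \<otimes> h)))"
      using h(1) v(1) EV E(7)[OF t] by (simp add: q_diff q_add q_scale mul_scale_left)
    then show "q (E t \<otimes> h) = scale (lm t) (q (E t))" by (rule solve) (rule E(3)[OF t])
  qed (use E finite_spec card_spec in auto)
qed

lemma selfadjoint_spectral:
  assumes h: "h \<in> V" "star h = h"
  obtains F :: "complex set" and E lm where "finite F" "card F \<le> nat \<lfloor>16 * C^2\<rfloor>"
    "\<And>t. E t \<in> V" "\<And>t. star (E t) = E t" "\<And>t. t \<in> F ==> q (E t) \<noteq> 0"
    "\<And>s t. s \<in> F ==> t \<in> F ==> q (E s \<otimes> E t) = (if s = t then q (E t) else 0)"
    "q e = (\<Sum>t\<in>F. q (E t))"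
    "\<And>t. t \<in> F ==> q (h \<otimes> E t) = scale (lm t) (q (E t))"
    "\<And>t. t \<in> F ==> q (E t \<otimes> h) = scale (lm t) (q (E t))"
proof -
  \<comment> \<open>Scaling to norm at most 1/2, where the Cayley transform is available;
    idempotents are unaffected and eigenvalues are divided by \<open>r\<close>.\<close>
  define r where "r = 1 / (2 * (N h + 1))"
  have r: "r > 0" using h(1) by (simp add: r_def add_nonneg_pos)
  let ?k = "scale (complex_of_real r) h"
  have ks: "star ?k = ?k" using h by (simp add: star_scale)
  have kN: "N ?k \<le> 1/2" using h r by (simp add: N_scale) (simp add: r_def field_simps)
  have kV: "?k \<in> V" using h by simp
  obtain F :: "complex set" and E lm where
    F: "finite F" "card F \<le> nat \<lfloor>16 * C^2\<rfloor>" and EV: "\<And>t. E t \<in> V" and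
    E: "\<And>t. star (E t) = E t" "\<And>t. t \<in> F ==> q (E t) \<noteq> 0"
    "\<And>s t. s \<in> F ==> t \<in> F ==> q (E s \<otimes> E t) = (if s = t then q (E t) else 0)"
    "q e = (\<Sum>t\<in>F. q (E t))" and
    k: "\<And>t. t \<in> F ==> q (?k \<otimes> E t) = scale (lm t) (q (E t))"
    "\<And>t. t \<in> F ==> q (E t \<otimes> ?k) = scale (lm t) (q (E t))"
    by (rule selfadjoint_spectral_small[OF kV ks kN]) (rule that; assumption)
  have un: "x = scale (l / complex_of_real r) y" if "scale (complex_of_real r) x = scale l y" for x y :: "'g \<Rightarrow> complex" and l
  proof -
    have "scale (inverse (complex_of_real r)) (scale (complex_of_real r) x) = scale (inverse (complex_of_real r)) (scale l y)"
      using that by simp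
    then show ?thesis using r by (simp add: divide_inverse mult.commute)
  qed
  show ?thesis
  proof (rule that[of F E "\<lambda>t. lm t / complex_of_real r"])
    fix t assume t: "t \<in> F"
    show "q (h \<otimes> E t) = scale (lm t / complex_of_real r) (q (E t))"
      by (rule un) (use k(1)[OF t] h(1) EV in \<open>simp add: mul_scale_left q_scale\<close>)
    show "q (E t \<otimes> h) = scale (lm t / complex_of_real r) (q (E t))"
      by (rule un) (use k(2)[OF t] h(1) EV in \<open>simp add: mul_scale_right q_scale\<close>)
  qed (use F EV E in auto)
qed

end

section \<open>Orthogonal idempotents and finite dimension of the image\<close>

interpretation fun_space: vector_space "scale :: complex \<Rightarrow> ('i \<Rightarrow> complex) \<Rightarrow> 'i \<Rightarrow> complex"
  by unfold_locales (simp_all add: scale_add_left scale_add_right)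

context cstar_l1
begin

text \<open>Representatives of pairwise orthogonal nonzero projections: selfadjointness holds in the
  algebra itself, idempotence and orthogonality only modulo the kernel.\<close>

definition orth :: "(nat \<Rightarrow> 'i \<Rightarrow> complex) \<Rightarrow> nat \<Rightarrow> bool" where
  "orth f m \<longleftrightarrow> (\<forall>i<m. f i \<in> V \<and> star (f i) = f i \<and> q (f i) \<noteq> 0) \<and>
     (\<forall>i<m. \<forall>j<m. q (f i \<otimes> f j) = (if i = j then q (f i) else 0))"

lemma orthD:
  assumes "orth f m" "i < m"
  shows "f i \<in> V" "star (f i) = f i" "q (f i) \<noteq> 0"
    "j < m ==> q (f i \<otimes> f j) = (if i = j then q (f i) else 0)"
  using assms unfolding orth_def by blast+

lemma q_mul_left_cong: "a \<in> V ==> a' \<in> V ==> b \<in> V ==> q a = q a' ==> q (a \<otimes> b) = q (a' \<otimes> b)"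
  and q_mul_right_cong: "a \<in> V ==> b \<in> V ==> b' \<in> V ==> q b = q b' ==> q (a \<otimes> b) = q (a \<otimes> b')"
  by (rule q_mul_cong; (assumption | rule refl))+

lemma q_split_left:
  assumes "finite I" "\<And>i. i \<in> I ==> f i \<in> V" "q e = (\<Sum>i\<in>I. q (f i))" "a \<in> V"
  shows "q a = (\<Sum>i\<in>I. q (f i \<otimes> a))"
proof -
  have "q (e \<otimes> a) = q (sum f I \<otimes> a)" using assms by (intro q_mul_left_cong) (simp_all add: q_sum)
  also have "\<dots> = (\<Sum>i\<in>I. q (f i \<otimes> a))" using assms by (simp add: mul_sum_left q_sum)
  finally show ?thesis using assms by simp
qed

lemma q_split_right:
  assumes "finite I" "\<And>i. i \<in> I ==> f i \<in> V" "q e = (\<Sum>i\<in>I. q (f i))" "a \<in> V"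
  shows "q a = (\<Sum>i\<in>I. q (a \<otimes> f i))"
proof -
  have "q (a \<otimes> e) = q (a \<otimes> sum f I)" using assms by (intro q_mul_right_cong) (simp_all add: q_sum)
  also have "\<dots> = (\<Sum>i\<in>I. q (a \<otimes> f i))" using assms by (simp add: mul_sum_right q_sum)
  finally show ?thesis using assms by simp
qed

lemma scale_eq_scale: "scale a u = scale b u ==> u \<noteq> 0 ==> a = b"
  by (metis fun_space.scale_right_imp_eq)

text \<open>The selfadjoint sum of the i f_i has the distinct eigenvalues 0, ..., m - 1. An
  eigenvalue missing from its spectral decomposition would make all components of the corresponding
  f_i vanish, so \<open>m\<close> is at most the number of spectral points.\<close>

lemma orth_bound:
  assumes f: "orth f m" shows "m \<le> nat \<lfloor>16 * C^2\<rfloor>"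
proof -
  note fD = orthD[OF f]
  define h where "h = (\<Sum>i<m. scale (of_nat i) (f i))"
  have hV: "h \<in> V" unfolding h_def by (intro sum_closed scale_closed fD(1)) simp
  have "star h = h" unfolding h_def using fD(1,2) by (subst star_sum) (simp_all add: star_scale)
  then obtain F :: "complex set" and E lm where F: "finite F" "card F \<le> nat \<lfloor>16 * C^2\<rfloor>"
    and EV: "\<And>t. E t \<in> V" and Ee: "q e = (\<Sum>t\<in>F. q (E t))"
    and Eh: "\<And>t. t \<in> F ==> q (E t \<otimes> h) = scale (lm t) (q (E t))"
    by (rule selfadjoint_spectral[OF hV]) (rule that; assumption)
  have "\<exists>t\<in>F. lm t = of_nat i" if i: "i < m" for i
  proof (rule ccontr)
    assume no: "\<not> (\<exists>t\<in>F. lm t = of_nat i)"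
    have hf: "q (h \<otimes> f i) = scale (of_nat i) (q (f i))"
    proof -
      have "h \<otimes> f i = (\<Sum>j<m. scale (of_nat j) (f j) \<otimes> f i)"
        unfolding h_def by (intro mul_sum_left scale_closed fD(1) i) simp
      also have "\<dots> = (\<Sum>j<m. scale (of_nat j) (f j \<otimes> f i))"
        by (intro sum.cong refl mul_scale_left fD(1) i) simp
      finally have "q (h \<otimes> f i) = q (\<Sum>j<m. scale (of_nat j) (f j \<otimes> f i))" by simp
      also have "\<dots> = (\<Sum>j<m. q (scale (of_nat j) (f j \<otimes> f i)))"
        by (intro q_sum scale_closed mul_closed fD(1) i) simp
      also have "\<dots> = (\<Sum>j<m. scale (of_nat j) (q (f j \<otimes> f i)))"
        by (intro sum.cong refl q_scale mul_closed fD(1) i) simp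
      also have "\<dots> = (\<Sum>j<m. if j = i then scale (of_nat i) (q (f i)) else 0)"
        using fD(4) i by (intro sum.cong) auto
      also have "\<dots> = scale (of_nat i) (q (f i))" using i by simp
      finally show ?thesis .
    qed
    have "q (E t \<otimes> f i) = 0" if t: "t \<in> F" for t
    proof (rule ccontr)
      assume nz: "q (E t \<otimes> f i) \<noteq> 0"
      have "q (E t \<otimes> h \<otimes> f i) = q (scale (lm t) (E t) \<otimes> f i)"
        using EV hV fD(1)[OF i] Eh[OF t] by (intro q_mul_left_cong) (simp_all add: q_scale)
      moreover have "q (E t \<otimes> (h \<otimes> f i)) = q (E t \<otimes> scale (of_nat i) (f i))"
        using EV hV fD(1)[OF i] hf by (intro q_mul_right_cong) (simp_all add: q_scale)
      ultimately have "scale (lm t) (q (E t \<otimes> f i)) = scale (of_nat i) (q (E t \<otimes> f i))"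
        using EV hV fD(1)[OF i] by (auto simp: mul_assoc mul_scale_left mul_scale_right q_scale)
      then have "lm t = of_nat i" using nz by (rule scale_eq_scale)
      then show False using no t by blast
    qed
    then have "q (f i) = 0" using q_split_left[OF F(1) EV Ee fD(1)[OF i]] by simp
    then show False using fD(3)[OF i] by simp
  qed
  then obtain \<tau> where \<tau>: "\<And>i. i < m ==> \<tau> i \<in> F \<and> lm (\<tau> i) = of_nat i" by metis
  have "inj_on \<tau> {..<m}" by (rule inj_onI) (metis \<tau> lessThan_iff of_nat_eq_iff)
  then have "card {..<m} \<le> card F" using \<tau> F(1) by (intro card_inj_on_le[of \<tau>]) auto
  then show ?thesis using F(2) by simp
qed

lemma ex_maximal_orth: "\<exists>f m. orth f m \<and> (\<forall>g. \<not> orth g (Suc m))"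
proof -
  have "\<exists>m. (\<exists>f. orth f m) \<and> (\<forall>k. (\<exists>f. orth f k) \<longrightarrow> k \<le> m)"
    by (rule Nat.ex_has_greatest_nat[of "\<lambda>m. \<exists>f. orth f m" 0 "nat \<lfloor>16 * C^2\<rfloor>"]) (auto simp: orth_bound orth_def[of _ 0])
  then obtain f m where "orth f m" "\<And>g k. orth g k ==> k \<le> m" by blast
  then have "orth f m \<and> (\<forall>g. \<not> orth g (Suc m))" using Suc_n_not_le_n by blast
  then show ?thesis by blast
qed

text \<open>Otherwise the remainder \<open>r\<close>, the unit minus the sum, is a further
  selfadjoint idempotent modulo the kernel, orthogonal to all others, and extends the
  family.\<close>

lemma maximal_orth_complete:
  assumes f: "orth f m" and max: "\<And>g. \<not> orth g (Suc m)"
  shows "q e = (\<Sum>i<m. q (f i))"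
proof (rule ccontr)
  note fD = orthD[OF f]
  define r where "r = e - (\<Sum>i<m. f i)"
  have rV: "r \<in> V" unfolding r_def by (intro diff_closed e_closed sum_closed fD(1)) simp
  assume "q e \<noteq> (\<Sum>i<m. q (f i))"
  moreover have sV: "sum f {..<m} \<in> V" by (intro sum_closed fD(1)) simp
  moreover have qs: "q (sum f {..<m}) = (\<Sum>i<m. q (f i))" by (intro q_sum fD(1)) simp
  ultimately have "q r \<noteq> 0" unfolding r_def by (simp add: q_diff)
  moreover have "star (sum f {..<m}) = sum f {..<m}"
    by (subst star_sum) (auto intro: fD(1) simp: fD(2))
  then have "star r = r" unfolding r_def using sV by (simp add: star_diff)
  moreover have left: "q (r \<otimes> f j) = 0" if j: "j < m" for j
  proof -
    have "sum f {..<m} \<otimes> f j = (\<Sum>i<m. f i \<otimes> f j)" by (intro mul_sum_left fD(1) j) simp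
    then have "r \<otimes> f j = f j - (\<Sum>i<m. f i \<otimes> f j)" using fD(1)[OF j] sV by (simp add: r_def mul_diff_left)
    moreover have "q (\<Sum>i<m. f i \<otimes> f j) = (\<Sum>i<m. q (f i \<otimes> f j))" by (intro q_sum mul_closed fD(1) j) simp
    moreover have "(\<Sum>i<m. f i \<otimes> f j) \<in> V" by (intro sum_closed mul_closed fD(1) j) simp
    ultimately have "q (r \<otimes> f j) = q (f j) - (\<Sum>i<m. q (f i \<otimes> f j))" using fD(1)[OF j] by (simp add: q_diff)
    moreover have "(\<Sum>i<m. q (f i \<otimes> f j)) = (\<Sum>i<m. if i = j then q (f j) else 0)" using fD(4) j by (intro sum.cong) auto
    moreover have "(\<Sum>i<m. if i = j then q (f j) else 0) = q (f j)" using j by simp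
    ultimately show ?thesis by simp
  qed
  moreover have "q (f j \<otimes> r) = 0" if j: "j < m" for j
  proof -
    have "f j \<otimes> sum f {..<m} = (\<Sum>i<m. f j \<otimes> f i)" by (intro mul_sum_right fD(1) j) simp
    then have "f j \<otimes> r = f j - (\<Sum>i<m. f j \<otimes> f i)" using fD(1)[OF j] sV by (simp add: r_def mul_diff_right)
    moreover have "q (\<Sum>i<m. f j \<otimes> f i) = (\<Sum>i<m. q (f j \<otimes> f i))" by (intro q_sum mul_closed fD(1) j) simp
    moreover have "(\<Sum>i<m. f j \<otimes> f i) \<in> V" by (intro sum_closed mul_closed fD(1) j) simp
    ultimately have "q (f j \<otimes> r) = q (f j) - (\<Sum>i<m. q (f j \<otimes> f i))" using fD(1)[OF j] by (simp add: q_diff)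
    moreover have "(\<Sum>i<m. q (f j \<otimes> f i)) = (\<Sum>i<m. if i = j then q (f j) else 0)" using fD(4) j by (intro sum.cong) auto
    moreover have "(\<Sum>i<m. if i = j then q (f j) else 0) = q (f j)" using j by simp
    ultimately show ?thesis by simp
  qed
  moreover have "q (r \<otimes> r) = q r"
  proof -
    have "r \<otimes> r = r \<otimes> (e - sum f {..<m})" by (simp add: r_def)
    also have "\<dots> = r - r \<otimes> sum f {..<m}" using sV rV by (simp add: mul_diff_right)
    finally have "q (r \<otimes> r) = q r - q (r \<otimes> sum f {..<m})" using sV rV by (simp add: q_diff)
    moreover have "r \<otimes> sum f {..<m} = (\<Sum>i<m. r \<otimes> f i)" by (intro mul_sum_right fD(1) rV) simp
    moreover have "q (\<Sum>i<m. r \<otimes> f i) = (\<Sum>i<m. q (r \<otimes> f i))" by (intro q_sum mul_closed fD(1) rV) simp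
    ultimately show ?thesis using left by simp
  qed
  moreover have "(f(m := r)) i = (if i = m then r else f i)" for i by simp
  moreover have "i = m \<or> i < m" if "i < Suc m" for i using that by auto
  ultimately have "orth (f(m := r)) (Suc m)" using fD rV unfolding orth_def by (smt (verit) nat_neq_iff)
  then show False using max by blast
qed

text \<open>In a family of maximal length no member can be split. A spectral idempotent of f c f
  with nonzero eigenvalue lies below f; being unable to split f, it must agree with f modulo the
  kernel, so f c f is a multiple of f.\<close>

lemma corner_selfadjoint:
  assumes f: "orth f m" and max: "\<And>g. \<not> orth g (Suc m)" and i: "i < m" and c: "c \<in> V" "star c = c"
  shows "\<exists>\<mu>. q (f i \<otimes> c \<otimes> f i) = scale \<mu> (q (f i))"
proof -
  note fD = orthD[OF f]
  note fV = fD(1)[OF i]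
  have ff: "q (f i \<otimes> f i) = q (f i)" using fD(4)[OF i i] by simp
  define x where "x = f i \<otimes> c \<otimes> f i"
  have xV: "x \<in> V" using c fV by (simp add: x_def)
  have "star x = x" using c fV fD(2)[OF i] by (simp add: x_def star_mul mul_assoc)
  then obtain F :: "complex set" and E lm where F: "finite F"
    and EV: "\<And>t. E t \<in> V" and Es: "\<And>t. star (E t) = E t" and E0: "\<And>t. t \<in> F ==> q (E t) \<noteq> 0"
    and EE: "\<And>s t. s \<in> F ==> t \<in> F ==> q (E s \<otimes> E t) = (if s = t then q (E t) else 0)"
    and Ee: "q e = (\<Sum>t\<in>F. q (E t))"
    and xE: "\<And>t. t \<in> F ==> q (x \<otimes> E t) = scale (lm t) (q (E t))"
    and Ex: "\<And>t. t \<in> F ==> q (E t \<otimes> x) = scale (lm t) (q (E t))"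
    by (rule selfadjoint_spectral[OF xV]) (rule that; assumption)
  have xf: "q (x \<otimes> f i) = q x"
  proof -
    have "q (f i \<otimes> c \<otimes> (f i \<otimes> f i)) = q (f i \<otimes> c \<otimes> f i)" using fV c ff by (intro q_mul_right_cong) auto
    then show ?thesis using fV c by (simp add: x_def mul_assoc)
  qed
  have fx: "q (f i \<otimes> x) = q x"
  proof -
    have "q (f i \<otimes> f i \<otimes> (c \<otimes> f i)) = q (f i \<otimes> (c \<otimes> f i))" using fV c ff by (intro q_mul_left_cong) auto
    then show ?thesis using fV c by (simp add: x_def mul_assoc)
  qed
  show ?thesis
  proof (cases "\<forall>t\<in>F. lm t = 0")
    case True
    then have "q x = 0" using q_split_right[OF F EV Ee xV] xE by simp
    then show ?thesis by (intro exI[of _ 0]) (simp add: x_def)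
  next
    case False
    \<comment> \<open>Dividing by the nonzero eigenvalue shows that \<open>E t\<close> is absorbed
      by \<open>f i\<close> on both sides, because \<open>x\<close> is.\<close>
    then obtain t where t: "t \<in> F" "lm t \<noteq> 0" by blast
    have Ef: "q (E t \<otimes> f i) = q (E t)"
    proof -
      have "q (E t \<otimes> x \<otimes> f i) = q (scale (lm t) (E t) \<otimes> f i)"
        using EV xV fV Ex[OF t(1)] by (intro q_mul_left_cong) (simp_all add: q_scale)
      moreover have "q (E t \<otimes> (x \<otimes> f i)) = q (E t \<otimes> x)" using EV xV fV xf by (intro q_mul_right_cong) simp_all
      ultimately have "scale (lm t) (q (E t)) = scale (lm t) (q (E t \<otimes> f i))"
        using EV xV fV Ex[OF t(1)] by (simp add: mul_assoc mul_scale_left q_scale)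
      then show ?thesis using fun_space.scale_left_imp_eq[OF t(2)] by metis
    qed
    have fE: "q (f i \<otimes> E t) = q (E t)"
    proof -
      have "q (f i \<otimes> (x \<otimes> E t)) = q (f i \<otimes> scale (lm t) (E t))"
        using EV xV fV xE[OF t(1)] by (intro q_mul_right_cong) (simp_all add: q_scale)
      moreover have "q (f i \<otimes> x \<otimes> E t) = q (x \<otimes> E t)" using EV xV fV fx by (intro q_mul_left_cong) simp_all
      ultimately have "scale (lm t) (q (E t)) = scale (lm t) (q (f i \<otimes> E t))"
        using EV xV fV xE[OF t(1)] by (auto simp: mul_assoc mul_scale_right q_scale)
      then show ?thesis using fun_space.scale_left_imp_eq[OF t(2)] by metis
    qed
    show ?thesis
    proof (cases "q (E t) = q (f i)")
      case True
      have "q (x \<otimes> f i) = q (x \<otimes> E t)" using True EV xV fV by (intro q_mul_right_cong) simp_all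
      then have "q x = scale (lm t) (q (f i))" using xf xE[OF t(1)] True by simp
      then show ?thesis unfolding x_def ..
    next
      case False
      have Et: "q (E t \<otimes> E t) = q (E t)" using EE[OF t(1) t(1)] by simp
      have Ej: "q (E t \<otimes> f j) = 0" if j: "j < m" "j \<noteq> i" for j
      proof -
        have "q (E t \<otimes> f i \<otimes> f j) = q (E t \<otimes> f j)" using EV fV fD(1)[OF j(1)] Ef by (intro q_mul_left_cong) simp_all
        moreover have "q (E t \<otimes> (f i \<otimes> f j)) = 0" using EV fV fD(1)[OF j(1)] fD(4)[OF i j(1)] j(2) by (intro q_mul_0) simp_all
        ultimately show ?thesis using EV fV fD(1)[OF j(1)] by (simp add: mul_assoc)
      qed
      have jE: "q (f j \<otimes> E t) = 0" if j: "j < m" "j \<noteq> i" for j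
      proof -
        have "q (f j \<otimes> (f i \<otimes> E t)) = q (f j \<otimes> E t)" using EV fV fD(1)[OF j(1)] fE by (intro q_mul_right_cong) simp_all
        moreover have "q (f j \<otimes> f i \<otimes> E t) = 0" using EV fV fD(1)[OF j(1)] fD(4)[OF j(1) i] j(2) by (intro q_mul_0) simp_all
        ultimately show ?thesis using EV fV fD(1)[OF j(1)] by (simp add: mul_assoc)
      qed
      \<comment> \<open>\<open>f i\<close> is replaced by its two parts \<open>E t\<close> and
        \<open>f i - E t\<close>, the second one in the new position \<open>m\<close>; both are
        nonzero modulo the kernel.\<close>
      define g where "g = f(i := E t, m := f i - E t)"
      have g: "g i = E t" "g m = f i - E t" "\<And>j. j < m ==> j \<noteq> i ==> g j = f j" using i by (auto simp: g_def)
      have gV: "g j \<in> V \<and> star (g j) = g j \<and> q (g j) \<noteq> 0" if "j < Suc m" for j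
      proof -
        consider "j = i" | "j = m" | "j < m" "j \<noteq> i" using \<open>j < Suc m\<close> by linarith
        then show ?thesis
          by cases (use EV Es E0[OF t(1)] fV fD False i in \<open>auto simp: g q_diff star_diff\<close>)
      qed
      have gg: "q (g j \<otimes> g k) = (if j = k then q (g j) else 0)" if jk: "j < Suc m" "k < Suc m" for j k
      proof -
        consider "j = i" | "j = m" | "j < m" "j \<noteq> i" using jk(1) by linarith
        then show ?thesis
        proof cases
          case 1
          consider "k = i" | "k = m" | "k < m" "k \<noteq> i" using jk(2) by linarith
          then show ?thesis
            by cases (use EV fV i Ef Et Ej 1 in \<open>auto simp: g mul_diff_right q_diff\<close>)
        next
          case 2
          consider "k = i" | "k = m" | "k < m" "k \<noteq> i" using jk(2) by linarith
          then show ?thesis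
            by cases (use EV fV i fE Ef Et Ej ff fD(1) fD(4)[OF i] 2 in \<open>auto simp: g mul_diff_right mul_diff_left q_diff\<close>)
        next
          case 3
          consider "k = i" | "k = m" | "k < m" "k \<noteq> i" using jk(2) by linarith
          then show ?thesis
            by cases (use EV fV i jE fD(1) fD(4)[OF 3(1)] 3 in \<open>auto simp: g mul_diff_right q_diff\<close>)
        qed
      qed
      have "orth g (Suc m)" using gV gg unfolding orth_def by blast
      then show ?thesis using max by blast
    qed
  qed
qed

lemma corner:
  assumes f: "orth f m" and max: "\<And>g. \<not> orth g (Suc m)" and i: "i < m" and c: "c \<in> V"
  shows "\<exists>\<mu>. q (f i \<otimes> c \<otimes> f i) = scale \<mu> (q (f i))"
proof -
  note fV = orthD(1)[OF f i]
  define c1 where "c1 = scale (1/2) (c + star c)"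
  define c2 where "c2 = scale (- \<i> / 2) (c - star c)"
  have V: "c1 \<in> V" "c2 \<in> V" using c by (simp_all add: c1_def c2_def)
  have "star c1 = c1" using c by (simp add: c1_def star_scale star_add add.commute)
  moreover have "star c2 = c2"
    using c by (intro ext) (simp add: c2_def star_scale star_diff scale_apply algebra_simps)
  ultimately obtain \<mu>1 \<mu>2 where \<mu>: "q (f i \<otimes> c1 \<otimes> f i) = scale \<mu>1 (q (f i))" "q (f i \<otimes> c2 \<otimes> f i) = scale \<mu>2 (q (f i))"
    using corner_selfadjoint[OF f max i] V by metis
  have "c = c1 + scale \<i> c2" by (rule ext) (simp add: c1_def c2_def scale_apply field_simps)
  then have "f i \<otimes> c \<otimes> f i = f i \<otimes> c1 \<otimes> f i + scale \<i> (f i \<otimes> c2 \<otimes> f i)"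
    using V fV by (simp add: mul_add_left mul_add_right mul_scale_left mul_scale_right)
  then have "q (f i \<otimes> c \<otimes> f i) = scale (\<mu>1 + \<i> * \<mu>2) (q (f i))"
    using V fV by (simp add: q_add q_scale \<mu> scale_add_left)
  then show ?thesis ..
qed

text \<open>Every eigenvalue of \<open>h\<close> modulo the kernel has square 0, hence is 0, and
  \<open>h\<close> is the sum of its spectral components.\<close>

lemma selfadjoint_square_0:
  assumes h: "h \<in> V" "star h = h" "q (h \<otimes> h) = 0" shows "q h = 0"
proof -
  obtain F :: "complex set" and E lm where F: "finite F"
    and EV: "\<And>t. E t \<in> V" and E0: "\<And>t. t \<in> F ==> q (E t) \<noteq> 0"
    and Ee: "q e = (\<Sum>t\<in>F. q (E t))"
    and hE: "\<And>t. t \<in> F ==> q (h \<otimes> E t) = scale (lm t) (q (E t))"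
    by (rule selfadjoint_spectral[OF h(1,2)]) (rule that; assumption)
  have "lm t = 0" if t: "t \<in> F" for t
  proof -
    have "q (h \<otimes> h \<otimes> E t) = 0" using h EV by (intro q_mul_0) auto
    moreover have "q (h \<otimes> (h \<otimes> E t)) = q (h \<otimes> scale (lm t) (E t))"
      using h EV hE[OF t] by (intro q_mul_right_cong) (auto simp: q_scale)
    ultimately have "scale (lm t * lm t) (q (E t)) = 0"
      using h EV by (simp add: mul_assoc mul_scale_right q_scale hE[OF t])
    then show ?thesis using E0[OF t] by simp
  qed
  then show ?thesis using q_split_right[OF F EV Ee h(1)] hE by simp
qed

text \<open>A nonzero element \<open>b\<close> of the corner satisfies b* b = \<nu> f_j with \<nu>
  \<noteq> 0. Any other x in the corner is then \<nu>^(-1) x b* b, and x b* is a multiple of f_i,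
  which makes x a multiple of b; all this modulo the kernel.\<close>

lemma off_diagonal:
  assumes f: "orth f m" and max: "\<And>g. \<not> orth g (Suc m)" and i: "i < m" and j: "j < m" and ij: "i \<noteq> j"
  shows "\<exists>b. \<forall>c\<in>V. \<exists>\<mu>. q (f i \<otimes> c \<otimes> f j) = scale \<mu> b"
proof (cases "\<forall>c\<in>V. q (f i \<otimes> c \<otimes> f j) = 0")
  case True
  then show ?thesis by (intro exI[of _ 0]) simp
next
  case False
  note fD = orthD[OF f]
  note fV [simp] = fD(1)[OF i] fD(1)[OF j]
  have ff: "q (f i \<otimes> f i) = q (f i)" "q (f j \<otimes> f j) = q (f j)" "q (f i \<otimes> f j) = 0" "q (f j \<otimes> f i) = 0"
    using fD(4) i j ij by auto
  obtain c0 where c0 [simp]: "c0 \<in> V" and nz: "q (f i \<otimes> c0 \<otimes> f j) \<noteq> 0" using False by blast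
  define b where "b = f i \<otimes> c0 \<otimes> f j"
  have bV [simp]: "b \<in> V" by (simp add: b_def)
  have sb: "star b = f j \<otimes> star c0 \<otimes> f i" using fD(2) i j by (simp add: b_def star_mul mul_assoc)
  have fb: "q (f i \<otimes> b) = q b"
  proof -
    have "q (f i \<otimes> f i \<otimes> (c0 \<otimes> f j)) = q (f i \<otimes> (c0 \<otimes> f j))" using ff by (intro q_mul_left_cong) auto
    then show ?thesis by (simp add: b_def mul_assoc)
  qed
  have bf: "q (b \<otimes> f j) = q b"
  proof -
    have "q (f i \<otimes> c0 \<otimes> (f j \<otimes> f j)) = q (f i \<otimes> c0 \<otimes> f j)" using ff by (intro q_mul_right_cong) auto
    then show ?thesis by (simp add: b_def mul_assoc)
  qed
  obtain \<nu> where \<nu>: "q (star b \<otimes> b) = scale \<nu> (q (f j))"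
  proof -
    have "star b \<otimes> b = f j \<otimes> (star c0 \<otimes> f i \<otimes> f i \<otimes> c0) \<otimes> f j" unfolding sb by (simp add: b_def mul_assoc)
    then show ?thesis using that corner[OF f max j, of "star c0 \<otimes> f i \<otimes> f i \<otimes> c0"] by auto
  qed
  \<comment> \<open>If \<nu> = 0, all four products of \<open>b\<close> and \<open>star b\<close>
    vanish modulo the kernel. Then the selfadjoint element \<open>b + star b\<close> has square 0
    and vanishes, and multiplying by \<open>f i\<close> on the left leaves b = 0.\<close>
  have "\<nu> \<noteq> 0"
  proof
    assume "\<nu> = 0"
    then have sbb: "q (star b \<otimes> b) = 0" using \<nu> by simp
    obtain \<mu> where \<mu>: "q (b \<otimes> star b) = scale \<mu> (q (f i))"
    proof -
      have "b \<otimes> star b = f i \<otimes> (c0 \<otimes> f j \<otimes> f j \<otimes> star c0) \<otimes> f i" unfolding sb by (simp add: b_def mul_assoc)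
      then show ?thesis using that corner[OF f max i, of "c0 \<otimes> f j \<otimes> f j \<otimes> star c0"] by auto
    qed
    have "q (b \<otimes> star b \<otimes> b) = q (scale \<mu> (f i) \<otimes> b)" using \<mu> by (intro q_mul_left_cong) (auto simp: q_scale)
    moreover have "q (b \<otimes> (star b \<otimes> b)) = 0" using sbb by (intro q_mul_0) auto
    ultimately have "scale \<mu> (q b) = 0" by (simp add: mul_assoc mul_scale_left q_scale fb)
    then have "\<mu> = 0" using nz by (simp add: b_def)
    then have bsb: "q (b \<otimes> star b) = 0" using \<mu> by simp
    have "q ((f j \<otimes> f i) \<otimes> (c0 \<otimes> f j)) = 0" by (rule q_mul_0) (simp_all add: ff)
    then have "q (f i \<otimes> c0 \<otimes> ((f j \<otimes> f i) \<otimes> (c0 \<otimes> f j))) = 0" by (intro q_mul_0) simp_all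
    then have bb: "q (b \<otimes> b) = 0" by (simp add: b_def mul_assoc)
    have "q ((f i \<otimes> f j) \<otimes> (star c0 \<otimes> f i)) = 0" by (rule q_mul_0) (simp_all add: ff)
    then have "q (f j \<otimes> star c0 \<otimes> ((f i \<otimes> f j) \<otimes> (star c0 \<otimes> f i))) = 0" by (intro q_mul_0) simp_all
    then have ss: "q (star b \<otimes> star b) = 0" by (simp add: sb mul_assoc)
    have "q (b + star b) = 0"
      by (rule selfadjoint_square_0)
        (simp_all add: star_add add.commute mul_add_left mul_add_right q_add bb bsb sbb ss)
    then have "q (f i \<otimes> (b + star b)) = 0" by (intro q_mul_0) auto
    moreover have "q (f i \<otimes> f j \<otimes> (star c0 \<otimes> f i)) = 0" using ff by (intro q_mul_0) auto
    then have "q (f i \<otimes> star b) = 0" by (simp add: sb mul_assoc)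
    ultimately have "q b = 0" by (simp add: mul_add_right q_add fb)
    then show False using nz by (simp add: b_def)
  qed
  have "\<exists>\<mu>. q (f i \<otimes> c \<otimes> f j) = scale \<mu> (q b)" if c [simp]: "c \<in> V" for c
  proof -
    define x where "x = f i \<otimes> c \<otimes> f j"
    have xV [simp]: "x \<in> V" by (simp add: x_def)
    have xf: "q (x \<otimes> f j) = q x"
    proof -
      have "q (f i \<otimes> c \<otimes> (f j \<otimes> f j)) = q (f i \<otimes> c \<otimes> f j)" using ff by (intro q_mul_right_cong) auto
      then show ?thesis by (simp add: x_def mul_assoc)
    qed
    obtain \<mu> where \<mu>: "q (x \<otimes> star b) = scale \<mu> (q (f i))"
    proof -
      have "x \<otimes> star b = f i \<otimes> (c \<otimes> f j \<otimes> f j \<otimes> star c0) \<otimes> f i" unfolding sb by (simp add: x_def mul_assoc)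
      then show ?thesis using that corner[OF f max i, of "c \<otimes> f j \<otimes> f j \<otimes> star c0"] by auto
    qed
    have "q (x \<otimes> star b \<otimes> b) = q (scale \<mu> (f i) \<otimes> b)" using \<mu> by (intro q_mul_left_cong) (auto simp: q_scale)
    moreover have "q (x \<otimes> (star b \<otimes> b)) = q (x \<otimes> scale \<nu> (f j))" using \<nu> by (intro q_mul_right_cong) (auto simp: q_scale)
    ultimately have "scale \<nu> (q x) = scale \<mu> (q b)"
      by (simp add: mul_assoc mul_scale_left mul_scale_right q_scale fb xf)
    then have "scale (inverse \<nu>) (scale \<nu> (q x)) = scale (inverse \<nu>) (scale \<mu> (q b))" by simp
    then have "q x = scale (inverse \<nu> * \<mu>) (q b)" using \<open>\<nu> \<noteq> 0\<close> by simp
    then show ?thesis unfolding x_def ..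
  qed
  then show ?thesis by blast
qed

text \<open>Peirce decomposition: every image is the sum of its m^2 corners, and each corner is
  spanned by one vector.\<close>

theorem finite_dimensional_image: "\<exists>B. finite B \<and> (\<forall>a\<in>V. q a \<in> fun_space.span B)"
proof -
  obtain f m where f: "orth f m" and max: "\<And>g. \<not> orth g (Suc m)" using ex_maximal_orth by blast
  have fV: "f i \<in> V" if "i \<in> {..<m}" for i using orthD(1)[OF f] that by simp
  have "\<exists>b. \<forall>c\<in>V. \<exists>\<mu>. q (f i \<otimes> c \<otimes> f j) = scale \<mu> b" if "i < m" "j < m" for i j
    using corner[OF f max] off_diagonal[OF f max] that by (cases "i = j") blast+
  then obtain b where b: "\<And>i j c. i < m ==> j < m ==> c \<in> V ==> \<exists>\<mu>. q (f i \<otimes> c \<otimes> f j) = scale \<mu> (b i j)" by metis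
  let ?B = "(\<lambda>(i, j). b i j) ` ({..<m} \<times> {..<m})"
  have "q a \<in> fun_space.span ?B" if a: "a \<in> V" for a
  proof -
    note complete = maximal_orth_complete[OF f max]
    have "q a = (\<Sum>i<m. q (f i \<otimes> a))" by (rule q_split_left[OF _ fV complete a]) auto
    also have "\<dots> = (\<Sum>i<m. \<Sum>j<m. q (f i \<otimes> a \<otimes> f j))"
      by (intro sum.cong refl q_split_right[OF _ fV complete]) (auto simp: a fV)
    also have "\<dots> \<in> fun_space.span ?B"
    proof (intro fun_space.span_sum)
      fix i j assume ij: "i \<in> {..<m}" "j \<in> {..<m}"
      then obtain \<mu> where "q (f i \<otimes> a \<otimes> f j) = scale \<mu> (b i j)" using b[of i j a] a by auto
      moreover have "b i j \<in> fun_space.span ?B" using ij by (intro fun_space.span_base) auto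
      ultimately show "q (f i \<otimes> a \<otimes> f j) \<in> fun_space.span ?B" by (simp add: fun_space.span_scale)
    qed
    finally show ?thesis .
  qed
  then show ?thesis by (intro exI[of _ ?B]) auto
qed

text \<open>The point indicators are linearly independent and all lie in the image, so the finite
  spanning set bounds the number of points.\<close>

theorem finite_index:
  assumes ind: "\<And>x. \<exists>a\<in>V. q a = (\<lambda>y. if y = x then 1 else 0)"
  shows "finite (UNIV :: 'g set)"
proof -
  obtain B where B: "finite B" "\<And>a. a \<in> V ==> q a \<in> fun_space.span B" using finite_dimensional_image by blast
  let ?u = "\<lambda>x y :: 'g. if y = x then 1 else 0 :: complex"
  have inj: "inj ?u" by (rule injI) (metis zero_neq_one)
  have ind_u: "fun_space.independent (range ?u)"
  proof
    assume "fun_space.dependent (range ?u)"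
    then obtain t c v where t: "finite t" "t \<subseteq> range ?u" "(\<Sum>v\<in>t. scale (c v) v) = 0" "v \<in> t" "c v \<noteq> 0"
      unfolding fun_space.dependent_explicit by (elim exE conjE bexE) (rule that; assumption)
    have "v \<in> range ?u" by (rule subsetD[OF t(2,4)])
    then obtain x where x: "v = ?u x" by (rule rangeE)
    have w: "w x = (if w = v then 1 else 0)" if "w \<in> t" for w
    proof -
      have "w \<in> range ?u" by (rule subsetD[OF t(2) that])
      then obtain y where "w = ?u y" by (rule rangeE)
      moreover have "?u y x = (if ?u y = ?u x then 1 else 0)"
        using injD[OF inj, of y x] by (cases "y = x") auto
      ultimately show ?thesis unfolding x by (simp only:)
    qed
    have "0 = (\<Sum>w\<in>t. scale (c w) w) x" using t(3) by simp
    also have "\<dots> = (\<Sum>w\<in>t. if w = v then c v else 0)"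
      unfolding sum_fun_app scale_apply by (intro sum.cong) (auto simp: w)
    also have "\<dots> = c v" using t by simp
    finally show False using t(5) by simp
  qed
  have "range ?u \<subseteq> fun_space.span B"
  proof (rule image_subsetI)
    fix x obtain a where "a \<in> V" "q a = ?u x" using ind[of x] by blast
    then show "?u x \<in> fun_space.span B" using B(2)[of a] by simp
  qed
  then have "finite (range ?u)" using fun_space.independent_span_bound[OF B(1) ind_u] by blast
  then show ?thesis using finite_imageD[OF _ inj] by blast
qed

end

section \<open>The C*-case for the dual of \<open>M\<^sub>*\<close>\<close>

lemma infsum_finite_sum:
  fixes g :: "'i \<Rightarrow> 'g \<Rightarrow> real"
  assumes "finite F" "\<And>x. x \<in> F ==> g x summable_on UNIV"
  shows "(\<lambda>z. \<Sum>x\<in>F. g x z) summable_on UNIV \<and> (\<Sum>\<^sub>\<infinity>z. \<Sum>x\<in>F. g x z) = (\<Sum>x\<in>F. infsum (g x) UNIV)"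
  using assms
proof (induction F rule: finite_induct)
  case (insert x F)
  then have IH: "(\<lambda>z. \<Sum>x\<in>F. g x z) summable_on UNIV" "(\<Sum>\<^sub>\<infinity>z. \<Sum>x\<in>F. g x z) = (\<Sum>x\<in>F. infsum (g x) UNIV)"
    by auto
  have gx: "g x summable_on UNIV" using insert.prems by simp
  show ?case
    using insert.hyps summable_on_add[OF gx IH(1)] infsum_add[OF gx IH(1)] IH(2) by simp
qed simp

context weighted_lc_group
begin

lemma point_coeff_summable:
  assumes \<Phi>: "\<Phi> \<in> Carrier (dual (M_star \<omega>))"
  shows "(\<lambda>x. cmod (point_coeff \<Phi> x)) summable_on UNIV"
proof (rule nonneg_bdd_above_summable_on)
  show "bdd_above (sum (\<lambda>x. cmod (point_coeff \<Phi> x)) ` {F. F \<subseteq> UNIV \<and> finite F})"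
    by (rule bdd_aboveI[of _ "nA \<Phi>"]) (auto simp: sum_point_coeff_le'[OF \<Phi>])
qed simp

lemma l1_point_coeff_le:
  assumes \<Phi>: "\<Phi> \<in> Carrier (dual (M_star \<omega>))"
  shows "l1 (point_coeff \<Phi>) \<le> nA \<Phi>"
  unfolding l1_def
  by (rule infsum_le_finite_sums[OF point_coeff_summable[OF \<Phi>]]) (rule sum_point_coeff_le'[OF \<Phi>])

text \<open>Finite sums over x are exchanged with the sum over z. For each z the translated
  coefficients of \<Psi> contribute at most their full l^1 norm, as translation only relabels the
  points.\<close>

lemma l1_point_coeff_Mult:
  assumes \<Phi>: "\<Phi> \<in> Carrier (dual (M_star \<omega>))" and \<Psi>: "\<Psi> \<in> Carrier (dual (M_star \<omega>))"
  shows "l1 (point_coeff (Mult A \<Phi> \<Psi>)) \<le> l1 (point_coeff \<Phi>) * l1 (point_coeff \<Psi>)"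
proof -
  have \<Phi>\<Psi>: "Mult A \<Phi> \<Psi> \<in> Carrier (dual (M_star \<omega>))"
    using normed_algebraD(2)[OF normed_algebra_A] \<Phi> \<Psi> by simp
  let ?f = "\<lambda>z. cmod (point_coeff \<Phi> z)" and ?g = "\<lambda>z. cmod (point_coeff \<Psi> z)"
  have part: "(\<Sum>x\<in>F. ?g (- z + x)) \<le> l1 (point_coeff \<Psi>)" if "finite F" for F z
  proof -
    have "(\<Sum>x\<in>F. ?g (- z + x)) = sum ?g ((\<lambda>x. - z + x) ` F)"
      by (subst sum.reindex) (auto simp: inj_on_def)
    also have "\<dots> \<le> l1 (point_coeff \<Psi>)"
      unfolding l1_def using that by (intro finite_sum_le_infsum point_coeff_summable[OF \<Psi>]) auto
    finally show ?thesis .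
  qed
  have sm: "(\<lambda>z. ?f z * l1 (point_coeff \<Psi>)) summable_on UNIV"
    by (rule summable_on_cmult_left[OF point_coeff_summable[OF \<Phi>]])
  have g_le: "?g (- z + x) \<le> l1 (point_coeff \<Psi>)" for x z using part[of "{x}" z] by simp
  have smx: "(\<lambda>z. ?f z * ?g (- z + x)) summable_on UNIV" for x
    by (rule summable_on_comparison_test[OF sm]) (auto intro!: mult_left_mono g_le)
  have "(\<Sum>x\<in>F. cmod (point_coeff (Mult A \<Phi> \<Psi>) x)) \<le> l1 (point_coeff \<Phi>) * l1 (point_coeff \<Psi>)" if F: "finite F" for F
  proof -
    have "cmod (point_coeff (Mult A \<Phi> \<Psi>) x) \<le> (\<Sum>\<^sub>\<infinity>z. ?f z * ?g (- z + x))" for x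
    proof -
      have "point_coeff (Mult A \<Phi> \<Psi>) x = (\<Sum>\<^sub>\<infinity>z. point_coeff \<Phi> z * point_coeff \<Psi> (- z + x))"
        using point_coeff_Mult[OF \<Phi> \<Psi>] by (rule infsumI[symmetric])
      then show ?thesis
        using norm_infsum_bound[of "\<lambda>z. point_coeff \<Phi> z * point_coeff \<Psi> (- z + x)" UNIV] smx[of x] by (simp add: norm_mult)
    qed
    then have "(\<Sum>x\<in>F. cmod (point_coeff (Mult A \<Phi> \<Psi>) x)) \<le> (\<Sum>x\<in>F. \<Sum>\<^sub>\<infinity>z. ?f z * ?g (- z + x))" by (intro sum_mono)
    also have "\<dots> = (\<Sum>\<^sub>\<infinity>z. \<Sum>x\<in>F. ?f z * ?g (- z + x))"
      using infsum_finite_sum[OF F, of "\<lambda>x z. ?f z * ?g (- z + x)"] smx by simp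
    also have "\<dots> \<le> (\<Sum>\<^sub>\<infinity>z. ?f z * l1 (point_coeff \<Psi>))"
    proof (rule infsum_mono)
      show "(\<lambda>z. \<Sum>x\<in>F. ?f z * ?g (- z + x)) summable_on UNIV"
        using infsum_finite_sum[OF F, of "\<lambda>x z. ?f z * ?g (- z + x)"] smx by simp
      show "(\<Sum>x\<in>F. ?f z * ?g (- z + x)) \<le> ?f z * l1 (point_coeff \<Psi>)" for z
        unfolding sum_distrib_left[symmetric] by (intro mult_left_mono part[OF F]) simp
    qed (rule sm)
    also have "\<dots> = l1 (point_coeff \<Phi>) * l1 (point_coeff \<Psi>)"
      unfolding l1_def[of "point_coeff \<Phi>"] using point_coeff_summable[OF \<Phi>] by (intro infsum_cmult_left) simp
    finally show ?thesis .
  qed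
  then show ?thesis
    unfolding l1_def[of "point_coeff (Mult A \<Phi> \<Psi>)"] by (intro infsum_le_finite_sums point_coeff_summable[OF \<Phi>\<Psi>])
qed

theorem cstar_imp_finite:
  assumes "is_cstar_algebra A"
  shows "finite (UNIV :: 'a set)"
proof -
  obtain p st c d where c: "c > 0" and p: "\<And>u. u \<in> Carrier A ==> c * Norm A u \<le> p u \<and> p u \<le> d * Norm A u"
    and cs: "cstar_algebra (A\<lparr>Norm := p\<rparr>) st"
    using assms unfolding is_cstar_algebra_def equivalent_norms_def by blast
  let ?B = "A\<lparr>Norm := p\<rparr>"
  have B: "Carrier ?B = Carrier (dual (M_star \<omega>))" "Norm ?B = p" "Mult ?B = Mult A" by simp_all
  \<comment> \<open>The constant 1/c comes from the equivalence of the given norm with the C*-norm;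
    \<open>delta 0\<close> serves as right unit.\<close>
  interpret cstar_l1 ?B st "delta 0" point_coeff "1 / c"
  proof
    show "cstar_algebra ?B st" by (rule cs)
    show "delta 0 \<in> Carrier ?B" using delta_in_A(1)[of 0] by simp
    show "Mult ?B a (delta 0) = a" if "a \<in> Carrier ?B" for a using Mult_delta_zero[of a] that by simp
    show "point_coeff (a + b) = point_coeff a + point_coeff b" for a b
      by (rule ext) (simp add: point_coeff_add)
    show "point_coeff (scale t a) = scale t (point_coeff a)" for t a
      by (rule ext) (simp add: point_coeff_scale scale_apply)
    show "(\<lambda>x. cmod (point_coeff a x)) summable_on UNIV" if "a \<in> Carrier ?B" for a
      using point_coeff_summable that by simp
    show "l1 (point_coeff a) \<le> 1 / c * Norm ?B a" if "a \<in> Carrier ?B" for a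
    proof -
      have "c * nA a \<le> p a" using p[of a] that by simp
      then have "nA a \<le> p a / c" using c by (simp add: field_simps)
      then show ?thesis using l1_point_coeff_le[of a] that by simp
    qed
    show "l1 (point_coeff (Mult ?B a b)) \<le> l1 (point_coeff a) * l1 (point_coeff b)"
      if "a \<in> Carrier ?B" "b \<in> Carrier ?B" for a b
      using l1_point_coeff_Mult[of a b] that by simp
    have "point_coeff (delta 0) 0 = 1" by (simp add: point_coeff_delta)
    then show "point_coeff (delta 0) \<noteq> 0" by auto
  qed
  show ?thesis
  proof (rule finite_index)
    fix x
    show "\<exists>a\<in>Carrier ?B. point_coeff a = (\<lambda>y. if y = x then 1 else 0)"
      using delta_in_A(1)[of x] by (intro bexI[of _ "delta x"]) (auto simp: point_coeff_delta fun_eq_iff)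
  qed
qed

end

section \<open>Convolution operators over a finite group\<close>

definition gconv :: "('a::group_add \<Rightarrow> complex) \<Rightarrow> ('a \<Rightarrow> complex) \<Rightarrow> 'a \<Rightarrow> complex" where
  "gconv \<phi> \<psi> = (\<lambda>x. \<Sum>z\<in>UNIV. \<phi> z * \<psi> (- z + x))"

definition l2 :: "('a \<Rightarrow> complex) \<Rightarrow> real" where
  "l2 \<psi> = L2_set (\<lambda>x. cmod (\<psi> x)) UNIV"

definition adj :: "('a::group_add \<Rightarrow> complex) \<Rightarrow> 'a \<Rightarrow> complex" where
  "adj \<phi> = (\<lambda>x. cnj (\<phi> (- x)))"

definition conv_norm :: "('a::group_add \<Rightarrow> complex) \<Rightarrow> real" where
  "conv_norm \<phi> = (SUP \<psi>\<in>{\<psi>. l2 \<psi> \<le> 1}. l2 (gconv \<phi> \<psi>))"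

lemma l2_nonneg [simp]: "0 \<le> l2 \<psi>"
  by (simp add: l2_def L2_set_def sum_nonneg)

lemma l2_add: "l2 (\<phi> + \<psi>) \<le> l2 \<phi> + l2 \<psi>"
proof -
  have "l2 (\<phi> + \<psi>) \<le> L2_set (\<lambda>x. cmod (\<phi> x) + cmod (\<psi> x)) UNIV"
    unfolding l2_def by (rule L2_set_mono) (auto intro: norm_triangle_ineq)
  then show ?thesis unfolding l2_def by (rule order_trans[OF _ L2_set_triangle_ineq])
qed

lemma l2_scale: "l2 (scale c \<psi>) = cmod c * l2 \<psi>"
  unfolding l2_def by (simp add: scale_apply norm_mult L2_set_right_distrib)

lemma l2_zero [simp]: "l2 0 = 0"
  using l2_scale[of 0 0] by simp

lemma l2_sum: "l2 (sum f I) \<le> (\<Sum>i\<in>I. l2 (f i))"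
proof (induction I rule: infinite_finite_induct)
  case (insert i I)
  have "l2 (f i + sum f I) \<le> l2 (f i) + (\<Sum>i\<in>I. l2 (f i))"
    using l2_add[of "f i" "sum f I"] insert.IH by linarith
  then have "l2 (sum f (insert i I)) \<le> (\<Sum>i\<in>insert i I. l2 (f i))" using insert.hyps by simp
  then show ?case .
next
  case (infinite I)
  then have "l2 (sum f I) \<le> (\<Sum>i\<in>I. l2 (f i))" by simp
  then show ?case .
next
  case empty
  have "l2 (sum f {}) \<le> (\<Sum>i\<in>{}. l2 (f i))" by simp
  then show ?case .
qed

lemma l2_square: "(l2 \<psi>)^2 = (\<Sum>x\<in>UNIV. (cmod (\<psi> x))^2)"
  by (simp add: l2_def L2_set_def sum_nonneg)

lemma sum_translate: "(\<Sum>y\<in>UNIV. h (z + y)) = (\<Sum>y\<in>UNIV. h (y::'a::group_add))"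
proof (rule sum.reindex_bij_witness[of _ "\<lambda>y. - z + y" "\<lambda>y. z + y"])
qed (simp_all add: add.assoc[symmetric])

lemma sum_uminus: "(\<Sum>y\<in>UNIV. h (- y)) = (\<Sum>y\<in>UNIV. h (y::'a::group_add))"
  by (rule sum.reindex_bij_witness[of _ uminus uminus]) simp_all

lemma l2_translate: "l2 (\<lambda>x. \<psi> (- z + x)) = l2 \<psi>" for \<psi> :: "'a::group_add \<Rightarrow> complex"
  unfolding l2_def L2_set_def using sum_translate[of "\<lambda>y. (cmod (\<psi> y))^2" "- z"] by simp

lemma gconv_sum: "gconv \<phi> \<psi> = (\<Sum>z\<in>UNIV. scale (\<phi> z) (\<lambda>x. \<psi> (- z + x)))"
  by (rule ext) (simp add: gconv_def sum_fun_app scale_apply)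

lemma l2_gconv_le: "l2 (gconv \<phi> \<psi>) \<le> (\<Sum>z\<in>UNIV. cmod (\<phi> z)) * l2 \<psi>"
proof -
  have "l2 (gconv \<phi> \<psi>) \<le> (\<Sum>z\<in>UNIV. l2 (scale (\<phi> z) (\<lambda>x. \<psi> (- z + x))))" unfolding gconv_sum by (rule l2_sum)
  then show ?thesis by (simp add: l2_scale l2_translate sum_distrib_right)
qed

lemma gconv_scale_right: "gconv \<phi> (scale c \<psi>) = scale c (gconv \<phi> \<psi>)"
  and gconv_scale_left: "gconv (scale c \<phi>) \<psi> = scale c (gconv \<phi> \<psi>)"
  and gconv_add_left: "gconv (\<phi> + \<phi>') \<psi> = gconv \<phi> \<psi> + gconv \<phi>' \<psi>"
  by (rule ext, simp add: gconv_def scale_apply sum_distrib_left algebra_simps sum.distrib)+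

lemma gconv_assoc: "gconv (gconv \<phi> \<psi>) \<eta> = gconv \<phi> (gconv \<psi> \<eta>)"
proof
  fix x
  have "gconv (gconv \<phi> \<psi>) \<eta> x = (\<Sum>y\<in>UNIV. \<Sum>z\<in>UNIV. \<phi> z * \<psi> (- z + y) * \<eta> (- y + x))"
    by (simp add: gconv_def sum_distrib_right)
  also have "\<dots> = (\<Sum>z\<in>UNIV. \<Sum>y\<in>UNIV. \<phi> z * \<psi> (- z + y) * \<eta> (- y + x))" by (rule sum.swap)
  also have "\<dots> = (\<Sum>z\<in>UNIV. \<Sum>w\<in>UNIV. \<phi> z * \<psi> (- z + (z + w)) * \<eta> (- (z + w) + x))"
    by (intro sum.cong refl sum_translate[symmetric])
  also have "\<dots> = (\<Sum>z\<in>UNIV. \<Sum>w\<in>UNIV. \<phi> z * (\<psi> w * \<eta> (- w + (- z + x))))"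
    by (simp only: minus_add add.assoc mult.assoc minus_add_cancel)
  also have "\<dots> = gconv \<phi> (gconv \<psi> \<eta>) x" by (simp add: gconv_def sum_distrib_left)
  finally show "gconv (gconv \<phi> \<psi>) \<eta> x = gconv \<phi> (gconv \<psi> \<eta>) x" .
qed

lemma adj_adj [simp]: "adj (adj \<phi>) = \<phi>"
  by (simp add: adj_def)

lemma gconv_adjoint: "(\<Sum>x\<in>UNIV. gconv \<phi> \<psi> x * cnj (\<eta> x)) = (\<Sum>x\<in>UNIV. \<psi> x * cnj (gconv (adj \<phi>) \<eta> x))"
proof -
  have "(\<Sum>x\<in>UNIV. gconv \<phi> \<psi> x * cnj (\<eta> x)) = (\<Sum>x\<in>UNIV. \<Sum>z\<in>UNIV. \<phi> z * \<psi> (- z + x) * cnj (\<eta> x))"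
    by (simp add: gconv_def sum_distrib_right)
  also have "\<dots> = (\<Sum>z\<in>UNIV. \<Sum>x\<in>UNIV. \<phi> z * \<psi> (- z + x) * cnj (\<eta> x))" by (rule sum.swap)
  also have "\<dots> = (\<Sum>z\<in>UNIV. \<Sum>y\<in>UNIV. \<phi> z * \<psi> (- z + (z + y)) * cnj (\<eta> (z + y)))"
    by (intro sum.cong refl sum_translate[symmetric])
  also have "\<dots> = (\<Sum>z\<in>UNIV. \<Sum>y\<in>UNIV. \<phi> z * \<psi> y * cnj (\<eta> (z + y)))" by simp
  also have "\<dots> = (\<Sum>y\<in>UNIV. \<Sum>z\<in>UNIV. \<phi> z * \<psi> y * cnj (\<eta> (z + y)))" by (rule sum.swap)
  also have "\<dots> = (\<Sum>y\<in>UNIV. \<Sum>w\<in>UNIV. \<phi> (- w) * \<psi> y * cnj (\<eta> (- w + y)))"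
    by (intro sum.cong refl sum_uminus[symmetric])
  also have "\<dots> = (\<Sum>x\<in>UNIV. \<psi> x * cnj (gconv (adj \<phi>) \<eta> x))"
    by (simp add: gconv_def adj_def sum_distrib_left mult_ac)
  finally show ?thesis .
qed

lemma adj_gconv: "adj (gconv \<phi> \<psi>) = gconv (adj \<psi>) (adj \<phi>)"
proof
  fix x
  have "adj (gconv \<phi> \<psi>) x = (\<Sum>z\<in>UNIV. cnj (\<phi> z) * cnj (\<psi> (- z + - x)))" by (simp add: adj_def gconv_def)
  also have "\<dots> = (\<Sum>z\<in>UNIV. cnj (\<phi> (- x + z)) * cnj (\<psi> (- (- x + z) + - x)))" by (rule sum_translate[symmetric])
  also have "\<dots> = (\<Sum>z\<in>UNIV. adj \<psi> z * adj \<phi> (- z + x))"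
    by (simp only: adj_def minus_add add.assoc minus_minus add.right_inverse add_0_right mult.commute)
  finally show "adj (gconv \<phi> \<psi>) x = gconv (adj \<psi>) (adj \<phi>) x" by (simp add: gconv_def)
qed

lemma inner_le_l2: "cmod (\<Sum>x\<in>UNIV. \<psi> x * cnj (\<eta> x)) \<le> l2 \<psi> * l2 \<eta>"
proof -
  have "cmod (\<Sum>x\<in>UNIV. \<psi> x * cnj (\<eta> x)) \<le> (\<Sum>x\<in>UNIV. \<bar>cmod (\<psi> x)\<bar> * \<bar>cmod (\<eta> x)\<bar>)"
    using norm_sum[of "\<lambda>x. \<psi> x * cnj (\<eta> x)" UNIV] by (simp add: norm_mult)
  then show ?thesis unfolding l2_def by (rule order_trans[OF _ L2_set_mult_ineq])
qed

lemma conv_norm_least: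
  assumes "\<And>\<psi>. l2 (gconv \<phi> \<psi>) \<le> B * l2 \<psi>" "0 \<le> B" shows "conv_norm \<phi> \<le> B"
  unfolding conv_norm_def
proof (rule cSUP_least)
  have "l2 0 \<le> 1" by simp
  then show "{\<psi> :: 'a \<Rightarrow> complex. l2 \<psi> \<le> 1} \<noteq> {}" by blast
  fix \<psi> :: "'a \<Rightarrow> complex" assume "\<psi> \<in> {\<psi>. l2 \<psi> \<le> 1}"
  then have "B * l2 \<psi> \<le> B * 1" using assms(2) by (intro mult_left_mono) auto
  then show "l2 (gconv \<phi> \<psi>) \<le> B" using assms(1)[of \<psi>] by simp
qed

lemma conv_norm_le_sum: "conv_norm \<phi> \<le> (\<Sum>z\<in>UNIV. cmod (\<phi> z))"
  by (rule conv_norm_least) (auto intro: l2_gconv_le sum_nonneg)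

context
  assumes fin: "finite (UNIV :: 'a::group_add set)"
begin

lemma cmod_le_l2: "cmod (\<psi> (x :: 'a)) \<le> l2 \<psi>"
  unfolding l2_def using fin by (intro member_le_L2_set) auto

lemma l2_le_conv_norm: "l2 (gconv \<phi> \<psi>) \<le> conv_norm \<phi> * l2 (\<psi> :: 'a \<Rightarrow> complex)"
proof (cases "l2 \<psi> = 0")
  case True
  then show ?thesis using l2_gconv_le[of \<phi> \<psi>] by simp
next
  case False
  then have pos: "l2 \<psi> > 0" by (simp add: order_less_le)
  have bdd: "bdd_above ((\<lambda>\<psi>. l2 (gconv \<phi> \<psi>)) ` {\<psi>. l2 \<psi> \<le> 1})"
  proof (rule bdd_aboveI2)
    fix \<eta> :: "'a \<Rightarrow> complex" assume "\<eta> \<in> {\<psi>. l2 \<psi> \<le> 1}"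
    then have "(\<Sum>z\<in>UNIV. cmod (\<phi> z)) * l2 \<eta> \<le> (\<Sum>z\<in>UNIV. cmod (\<phi> z)) * 1" by (intro mult_left_mono sum_nonneg) auto
    then show "l2 (gconv \<phi> \<eta>) \<le> (\<Sum>z\<in>UNIV. cmod (\<phi> z))" using l2_gconv_le[of \<phi> \<eta>] by simp
  qed
  let ?\<eta> = "scale (complex_of_real (1 / l2 \<psi>)) \<psi>"
  have "l2 ?\<eta> \<le> 1" using pos by (simp add: l2_scale norm_divide)
  then have "l2 (gconv \<phi> ?\<eta>) \<le> conv_norm \<phi>" unfolding conv_norm_def using bdd by (intro cSUP_upper) auto
  then show ?thesis using pos by (simp add: gconv_scale_right l2_scale norm_divide field_simps)
qed

text \<open>Convolving the unit vector at 0, which has norm 1, reproduces \<phi>, so the operator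
  norm dominates the l^2 norm of \<phi>. Definiteness of the C*-norm and its equivalence with the
  given norm rest on this.\<close>

lemma cmod_le_conv_norm: "cmod (\<phi> (x :: 'a)) \<le> conv_norm \<phi>"
proof -
  let ?d = "\<lambda>y :: 'a. if y = 0 then 1 else 0 :: complex"
  have "(cmod (?d y))^2 = (if y = 0 then 1 else 0)" for y by simp
  then have "(l2 ?d)^2 = 1" using fin by (simp add: l2_square)
  then have "l2 ?d = 1" using l2_nonneg[of ?d] by (simp add: power2_eq_1_iff)
  moreover have "gconv \<phi> ?d = \<phi>"
  proof
    fix y :: 'a
    have z: "- z + y = 0 \<longleftrightarrow> z = y" for z
    proof
      assume "- z + y = 0"
      then have "z + (- z + y) = z" by simp
      then show "z = y" by (simp only: add_minus_cancel)
    qed simp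
    have "gconv \<phi> ?d y = (\<Sum>z\<in>UNIV. if z = y then \<phi> z else 0)"
      unfolding gconv_def by (intro sum.cong refl) (simp add: z)
    then show "gconv \<phi> ?d y = \<phi> y" using fin by simp
  qed
  ultimately have "l2 \<phi> \<le> conv_norm \<phi>" using l2_le_conv_norm[of \<phi> ?d] by simp
  then show ?thesis using cmod_le_l2[of \<phi> x] by linarith
qed

lemma conv_norm_nonneg: "0 \<le> conv_norm (\<phi> :: 'a \<Rightarrow> complex)"
  using cmod_le_conv_norm[of \<phi> 0] norm_ge_zero[of "\<phi> 0"] by linarith

lemma conv_norm_add: "conv_norm (\<phi> + \<psi> :: 'a \<Rightarrow> complex) \<le> conv_norm \<phi> + conv_norm \<psi>"
proof (rule conv_norm_least)
  fix \<eta> :: "'a \<Rightarrow> complex"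
  show "l2 (gconv (\<phi> + \<psi>) \<eta>) \<le> (conv_norm \<phi> + conv_norm \<psi>) * l2 \<eta>"
    using l2_add[of "gconv \<phi> \<eta>" "gconv \<psi> \<eta>"] l2_le_conv_norm[of \<phi> \<eta>] l2_le_conv_norm[of \<psi> \<eta>]
    by (simp add: gconv_add_left distrib_right)
qed (simp add: conv_norm_nonneg)

lemma conv_norm_scale: "conv_norm (scale c (\<phi> :: 'a \<Rightarrow> complex)) = cmod c * conv_norm \<phi>"
proof -
  have le: "conv_norm (scale c \<phi>) \<le> cmod c * conv_norm \<phi>" for c and \<phi> :: "'a \<Rightarrow> complex"
  proof (rule conv_norm_least)
    show "l2 (gconv (scale c \<phi>) \<psi>) \<le> cmod c * conv_norm \<phi> * l2 \<psi>" for \<psi>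
      using mult_left_mono[OF l2_le_conv_norm[of \<phi> \<psi>] norm_ge_zero[of c]]
      by (simp add: gconv_scale_left l2_scale mult.assoc)
  qed (simp add: conv_norm_nonneg)
  show ?thesis
  proof (cases "c = 0")
    case True
    then show ?thesis using le[of 0 \<phi>] conv_norm_nonneg[of "0 :: 'a \<Rightarrow> complex"] by simp
  next
    case False
    have "cmod c * conv_norm \<phi> \<le> cmod c * (cmod (1 / c) * conv_norm (scale c \<phi>))"
      using le[of "1 / c" "scale c \<phi>"] False by (intro mult_left_mono) auto
    then show ?thesis using le[of c \<phi>] False by (simp add: norm_divide)
  qed
qed

lemma conv_norm_mult: "conv_norm (gconv \<phi> (\<psi> :: 'a \<Rightarrow> complex)) \<le> conv_norm \<phi> * conv_norm \<psi>"
proof (rule conv_norm_least)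
  fix \<eta> :: "'a \<Rightarrow> complex"
  have "l2 (gconv \<phi> (gconv \<psi> \<eta>)) \<le> conv_norm \<phi> * l2 (gconv \<psi> \<eta>)" by (rule l2_le_conv_norm)
  also have "\<dots> \<le> conv_norm \<phi> * (conv_norm \<psi> * l2 \<eta>)" by (intro mult_left_mono l2_le_conv_norm conv_norm_nonneg)
  finally show "l2 (gconv (gconv \<phi> \<psi>) \<eta>) \<le> conv_norm \<phi> * conv_norm \<psi> * l2 \<eta>" by (simp add: gconv_assoc mult.assoc)
qed (simp add: conv_norm_nonneg)

text \<open>The squared norm of \<phi> * \<psi> is the inner product of \<psi> with \<phi>* \<phi>
  \<psi>, whence the lower bound by Cauchy-Schwarz. Applied to \<phi> and to its adjoint it shows
  that both have the same norm, and submultiplicativity gives the upper bound.\<close>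

lemma conv_norm_cstar: "conv_norm (gconv (adj \<phi>) (\<phi> :: 'a \<Rightarrow> complex)) = (conv_norm \<phi>)^2"
proof -
  have sq: "(conv_norm \<phi>)^2 \<le> conv_norm (gconv (adj \<phi>) \<phi>)" for \<phi> :: "'a \<Rightarrow> complex"
  proof -
    let ?k = "conv_norm (gconv (adj \<phi>) \<phi>)"
    have "conv_norm \<phi> \<le> sqrt ?k"
    proof (rule conv_norm_least)
      fix \<psi> :: "'a \<Rightarrow> complex"
      have "complex_of_real ((l2 (gconv \<phi> \<psi>))^2) = (\<Sum>x\<in>UNIV. gconv \<phi> \<psi> x * cnj (gconv \<phi> \<psi> x))"
        by (simp add: l2_square complex_norm_square del: of_real_power)
      also have "\<dots> = (\<Sum>x\<in>UNIV. \<psi> x * cnj (gconv (gconv (adj \<phi>) \<phi>) \<psi> x))"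
        by (simp add: gconv_adjoint gconv_assoc)
      finally have "cmod (complex_of_real ((l2 (gconv \<phi> \<psi>))^2)) \<le> l2 \<psi> * l2 (gconv (gconv (adj \<phi>) \<phi>) \<psi>)"
        using inner_le_l2[of \<psi> "gconv (gconv (adj \<phi>) \<phi>) \<psi>"] by simp
      then have "(l2 (gconv \<phi> \<psi>))^2 \<le> l2 \<psi> * l2 (gconv (gconv (adj \<phi>) \<phi>) \<psi>)"
        by (simp only: norm_of_real abs_power2)
      also have "\<dots> \<le> l2 \<psi> * (?k * l2 \<psi>)" by (intro mult_left_mono l2_le_conv_norm) simp
      also have "\<dots> = (sqrt ?k * l2 \<psi>)^2" using conv_norm_nonneg by (simp add: power_mult_distrib power2_eq_square)
      finally show "l2 (gconv \<phi> \<psi>) \<le> sqrt ?k * l2 \<psi>" by (rule power2_le_imp_le) (simp add: conv_norm_nonneg)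
    qed (simp add: conv_norm_nonneg)
    then have "(conv_norm \<phi>)^2 \<le> (sqrt ?k)^2" by (intro power_mono conv_norm_nonneg)
    then show ?thesis using conv_norm_nonneg by simp
  qed
  have le: "conv_norm \<phi> \<le> conv_norm (adj \<phi>)" for \<phi> :: "'a \<Rightarrow> complex"
  proof (cases "conv_norm \<phi> = 0")
    case False
    then have "conv_norm \<phi> > 0" using conv_norm_nonneg[of \<phi>] by simp
    moreover have "conv_norm \<phi> * conv_norm \<phi> \<le> conv_norm (adj \<phi>) * conv_norm \<phi>"
      using sq[of \<phi>] conv_norm_mult[of "adj \<phi>" \<phi>] by (simp add: power2_eq_square)
    ultimately show ?thesis by simp
  qed (simp add: conv_norm_nonneg)
  have "conv_norm (adj \<phi>) = conv_norm \<phi>" using le[of \<phi>] le[of "adj \<phi>"] by simp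
  then show ?thesis using sq[of \<phi>] conv_norm_mult[of "adj \<phi>" \<phi>] by (simp add: power2_eq_square)
qed

end

section \<open>The algebra of a finite group\<close>

locale weighted_finite_group = weighted_lc_group \<omega> for \<omega> :: "'a::{topological_group_add, t2_space} \<Rightarrow> real" +
  assumes finite_group: "finite (UNIV :: 'a set)"
begin

text \<open>A finite Hausdorff space is discrete.\<close>

lemma all_borel [simp]: "E \<in> sets borel" for E :: "'a set"
  using finite_subset[OF subset_UNIV finite_group] finite_imp_closed by (intro borel_closed) blast

lemma M_eq_sum: "\<mu> \<in> M ==> \<mu> = (\<Sum>x\<in>UNIV. scale (\<mu> {x}) (dirac x))"
proof
  fix E assume \<mu>: "\<mu> \<in> M"
  have "\<mu> E = (\<Sum>x\<in>E. \<mu> {x})" if "finite E" for E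
    using that
  proof (induction E rule: finite_induct)
    case empty
    have "(indicator {} :: 'a \<Rightarrow> complex) = (\<lambda>x. 0 * indicator {} x)" by (auto simp: fun_eq_iff)
    then have "\<mu> {} = cm_integral \<mu> (\<lambda>x. 0 * indicator {} x)" using cm_integral_indicator[OF \<mu>, of "{}"] by simp
    also have "\<dots> = 0 * cm_integral \<mu> (indicator {})" by (rule cm_integral_cmult[OF \<mu>, of _ 1]) auto
    finally show ?case by simp
  next
    case (insert y E)
    have "(indicator (insert y E) :: 'a \<Rightarrow> complex) = (\<lambda>x. indicator {y} x + indicator E x)"
      using insert.hyps by (auto simp: indicator_def fun_eq_iff)
    then have "\<mu> (insert y E) = cm_integral \<mu> (\<lambda>x. indicator {y} x + indicator E x)"
      using cm_integral_indicator[OF \<mu>, of "insert y E"] by simp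
    also have "\<dots> = cm_integral \<mu> (indicator {y}) + cm_integral \<mu> (indicator E)"
    proof (rule cm_integral_add[OF \<mu>])
      show "indicator {y} \<in> borel_measurable borel" "indicator E \<in> borel_measurable borel"
        by (rule borel_measurable_indicator, simp)+
      show "cmod (indicator {y} x) \<le> 1" "cmod (indicator E x) \<le> 1" for x by (simp_all add: indicator_def)
    qed
    also have "\<dots> = \<mu> {y} + \<mu> E" by (simp add: cm_integral_indicator[OF \<mu>])
    finally show ?case using insert by simp
  qed
  then have "\<mu> E = (\<Sum>x\<in>E. \<mu> {x})" using finite_subset[OF subset_UNIV finite_group] by blast
  also have "\<dots> = (\<Sum>x\<in>UNIV. if x \<in> E then \<mu> {x} else 0)"
    using finite_group by (simp add: sum.If_cases)
  also have "\<dots> = (\<Sum>x\<in>UNIV. scale (\<mu> {x}) (dirac x)) E"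
    unfolding sum_fun_app scale_apply by (intro sum.cong) (auto simp: dirac_def indicator_def)
  finally show "\<mu> E = (\<Sum>x\<in>UNIV. scale (\<mu> {x}) (dirac x)) E" .
qed

lemma MS_eq_sum:
  assumes f: "f \<in> MS"
  shows "f = (\<Sum>x\<in>UNIV. scale (f (dirac x)) (ev x))"
proof
  fix \<mu>
  show "f \<mu> = (\<Sum>x\<in>UNIV. scale (f (dirac x)) (ev x)) \<mu>"
  proof (cases "\<mu> \<in> M")
    case True
    have "f \<mu> = f (\<Sum>x\<in>UNIV. scale (\<mu> {x}) (dirac x))" using M_eq_sum[OF True] by simp
    also have "\<dots> = (\<Sum>x\<in>UNIV. f (scale (\<mu> {x}) (dirac x)))"
      by (rule dual_sum[OF seminormed_M MS_dual[OF f] finite_group]) (simp add: M_scale dirac_M)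
    also have "\<dots> = (\<Sum>x\<in>UNIV. f (dirac x) * \<mu> {x})"
      by (intro sum.cong refl) (simp add: dualD(3)[OF MS_dual[OF f] dirac_M] mult.commute)
    finally show ?thesis by (simp add: ev_sum_apply[OF True])
  next
    case False
    then show ?thesis using dualD(4)[OF MS_dual[OF f]] by (simp add: sum_fun_app scale_apply ev_def)
  qed
qed

abbreviation "MD \<equiv> Carrier (dual (M_star \<omega>))"

lemma functional_eq:
  assumes \<Phi>: "\<Phi> \<in> MD" and f: "f \<in> MS"
  shows "\<Phi> f = (\<Sum>x\<in>UNIV. f (dirac x) * point_coeff \<Phi> x)"
  using functional_ev_sum[OF \<Phi> finite_group, of "\<lambda>x. f (dirac x)"] MS_eq_sum[OF f] by simp

lemma point_coeff_inj:
  assumes "\<Phi> \<in> MD" "\<Psi> \<in> MD" "point_coeff \<Phi> = point_coeff \<Psi>"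
  shows "\<Phi> = \<Psi>"
proof
  fix f show "\<Phi> f = \<Psi> f"
    using functional_eq[OF assms(1)] functional_eq[OF assms(2)] assms(3) dualD(4)[OF assms(1)] dualD(4)[OF assms(2)]
    by (cases "f \<in> MS") auto
qed

definition of_coeff :: "('a \<Rightarrow> complex) \<Rightarrow> (('a set \<Rightarrow> complex) \<Rightarrow> complex) \<Rightarrow> complex" where
  "of_coeff c = (\<Sum>x\<in>UNIV. scale (c x) (delta x))"

lemma of_coeff_in [simp]: "of_coeff c \<in> MD"
  unfolding of_coeff_def
  by (intro seminormed_sum[OF seminormed_dual[OF seminormed_MS] finite_group]) (rule dual_scale(1)[OF seminormed_MS delta_in_A(1)])

lemma point_coeff_of_coeff [simp]: "point_coeff (of_coeff c) = c"
proof
  fix y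
  have "point_coeff (of_coeff c) y = (\<Sum>x\<in>UNIV. c x * point_coeff (delta x) y)"
    by (simp add: point_coeff_def of_coeff_def sum_fun_app scale_apply)
  also have "\<dots> = (\<Sum>x\<in>UNIV. if x = y then c x else 0)" by (intro sum.cong) (auto simp: point_coeff_delta)
  also have "\<dots> = c y" using finite_group by simp
  finally show "point_coeff (of_coeff c) y = c y" .
qed

lemma of_coeff_point_coeff: "\<Phi> \<in> MD ==> of_coeff (point_coeff \<Phi>) = \<Phi>"
  by (rule point_coeff_inj) simp_all

text \<open>The coordinate functionals \<open>r x\<close> and the point masses are dual bases, so a
  bidual element is represented by its values on the coordinates.\<close>

lemma reflexive: "reflexive_space A"
  unfolding reflexive_space_def
proof
  note SA = normed_algebraD(1)[OF normed_algebra_A]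
  fix F assume F: "F \<in> Carrier (dual (dual A))"
  define r where "r x = (\<lambda>\<Phi>. if \<Phi> \<in> MD then point_coeff \<Phi> x else 0)" for x
  have r: "r x \<in> Carrier (dual A)" for x
  proof (rule dualI)
    fix \<Phi> assume "\<Phi> \<in> Carrier A"
    then show "cmod (r x \<Phi>) \<le> 1 * Norm A \<Phi>" using sum_point_coeff_le'[of \<Phi> "{x}"] by (simp add: r_def)
  next
    fix \<Phi> \<Psi> assume "\<Phi> \<in> Carrier A" "\<Psi> \<in> Carrier A"
    then show "r x (\<Phi> + \<Psi>) = r x \<Phi> + r x \<Psi>"
      using seminormedD(2)[OF SA, of \<Phi> \<Psi>] by (simp add: r_def point_coeff_add)
  next
    fix c \<Phi> assume "\<Phi> \<in> Carrier A"
    then show "r x (scale c \<Phi>) = c * r x \<Phi>"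
      using seminormedD(3)[OF SA, of \<Phi> c] by (simp add: r_def point_coeff_scale)
  qed (simp add: r_def)
  let ?u = "of_coeff (\<lambda>x. F (r x))"
  have "F f = f ?u" if f: "f \<in> Carrier (dual A)" for f
  proof -
    have expand: "f (of_coeff c) = (\<Sum>x\<in>UNIV. c x * f (delta x))" for c
    proof -
      have d: "delta x \<in> Carrier A" for x by (simp add: delta_in_A)
      have "f (of_coeff c) = (\<Sum>x\<in>UNIV. f (scale (c x) (delta x)))"
        unfolding of_coeff_def by (rule dual_sum[OF SA f finite_group]) (rule seminormedD(3)[OF SA d])
      then show ?thesis by (simp add: dualD(3)[OF f d])
    qed
    have "f = (\<Sum>x\<in>UNIV. scale (f (delta x)) (r x))"
    proof
      fix \<Phi> show "f \<Phi> = (\<Sum>x\<in>UNIV. scale (f (delta x)) (r x)) \<Phi>"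
      proof (cases "\<Phi> \<in> MD")
        case True
        then have "f \<Phi> = (\<Sum>x\<in>UNIV. point_coeff \<Phi> x * f (delta x))"
          using expand[of "point_coeff \<Phi>"] by (simp add: of_coeff_point_coeff)
        then show ?thesis using True by (simp add: sum_fun_app scale_apply r_def mult.commute)
      next
        case False
        then show ?thesis using dualD(4)[OF f, of \<Phi>] by (simp add: sum_fun_app scale_apply r_def)
      qed
    qed
    then have "F f = F (\<Sum>x\<in>UNIV. scale (f (delta x)) (r x))" by simp
    also have "\<dots> = (\<Sum>x\<in>UNIV. F (scale (f (delta x)) (r x)))"
      by (rule dual_sum[OF seminormed_dual[OF SA] F finite_group]) (rule dual_scale(1)[OF SA r])
    also have "\<dots> = f ?u" by (simp add: expand dualD(3)[OF F r] mult.commute)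
    finally show ?thesis .
  qed
  moreover have "?u \<in> Carrier A" by simp
  ultimately show "\<exists>u\<in>Carrier A. \<forall>f\<in>Carrier (dual A). F f = f u" by blast
qed

lemma arens_regular_A: "arens_regular A"
  by (rule reflexive_imp_arens_regular[OF normed_algebra_A reflexive])

lemma point_coeff_Mult_gconv:
  assumes "\<Phi> \<in> MD" "\<Psi> \<in> MD"
  shows "point_coeff (Mult A \<Phi> \<Psi>) = gconv (point_coeff \<Phi>) (point_coeff \<Psi>)"
proof
  fix x
  show "point_coeff (Mult A \<Phi> \<Psi>) x = gconv (point_coeff \<Phi>) (point_coeff \<Psi>) x"
    using has_sum_unique[OF point_coeff_Mult[OF assms, of x] has_sum_finite[OF finite_group]] by (simp add: gconv_def)
qed

definition cnorm :: "((('a set \<Rightarrow> complex) \<Rightarrow> complex) \<Rightarrow> complex) \<Rightarrow> real" where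
  "cnorm \<Phi> = conv_norm (point_coeff \<Phi>)"

definition cstar :: "((('a set \<Rightarrow> complex) \<Rightarrow> complex) \<Rightarrow> complex) \<Rightarrow> (('a set \<Rightarrow> complex) \<Rightarrow> complex) \<Rightarrow> complex" where
  "cstar \<Phi> = of_coeff (adj (point_coeff \<Phi>))"

lemma cnorm_le: "\<Phi> \<in> MD ==> cnorm \<Phi> \<le> nA \<Phi>"
  using conv_norm_le_sum[of "point_coeff \<Phi>"] sum_point_coeff_le'[of \<Phi> UNIV] finite_group by (simp add: cnorm_def)

text \<open>The value of \<open>f\<close> at a point mass is at most \<omega> x times its norm and
  each coefficient is at most the operator norm; summing over the group produces the
  constant.\<close>

lemma le_cnorm: "\<Phi> \<in> MD ==> nA \<Phi> \<le> (\<Sum>x\<in>UNIV. \<omega> x) * cnorm \<Phi>"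
proof -
  assume \<Phi>: "\<Phi> \<in> MD"
  have W: "0 \<le> (\<Sum>x\<in>UNIV. \<omega> x)" using weight_pos by (intro sum_nonneg) (simp add: less_imp_le)
  show ?thesis
  proof (rule dual_norm_le[OF seminormed_MS])
    fix f assume "f \<in> Carrier (M_star \<omega>)"
    then have f: "f \<in> MS" by simp
    have "cmod (\<Phi> f) \<le> (\<Sum>x\<in>UNIV. cmod (f (dirac x)) * cmod (point_coeff \<Phi> x))"
      unfolding functional_eq[OF \<Phi> f] by (rule order_trans[OF norm_sum]) (simp add: norm_mult)
    also have "\<dots> \<le> (\<Sum>x\<in>UNIV. (nS f * \<omega> x) * cnorm \<Phi>)"
      using MS_le[OF f dirac_M] cmod_le_conv_norm[OF finite_group, of "point_coeff \<Phi>"] nS_nonneg[OF f] weight_pos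
      by (intro sum_mono mult_mono) (auto simp: nrm_dirac cnorm_def less_imp_le)
    also have "\<dots> = (\<Sum>x\<in>UNIV. \<omega> x) * cnorm \<Phi> * Norm (M_star \<omega>) f"
      by (simp add: sum_distrib_left sum_distrib_right mult_ac)
    finally show "cmod (\<Phi> f) \<le> (\<Sum>x\<in>UNIV. \<omega> x) * cnorm \<Phi> * Norm (M_star \<omega>) f" .
  qed (use W conv_norm_nonneg[OF finite_group] in \<open>simp add: cnorm_def\<close>)
qed

lemma is_cstar: "is_cstar_algebra A"
  unfolding is_cstar_algebra_def
proof (intro exI conjI)
  let ?W = "\<Sum>x\<in>UNIV. \<omega> x"
  have W: "?W > 0" using finite_group weight_pos by (intro sum_pos) auto
  have eqv: "nA \<Phi> / ?W \<le> cnorm \<Phi>" if "\<Phi> \<in> MD" for \<Phi>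
    using le_cnorm[OF that] W by (simp add: field_simps)
  then show "equivalent_norms (Carrier A) (Norm A) cnorm"
    unfolding equivalent_norms_def using W cnorm_le by (intro exI[of _ "1 / ?W"] conjI exI[of _ 1]) auto
  let ?B = "A\<lparr>Norm := cnorm\<rparr>"
  note NA = normed_algebraD[OF normed_algebra_A] note SA = NA(1)
  have add: "u + v \<in> MD" if "u \<in> MD" "v \<in> MD" for u v using seminormedD(2)[OF SA] that by simp
  have scl: "scale c u \<in> MD" if "u \<in> MD" for u c using seminormedD(3)[OF SA] that by simp
  have mlt: "Mult A u v \<in> MD" if "u \<in> MD" "v \<in> MD" for u v using NA(2) that by simp
  have dif: "u - v \<in> MD" if "u \<in> MD" "v \<in> MD" for u v using seminormed_diff(1)[OF SA] that by simp
  have pc_add: "point_coeff (u + v) = point_coeff u + point_coeff v" for u v :: "(('a set \<Rightarrow> complex) \<Rightarrow> complex) \<Rightarrow> complex"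
    by (rule ext) (simp add: point_coeff_add)
  have pc_scale: "point_coeff (scale c u) = scale c (point_coeff u)" for c and u :: "(('a set \<Rightarrow> complex) \<Rightarrow> complex) \<Rightarrow> complex"
    by (rule ext) (simp add: point_coeff_scale scale_apply)
  have nonneg: "0 \<le> cnorm u" for u by (simp add: cnorm_def conv_norm_nonneg[OF finite_group])
  have zero: "u = 0" if u: "u \<in> MD" "cnorm u = 0" for u
  proof (rule point_coeff_inj[OF u(1)])
    show "0 \<in> MD" using seminormedD(1)[OF SA] by simp
    show "point_coeff u = point_coeff 0"
      using cmod_le_conv_norm[OF finite_group, of "point_coeff u"] u(2) by (auto simp: cnorm_def point_coeff_def fun_eq_iff)
  qed
  have "banach_space ?B"
    unfolding banach_space_def
  proof (intro conjI ballI allI impI)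
    show "0 \<in> Carrier ?B" using seminormedD(1)[OF SA] by simp
    show "norm_on (Carrier ?B) (Norm ?B)"
      unfolding norm_on_def
    proof (intro conjI ballI allI)
      fix u v c assume u: "u \<in> Carrier ?B" and v: "v \<in> Carrier ?B"
      have sc: "Norm ?B (scale c u) = cmod c * Norm ?B u" for c and u :: "(('a set \<Rightarrow> complex) \<Rightarrow> complex) \<Rightarrow> complex"
        by (simp add: cnorm_def pc_scale conv_norm_scale[OF finite_group])
      show "Norm ?B (u + v) \<le> Norm ?B u + Norm ?B v"
        by (simp add: cnorm_def pc_add conv_norm_add[OF finite_group])
      have "cnorm 0 = 0" using sc[of 0 0] by simp
      then show "(Norm ?B u = 0) = (u = 0)" using zero[of u] u by auto
      show "Norm ?B (scale c u) = cmod c * Norm ?B u" by (rule sc)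
    qed (simp_all add: nonneg)
    fix s :: "nat \<Rightarrow> (('a set \<Rightarrow> complex) \<Rightarrow> complex) \<Rightarrow> complex"
    assume s: "\<forall>n. s n \<in> Carrier ?B" and cau: "\<forall>e>0. \<exists>N. \<forall>m\<ge>N. \<forall>n\<ge>N. Norm ?B (s m - s n) < e"
    have sV: "s n \<in> MD" for n using s by simp
    \<comment> \<open>Completeness is imported from the dual norm: equivalence turns a Cauchy
      sequence for \<open>cnorm\<close> into one for \<open>nA\<close>, and the limit is carried
      back.\<close>
    have "\<exists>N. \<forall>m\<ge>N. \<forall>n\<ge>N. nA (s m - s n) < e" if e: "e > 0" for e
    proof -
      obtain N where N: "\<forall>m\<ge>N. \<forall>n\<ge>N. cnorm (s m - s n) < e / ?W" using cau[rule_format, of "e / ?W"] e W by auto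
      have "nA (s m - s n) < e" if "m \<ge> N" "n \<ge> N" for m n
      proof -
        have "cnorm (s m - s n) < e / ?W" using N that by blast
        then have "?W * cnorm (s m - s n) < e" using W by (simp add: field_simps)
        then show ?thesis using le_cnorm[OF dif[OF sV sV], of m n] by linarith
      qed
      then show ?thesis by blast
    qed
    then obtain l where l: "l \<in> MD" "(\<lambda>n. nA (s n - l)) \<longlonglongrightarrow> 0"
      using banach_space_dual[OF seminormed_MS] sV unfolding banach_space_def by blast
    have "(\<lambda>n. cnorm (s n - l)) \<longlonglongrightarrow> 0"
      by (rule tendsto_sandwich[OF _ _ tendsto_const l(2)]) (auto simp: nonneg cnorm_le dif sV l(1))
    then show "\<exists>l\<in>Carrier ?B. (\<lambda>n. Norm ?B (s n - l)) \<longlonglongrightarrow> 0" using l(1) by auto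
  qed (use add scl in simp_all)
  moreover have "Mult A (Mult A u v) w = Mult A u (Mult A v w)" if "u \<in> MD" "v \<in> MD" "w \<in> MD" for u v w
    by (rule point_coeff_inj) (simp_all add: that mlt point_coeff_Mult_gconv gconv_assoc)
  moreover have "cnorm (Mult A u v) \<le> cnorm u * cnorm v" if "u \<in> MD" "v \<in> MD" for u v
    using that by (simp add: cnorm_def point_coeff_Mult_gconv conv_norm_mult[OF finite_group])
  ultimately have "banach_algebra ?B"
    unfolding banach_algebra_def using NA(4-7) mlt by simp
  moreover have "cstar u \<in> MD" "u \<in> MD ==> cstar (cstar u) = u" for u
    by (simp_all add: cstar_def of_coeff_point_coeff)
  moreover have "cstar (u + v) = cstar u + cstar v" if "u \<in> MD" "v \<in> MD" for u v
    by (rule point_coeff_inj) (auto simp: cstar_def add pc_add adj_def fun_eq_iff)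
  moreover have "cstar (scale c u) = scale (cnj c) (cstar u)" if "u \<in> MD" for u c
    by (rule point_coeff_inj) (auto simp: cstar_def scl pc_scale adj_def fun_eq_iff scale_apply)
  moreover have "cstar (Mult A u v) = Mult A (cstar v) (cstar u)" if "u \<in> MD" "v \<in> MD" for u v
    by (rule point_coeff_inj) (simp_all add: that cstar_def mlt point_coeff_Mult_gconv adj_gconv)
  moreover have "cnorm (Mult A (cstar u) u) = (cnorm u)^2" if "u \<in> MD" for u
    using that by (simp add: cnorm_def cstar_def point_coeff_Mult_gconv conv_norm_cstar[OF finite_group])
  ultimately show "cstar_algebra ?B cstar"
    unfolding cstar_algebra_def by simp
qed

end

section \<open>Each condition is equivalent to finiteness\<close>

lemma weight_one: "weight (\<lambda>_. 1)"
  by (simp add: weight_def)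

theorem proposition2p8:
  assumes "locally_compact_space (euclidean :: 'a::{topological_group_add, t2_space} topology)"
  shows "(arens_regular (M_star_dual (\<lambda>_::'a. 1)) \<longleftrightarrow>
            (\<forall>\<omega>::'a \<Rightarrow> real. weight \<omega> \<longrightarrow> arens_regular (M_star_dual \<omega>)))
       \<and> ((\<forall>\<omega>::'a \<Rightarrow> real. weight \<omega> \<longrightarrow> arens_regular (M_star_dual \<omega>)) \<longleftrightarrow>
            (\<exists>\<omega>::'a \<Rightarrow> real. weight \<omega> \<and> arens_regular (M_star_dual \<omega>) \<and> bounded (range (weight_star \<omega>))))
       \<and> ((\<exists>\<omega>::'a \<Rightarrow> real. weight \<omega> \<and> arens_regular (M_star_dual \<omega>) \<and> bounded (range (weight_star \<omega>))) \<longleftrightarrow>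
            (\<exists>\<omega>::'a \<Rightarrow> real. weight \<omega> \<and> reflexive_space (M_star_dual \<omega>) \<and> bounded (range (weight_star \<omega>))))
       \<and> ((\<exists>\<omega>::'a \<Rightarrow> real. weight \<omega> \<and> reflexive_space (M_star_dual \<omega>) \<and> bounded (range (weight_star \<omega>))) \<longleftrightarrow>
            (\<exists>\<omega>::'a \<Rightarrow> real. weight \<omega> \<and> is_cstar_algebra (M_star_dual \<omega>)))
       \<and> ((\<exists>\<omega>::'a \<Rightarrow> real. weight \<omega> \<and> is_cstar_algebra (M_star_dual \<omega>)) \<longleftrightarrow>
            finite (UNIV :: 'a set))"
proof -
  let ?fin = "finite (UNIV :: 'a set)" and ?one = "\<lambda>_::'a. 1 :: real"
  have lc: "weighted_lc_group \<omega>" if "weight \<omega>" for \<omega> :: "'a \<Rightarrow> real"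
    using that assms by unfold_locales
  have c: ?fin if "weight \<omega>" "arens_regular (M_star_dual \<omega>)" "bounded (range (weight_star \<omega>))" for \<omega> :: "'a \<Rightarrow> real"
    using weighted_lc_group.arens_regular_imp_finite[OF lc] that by blast
  have d: ?fin if "weight \<omega>" "reflexive_space (M_star_dual \<omega>)" for \<omega> :: "'a \<Rightarrow> real"
    using weighted_lc_group.reflexive_imp_finite[OF lc] that by blast
  have e: ?fin if "weight \<omega>" "is_cstar_algebra (M_star_dual \<omega>)" for \<omega> :: "'a \<Rightarrow> real"
    using weighted_lc_group.cstar_imp_finite[OF lc] that by blast
  have f: "arens_regular (M_star_dual \<omega>)" "reflexive_space (M_star_dual \<omega>)" "is_cstar_algebra (M_star_dual \<omega>)"
    if "weight \<omega>" ?fin for \<omega> :: "'a \<Rightarrow> real"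
  proof -
    interpret weighted_lc_group \<omega> by (rule lc[OF that(1)])
    interpret weighted_finite_group \<omega> by unfold_locales (rule that(2))
    show "arens_regular (M_star_dual \<omega>)" "reflexive_space (M_star_dual \<omega>)" "is_cstar_algebra (M_star_dual \<omega>)"
      by (rule arens_regular_A reflexive is_cstar)+
  qed
  \<comment> \<open>The constant weight witnesses the existence statements and also links the
    unweighted condition to the one over all weights.\<close>
  have one: "weight ?one" "bounded (range (weight_star ?one))"
    by (rule weight_one) (simp add: weight_star_def[abs_def])
  have "arens_regular (M_star_dual ?one) \<longleftrightarrow> ?fin"
    using c[OF one(1) _ one(2)] f(1)[OF one(1)] by (rule iffI)
  moreover have "(\<forall>\<omega>::'a \<Rightarrow> real. weight \<omega> \<longrightarrow> arens_regular (M_star_dual \<omega>)) \<longleftrightarrow> ?fin"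
    by (intro iffI allI impI) (use c[OF one(1) _ one(2)] one(1) f(1) in simp_all)
  moreover have "(\<exists>\<omega>::'a \<Rightarrow> real. weight \<omega> \<and> arens_regular (M_star_dual \<omega>) \<and> bounded (range (weight_star \<omega>))) \<longleftrightarrow> ?fin"
  proof
    assume "\<exists>\<omega>::'a \<Rightarrow> real. weight \<omega> \<and> arens_regular (M_star_dual \<omega>) \<and> bounded (range (weight_star \<omega>))"
    then obtain \<omega> :: "'a \<Rightarrow> real" where "weight \<omega>" "arens_regular (M_star_dual \<omega>)" "bounded (range (weight_star \<omega>))"
      by (elim exE conjE)
    then show ?fin by (rule c)
  next
    assume ?fin
    then show "\<exists>\<omega>::'a \<Rightarrow> real. weight \<omega> \<and> arens_regular (M_star_dual \<omega>) \<and> bounded (range (weight_star \<omega>))"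
      using f(1)[OF one(1)] one by (intro exI[of _ ?one] conjI)
  qed
  moreover have "(\<exists>\<omega>::'a \<Rightarrow> real. weight \<omega> \<and> reflexive_space (M_star_dual \<omega>) \<and> bounded (range (weight_star \<omega>))) \<longleftrightarrow> ?fin"
  proof
    assume "\<exists>\<omega>::'a \<Rightarrow> real. weight \<omega> \<and> reflexive_space (M_star_dual \<omega>) \<and> bounded (range (weight_star \<omega>))"
    then obtain \<omega> :: "'a \<Rightarrow> real" where "weight \<omega>" "reflexive_space (M_star_dual \<omega>)" by (elim exE conjE)
    then show ?fin by (rule d)
  next
    assume ?fin
    then show "\<exists>\<omega>::'a \<Rightarrow> real. weight \<omega> \<and> reflexive_space (M_star_dual \<omega>) \<and> bounded (range (weight_star \<omega>))"
      using f(2)[OF one(1)] one by (intro exI[of _ ?one] conjI)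
  qed
  moreover have "(\<exists>\<omega>::'a \<Rightarrow> real. weight \<omega> \<and> is_cstar_algebra (M_star_dual \<omega>)) \<longleftrightarrow> ?fin"
  proof
    assume "\<exists>\<omega>::'a \<Rightarrow> real. weight \<omega> \<and> is_cstar_algebra (M_star_dual \<omega>)"
    then obtain \<omega> :: "'a \<Rightarrow> real" where "weight \<omega>" "is_cstar_algebra (M_star_dual \<omega>)" by (elim exE conjE)
    then show ?fin by (rule e)
  next
    assume ?fin
    then show "\<exists>\<omega>::'a \<Rightarrow> real. weight \<omega> \<and> is_cstar_algebra (M_star_dual \<omega>)"
      using f(3)[OF one(1)] one by (intro exI[of _ ?one] conjI)
  qed
  ultimately show ?thesis by (simp only: simp_thms)
qed

end
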